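(* Let $\mathfrak{L}$ be a (possibly curved) complete filtered $L_\infty$-algebra and let $\mathfrak{M}$, $\mathfrak{N}$ be $L_\infty$-modules over $\mathfrak{L}$. Let $$F\colon \mathfrak{M}\to(\mathfrak{M}^\bullet,\partial_F^\bullet)\quad\text{and}\quad G\colon\mathfrak{N}\to(\mathfrak{N}^\bullet,\partial_G^\bullet)$$ be resolutions of $\mathfrak{M}$ and $\mathfrak{N}$ by $L_\infty$-modules over $\mathfrak{L}$, and let $\mathscr{U}\colon F\to G$ be an $L_\infty$-morphism of resolutions, consisting of $L_\infty$-morphisms of modules $\mathscr{U}\colon\mathfrak{M}\to\mathfrak{N}$ and $\mathscr{U}^n\colon\mathfrak{M}^n\to\mathfrak{N}^n$ ($n\ge 0$). Suppose that $\pi\in\mathrm{MC}(F)\cap\mathrm{MC}(G)$ and that the twisted morphism $(\mathscr{U}^n)^\pi\colon(\mathfrak{M}^n)^\pi\to(\mathfrak{N}^n)^\pi$ is a quasi-isomorphism for all $n\geq 0$. Then $\mathscr{U}^\pi\colon\mathfrak{M}^\pi\to\mathfrak{N}^\pi$ is an $L_\infty$-quasi-isomorphism.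
   Context: Fix a field $\mathbb{K}$ of characteristic $0$. For a graded vector space $V$, $V[k]^\ell=V^{\ell+k}$. **$L_\infty$-algebras.** For a graded vector space $\mathfrak{L}$ let $S^c(\mathfrak{L})=\bigoplus_{n\ge0}\bigvee^n(\mathfrak{L}[1])$ be the cofree counital conilpotent cocommutative coalgebra ($\bigvee$ denotes the graded symmetric product; $S^c(\mathfrak L)$ is also a commutative algebra under $\vee$). A (possibly curved) $L_\infty$-structure on $\mathfrak{L}$ is a degree $+1$ coderivation $Q$ of $S^c(\mathfrak{L})$ with $Q^2=0$; it is determined by its components $Q_n\colon\bigvee^n(\mathfrak{L}[1])\to\mathfrak{L}[2]$, $n\ge0$. It is flat if $Q_0=0$. All $L_\infty$-algebras carry a decreasing filtration $\mathfrak{L}=\mathcal{F}^0\mathfrak{L}\supset\mathcal{F}^1\mathfrak{L}\supset\cdots$ respected by the structure and complete (in particular $\bigcap_k\mathcal{F}^k\mathfrak{L}=0$), and infinite sums are understood in the associated topology (similarly for modules; all structure maps and morphisms respect filtrations). **Modules.** An $L_\infty$-module over $\mathfrak{L}$ is a graded vector space $\mathfrak{M}$ with a square-zero degree $+1$ coderivation $\varphi$ (over $Q$) of the cofree $S^c(\mathfrak{L})$-comodule $S^c(\mathfrak{L})\otimes\mathfrak{M}$; it is determined by components $\varphi_n\colon\bigvee^n\mathfrak{L}[1]\otimes\mathfrak{M}\to\mathfrak{M}[1]$, $n\ge0$. If $\mathfrak{L}$ is flat, $\varphi_0$ is a differential on $\mathfrak{M}$. An $L_\infty$-morphism of modules $(\mathfrak{M},\varphi)\to(\widetilde{\mathfrak{M}},\tilde\varphi)$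 is a degree $0$ comodule morphism $F\colon S^c(\mathfrak{L})\otimes\mathfrak{M}\to S^c(\mathfrak{L})\otimes\widetilde{\mathfrak{M}}$ with $F\varphi=\tilde\varphi F$; it is determined by components $F_n\colon\bigvee^n\mathfrak{L}[1]\otimes\mathfrak{M}\to\widetilde{\mathfrak{M}}$, $n\geq 0$. If $\mathfrak{L}$ is flat, $F$ is an ($L_\infty$-)quasi-isomorphism if $F_0\colon(\mathfrak{M},\varphi_0)\to(\widetilde{\mathfrak{M}},\tilde\varphi_0)$ is a quasi-isomorphism of complexes. **Twisting.** For $\pi\in\mathcal{F}^1\mathfrak{L}[1]^0$ put $\exp(\pi)=e^{\pi}=\sum_n\pi^n/n!$. The twist $\mathfrak{L}^\pi=(\mathfrak{L},Q^\pi)$ has $Q^\pi(a)=\exp(-\pi)\vee Q(\exp(\pi)\vee a)$; a module $(\mathfrak{M},\varphi)$ twists to the $\mathfrak{L}^\pi$-module $\mathfrak{M}^\pi=(\mathfrak{M},\varphi^\pi)$ with $\varphi^\pi(X)=e^{-\pi}\varphi(e^{\pi}X)$; a morphism of modules $F$ twists to $F^\pi(X)=e^{-\pi}F(e^\pi X)$, $F^\pi\colon\mathfrak{M}^\pi\to\widetilde{\mathfrak{M}}^\pi$. The element $\pi$ is Maurer–Cartan (MC) if $\sum_{n\ge0}Q_n(\pi^n)/n!=0$, equivalently $\mathfrak{L}^\pi$ is flat. **Resolutions.** A resolution $F\colon\mathfrak{M}\to(\mathfrak{M}^\bullet,\partial^\bullet)$ of an $L_\infty$-module is an exact sequence $0\to(\mathfrak{M},\varphi)\xrightarrow{F}(\mathfrak{M}^0,\varphi^0)\xrightarrow{\partial^0}(\mathfrak{M}^1,\varphi^1)\xrightarrow{\partial^1}\cdots$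 in which all $\mathfrak{M}^i$ are $L_\infty$-modules over $\mathfrak{L}$ and $F,\partial^i$ are $L_\infty$-morphisms of modules (exactness is that of the underlying sequence of comodules $S^c(\mathfrak{L})\otimes\mathfrak{M}\to S^c(\mathfrak{L})\otimes\mathfrak{M}^0\to\cdots$). $\mathrm{MC}(F)$, the set of *resolution adapted MC elements*, is the set of MC elements $\pi$ of $\mathfrak{L}$ such that the induced complex $$0\to\mathrm{H}(\mathfrak{M},\varphi^\pi_0)\xrightarrow{F_0^\pi}\mathrm{H}(\mathfrak{M}^0,(\varphi^0)^\pi_0)\xrightarrow{(\partial^0)^\pi_0}\mathrm{H}(\mathfrak{M}^1,(\varphi^1)^\pi_0)\xrightarrow{(\partial^1)^\pi_0}\cdots$$ is acyclic (exact everywhere). Given resolutions $F\colon\mathfrak{M}\to\mathfrak{M}^\bullet$ and $G\colon\mathfrak{N}\to\mathfrak{N}^\bullet$, an $L_\infty$-morphism of resolutions $F\to G$ is a family of $L_\infty$-morphisms of modules $\mathscr{U}\colon\mathfrak{M}\to\mathfrak{N}$, $\mathscr{U}^n\colon\mathfrak{M}^n\to\mathfrak{N}^n$ ($n\ge0$) with $G\circ\mathscr{U}=\mathscr{U}^0\circ F$ and $\partial_G^n\circ\mathscr{U}^n=\mathscr{U}^{n+1}\circ\partial_F^n$ for all $n$. *)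

theory Defs
  imports Complex_Main "HOL-Library.Poly_Mapping"
begin

section \<open>Filtered graded vector spaces\<close>

text \<open>
  A graded vector space over the field \<open>'k\<close> with a decreasing filtration is a family of subspaces
  \<open>fil V k i\<close> (filtration index \<open>k\<close>, degree \<open>i\<close>) of an ambient vector space \<open>'v\<close>; the degree-\<open>i\<close>
  component of \<open>V\<close> itself is \<open>fil V 0 i\<close>.  Different degrees are treated as disjoint copies even if
  the subspaces overlap, so a homogeneous element is a pair \<open>(i, x)\<close> with \<open>x \<in> fil V 0 i\<close>.
  Working with subspaces of an ambient type lets a whole sequence of spaces share one type.
\<close>

record ('k, 'v) fspace =
  scl :: "'k \<Rightarrow> 'v \<Rightarrow> 'v"
  fil :: "nat \<Rightarrow> int \<Rightarrow> 'v set"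

definition shift :: "int \<Rightarrow> ('k, 'v) fspace \<Rightarrow> ('k, 'v) fspace" where
  "shift n V = \<lparr>scl = scl V, fil = (\<lambda>k i. fil V k (i + n))\<rparr>"

definition flimit :: "('k, 'v::ab_group_add) fspace \<Rightarrow> int \<Rightarrow> (nat \<Rightarrow> 'v) \<Rightarrow> 'v \<Rightarrow> bool" where
  "flimit V i x y \<longleftrightarrow> y \<in> fil V 0 i \<and> (\<forall>k. \<exists>N. \<forall>n\<ge>N. x n - y \<in> fil V k i)"

definition flim :: "('k, 'v::ab_group_add) fspace \<Rightarrow> (nat \<Rightarrow> 'v) \<Rightarrow> 'v" where
  "flim V x = (THE y. \<exists>i. flimit V i x y)"

text \<open>Completeness of a graded space is completeness in every degree.\<close>

definition complete_fspace :: "('k::field, 'v::ab_group_add) fspace \<Rightarrow> bool" where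
  "complete_fspace V \<longleftrightarrow>
     vector_space (scl V) \<and>
     (\<forall>k i. module.subspace (scl V) (fil V k i)) \<and>
     (\<forall>k i. fil V (Suc k) i \<subseteq> fil V k i) \<and>
     (\<forall>i. (\<Inter>k. fil V k i) = {0}) \<and>
     (\<forall>i x. (\<forall>n. x n \<in> fil V 0 i) \<and>
            (\<forall>k. \<exists>N. \<forall>m\<ge>N. \<forall>n\<ge>N. x m - x n \<in> fil V k i)
            \<longrightarrow> (\<exists>y. flimit V i x y))"

definition linear_on ::
    "('k \<Rightarrow> 'v \<Rightarrow> 'v) \<Rightarrow> ('k \<Rightarrow> 'w \<Rightarrow> 'w) \<Rightarrow> 'v set \<Rightarrow> ('v::ab_group_add \<Rightarrow> 'w::ab_group_add) \<Rightarrow> bool" where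
  "linear_on s t A f \<longleftrightarrow>
     (\<forall>x\<in>A. \<forall>y\<in>A. f (x + y) = f x + f y) \<and> (\<forall>c. \<forall>x\<in>A. f (s c x) = t c (f x))"

definition filtered_map ::
    "('k, 'v::ab_group_add) fspace \<Rightarrow> ('k, 'w::ab_group_add) fspace \<Rightarrow> int \<Rightarrow> ('v \<Rightarrow> 'w) \<Rightarrow> bool" where
  "filtered_map V W d f \<longleftrightarrow>
     (\<forall>i. linear_on (scl V) (scl W) (fil V 0 i) f) \<and>
     (\<forall>k i. f ` fil V k i \<subseteq> fil W k (i + d))"

section \<open>Free vector spaces and their quotients\<close>

definition fscale :: "'k::field \<Rightarrow> ('x \<Rightarrow>\<^sub>0 'k) \<Rightarrow> ('x \<Rightarrow>\<^sub>0 'k)" where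
  "fscale c p = Poly_Mapping.map ((*) c) p"

definition gen :: "'x \<Rightarrow> ('x \<Rightarrow>\<^sub>0 'k::field)" where
  "gen x = Poly_Mapping.single x 1"

text \<open>Linear extension of a map given on the generators.\<close>

definition lext :: "('k \<Rightarrow> 'v \<Rightarrow> 'v) \<Rightarrow> ('x \<Rightarrow> 'v) \<Rightarrow> ('x \<Rightarrow>\<^sub>0 'k::field) \<Rightarrow> 'v::ab_group_add" where
  "lext s g p = (\<Sum>x\<in>Poly_Mapping.keys p. s (Poly_Mapping.lookup p x) (g x))"

text \<open>
  The quotient of a free vector space by the span of a set \<open>R\<close> of relations is realised inside the
  free space itself, as the image of a linear projection \<open>qproj R\<close> with kernel \<open>span R\<close> (that is, as
  a complement of \<open>span R\<close>).  So \<open>qproj R p\<close> is the class of \<open>p\<close>, and it is at the same time a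
  representative of that class.  A linear map out of the quotient is given by \<open>lext\<close>, applied to
  this representative, of any assignment on generators that is compatible with the relations.
\<close>

definition qproj :: "('x \<Rightarrow>\<^sub>0 'k::field) set \<Rightarrow> ('x \<Rightarrow>\<^sub>0 'k) \<Rightarrow> ('x \<Rightarrow>\<^sub>0 'k)" where
  "qproj R = (SOME P. Vector_Spaces.linear fscale fscale P \<and> (\<forall>p. P (P p) = P p) \<and>
                      {p. P p = 0} = module.span fscale R)"

lemma lookup_fscale: "Poly_Mapping.lookup (fscale c p) x = c * Poly_Mapping.lookup p x"
  by (simp add: fscale_def Poly_Mapping.map.rep_eq when_def)

lemma vector_space_fscale: "vector_space (fscale :: 'k::field \<Rightarrow> ('x \<Rightarrow>\<^sub>0 'k) \<Rightarrow> _)"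
  by unfold_locales
    (auto intro!: poly_mapping_eqI simp: lookup_fscale lookup_add algebra_simps)

lemma qproj:
  fixes R :: "('x \<Rightarrow>\<^sub>0 'k::field) set"
  shows "Vector_Spaces.linear fscale fscale (qproj R)"
    and "qproj R (qproj R p) = qproj R p"
    and "qproj R p = qproj R q \<longleftrightarrow> p - q \<in> module.span fscale R"
proof -
  interpret vector_space "fscale :: 'k \<Rightarrow> ('x \<Rightarrow>\<^sub>0 'k) \<Rightarrow> _" by (rule vector_space_fscale)
  interpret vector_space_pair "fscale :: 'k \<Rightarrow> ('x \<Rightarrow>\<^sub>0 'k) \<Rightarrow> _" "fscale :: 'k \<Rightarrow> ('x \<Rightarrow>\<^sub>0 'k) \<Rightarrow> _"
    by unfold_locales
  obtain B where B: "B \<subseteq> span R" "independent B" "span R \<subseteq> span B"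
    by (rule maximal_independent_subset[of "span R"])
  define C where "C = extend_basis B"
  have C: "independent C" "span C = UNIV" "B \<subseteq> C"
    unfolding C_def
    by (rule independent_extend_basis[OF B(2)], rule span_extend_basis[OF B(2)],
        rule extend_basis_superset[OF B(2)])
  have spanB: "span B = span R"
  proof (rule subset_antisym)
    show "span B \<subseteq> span R" using span_mono[OF B(1)] by (simp add: span_span)
  qed (rule B(3))
  define P where "P = construct C (\<lambda>c. if c \<in> B then 0 else c)"
  have lin: "Vector_Spaces.linear fscale fscale P"
    unfolding P_def by (rule linear_construct[OF C(1)])
  interpret P: Vector_Spaces.linear fscale fscale P by (rule lin)
  have Pb: "P b = (if b \<in> B then 0 else b)" if "b \<in> C" for b
    unfolding P_def using construct_basis[OF C(1) that] by auto
  have diff: "p - P p \<in> span B" for p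
  proof -
    have "p \<in> span C" using C(2) by simp
    then show ?thesis
    proof (induction rule: span_induct_alt)
      case base then show ?case by (simp add: span_zero P.zero)
    next
      case (step c x y)
      have "x - P x \<in> span B" using Pb[OF step(1)] by (auto intro: span_base span_zero)
      then have "fscale c (x - P x) + (y - P y) \<in> span B"
        using step by (intro span_add span_scale)
      then show ?case by (simp add: P.add P.scale scale_right_diff_distrib algebra_simps)
    qed
  qed
  have kerB: "P p = 0" if "p \<in> span B" for p
    using that
  proof (induction rule: span_induct_alt)
    case base then show ?case by (simp add: P.zero)
  next
    case (step c x y)
    then show ?case using Pb[of x] C(3) by (auto simp: P.add P.scale)
  qed
  have ker: "{p. P p = 0} = span R"
  proof (intro subset_antisym subsetI)
    fix p assume "p \<in> {p. P p = 0}"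
    then show "p \<in> span R" using diff[of p] spanB by simp
  next
    fix p assume "p \<in> span R"
    then show "p \<in> {p. P p = 0}" by (simp add: kerB flip: spanB)
  qed
  have idem: "P (P p) = P p" for p
    using kerB[OF diff[of p]] by (simp add: P.diff)
  have "\<exists>P. Vector_Spaces.linear fscale fscale P \<and> (\<forall>p. P (P p) = P p) \<and> {p. P p = 0} = span R"
    using lin ker idem by blast
  from someI_ex[OF this, folded qproj_def]
  have *: "Vector_Spaces.linear fscale fscale (qproj R)" "\<And>p. qproj R (qproj R p) = qproj R p"
    "{p. qproj R p = 0} = span R" by blast+
  show "Vector_Spaces.linear fscale fscale (qproj R)" "qproj R (qproj R p) = qproj R p"
    by (fact *)+
  interpret Q: Vector_Spaces.linear fscale fscale "qproj R" by (rule *(1))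
  show "qproj R p = qproj R q \<longleftrightarrow> p - q \<in> module.span fscale R"
    unfolding *(3)[symmetric] by (simp add: Q.diff)
qed

section \<open>Tensor products\<close>

definition ksign :: "int \<Rightarrow> 'k::field" where
  "ksign n = (if even n then 1 else - 1)"

definition tensor_rel ::
    "('k::field, 'v::ab_group_add) fspace \<Rightarrow> ('k, 'w::ab_group_add) fspace \<Rightarrow>
     ((int \<times> 'v) \<times> (int \<times> 'w) \<Rightarrow>\<^sub>0 'k) set" where
  "tensor_rel V W =
     {gen ((i, x + x'), (j, y)) - gen ((i, x), (j, y)) - gen ((i, x'), (j, y)) | i j x x' y.
        x \<in> fil V 0 i \<and> x' \<in> fil V 0 i \<and> y \<in> fil W 0 j} \<union>
     {gen ((i, x), (j, y + y')) - gen ((i, x), (j, y)) - gen ((i, x), (j, y')) | i j x y y'.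
        x \<in> fil V 0 i \<and> y \<in> fil W 0 j \<and> y' \<in> fil W 0 j} \<union>
     {gen ((i, scl V c x), (j, y)) - fscale c (gen ((i, x), (j, y))) | i j c x y.
        x \<in> fil V 0 i \<and> y \<in> fil W 0 j} \<union>
     {gen ((i, x), (j, scl W c y)) - fscale c (gen ((i, x), (j, y))) | i j c x y.
        x \<in> fil V 0 i \<and> y \<in> fil W 0 j}"

definition tens ::
    "('k::field, 'v::ab_group_add) fspace \<Rightarrow> ('k, 'w::ab_group_add) fspace \<Rightarrow>
     int \<times> 'v \<Rightarrow> int \<times> 'w \<Rightarrow> ((int \<times> 'v) \<times> (int \<times> 'w) \<Rightarrow>\<^sub>0 'k)" where
  "tens V W a b = qproj (tensor_rel V W) (gen (a, b))"

definition tensor ::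
    "('k::field, 'v::ab_group_add) fspace \<Rightarrow> ('k, 'w::ab_group_add) fspace \<Rightarrow>
     ('k, (int \<times> 'v) \<times> (int \<times> 'w) \<Rightarrow>\<^sub>0 'k) fspace" where
  "tensor V W =
     \<lparr>scl = fscale,
      fil = (\<lambda>k d. module.span fscale
               {tens V W (i, x) (j, y) | i j x y p q.
                  x \<in> fil V p i \<and> y \<in> fil W q j \<and> p + q = k \<and> i + j = d})\<rparr>"

text \<open>
  The tensor product of homogeneous maps \<open>f\<close> (of degree \<open>d\<close>) and \<open>g\<close> (of degree \<open>e\<close>), with values in
  the tensor product of \<open>V\<close> and \<open>W\<close>, follows the Koszul rule
  \<open>(f \<otimes> g)(x \<otimes> y) = (-1)^(\<bar>g\<bar> \<bar>x\<bar>) f x \<otimes> g y\<close>.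
\<close>

definition tensor_map ::
    "('k::field, 'v::ab_group_add) fspace \<Rightarrow> ('k, 'w::ab_group_add) fspace \<Rightarrow>
     int \<Rightarrow> ('a \<Rightarrow> 'v) \<Rightarrow> int \<Rightarrow> ('b \<Rightarrow> 'w) \<Rightarrow>
     ((int \<times> 'a) \<times> (int \<times> 'b) \<Rightarrow>\<^sub>0 'k) \<Rightarrow> ((int \<times> 'v) \<times> (int \<times> 'w) \<Rightarrow>\<^sub>0 'k)" where
  "tensor_map V W d f e g =
     lext fscale (\<lambda>((i, x), (j, y)). fscale (ksign (e * i)) (tens V W (i + d, f x) (j + e, g y)))"

definition tensor_assoc ::
    "('k::field, 'u::ab_group_add) fspace \<Rightarrow> ('k, 'v::ab_group_add) fspace \<Rightarrow>
     ('k, 'w::ab_group_add) fspace \<Rightarrow>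
     ((int \<times> ((int \<times> 'u) \<times> (int \<times> 'v) \<Rightarrow>\<^sub>0 'k)) \<times> (int \<times> 'w) \<Rightarrow>\<^sub>0 'k) \<Rightarrow>
     ((int \<times> 'u) \<times> (int \<times> ((int \<times> 'v) \<times> (int \<times> 'w) \<Rightarrow>\<^sub>0 'k)) \<Rightarrow>\<^sub>0 'k)" where
  "tensor_assoc U V W =
     lext fscale (\<lambda>((d, t), (l, z)).
       lext fscale (\<lambda>((i, x), (j, y)).
         tens U (tensor V W) (i, x) (j + l, tens V W (j, y) (l, z))) t)"

section \<open>The symmetric coalgebra\<close>

text \<open>
  The direct sum of the graded symmetric powers of \<open>V\<close> is spanned by words of homogeneous letters
  \<open>(i, x)\<close>, modulo multilinearity and the graded commutation rule (which, in characteristic 0,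
  makes squares of odd elements vanish).
\<close>

definition is_word :: "('k, 'v) fspace \<Rightarrow> (int \<times> 'v) list \<Rightarrow> bool" where
  "is_word V w \<longleftrightarrow> (\<forall>(i, x)\<in>set w. x \<in> fil V 0 i)"

definition wdeg :: "(int \<times> 'v) list \<Rightarrow> int" where
  "wdeg w = sum_list (map fst w)"

definition sym_rel ::
    "('k::field, 'v::ab_group_add) fspace \<Rightarrow> ((int \<times> 'v) list \<Rightarrow>\<^sub>0 'k) set" where
  "sym_rel V =
     {gen (u @ (i, x + y) # v) - gen (u @ (i, x) # v) - gen (u @ (i, y) # v) | u v i x y.
        is_word V u \<and> is_word V v \<and> x \<in> fil V 0 i \<and> y \<in> fil V 0 i} \<union>
     {gen (u @ (i, scl V c x) # v) - fscale c (gen (u @ (i, x) # v)) | u v i c x.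
        is_word V u \<and> is_word V v \<and> x \<in> fil V 0 i} \<union>
     {gen (u @ (i, x) # (j, y) # v) - fscale (ksign (i * j)) (gen (u @ (j, y) # (i, x) # v)) | u v i j x y.
        is_word V u \<and> is_word V v \<and> x \<in> fil V 0 i \<and> y \<in> fil V 0 j}"

definition sym_word ::
    "('k::field, 'v::ab_group_add) fspace \<Rightarrow> (int \<times> 'v) list \<Rightarrow> ((int \<times> 'v) list \<Rightarrow>\<^sub>0 'k)" where
  "sym_word V w = qproj (sym_rel V) (gen w)"

definition sym :: "('k::field, 'v::ab_group_add) fspace \<Rightarrow> ('k, (int \<times> 'v) list \<Rightarrow>\<^sub>0 'k) fspace" where
  "sym V =
     \<lparr>scl = fscale,
      fil = (\<lambda>k d. module.span fscale
               {sym_word V w | w ps.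
                  list_all2 (\<lambda>(i, x) p. x \<in> fil V p i) w ps \<and> sum_list ps = k \<and> wdeg w = d})\<rparr>"

definition sym_mult ::
    "('k::field, 'v::ab_group_add) fspace \<Rightarrow>
     ((int \<times> 'v) list \<Rightarrow>\<^sub>0 'k) \<Rightarrow> ((int \<times> 'v) list \<Rightarrow>\<^sub>0 'k) \<Rightarrow> ((int \<times> 'v) list \<Rightarrow>\<^sub>0 'k)" where
  "sym_mult V X Y = lext fscale (\<lambda>u. lext fscale (\<lambda>v. sym_word V (u @ v)) Y) X"

text \<open>
  All ways of distributing the letters of a word over two subwords, with Koszul signs.  This
  expresses that the coproduct is multiplicative with primitive letters:
  \<open>\<Delta>(x \<or> w) = (x \<otimes> 1 + 1 \<otimes> x) \<Delta>(w)\<close>.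
\<close>

fun unshuffles :: "(int \<times> 'v) list \<Rightarrow> (int \<times> (int \<times> 'v) list \<times> (int \<times> 'v) list) list" where
  "unshuffles [] = [(0, [], [])]"
| "unshuffles (a # w) =
     map (\<lambda>(n, u, v). (n, a # u, v)) (unshuffles w) @
     map (\<lambda>(n, u, v). (n + fst a * wdeg u, u, a # v)) (unshuffles w)"

definition coprod ::
    "('k::field, 'v::ab_group_add) fspace \<Rightarrow> ((int \<times> 'v) list \<Rightarrow>\<^sub>0 'k) \<Rightarrow>
     ((int \<times> ((int \<times> 'v) list \<Rightarrow>\<^sub>0 'k)) \<times> (int \<times> ((int \<times> 'v) list \<Rightarrow>\<^sub>0 'k)) \<Rightarrow>\<^sub>0 'k)" where
  "coprod V =
     lext fscale (\<lambda>w. \<Sum>(n, u, v)\<leftarrow>unshuffles w.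
       fscale (ksign n) (tens (sym V) (sym V) (wdeg u, sym_word V u) (wdeg v, sym_word V v)))"

definition counit :: "((int \<times> 'v) list \<Rightarrow>\<^sub>0 'k::field) \<Rightarrow> 'k" where
  "counit = lext (*) (\<lambda>w. if w = [] then 1 else 0)"

definition sym_proj1 ::
    "('k::field, 'v::ab_group_add) fspace \<Rightarrow> ((int \<times> 'v) list \<Rightarrow>\<^sub>0 'k) \<Rightarrow> 'v" where
  "sym_proj1 V = lext (scl V) (\<lambda>w. case w of [(i, x)] \<Rightarrow> x | _ \<Rightarrow> 0)"

section \<open>\<open>L\<^sub>\<infinity>\<close>-algebras, modules and morphisms\<close>

type_synonym ('k, 'l) symc = "(int \<times> 'l) list \<Rightarrow>\<^sub>0 'k"
type_synonym ('k, 'l, 'm) comod = "(int \<times> ('k, 'l) symc) \<times> (int \<times> 'm) \<Rightarrow>\<^sub>0 'k"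

definition Sc :: "('k::field, 'l::ab_group_add) fspace \<Rightarrow> ('k, ('k, 'l) symc) fspace" where
  "Sc L = sym (shift 1 L)"

definition linf_algebra ::
    "('k::field, 'l::ab_group_add) fspace \<Rightarrow> (('k, 'l) symc \<Rightarrow> ('k, 'l) symc) \<Rightarrow> bool" where
  "linf_algebra L Q \<longleftrightarrow>
     complete_fspace L \<and>
     filtered_map (Sc L) (Sc L) 1 Q \<and>
     (\<forall>i. \<forall>X\<in>fil (Sc L) 0 i.
        coprod (shift 1 L) (Q X) =
          tensor_map (Sc L) (Sc L) 1 Q 0 id (coprod (shift 1 L) X) +
          tensor_map (Sc L) (Sc L) 0 id 1 Q (coprod (shift 1 L) X)) \<and>
     (\<forall>i. \<forall>X\<in>fil (Sc L) 0 i. Q (Q X) = 0)"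

definition flat :: "('k::field, 'l::ab_group_add) fspace \<Rightarrow> (('k, 'l) symc \<Rightarrow> ('k, 'l) symc) \<Rightarrow> bool" where
  "flat L Q \<longleftrightarrow> sym_proj1 (shift 1 L) (Q (sym_word (shift 1 L) [])) = 0"

definition Cm ::
    "('k::field, 'l::ab_group_add) fspace \<Rightarrow> ('k, 'm::ab_group_add) fspace \<Rightarrow>
     ('k, ('k, 'l, 'm) comod) fspace" where
  "Cm L M = tensor (Sc L) M"

definition coact ::
    "('k::field, 'l::ab_group_add) fspace \<Rightarrow> ('k, 'm::ab_group_add) fspace \<Rightarrow>
     ('k, 'l, 'm) comod \<Rightarrow> ('k, 'l, ('k, 'l, 'm) comod) comod" where
  "coact L M X =
     tensor_assoc (Sc L) (Sc L) M
       (tensor_map (tensor (Sc L) (Sc L)) M 0 (coprod (shift 1 L)) 0 id X)"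

definition linf_module ::
    "('k::field, 'l::ab_group_add) fspace \<Rightarrow> (('k, 'l) symc \<Rightarrow> ('k, 'l) symc) \<Rightarrow>
     ('k, 'm::ab_group_add) fspace \<Rightarrow> (('k, 'l, 'm) comod \<Rightarrow> ('k, 'l, 'm) comod) \<Rightarrow> bool" where
  "linf_module L Q M \<phi> \<longleftrightarrow>
     complete_fspace M \<and>
     filtered_map (Cm L M) (Cm L M) 1 \<phi> \<and>
     (\<forall>i. \<forall>X\<in>fil (Cm L M) 0 i.
        coact L M (\<phi> X) =
          tensor_map (Sc L) (Cm L M) 1 Q 0 id (coact L M X) +
          tensor_map (Sc L) (Cm L M) 0 id 1 \<phi> (coact L M X)) \<and>
     (\<forall>i. \<forall>X\<in>fil (Cm L M) 0 i. \<phi> (\<phi> X) = 0)"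

definition linf_morphism ::
    "('k::field, 'l::ab_group_add) fspace \<Rightarrow>
     ('k, 'm::ab_group_add) fspace \<Rightarrow> (('k, 'l, 'm) comod \<Rightarrow> ('k, 'l, 'm) comod) \<Rightarrow>
     ('k, 'n::ab_group_add) fspace \<Rightarrow> (('k, 'l, 'n) comod \<Rightarrow> ('k, 'l, 'n) comod) \<Rightarrow>
     (('k, 'l, 'm) comod \<Rightarrow> ('k, 'l, 'n) comod) \<Rightarrow> bool" where
  "linf_morphism L M \<phi> N \<psi> F \<longleftrightarrow>
     filtered_map (Cm L M) (Cm L N) 0 F \<and>
     (\<forall>i. \<forall>X\<in>fil (Cm L M) 0 i.
        coact L N (F X) = tensor_map (Sc L) (Cm L N) 0 id 0 F (coact L M X)) \<and>
     (\<forall>i. \<forall>X\<in>fil (Cm L M) 0 i. F (\<phi> X) = \<psi> (F X))"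

text \<open>
  The component with no algebra arguments, \<open>m \<mapsto> (\<epsilon> \<otimes> id)(F (1 \<otimes> m))\<close>, of a comodule morphism or
  coderivation.  It is a family indexed by the degree of \<open>m\<close>.
\<close>

definition comp0 ::
    "('k::field, 'l::ab_group_add) fspace \<Rightarrow> ('k, 'm::ab_group_add) fspace \<Rightarrow>
     ('k, 'n::ab_group_add) fspace \<Rightarrow> (('k, 'l, 'm) comod \<Rightarrow> ('k, 'l, 'n) comod) \<Rightarrow> int \<Rightarrow> 'm \<Rightarrow> 'n" where
  "comp0 L M N F i m =
     lext (scl N) (\<lambda>((j, s), (l, n)). scl N (counit s) n)
       (F (tens (Sc L) M (0, sym_word (shift 1 L) []) (i, m)))"

section \<open>Cohomology of complexes\<close>

definition is_complex :: "('k, 'v::ab_group_add) fspace \<Rightarrow> (int \<Rightarrow> 'v \<Rightarrow> 'v) \<Rightarrow> bool" where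
  "is_complex V d \<longleftrightarrow>
     (\<forall>i. linear_on (scl V) (scl V) (fil V 0 i) (d i) \<and> d i ` fil V 0 i \<subseteq> fil V 0 (i + 1) \<and>
          (\<forall>x\<in>fil V 0 i. d (i + 1) (d i x) = 0))"

definition chain_map ::
    "('k, 'v::ab_group_add) fspace \<Rightarrow> (int \<Rightarrow> 'v \<Rightarrow> 'v) \<Rightarrow>
     ('k, 'w::ab_group_add) fspace \<Rightarrow> (int \<Rightarrow> 'w \<Rightarrow> 'w) \<Rightarrow> (int \<Rightarrow> 'v \<Rightarrow> 'w) \<Rightarrow> bool" where
  "chain_map V d W e f \<longleftrightarrow>
     (\<forall>i. linear_on (scl V) (scl W) (fil V 0 i) (f i) \<and> f i ` fil V 0 i \<subseteq> fil W 0 i \<and>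
          (\<forall>x\<in>fil V 0 i. f (i + 1) (d i x) = e i (f i x)))"

definition cocycles :: "('k, 'v::ab_group_add) fspace \<Rightarrow> (int \<Rightarrow> 'v \<Rightarrow> 'v) \<Rightarrow> int \<Rightarrow> 'v set" where
  "cocycles V d i = {x \<in> fil V 0 i. d i x = 0}"

definition cohomologous ::
    "('k, 'v::ab_group_add) fspace \<Rightarrow> (int \<Rightarrow> 'v \<Rightarrow> 'v) \<Rightarrow> int \<Rightarrow> ('v \<times> 'v) set" where
  "cohomologous V d i =
     {(x, y). x \<in> cocycles V d i \<and> y \<in> cocycles V d i \<and> x - y \<in> d (i - 1) ` fil V 0 (i - 1)}"

definition cohom ::
    "('k, 'v::ab_group_add) fspace \<Rightarrow> (int \<Rightarrow> 'v \<Rightarrow> 'v) \<Rightarrow> int \<Rightarrow> 'v set set" where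
  "cohom V d i = cocycles V d i // cohomologous V d i"

definition cohom_zero ::
    "('k, 'v::ab_group_add) fspace \<Rightarrow> (int \<Rightarrow> 'v \<Rightarrow> 'v) \<Rightarrow> int \<Rightarrow> 'v set" where
  "cohom_zero V d i = cohomologous V d i `` {0}"

definition cohom_map ::
    "('k, 'w::ab_group_add) fspace \<Rightarrow> (int \<Rightarrow> 'w \<Rightarrow> 'w) \<Rightarrow> (int \<Rightarrow> 'v \<Rightarrow> 'w) \<Rightarrow> int \<Rightarrow> 'v set \<Rightarrow> 'w set" where
  "cohom_map W e f i X = (\<Union>x\<in>X. cohomologous W e i `` {f i x})"

definition quasi_iso ::
    "('k, 'v::ab_group_add) fspace \<Rightarrow> (int \<Rightarrow> 'v \<Rightarrow> 'v) \<Rightarrow>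
     ('k, 'w::ab_group_add) fspace \<Rightarrow> (int \<Rightarrow> 'w \<Rightarrow> 'w) \<Rightarrow> (int \<Rightarrow> 'v \<Rightarrow> 'w) \<Rightarrow> bool" where
  "quasi_iso V d W e f \<longleftrightarrow>
     is_complex V d \<and> is_complex W e \<and> chain_map V d W e f \<and>
     (\<forall>i. bij_betw (cohom_map W e f i) (cohom V d i) (cohom W e i))"

definition linf_quasi_iso ::
    "('k::field, 'l::ab_group_add) fspace \<Rightarrow> (('k, 'l) symc \<Rightarrow> ('k, 'l) symc) \<Rightarrow>
     ('k, 'm::ab_group_add) fspace \<Rightarrow> (('k, 'l, 'm) comod \<Rightarrow> ('k, 'l, 'm) comod) \<Rightarrow>
     ('k, 'n::ab_group_add) fspace \<Rightarrow> (('k, 'l, 'n) comod \<Rightarrow> ('k, 'l, 'n) comod) \<Rightarrow>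
     (('k, 'l, 'm) comod \<Rightarrow> ('k, 'l, 'n) comod) \<Rightarrow> bool" where
  "linf_quasi_iso L Q M \<phi> N \<psi> F \<longleftrightarrow>
     flat L Q \<and> linf_morphism L M \<phi> N \<psi> F \<and>
     quasi_iso M (comp0 L M M \<phi>) N (comp0 L N N \<psi>) (comp0 L M N F)"

section \<open>Twisting\<close>

text \<open>
  The exponential of \<open>\<pi>\<close> only exists in the completion of the symmetric coalgebra, so it is given by
  its partial sums, and twisted maps are defined as limits in the filtration topology.  For \<open>\<pi>\<close> of
  degree 0 in filtration 1 these limits exist in the uncompleted spaces: changing either partial sum
  beyond the \<open>N\<close>-th term changes the result only within the \<open>(N + 1)\<close>-st filtration step.
\<close>

definition exp_sum :: "('k::field_char_0, 'l::ab_group_add) fspace \<Rightarrow> 'l \<Rightarrow> nat \<Rightarrow> ('k, 'l) symc" where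
  "exp_sum L \<pi> N = (\<Sum>n\<le>N. fscale (1 / fact n) (sym_word (shift 1 L) (replicate n (0, \<pi>))))"

definition twist_alg ::
    "('k::field_char_0, 'l::ab_group_add) fspace \<Rightarrow> 'l \<Rightarrow>
     (('k, 'l) symc \<Rightarrow> ('k, 'l) symc) \<Rightarrow> ('k, 'l) symc \<Rightarrow> ('k, 'l) symc" where
  "twist_alg L \<pi> Q a =
     flim (Sc L) (\<lambda>N. sym_mult (shift 1 L) (exp_sum L (- \<pi>) N)
                        (Q (sym_mult (shift 1 L) (exp_sum L \<pi> N) a)))"

text \<open>The action of a degree-0 element of the symmetric algebra on the left tensor factor.\<close>

definition act ::
    "('k::field, 'l::ab_group_add) fspace \<Rightarrow> ('k, 'm::ab_group_add) fspace \<Rightarrow>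
     ('k, 'l) symc \<Rightarrow> ('k, 'l, 'm) comod \<Rightarrow> ('k, 'l, 'm) comod" where
  "act L M A = tensor_map (Sc L) M 0 (sym_mult (shift 1 L) A) 0 id"

text \<open>Twisting of comodule maps: used for module structures (\<open>N = M\<close>) and for morphisms.\<close>

definition twist ::
    "('k::field_char_0, 'l::ab_group_add) fspace \<Rightarrow> 'l \<Rightarrow>
     ('k, 'm::ab_group_add) fspace \<Rightarrow> ('k, 'n::ab_group_add) fspace \<Rightarrow>
     (('k, 'l, 'm) comod \<Rightarrow> ('k, 'l, 'n) comod) \<Rightarrow> ('k, 'l, 'm) comod \<Rightarrow> ('k, 'l, 'n) comod" where
  "twist L \<pi> M N F X =
     flim (Cm L N) (\<lambda>k. act L N (exp_sum L (- \<pi>) k) (F (act L M (exp_sum L \<pi> k) X)))"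

definition maurer_cartan ::
    "('k::field_char_0, 'l::ab_group_add) fspace \<Rightarrow> (('k, 'l) symc \<Rightarrow> ('k, 'l) symc) \<Rightarrow> 'l \<Rightarrow> bool" where
  "maurer_cartan L Q \<pi> \<longleftrightarrow>
     \<pi> \<in> fil (shift 1 L) 1 0 \<and>
     flimit (shift 1 L) 1
       (\<lambda>N. \<Sum>n\<le>N. scl L (1 / fact n)
          (sym_proj1 (shift 1 L) (Q (sym_word (shift 1 L) (replicate n (0, \<pi>)))))) 0"

section \<open>Resolutions\<close>

definition resolution ::
    "('k::field, 'l::ab_group_add) fspace \<Rightarrow> (('k, 'l) symc \<Rightarrow> ('k, 'l) symc) \<Rightarrow>
     ('k, 'm::ab_group_add) fspace \<Rightarrow> (('k, 'l, 'm) comod \<Rightarrow> ('k, 'l, 'm) comod) \<Rightarrow>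
     (nat \<Rightarrow> ('k, 'r::ab_group_add) fspace) \<Rightarrow> (nat \<Rightarrow> ('k, 'l, 'r) comod \<Rightarrow> ('k, 'l, 'r) comod) \<Rightarrow>
     (('k, 'l, 'm) comod \<Rightarrow> ('k, 'l, 'r) comod) \<Rightarrow>
     (nat \<Rightarrow> ('k, 'l, 'r) comod \<Rightarrow> ('k, 'l, 'r) comod) \<Rightarrow> bool" where
  "resolution L Q M \<phi> Mr \<phi>r F D \<longleftrightarrow>
     linf_module L Q M \<phi> \<and> (\<forall>n. linf_module L Q (Mr n) (\<phi>r n)) \<and>
     linf_morphism L M \<phi> (Mr 0) (\<phi>r 0) F \<and>
     (\<forall>n. linf_morphism L (Mr n) (\<phi>r n) (Mr (Suc n)) (\<phi>r (Suc n)) (D n)) \<and>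
     (\<forall>i. {X \<in> fil (Cm L M) 0 i. F X = 0} = {0} \<and>
          F ` fil (Cm L M) 0 i = {X \<in> fil (Cm L (Mr 0)) 0 i. D 0 X = 0} \<and>
          (\<forall>n. D n ` fil (Cm L (Mr n)) 0 i = {X \<in> fil (Cm L (Mr (Suc n))) 0 i. D (Suc n) X = 0}))"

definition resolution_morphism ::
    "('k::field, 'l::ab_group_add) fspace \<Rightarrow>
     ('k, 'm::ab_group_add) fspace \<Rightarrow> (('k, 'l, 'm) comod \<Rightarrow> ('k, 'l, 'm) comod) \<Rightarrow>
     (nat \<Rightarrow> ('k, 'r::ab_group_add) fspace) \<Rightarrow> (nat \<Rightarrow> ('k, 'l, 'r) comod \<Rightarrow> ('k, 'l, 'r) comod) \<Rightarrow>
     (('k, 'l, 'm) comod \<Rightarrow> ('k, 'l, 'r) comod) \<Rightarrow>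
     (nat \<Rightarrow> ('k, 'l, 'r) comod \<Rightarrow> ('k, 'l, 'r) comod) \<Rightarrow>
     ('k, 'n::ab_group_add) fspace \<Rightarrow> (('k, 'l, 'n) comod \<Rightarrow> ('k, 'l, 'n) comod) \<Rightarrow>
     (nat \<Rightarrow> ('k, 's::ab_group_add) fspace) \<Rightarrow> (nat \<Rightarrow> ('k, 'l, 's) comod \<Rightarrow> ('k, 'l, 's) comod) \<Rightarrow>
     (('k, 'l, 'n) comod \<Rightarrow> ('k, 'l, 's) comod) \<Rightarrow>
     (nat \<Rightarrow> ('k, 'l, 's) comod \<Rightarrow> ('k, 'l, 's) comod) \<Rightarrow>
     (('k, 'l, 'm) comod \<Rightarrow> ('k, 'l, 'n) comod) \<Rightarrow>
     (nat \<Rightarrow> ('k, 'l, 'r) comod \<Rightarrow> ('k, 'l, 's) comod) \<Rightarrow> bool" where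
  "resolution_morphism L M \<phi> Mr \<phi>r F D N \<psi> Nr \<psi>r G E U Ur \<longleftrightarrow>
     linf_morphism L M \<phi> N \<psi> U \<and>
     (\<forall>n. linf_morphism L (Mr n) (\<phi>r n) (Nr n) (\<psi>r n) (Ur n)) \<and>
     (\<forall>i. (\<forall>X\<in>fil (Cm L M) 0 i. G (U X) = Ur 0 (F X)) \<and>
          (\<forall>n. \<forall>X\<in>fil (Cm L (Mr n)) 0 i. E n (Ur n X) = Ur (Suc n) (D n X)))"

text \<open>
  Resolution adapted Maurer--Cartan elements: the cohomologies of the twisted modules (with respect
  to the twisted differentials \<open>(\<phi>\<^sup>\<pi>)\<^sub>0\<close>) form an acyclic complex.
\<close>

definition MC_res ::
    "('k::field_char_0, 'l::ab_group_add) fspace \<Rightarrow> (('k, 'l) symc \<Rightarrow> ('k, 'l) symc) \<Rightarrow>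
     ('k, 'm::ab_group_add) fspace \<Rightarrow> (('k, 'l, 'm) comod \<Rightarrow> ('k, 'l, 'm) comod) \<Rightarrow>
     (nat \<Rightarrow> ('k, 'r::ab_group_add) fspace) \<Rightarrow> (nat \<Rightarrow> ('k, 'l, 'r) comod \<Rightarrow> ('k, 'l, 'r) comod) \<Rightarrow>
     (('k, 'l, 'm) comod \<Rightarrow> ('k, 'l, 'r) comod) \<Rightarrow>
     (nat \<Rightarrow> ('k, 'l, 'r) comod \<Rightarrow> ('k, 'l, 'r) comod) \<Rightarrow> 'l set" where
  "MC_res L Q M \<phi> Mr \<phi>r F D =
     {\<pi>. maurer_cartan L Q \<pi> \<and>
        (let d  = comp0 L M M (twist L \<pi> M M \<phi>);
             dr = (\<lambda>n. comp0 L (Mr n) (Mr n) (twist L \<pi> (Mr n) (Mr n) (\<phi>r n)));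
             f  = comp0 L M (Mr 0) (twist L \<pi> M (Mr 0) F);
             g  = (\<lambda>n. comp0 L (Mr n) (Mr (Suc n)) (twist L \<pi> (Mr n) (Mr (Suc n)) (D n)));
             f' = cohom_map (Mr 0) (dr 0) f;
             g' = (\<lambda>n. cohom_map (Mr (Suc n)) (dr (Suc n)) (g n))
         in \<forall>i. {X \<in> cohom M d i. f' i X = cohom_zero (Mr 0) (dr 0) i} = {cohom_zero M d i} \<and>
                f' i ` cohom M d i =
                  {X \<in> cohom (Mr 0) (dr 0) i. g' 0 i X = cohom_zero (Mr 1) (dr 1) i} \<and>
                (\<forall>n. g' n i ` cohom (Mr n) (dr n) i =
                  {X \<in> cohom (Mr (Suc n)) (dr (Suc n)) i.
                     g' (Suc n) i X = cohom_zero (Mr (Suc (Suc n))) (dr (Suc (Suc n))) i}))}"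

end

theory Submission
  imports Defs
begin

text \<open>
  The condition that \<open>\<pi>\<close> is adapted to both resolutions presents \<open>H(M\<^sup>\<pi>)\<close> and \<open>H(N\<^sup>\<pi>)\<close> as the kernels of
  \<open>H(M\<^sup>0) \<rightarrow> H(M\<^sup>1)\<close> and \<open>H(N\<^sup>0) \<rightarrow> H(N\<^sup>1)\<close>, everything being twisted by \<open>\<pi>\<close>.  A morphism of resolutions
  induces a map between these left exact sequences.  It is bijective on the middle and on the right
  terms, hence on the kernels (\<open>quasi_iso_of_kernels\<close>).

  This chase presupposes that twisting and the passage to linear parts are functorial: that twists
  exist, that the twist of a morphism is a morphism between the twisted modules, that the linear part
  of a composite is the composite of the linear parts, and that the linear part of a twisted module
  structure is a differential.  All of this rests on one fact.  The letter \<open>\<pi>\<close> is primitive, so the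
  operator \<open>l\<close> of multiplication by \<open>\<pi>\<close> satisfies \<open>\<Delta> l = (l \<otimes> 1 + 1 \<otimes> l) \<Delta>\<close>, and therefore
  \<open>\<Delta> e\<^sup>l = (e\<^sup>l \<otimes> e\<^sup>l) \<Delta>\<close>; likewise for the coaction.

  The exponential is available only through its partial sums, and neither the symmetric coalgebra nor
  the cofree comodules are complete.  But if \<open>F = (id \<otimes> f) \<circ> coact\<close>, then
  \<open>F e\<^sup>l = e\<^sup>l ((id \<otimes> f e\<^sup>l) \<circ> coact)\<close>, and \<open>f e\<^sup>l\<close> converges because \<open>f\<close> takes values in a complete
  module.  Morphisms have this form (\<open>comodule_morphism_formula\<close>), and module structures have it up to
  the summand \<open>Q \<otimes> id\<close> (\<open>comodule_coderivation_formula\<close>).  The coderivation \<open>Q\<close> is treated in the same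
  way, once it is recovered from its projection to letters (\<open>coderivation_eq_coder\<close>).

  The twist of \<open>F\<close> is handled through the relation \<open>twisted_value\<close>: its value at \<open>x\<close> is the \<open>y\<close> for which
  \<open>F e\<^sup>l x - e\<^sup>l y\<close> tends to zero.  Composites are then immediate, and \<open>y\<close> is unique because tensor
  products and symmetric powers of separated spaces are separated (\<open>separated_tensor\<close>,
  \<open>separated_sym\<close>).  Identities between twists thus follow from identities between the maps.

  Finally, the Maurer--Cartan equation says that the twisted coderivation kills \<open>1\<close>.  So the twisted
  structures and morphisms map \<open>1 \<otimes> M\<close> to subspaces of the same form (\<open>twist_one\<close>), where they act by
  their linear parts; this is why linear parts compose and why the linear part of a module structure
  has square zero.
\<close>


section \<open>Filtered graded spaces\<close>

text \<open>
  What remains of completeness for tensor products and symmetric powers of complete spaces: these are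
  filtered and separated, but in general not complete.
\<close>

definition filtered_space :: "('k::field, 'v::ab_group_add) fspace \<Rightarrow> bool" where
  "filtered_space V \<longleftrightarrow>
     vector_space (scl V) \<and>
     (\<forall>k i. module.subspace (scl V) (fil V k i)) \<and>
     (\<forall>k i. fil V (Suc k) i \<subseteq> fil V k i)"

definition separated :: "('k::field, 'v::ab_group_add) fspace \<Rightarrow> bool" where
  "separated V \<longleftrightarrow> filtered_space V \<and> (\<forall>i. (\<Inter>k. fil V k i) = {0})"

lemma complete_fspace_separated: "complete_fspace V \<Longrightarrow> separated V"
  by (simp add: complete_fspace_def separated_def filtered_space_def)

lemma separated_filtered: "separated V \<Longrightarrow> filtered_space V"
  by (simp add: separated_def)

lemma separatedD: "separated V \<Longrightarrow> (\<And>k. x \<in> fil V k i) \<Longrightarrow> x = 0"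
  by (auto simp: separated_def)

lemma filtered_space_module: "filtered_space V \<Longrightarrow> module (scl V)"
  by (simp add: filtered_space_def module_iff_vector_space)

lemma filtered_space_vector_space: "filtered_space V \<Longrightarrow> vector_space (scl V)"
  by (simp add: filtered_space_def)

lemma separatedI:
  assumes "filtered_space V" "\<And>i x. (\<And>k. x \<in> fil V k i) \<Longrightarrow> x = 0"
  shows "separated V"
proof -
  have "0 \<in> fil V k i" for k i
    using module.subspace_0[OF filtered_space_module[OF assms(1)]] assms(1)
    by (simp add: filtered_space_def)
  then show ?thesis
    unfolding separated_def by (intro conjI allI assms(1) equalityI subsetI) (auto intro: assms(2))
qed

context
  fixes V :: "('k::field, 'v::ab_group_add) fspace"
  assumes V: "filtered_space V"
begin

lemma fil_subspace: "module.subspace (scl V) (fil V k i)"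
  using V by (simp add: filtered_space_def)

lemma fil_zero: "0 \<in> fil V k i"
  by (rule module.subspace_0[OF filtered_space_module[OF V] fil_subspace])

lemma fil_add: "x \<in> fil V k i \<Longrightarrow> y \<in> fil V k i \<Longrightarrow> x + y \<in> fil V k i"
  by (rule module.subspace_add[OF filtered_space_module[OF V] fil_subspace])

lemma fil_diff: "x \<in> fil V k i \<Longrightarrow> y \<in> fil V k i \<Longrightarrow> x - y \<in> fil V k i"
  by (rule module.subspace_diff[OF filtered_space_module[OF V] fil_subspace])

lemma fil_scale: "x \<in> fil V k i \<Longrightarrow> scl V c x \<in> fil V k i"
  by (rule module.subspace_scale[OF filtered_space_module[OF V] fil_subspace])

lemma fil_sum: "(\<And>a. a \<in> A \<Longrightarrow> g a \<in> fil V k i) \<Longrightarrow> (\<Sum>a\<in>A. g a) \<in> fil V k i"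
  by (rule module.subspace_sum[OF filtered_space_module[OF V] fil_subspace])

lemma fil_mono: "k \<le> l \<Longrightarrow> x \<in> fil V l i \<Longrightarrow> x \<in> fil V k i"
proof (induction l rule: dec_induct)
  case (step n)
  then show ?case using V unfolding filtered_space_def by blast
qed

lemma fil_0: "x \<in> fil V k i \<Longrightarrow> x \<in> fil V 0 i"
  by (rule fil_mono[of 0 k]) auto

lemmas scl_simps =
  module.scale_zero_left[OF filtered_space_module[OF V]]
  module.scale_zero_right[OF filtered_space_module[OF V]]
  module.scale_one[OF filtered_space_module[OF V]]
  module.scale_scale[OF filtered_space_module[OF V]]

lemmas scl_distribs =
  module.scale_right_distrib[OF filtered_space_module[OF V]]
  module.scale_right_diff_distrib[OF filtered_space_module[OF V]]
  module.scale_left_distrib[OF filtered_space_module[OF V]]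
  module.scale_left_diff_distrib[OF filtered_space_module[OF V]]

lemmas scl_sum_right = module.scale_sum_right[OF filtered_space_module[OF V]]
lemmas scl_minus = module.scale_minus_left[OF filtered_space_module[OF V]]
  module.scale_minus_right[OF filtered_space_module[OF V]]

lemma scl_minus1: "scl V (- 1) x = - x"
  by (simp add: scl_minus scl_simps)

lemma fil_neg: "x \<in> fil V k i \<Longrightarrow> - x \<in> fil V k i"
  using fil_scale[of x k i "-1"] by (simp add: scl_minus1)

end

lemma filtered_space_shift: "filtered_space V \<Longrightarrow> filtered_space (shift n V)"
  by (simp add: filtered_space_def shift_def)

lemma separated_shift: "separated V \<Longrightarrow> separated (shift n V)"
  by (simp add: separated_def filtered_space_shift) (simp add: shift_def)

lemma linear_onD:
  assumes "linear_on s t A f"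
  shows linear_on_add: "x \<in> A \<Longrightarrow> y \<in> A \<Longrightarrow> f (x + y) = f x + f y"
    and linear_on_scale: "x \<in> A \<Longrightarrow> f (s c x) = t c (f x)"
  using assms by (simp_all add: linear_on_def)

lemma filtered_mapI:
  assumes "\<And>i x y. x \<in> fil V 0 i \<Longrightarrow> y \<in> fil V 0 i \<Longrightarrow> f (x + y) = f x + f y"
    and "\<And>i c x. x \<in> fil V 0 i \<Longrightarrow> f (scl V c x) = scl W c (f x)"
    and "\<And>k i x. x \<in> fil V k i \<Longrightarrow> f x \<in> fil W k (i + d)"
  shows "filtered_map V W d f"
  using assms by (auto simp: filtered_map_def linear_on_def)

context
  fixes V :: "('k::field, 'v::ab_group_add) fspace" and W :: "('k, 'w::ab_group_add) fspace"
    and d f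
  assumes f: "filtered_map V W d f"
begin

lemma fm_in: "x \<in> fil V k i \<Longrightarrow> f x \<in> fil W k (i + d)"
  using f unfolding filtered_map_def by blast

lemma fm_add: "x \<in> fil V 0 i \<Longrightarrow> y \<in> fil V 0 i \<Longrightarrow> f (x + y) = f x + f y"
  using f unfolding filtered_map_def linear_on_def by blast

lemma fm_scale: "x \<in> fil V 0 i \<Longrightarrow> f (scl V c x) = scl W c (f x)"
  using f unfolding filtered_map_def linear_on_def by blast

context
  assumes V: "filtered_space V" and W: "filtered_space W"
begin

lemma fm_zero: "f 0 = 0"
  using fm_scale[of 0 undefined 0] fil_zero[OF V] by (simp add: scl_simps[OF V] scl_simps[OF W])

lemma fm_neg: "x \<in> fil V 0 i \<Longrightarrow> f (- x) = - f x"
  using fm_scale[of x i "-1"] by (simp add: scl_minus1[OF V] scl_minus1[OF W])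

lemma fm_diff: "x \<in> fil V 0 i \<Longrightarrow> y \<in> fil V 0 i \<Longrightarrow> f (x - y) = f x - f y"
  using fm_add[of x i "- y"] fm_neg[of y i] fil_neg[OF V, of y] by simp

lemma fm_sum:
  "finite A \<Longrightarrow> (\<And>a. a \<in> A \<Longrightarrow> g a \<in> fil V 0 i) \<Longrightarrow> f (\<Sum>a\<in>A. g a) = (\<Sum>a\<in>A. f (g a))"
proof (induction A rule: finite_induct)
  case empty
  then show ?case by (simp add: fm_zero)
next
  case (insert x F)
  then have "f (g x + sum g F) = f (g x) + f (sum g F)"
    by (intro fm_add[of _ i]) (auto intro: fil_sum[OF V])
  then show ?case using insert by simp
qed

end
end

lemma fm_comp:
  assumes f: "filtered_map U V d f" and g: "filtered_map V W e g"
    and "filtered_space U"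
  shows "filtered_map U W (d + e) (\<lambda>x. g (f x))"
proof (rule filtered_mapI)
  fix k i x assume "x \<in> fil U k i"
  then show "g (f x) \<in> fil W k (i + (d + e))"
    using fm_in[OF g fm_in[OF f]] by (simp add: add.assoc)
qed (auto simp: fm_add[OF f] fm_scale[OF f] fm_add[OF g fm_in[OF f] fm_in[OF f]]
      fm_scale[OF g fm_in[OF f]])

lemma fm_id: "filtered_map V V 0 id" "filtered_map V V 0 (\<lambda>x. x)"
  by (auto intro: filtered_mapI)

lemma fm_plus:
  assumes f: "filtered_map V W d f" and g: "filtered_map V W d g" and W: "filtered_space W"
  shows "filtered_map V W d (\<lambda>x. f x + g x)"
  by (rule filtered_mapI)
    (auto simp: fm_add[OF f] fm_add[OF g] fm_scale[OF f] fm_scale[OF g] scl_distribs[OF W]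
      intro!: fil_add[OF W] fm_in[OF f] fm_in[OF g])

lemma fm_smult:
  assumes f: "filtered_map V W d f" and W: "filtered_space W"
  shows "filtered_map V W d (\<lambda>x. scl W c (f x))"
  by (rule filtered_mapI)
    (auto simp: fm_add[OF f] fm_scale[OF f] scl_distribs[OF W] scl_simps[OF W] mult.commute
      intro!: fil_scale[OF W] fm_in[OF f])

lemma fm_zero_map: "filtered_space W \<Longrightarrow> filtered_map V W d (\<lambda>_. 0)"
  by (rule filtered_mapI) (auto simp: scl_simps fil_zero)

section \<open>Free spaces\<close>

interpretation free: vector_space "fscale :: 'k::field \<Rightarrow> ('x \<Rightarrow>\<^sub>0 'k) \<Rightarrow> _"
  by (rule vector_space_fscale)

lemma keys_fscale: "Poly_Mapping.keys (fscale c p) \<subseteq> Poly_Mapping.keys p"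
  by (auto simp: lookup_fscale simp flip: lookup_not_eq_zero_eq_in_keys)

lemma lookup_gen: "Poly_Mapping.lookup (gen x) y = (if x = y then 1 else 0)"
  by (simp add: gen_def lookup_single when_def)

lemma keys_gen: "Poly_Mapping.keys (gen x :: 'x \<Rightarrow>\<^sub>0 'k::field) = {x}"
  by (simp add: gen_def)

lemma lext_superset:
  assumes "vector_space s" "finite A" "Poly_Mapping.keys p \<subseteq> A"
  shows "lext s g p = (\<Sum>x\<in>A. s (Poly_Mapping.lookup p x) (g x))"
proof -
  interpret vector_space s by fact
  show ?thesis unfolding lext_def
    by (rule sum.mono_neutral_left) (use assms in \<open>auto simp: in_keys_iff\<close>)
qed

lemma lext_add:
  assumes "vector_space s"
  shows "lext s g (p + q) = lext s g p + lext s g q"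
proof -
  interpret vector_space s by fact
  let ?A = "Poly_Mapping.keys p \<union> Poly_Mapping.keys q"
  have "Poly_Mapping.keys (p + q) \<subseteq> ?A" by (rule Poly_Mapping.keys_add)
  then show ?thesis
    by (simp add: lext_superset[OF assms, of ?A] lookup_add scale_left_distrib sum.distrib)
qed

lemma lext_fscale:
  assumes "vector_space s"
  shows "lext s g (fscale c p) = s c (lext s g p)"
proof -
  interpret vector_space s by fact
  show ?thesis
    using keys_fscale[of c p]
    by (simp add: lext_superset[OF assms, of "Poly_Mapping.keys p"] lookup_fscale scale_sum_right)
qed

lemma lext_gen:
  assumes "vector_space s"
  shows "lext s g (gen x) = g x"
proof -
  interpret vector_space s by fact
  show ?thesis by (simp add: lext_def keys_gen lookup_gen)
qed

lemma lext_zero: "lext s g 0 = 0"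
  by (simp add: lext_def)

lemma lext_diff:
  assumes "vector_space s"
  shows "lext s g (p - q) = lext s g p - lext s g q"
proof -
  interpret vector_space s by fact
  have "p - q = p + fscale (-1) q" by (simp add: free.scale_minus_left)
  then show ?thesis by (simp only: lext_add[OF assms] lext_fscale[OF assms]) simp
qed

lemma lext_sum:
  assumes "vector_space s"
  shows "lext s g (sum f A) = (\<Sum>a\<in>A. lext s g (f a))"
  by (induction A rule: infinite_finite_induct) (simp_all add: lext_zero lext_add[OF assms])

lemma lext_cong: "(\<And>x. x \<in> Poly_Mapping.keys p \<Longrightarrow> g x = h x) \<Longrightarrow> lext s g p = lext s h p"
  by (simp add: lext_def)

lemma lext_fun_add:
  assumes "vector_space s"
  shows "lext s (\<lambda>x. g x + h x) p = lext s g p + lext s h p"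
proof -
  interpret vector_space s by fact
  show ?thesis by (simp add: lext_def scale_right_distrib sum.distrib)
qed

lemma lext_fun_scale:
  assumes "vector_space s"
  shows "lext s (\<lambda>x. s c (g x)) p = s c (lext s g p)"
proof -
  interpret vector_space s by fact
  show ?thesis by (simp add: lext_def scale_sum_right mult.commute)
qed

lemma lext_fscale_gen: "lext fscale gen p = p"
proof (rule poly_mapping_eqI)
  fix x
  have "Poly_Mapping.lookup (lext fscale gen p) x =
      (\<Sum>y\<in>Poly_Mapping.keys p. if y = x then Poly_Mapping.lookup p y else 0)"
    unfolding lext_def lookup_sum lookup_fscale lookup_gen by (rule sum.cong) auto
  then show "Poly_Mapping.lookup (lext fscale gen p) x = Poly_Mapping.lookup p x"
    by (simp add: in_keys_iff)
qed

lemma lext_span: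
  assumes s: "vector_space s" and R: "\<And>r. r \<in> R \<Longrightarrow> lext s g r = 0" and p: "p \<in> free.span R"
  shows "lext s g p = 0"
proof -
  interpret vector_space s by fact
  from p show ?thesis
    by (induction rule: free.span_induct_alt)
      (simp_all add: lext_zero lext_add[OF s] lext_fscale[OF s] R)
qed

lemma diff_qproj: "p - qproj R p \<in> free.span R"
  using qproj(2)[of R p] by (simp flip: qproj(3))

text \<open>
  The universal property of the quotient of a free space: an assignment on generators that kills
  the relations may be evaluated on any representative, in particular on the one that \<open>qproj\<close> picks.
\<close>

lemma lext_qproj:
  assumes s: "vector_space s" and R: "\<And>r. r \<in> R \<Longrightarrow> lext s g r = 0"
  shows "lext s g (qproj R p) = lext s g p"
proof -
  have "lext s g (p - qproj R p) = 0"
    by (rule lext_span[OF s R diff_qproj])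
  then show ?thesis by (simp add: lext_diff[OF s])
qed

lemma qproj_add: "qproj R (p + q) = qproj R p + qproj R q"
  using qproj(1)[of R] by (simp add: Vector_Spaces.linear_def module_hom_def module_hom_axioms_def)

lemma qproj_scale: "qproj R (fscale c p) = fscale c (qproj R p)"
  using qproj(1)[of R] by (simp add: Vector_Spaces.linear_def module_hom_def module_hom_axioms_def)

lemma qproj_zero: "qproj R 0 = 0"
  using qproj_scale[of R 0 0] by simp

lemma qproj_diff: "qproj R (p - q) = qproj R p - qproj R q"
  using qproj_add[of R "p - q" q] by simp

lemma qproj_sum: "qproj R (sum f A) = (\<Sum>a\<in>A. qproj R (f a))"
  by (induction A rule: infinite_finite_induct) (simp_all add: qproj_add qproj_zero)

lemma qproj_relation: "r \<in> R \<Longrightarrow> qproj R r = 0"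
  using qproj(3)[of R r 0] free.span_base[of r R] by (simp add: qproj_zero)

lemma qproj_lext: "qproj R p = lext fscale (\<lambda>x. qproj R (gen x)) p"
proof -
  have "qproj R (lext fscale gen p) = lext fscale (\<lambda>x. qproj R (gen x)) p"
    by (simp add: lext_def qproj_sum qproj_scale)
  then show ?thesis by (simp add: lext_fscale_gen)
qed

definition supported :: "'x set \<Rightarrow> ('x \<Rightarrow>\<^sub>0 'k::field) set" where
  "supported K = {p. Poly_Mapping.keys p \<subseteq> K}"

lemma subspace_supported: "free.subspace (supported K :: ('x \<Rightarrow>\<^sub>0 'k::field) set)"
  unfolding supported_def
proof (rule free.subspaceI)
  show "x + y \<in> {p. Poly_Mapping.keys p \<subseteq> K}"
    if "x \<in> {p. Poly_Mapping.keys p \<subseteq> K}" "y \<in> {p. Poly_Mapping.keys p \<subseteq> K}"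
    for x y :: "'x \<Rightarrow>\<^sub>0 'k"
    using that Poly_Mapping.keys_add[of x y] by auto
  show "fscale c x \<in> {p. Poly_Mapping.keys p \<subseteq> K}"
    if "x \<in> {p. Poly_Mapping.keys p \<subseteq> K}" for c and x :: "'x \<Rightarrow>\<^sub>0 'k"
    using that keys_fscale[of c x] by auto
qed simp

lemma gen_supported: "gen x \<in> supported K \<longleftrightarrow> x \<in> K"
  by (simp add: supported_def keys_gen)

lemma qproj_supported:
  assumes "R \<subseteq> supported K" "p \<in> supported K"
  shows "qproj R p \<in> supported K"
proof -
  have "p - qproj R p \<in> supported K"
    using free.span_minimal[OF assms(1) subspace_supported] diff_qproj[of p R] by blast
  then have "p - (p - qproj R p) \<in> supported K"
    by (rule free.subspace_diff[OF subspace_supported assms(2)])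
  then show ?thesis by simp
qed

lemma span_supported: "S \<subseteq> supported K \<Longrightarrow> free.span S \<subseteq> supported K"
  by (rule free.span_minimal[OF _ subspace_supported])

lemma lext_eq_on_supported:
  "p \<in> supported K \<Longrightarrow> (\<And>x. x \<in> K \<Longrightarrow> g x = h x) \<Longrightarrow> lext s g p = lext s h p"
  by (rule lext_cong) (auto simp: supported_def)

section \<open>Maps out of tensor products\<close>

lemma scl_tensor [simp]: "scl (tensor V W) = fscale"
  by (simp add: tensor_def)

lemma scl_sym [simp]: "scl (sym V) = fscale"
  by (simp add: sym_def)

lemma scl_shift [simp]: "scl (shift n V) = scl V"
  by (simp add: shift_def)

lemma fil_tensor: "fil (tensor V W) k d = free.span {tens V W (i, x) (j, y) | i j x y p q.
    x \<in> fil V p i \<and> y \<in> fil W q j \<and> p + q = k \<and> i + j = d}"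
  by (simp add: tensor_def)

definition tensor_gens ::
    "('k, 'v) fspace \<Rightarrow> ('k, 'w) fspace \<Rightarrow> ((int \<times> 'v) \<times> (int \<times> 'w)) set" where
  "tensor_gens V W = {((i, x), (j, y)) | i x j y. x \<in> fil V 0 i \<and> y \<in> fil W 0 j}"

text \<open>
  Bilinearity and multilinearity are required degree by degree, because the same vector may belong to
  several degrees and then counts as several homogeneous elements.
\<close>

definition bilinear_map ::
    "('k::field, 'v::ab_group_add) fspace \<Rightarrow> ('k, 'w::ab_group_add) fspace \<Rightarrow>
     ('k, 'x::ab_group_add) fspace \<Rightarrow> int \<Rightarrow> ((int \<times> 'v) \<times> (int \<times> 'w) \<Rightarrow> 'x) \<Rightarrow> bool" where
  "bilinear_map V W X d g \<longleftrightarrow>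
     (\<forall>i j x x' y. x \<in> fil V 0 i \<longrightarrow> x' \<in> fil V 0 i \<longrightarrow> y \<in> fil W 0 j \<longrightarrow>
        g ((i, x + x'), (j, y)) = g ((i, x), (j, y)) + g ((i, x'), (j, y))) \<and>
     (\<forall>i j x y y'. x \<in> fil V 0 i \<longrightarrow> y \<in> fil W 0 j \<longrightarrow> y' \<in> fil W 0 j \<longrightarrow>
        g ((i, x), (j, y + y')) = g ((i, x), (j, y)) + g ((i, x), (j, y'))) \<and>
     (\<forall>i j c x y. x \<in> fil V 0 i \<longrightarrow> y \<in> fil W 0 j \<longrightarrow>
        g ((i, scl V c x), (j, y)) = scl X c (g ((i, x), (j, y)))) \<and>
     (\<forall>i j c x y. x \<in> fil V 0 i \<longrightarrow> y \<in> fil W 0 j \<longrightarrow>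
        g ((i, x), (j, scl W c y)) = scl X c (g ((i, x), (j, y)))) \<and>
     (\<forall>i j p q x y. x \<in> fil V p i \<longrightarrow> y \<in> fil W q j \<longrightarrow>
        g ((i, x), (j, y)) \<in> fil X (p + q) (i + j + d))"

lemma bilinear_mapI:
  assumes "\<And>i j x x' y. x \<in> fil V 0 i \<Longrightarrow> x' \<in> fil V 0 i \<Longrightarrow> y \<in> fil W 0 j \<Longrightarrow>
        g ((i, x + x'), (j, y)) = g ((i, x), (j, y)) + g ((i, x'), (j, y))"
    and "\<And>i j x y y'. x \<in> fil V 0 i \<Longrightarrow> y \<in> fil W 0 j \<Longrightarrow> y' \<in> fil W 0 j \<Longrightarrow>
        g ((i, x), (j, y + y')) = g ((i, x), (j, y)) + g ((i, x), (j, y'))"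
    and "\<And>i j c x y. x \<in> fil V 0 i \<Longrightarrow> y \<in> fil W 0 j \<Longrightarrow>
        g ((i, scl V c x), (j, y)) = scl X c (g ((i, x), (j, y)))"
    and "\<And>i j c x y. x \<in> fil V 0 i \<Longrightarrow> y \<in> fil W 0 j \<Longrightarrow>
        g ((i, x), (j, scl W c y)) = scl X c (g ((i, x), (j, y)))"
    and "\<And>i j p q x y. x \<in> fil V p i \<Longrightarrow> y \<in> fil W q j \<Longrightarrow>
        g ((i, x), (j, y)) \<in> fil X (p + q) (i + j + d)"
  shows "bilinear_map V W X d g"
  using assms unfolding bilinear_map_def by (intro conjI allI impI) simp_all

context
  fixes V :: "('k::field, 'v::ab_group_add) fspace" and W :: "('k, 'w::ab_group_add) fspace"
  assumes V: "filtered_space V" and W: "filtered_space W"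
begin

lemma tensor_rel_supported: "tensor_rel V W \<subseteq> supported (tensor_gens V W)"
proof -
  note * = free.subspace_diff[OF subspace_supported] free.subspace_scale[OF subspace_supported]
  show ?thesis
    unfolding tensor_rel_def
    by (intro Un_least; clarify; intro *)
      (auto simp: gen_supported tensor_gens_def intro: fil_add[OF V] fil_add[OF W]
        fil_scale[OF V] fil_scale[OF W])
qed

lemma tens_supported:
  "x \<in> fil V 0 i \<Longrightarrow> y \<in> fil W 0 j \<Longrightarrow> tens V W (i, x) (j, y) \<in> supported (tensor_gens V W)"
  unfolding tens_def
  by (rule qproj_supported[OF tensor_rel_supported]) (auto simp: gen_supported tensor_gens_def)

lemma tens_in:
  "x \<in> fil V p i \<Longrightarrow> y \<in> fil W q j \<Longrightarrow> tens V W (i, x) (j, y) \<in> fil (tensor V W) (p + q) (i + j)"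
  unfolding fil_tensor by (rule free.span_base) blast

lemma tensor_supported: "t \<in> fil (tensor V W) k d \<Longrightarrow> t \<in> supported (tensor_gens V W)"
  unfolding fil_tensor
  by (erule subsetD[OF span_supported, rotated])
    (auto intro!: tens_supported fil_0[OF V] fil_0[OF W])

lemma tensor_induct [consumes 1, case_names tens zero scale add]:
  assumes "t \<in> fil (tensor V W) k d"
    and "\<And>i j x y p q. x \<in> fil V p i \<Longrightarrow> y \<in> fil W q j \<Longrightarrow> p + q = k \<Longrightarrow> i + j = d \<Longrightarrow>
           P (tens V W (i, x) (j, y))"
    and "P 0"
    and "\<And>c t. t \<in> fil (tensor V W) k d \<Longrightarrow> P t \<Longrightarrow> P (fscale c t)"
    and "\<And>s t. s \<in> fil (tensor V W) k d \<Longrightarrow> t \<in> fil (tensor V W) k d \<Longrightarrow> P s \<Longrightarrow> P t \<Longrightarrow> P (s + t)"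
  shows "P t"
proof -
  have "t \<in> fil (tensor V W) k d \<and> P t"
    using assms(1) unfolding fil_tensor
  proof (induction rule: free.span_induct_alt)
    case base
    then show ?case by (simp add: assms(3) free.span_zero)
  next
    case (step c x y)
    have x: "x \<in> fil (tensor V W) k d" "P x"
      using step(1) by (auto simp: fil_tensor intro!: assms(2) free.span_base)
    then have "fscale c x \<in> fil (tensor V W) k d" "P (fscale c x)"
      by (auto simp: fil_tensor intro!: assms(4)[unfolded fil_tensor] free.span_scale)
    then show ?case
      using step(2) assms(5)[of "fscale c x" y] by (simp add: fil_tensor free.span_add)
  qed
  then show ?thesis by blast
qed

lemma filtered_space_tensor: "filtered_space (tensor V W)"
proof -
  have "fil (tensor V W) (Suc k) i \<subseteq> fil (tensor V W) k i" for k i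
    unfolding fil_tensor
  proof (rule free.span_minimal[OF _ free.subspace_span], clarify)
    fix i j :: int and x y p q
    assume *: "x \<in> fil V p i" "y \<in> fil W q j" "p + q = Suc k"
    have "\<exists>p' q'. x \<in> fil V p' i \<and> y \<in> fil W q' j \<and> p' + q' = k"
    proof (cases p)
      case 0
      then show ?thesis using * fil_mono[OF W, of k q y j] by auto
    next
      case (Suc p')
      then show ?thesis using * fil_mono[OF V, of p' p x i] by auto
    qed
    then show "tens V W (i, x) (j, y) \<in> free.span {tens V W (i', x) (j', y) | i' j' x y p q.
        x \<in> fil V p i' \<and> y \<in> fil W q j' \<and> p + q = k \<and> i' + j' = i + j}"
      by (intro free.span_base) blast
  qed
  then show ?thesis
    unfolding filtered_space_def by (simp add: vector_space_fscale) (simp add: fil_tensor)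
qed

lemma lext_tensor_rel:
  assumes X: "filtered_space X" and g: "bilinear_map V W X d g" and r: "r \<in> tensor_rel V W"
  shows "lext (scl X) g r = 0"
proof -
  note vs = filtered_space_vector_space[OF X]
  note l = lext_diff[OF vs] lext_fscale[OF vs] lext_gen[OF vs]
  from r show ?thesis
    unfolding tensor_rel_def using g unfolding bilinear_map_def
    by (elim UnE; clarify) (simp_all add: l)
qed

lemma lext_tens:
  assumes X: "filtered_space X" and g: "bilinear_map V W X d g"
  shows "lext (scl X) g (tens V W a b) = g (a, b)"
  unfolding tens_def
  using lext_qproj[OF filtered_space_vector_space[OF X] lext_tensor_rel[OF X g]]
  by (simp add: lext_gen[OF filtered_space_vector_space[OF X]])

lemma lext_tensor_filtered_map:
  assumes X: "filtered_space X" and g: "bilinear_map V W X d g"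
  shows "filtered_map (tensor V W) X d (lext (scl X) g)"
proof (rule filtered_mapI)
  note vs = filtered_space_vector_space[OF X]
  fix k i t assume "t \<in> fil (tensor V W) k i"
  then show "lext (scl X) g t \<in> fil X k (i + d)"
  proof (induction rule: tensor_induct)
    case (tens i j x y p q)
    then show ?case using g by (auto simp: lext_tens[OF X g] bilinear_map_def)
  qed (auto simp: lext_zero lext_fscale[OF vs] lext_add[OF vs] fil_zero[OF X]
      intro!: fil_scale[OF X] fil_add[OF X])
qed (simp_all add: lext_add[OF filtered_space_vector_space[OF X]]
    lext_fscale[OF filtered_space_vector_space[OF X]])

lemma tens_bilinear: "bilinear_map V W (tensor V W) 0 (\<lambda>(a, b). tens V W a b)"
proof (rule bilinear_mapI)
  fix i j x x' y assume "x \<in> fil V 0 i" "x' \<in> fil V 0 i" "y \<in> fil W 0 j"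
  then have "gen ((i, x + x'), (j, y)) - gen ((i, x), (j, y)) - gen ((i, x'), (j, y)) \<in> tensor_rel V W"
    unfolding tensor_rel_def by blast
  from qproj_relation[OF this] show "(case ((i, x + x'), (j, y)) of (a, b) \<Rightarrow> tens V W a b) =
      (case ((i, x), (j, y)) of (a, b) \<Rightarrow> tens V W a b) + (case ((i, x'), (j, y)) of (a, b) \<Rightarrow> tens V
        W a b)"
    by (simp add: tens_def qproj_diff qproj_add diff_diff_eq)
next
  fix i j x y y' assume "x \<in> fil V 0 i" "y \<in> fil W 0 j" "y' \<in> fil W 0 j"
  then have "gen ((i, x), (j, y + y')) - gen ((i, x), (j, y)) - gen ((i, x), (j, y')) \<in> tensor_rel V W"
    unfolding tensor_rel_def by blast
  from qproj_relation[OF this] show "(case ((i, x), (j, y + y')) of (a, b) \<Rightarrow> tens V W a b) =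
      (case ((i, x), (j, y)) of (a, b) \<Rightarrow> tens V W a b) + (case ((i, x), (j, y')) of (a, b) \<Rightarrow> tens V
        W a b)"
    by (simp add: tens_def qproj_diff qproj_add diff_diff_eq)
next
  fix i j c x y assume "x \<in> fil V 0 i" "y \<in> fil W 0 j"
  then have "gen ((i, scl V c x), (j, y)) - fscale c (gen ((i, x), (j, y))) \<in> tensor_rel V W"
    unfolding tensor_rel_def by blast
  from qproj_relation[OF this] show "(case ((i, scl V c x), (j, y)) of (a, b) \<Rightarrow> tens V W a b) =
      scl (tensor V W) c (case ((i, x), (j, y)) of (a, b) \<Rightarrow> tens V W a b)"
    by (simp add: tens_def qproj_diff qproj_scale)
next
  fix i j c x y assume "x \<in> fil V 0 i" "y \<in> fil W 0 j"
  then have "gen ((i, x), (j, scl W c y)) - fscale c (gen ((i, x), (j, y))) \<in> tensor_rel V W"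
    unfolding tensor_rel_def by blast
  from qproj_relation[OF this] show "(case ((i, x), (j, scl W c y)) of (a, b) \<Rightarrow> tens V W a b) =
      scl (tensor V W) c (case ((i, x), (j, y)) of (a, b) \<Rightarrow> tens V W a b)"
    by (simp add: tens_def qproj_diff qproj_scale)
qed (simp add: tens_in)

lemma tens_add_left: "x \<in> fil V 0 i \<Longrightarrow> x' \<in> fil V 0 i \<Longrightarrow> y \<in> fil W 0 j \<Longrightarrow>
    tens V W (i, x + x') (j, y) = tens V W (i, x) (j, y) + tens V W (i, x') (j, y)"
  and tens_add_right: "x \<in> fil V 0 i \<Longrightarrow> y \<in> fil W 0 j \<Longrightarrow> y' \<in> fil W 0 j \<Longrightarrow>
    tens V W (i, x) (j, y + y') = tens V W (i, x) (j, y) + tens V W (i, x) (j, y')"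
  and tens_scale_left: "x \<in> fil V 0 i \<Longrightarrow> y \<in> fil W 0 j \<Longrightarrow>
    tens V W (i, scl V c x) (j, y) = fscale c (tens V W (i, x) (j, y))"
  and tens_scale_right: "x \<in> fil V 0 i \<Longrightarrow> y \<in> fil W 0 j \<Longrightarrow>
    tens V W (i, x) (j, scl W c y) = fscale c (tens V W (i, x) (j, y))"
  using tens_bilinear unfolding bilinear_map_def by simp_all

lemma tens_zero_left: "y \<in> fil W 0 j \<Longrightarrow> tens V W (i, 0) (j, y) = 0"
  using tens_scale_left[OF fil_zero[OF V], of y j i 0] by (simp add: scl_simps[OF V])

lemma tens_zero_right: "x \<in> fil V 0 i \<Longrightarrow> tens V W (i, x) (j, 0) = 0"
  using tens_scale_right[OF _ fil_zero[OF W], of x i j 0] by (simp add: scl_simps[OF W])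

lemma tens_diff_left: "x \<in> fil V 0 i \<Longrightarrow> x' \<in> fil V 0 i \<Longrightarrow> y \<in> fil W 0 j \<Longrightarrow>
    tens V W (i, x - x') (j, y) = tens V W (i, x) (j, y) - tens V W (i, x') (j, y)"
  using tens_add_left[OF fil_diff[OF V], of x i x' x' y j] by simp

lemma tens_diff_right: "x \<in> fil V 0 i \<Longrightarrow> y \<in> fil W 0 j \<Longrightarrow> y' \<in> fil W 0 j \<Longrightarrow>
    tens V W (i, x) (j, y - y') = tens V W (i, x) (j, y) - tens V W (i, x) (j, y')"
  using tens_add_right[OF _ fil_diff[OF W], of x i y j y' y'] by simp

lemma tensor_ext:
  assumes X: "filtered_space X"
    and f: "filtered_map (tensor V W) X d f" and g: "filtered_map (tensor V W) X d g"
    and eq: "\<And>i j x y. x \<in> fil V 0 i \<Longrightarrow> y \<in> fil W 0 j \<Longrightarrow> f (tens V W (i, x) (j, y)) = g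
        (tens V W (i, x) (j, y))"
    and t: "t \<in> fil (tensor V W) k i"
  shows "f t = g t"
proof -
  note T = filtered_space_tensor
  from fil_0[OF T t] show ?thesis
    by (induction rule: tensor_induct)
      (auto simp: eq fm_zero[OF f T X] fm_zero[OF g T X]
        fm_scale[OF f, simplified] fm_scale[OF g, simplified] fm_add[OF f] fm_add[OF g])
qed

end

lemma tensor_map_bilinear:
  assumes V: "filtered_space V" and W: "filtered_space W"
    and f: "filtered_map V0 V d f" and g: "filtered_map W0 W e g"
  shows "bilinear_map V0 W0 (tensor V W) (d + e)
    (\<lambda>((i, x), (j, y)). fscale (ksign (e * i)) (tens V W (i + d, f x) (j + e, g y)))"
proof (rule bilinear_mapI)
  fix i j p q x y assume "x \<in> fil V0 p i" "y \<in> fil W0 q j"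
  then have "fscale (ksign (e * i)) (tens V W (i + d, f x) (j + e, g y))
     \<in> fil (tensor V W) (p + q) ((i + d) + (j + e))"
    using fil_scale[OF filtered_space_tensor[OF V W]] tens_in[OF V W fm_in[OF f] fm_in[OF g]]
    by simp
  then show "(\<lambda>((i, x), (j, y)). fscale (ksign (e * i)) (tens V W (i + d, f x) (j + e, g y)))
      ((i, x), (j, y)) \<in> fil (tensor V W) (p + q) (i + j + (d + e))" by (simp add: ac_simps)
qed (simp_all add: fm_add[OF f] fm_add[OF g] fm_scale[OF f] fm_scale[OF g]
    tens_add_left[OF V W fm_in[OF f] fm_in[OF f] fm_in[OF g]]
    tens_add_right[OF V W fm_in[OF f] fm_in[OF g] fm_in[OF g]]
    tens_scale_left[OF V W fm_in[OF f] fm_in[OF g]]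
    tens_scale_right[OF V W fm_in[OF f] fm_in[OF g]] free.scale_right_distrib mult.commute)

lemma tensor_map_filtered:
  assumes "filtered_space V0" "filtered_space W0" "filtered_space V" "filtered_space W"
    and "filtered_map V0 V d f" "filtered_map W0 W e g"
  shows "filtered_map (tensor V0 W0) (tensor V W) (d + e) (tensor_map V W d f e g)"
  unfolding tensor_map_def
  using lext_tensor_filtered_map[OF assms(1,2) filtered_space_tensor[OF assms(3,4)]
      tensor_map_bilinear[OF assms(3-6)]] by simp

lemma tensor_map_tens:
  assumes "filtered_space V0" "filtered_space W0" "filtered_space V" "filtered_space W"
    and "filtered_map V0 V d f" "filtered_map W0 W e g"
  shows "tensor_map V W d f e g (tens V0 W0 (i, x) (j, y)) =
    fscale (ksign (e * i)) (tens V W (i + d, f x) (j + e, g y))"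
  unfolding tensor_map_def
  using lext_tens[OF assms(1,2) filtered_space_tensor[OF assms(3,4)]
      tensor_map_bilinear[OF assms(3-6)]] by simp

text \<open>Components of different degrees are independent, because the relations are homogeneous.\<close>

lemma tensor_degrees_disjoint:
  assumes V: "filtered_space V" and W: "filtered_space W"
    and t: "t \<in> fil (tensor V W) 0 d" "t \<in> fil (tensor V W) 0 e" and "d \<noteq> e"
  shows "t = 0"
proof -
  let ?X = "\<lparr>scl = fscale, fil = \<lambda>k i. UNIV\<rparr> :: ('a, (int \<times> 'b) \<times> (int \<times> 'c) \<Rightarrow>\<^sub>0 'a) fspace"
  have X: "filtered_space ?X"
    by (simp add: filtered_space_def vector_space_fscale)
  define g where "g = (\<lambda>((i, x), (j, y)). if i + j = d then tens V W (i, x) (j, y) else 0)"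
  have g: "bilinear_map V W ?X 0 g"
    by (rule bilinear_mapI)
      (simp_all add: g_def tens_add_left[OF V W] tens_add_right[OF V W]
        tens_scale_left[OF V W] tens_scale_right[OF V W])
  have "lext fscale g s = (if k = d then s else 0)" if "s \<in> fil (tensor V W) 0 k" for s k
    using that
  proof (induction rule: tensor_induct[OF V W, consumes 1, case_names tens zero scale add])
    case (tens i j x y p q)
    then show ?case using lext_tens[OF V W X g] by (simp add: g_def)
  qed (simp_all add: lext_zero lext_fscale[OF vector_space_fscale] lext_add[OF vector_space_fscale])
  from this[OF t(1)] this[OF t(2)] show ?thesis using \<open>d \<noteq> e\<close> by simp
qed

section \<open>Maps out of symmetric powers\<close>

abbreviation letters_in :: "('k, 'v) fspace \<Rightarrow> (int \<times> 'v) list \<Rightarrow> nat list \<Rightarrow> bool" where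
  "letters_in V \<equiv> list_all2 (\<lambda>(i, x) p. x \<in> fil V p i)"

lemma fil_sym: "fil (sym V) k d = free.span {sym_word V w | w ps.
    letters_in V w ps \<and> sum_list ps = k \<and> wdeg w = d}"
  by (simp add: sym_def)

lemma is_word_simps [simp]:
  "is_word V []" "is_word V ((i, x) # w) \<longleftrightarrow> x \<in> fil V 0 i \<and> is_word V w"
  "is_word V (a # w) \<longleftrightarrow> snd a \<in> fil V 0 (fst a) \<and> is_word V w"
  "is_word V (u @ v) \<longleftrightarrow> is_word V u \<and> is_word V v"
  by (auto simp: is_word_def)

lemma wdeg_simps [simp]:
  "wdeg [] = 0" "wdeg (a # w) = fst a + wdeg w" "wdeg (u @ v) = wdeg u + wdeg v"
  by (simp_all add: wdeg_def)

definition multilinear_map ::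
    "('k::field, 'v::ab_group_add) fspace \<Rightarrow> ('k, 'x::ab_group_add) fspace \<Rightarrow> int \<Rightarrow>
     ((int \<times> 'v) list \<Rightarrow> 'x) \<Rightarrow> bool" where
  "multilinear_map V X d g \<longleftrightarrow>
     (\<forall>u v i x y. is_word V u \<longrightarrow> is_word V v \<longrightarrow> x \<in> fil V 0 i \<longrightarrow> y \<in> fil V 0 i \<longrightarrow>
        g (u @ (i, x + y) # v) = g (u @ (i, x) # v) + g (u @ (i, y) # v)) \<and>
     (\<forall>u v i c x. is_word V u \<longrightarrow> is_word V v \<longrightarrow> x \<in> fil V 0 i \<longrightarrow>
        g (u @ (i, scl V c x) # v) = scl X c (g (u @ (i, x) # v))) \<and>
     (\<forall>u v i j x y. is_word V u \<longrightarrow> is_word V v \<longrightarrow> x \<in> fil V 0 i \<longrightarrow> y \<in> fil V 0 j \<longrightarrow>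
        g (u @ (i, x) # (j, y) # v) = scl X (ksign (i * j)) (g (u @ (j, y) # (i, x) # v))) \<and>
     (\<forall>w ps. letters_in V w ps \<longrightarrow> g w \<in> fil X (sum_list ps) (wdeg w + d))"

lemma multilinear_mapI:
  assumes "\<And>u v i x y. is_word V u \<Longrightarrow> is_word V v \<Longrightarrow> x \<in> fil V 0 i \<Longrightarrow> y \<in> fil V 0 i \<Longrightarrow>
        g (u @ (i, x + y) # v) = g (u @ (i, x) # v) + g (u @ (i, y) # v)"
    and "\<And>u v i c x. is_word V u \<Longrightarrow> is_word V v \<Longrightarrow> x \<in> fil V 0 i \<Longrightarrow>
        g (u @ (i, scl V c x) # v) = scl X c (g (u @ (i, x) # v))"
    and "\<And>u v i j x y. is_word V u \<Longrightarrow> is_word V v \<Longrightarrow> x \<in> fil V 0 i \<Longrightarrow> y \<in> fil V 0 j \<Longrightarrow>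
        g (u @ (i, x) # (j, y) # v) = scl X (ksign (i * j)) (g (u @ (j, y) # (i, x) # v))"
    and "\<And>w ps. letters_in V w ps \<Longrightarrow> g w \<in> fil X (sum_list ps) (wdeg w + d)"
  shows "multilinear_map V X d g"
  unfolding multilinear_map_def
  by (intro conjI allI impI;
      (rule assms(1) | rule assms(2) | rule assms(3) | rule assms(4)); assumption)

lemma multilinear_mapD:
  assumes "multilinear_map V X d g"
  shows "is_word V u \<Longrightarrow> is_word V v \<Longrightarrow> x \<in> fil V 0 i \<Longrightarrow> y \<in> fil V 0 i \<Longrightarrow>
        g (u @ (i, x + y) # v) = g (u @ (i, x) # v) + g (u @ (i, y) # v)"
    and "is_word V u \<Longrightarrow> is_word V v \<Longrightarrow> x \<in> fil V 0 i \<Longrightarrow>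
        g (u @ (i, scl V c x) # v) = scl X c (g (u @ (i, x) # v))"
    and "is_word V u \<Longrightarrow> is_word V v \<Longrightarrow> x \<in> fil V 0 i \<Longrightarrow> y \<in> fil V 0 j \<Longrightarrow>
        g (u @ (i, x) # (j, y) # v) = scl X (ksign (i * j)) (g (u @ (j, y) # (i, x) # v))"
    and "letters_in V w ps \<Longrightarrow> g w \<in> fil X (sum_list ps) (wdeg w + d)"
  subgoal by (rule assms[unfolded multilinear_map_def, THEN conjunct1, rule_format])
  subgoal by (rule assms[unfolded multilinear_map_def, THEN conjunct2, THEN conjunct1, rule_format])
  subgoal by (rule assms[unfolded multilinear_map_def, THEN conjunct2, THEN conjunct2, THEN conjunct1,
          rule_format])
  subgoal by (rule assms[unfolded multilinear_map_def, THEN conjunct2, THEN conjunct2, THEN conjunct2,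
          rule_format])
  done

context
  fixes V :: "('k::field, 'v::ab_group_add) fspace"
  assumes V: "filtered_space V"
begin

lemma letters_in_is_word: "letters_in V w ps \<Longrightarrow> is_word V w"
  by (induction rule: list_all2_induct) (auto intro: fil_0[OF V])

lemma is_word_letters_in: "is_word V w \<Longrightarrow> letters_in V w (replicate (length w) 0)"
  by (induction w) auto

lemma sym_rel_supported: "sym_rel V \<subseteq> supported {w. is_word V w}"
proof -
  note * = free.subspace_diff[OF subspace_supported] free.subspace_scale[OF subspace_supported]
  show ?thesis
    unfolding sym_rel_def
    by (intro Un_least; clarify; intro *)
      (auto simp: gen_supported intro: fil_add[OF V] fil_scale[OF V])
qed

lemma sym_word_supported: "is_word V w \<Longrightarrow> sym_word V w \<in> supported {w. is_word V w}"
  unfolding sym_word_def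
  by (rule qproj_supported[OF sym_rel_supported]) (auto simp: gen_supported)

lemma sym_word_in: "letters_in V w ps \<Longrightarrow> sym_word V w \<in> fil (sym V) (sum_list ps) (wdeg w)"
  unfolding fil_sym by (rule free.span_base) blast

lemma sym_word_in_0: "is_word V w \<Longrightarrow> sym_word V w \<in> fil (sym V) 0 (wdeg w)"
  using sym_word_in[OF is_word_letters_in] by (simp add: sum_list_replicate)

lemma sym_supported: "t \<in> fil (sym V) k d \<Longrightarrow> t \<in> supported {w. is_word V w}"
  unfolding fil_sym
  by (erule subsetD[OF span_supported, rotated])
    (auto intro!: sym_word_supported intro: letters_in_is_word)

lemma sym_induct [consumes 1, case_names word zero scale add]:
  assumes "t \<in> fil (sym V) k d"
    and "\<And>w ps. letters_in V w ps \<Longrightarrow> sum_list ps = k \<Longrightarrow> wdeg w = d \<Longrightarrow> P (sym_word V w)"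
    and "P 0"
    and "\<And>c t. t \<in> fil (sym V) k d \<Longrightarrow> P t \<Longrightarrow> P (fscale c t)"
    and "\<And>s t. s \<in> fil (sym V) k d \<Longrightarrow> t \<in> fil (sym V) k d \<Longrightarrow> P s \<Longrightarrow> P t \<Longrightarrow> P (s + t)"
  shows "P t"
proof -
  have "t \<in> fil (sym V) k d \<and> P t"
    using assms(1) unfolding fil_sym
  proof (induction rule: free.span_induct_alt)
    case base
    then show ?case by (simp add: assms(3) free.span_zero)
  next
    case (step c x y)
    have x: "x \<in> fil (sym V) k d" "P x"
      using step(1) by (auto simp: fil_sym intro!: assms(2) free.span_base)
    then have "fscale c x \<in> fil (sym V) k d" "P (fscale c x)"
      by (auto simp: fil_sym intro!: assms(4)[unfolded fil_sym] free.span_scale)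
    then show ?case
      using step(2) assms(5)[of "fscale c x" y] by (simp add: fil_sym free.span_add)
  qed
  then show ?thesis by blast
qed

lemma letters_in_weaken:
  "letters_in V w ps \<Longrightarrow> sum_list ps = Suc k \<Longrightarrow> \<exists>qs. letters_in V w qs \<and> sum_list qs = k"
proof (induction arbitrary: k rule: list_all2_induct)
  case (Cons a w p ps)
  obtain i x where a: "a = (i, x)" by (cases a)
  show ?case
  proof (cases p)
    case 0
    then obtain qs where "letters_in V w qs" "sum_list qs = k" using Cons by auto
    then show ?thesis using Cons 0 by (intro exI[of _ "0 # qs"]) auto
  next
    case (Suc p')
    then have "x \<in> fil V p' i" using Cons a fil_mono[OF V, of p' p x i] by auto
    then show ?thesis using Cons Suc a by (intro exI[of _ "p' # ps"]) auto
  qed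
qed simp

lemma filtered_space_sym: "filtered_space (sym V)"
proof -
  have "fil (sym V) (Suc k) i \<subseteq> fil (sym V) k i" for k i
    unfolding fil_sym
  proof (rule free.span_minimal[OF _ free.subspace_span], clarify)
    fix w ps assume "letters_in V w ps" "sum_list ps = Suc k"
    then obtain qs where "letters_in V w qs" "sum_list qs = k"
      using letters_in_weaken by blast
    then show "sym_word V w \<in> free.span {sym_word V w' | w' ps.
        letters_in V w' ps \<and> sum_list ps = k \<and> wdeg w' = wdeg w}"
      by (intro free.span_base) blast
  qed
  then show ?thesis
    unfolding filtered_space_def by (simp add: vector_space_fscale) (simp add: fil_sym)
qed

lemma lext_sym_word:
  assumes X: "filtered_space X" and g: "multilinear_map V X d g"
  shows "lext (scl X) g (sym_word V w) = g w"
proof -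
  note vs = filtered_space_vector_space[OF X]
  note l = lext_diff[OF vs] lext_fscale[OF vs] lext_gen[OF vs]
  have "lext (scl X) g r = 0" if "r \<in> sym_rel V" for r
    using that unfolding sym_rel_def
    by (auto simp: l multilinear_mapD(1,2)[OF g] intro!: multilinear_mapD(3)[OF g])
  from lext_qproj[OF vs this] show ?thesis
    by (simp add: sym_word_def l)
qed

lemma lext_sym_filtered_map:
  assumes X: "filtered_space X" and g: "multilinear_map V X d g"
  shows "filtered_map (sym V) X d (lext (scl X) g)"
proof (rule filtered_mapI)
  note vs = filtered_space_vector_space[OF X]
  fix k i t assume "t \<in> fil (sym V) k i"
  then show "lext (scl X) g t \<in> fil X k (i + d)"
  proof (induction rule: sym_induct)
    case (word w ps)
    then show ?case using multilinear_mapD(4)[OF g] by (auto simp: lext_sym_word[OF X g])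
  qed (auto simp: lext_zero lext_fscale[OF vs] lext_add[OF vs] fil_zero[OF X]
      intro!: fil_scale[OF X] fil_add[OF X])
qed (simp_all add: lext_add[OF filtered_space_vector_space[OF X]]
    lext_fscale[OF filtered_space_vector_space[OF X]])

lemma sym_word_multilinear: "multilinear_map V (sym V) 0 (sym_word V)"
proof (rule multilinear_mapI)
  fix u v i x y assume "is_word V u" "is_word V v" "x \<in> fil V 0 i" "y \<in> fil V 0 i"
  then have "gen (u @ (i, x + y) # v) - gen (u @ (i, x) # v) - gen (u @ (i, y) # v) \<in> sym_rel V"
    unfolding sym_rel_def by blast
  from qproj_relation[OF this] show "sym_word V (u @ (i, x + y) # v) =
      sym_word V (u @ (i, x) # v) + sym_word V (u @ (i, y) # v)"
    by (simp add: sym_word_def qproj_diff qproj_add diff_diff_eq)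
next
  fix u v i c x assume "is_word V u" "is_word V v" "x \<in> fil V 0 i"
  then have "gen (u @ (i, scl V c x) # v) - fscale c (gen (u @ (i, x) # v)) \<in> sym_rel V"
    unfolding sym_rel_def by blast
  from qproj_relation[OF this] show "sym_word V (u @ (i, scl V c x) # v) =
      scl (sym V) c (sym_word V (u @ (i, x) # v))"
    by (simp add: sym_word_def qproj_diff qproj_scale)
next
  fix u v i j x y assume "is_word V u" "is_word V v" "x \<in> fil V 0 i" "y \<in> fil V 0 j"
  then have "gen (u @ (i, x) # (j, y) # v) - fscale (ksign (i * j)) (gen (u @ (j, y) # (i, x) # v))
      \<in> sym_rel V"
    unfolding sym_rel_def by blast
  from qproj_relation[OF this] show "sym_word V (u @ (i, x) # (j, y) # v) =
      scl (sym V) (ksign (i * j)) (sym_word V (u @ (j, y) # (i, x) # v))"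
    by (simp add: sym_word_def qproj_diff qproj_scale)
qed (simp add: sym_word_in)

lemma sym_word_ext:
  assumes X: "filtered_space X"
    and f: "filtered_map (sym V) X d f" and g: "filtered_map (sym V) X d g"
    and eq: "\<And>w. is_word V w \<Longrightarrow> f (sym_word V w) = g (sym_word V w)"
    and t: "t \<in> fil (sym V) k i"
  shows "f t = g t"
proof -
  note S = filtered_space_sym
  from fil_0[OF S t] show ?thesis
    by (induction rule: sym_induct)
      (auto simp: eq letters_in_is_word fm_zero[OF f S X] fm_zero[OF g S X]
        fm_scale[OF f, simplified] fm_scale[OF g, simplified] fm_add[OF f] fm_add[OF g])
qed

end


section \<open>Separation of tensor products and symmetric powers\<close>

text \<open>
  Induction on \<open>S\<close>.  Let the span of \<open>S\<close> meet the \<open>p\<close>-th step trivially.  Then there is at most one \<open>s\<close>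
  in this span with \<open>a + s\<close> in the \<open>p\<close>-th step, so that a step avoiding this single vector is deep
  enough for \<open>insert a S\<close>.
\<close>

lemma finite_span_meets_fil_trivially:
  assumes V: "separated V" and "finite S" and S: "S \<subseteq> fil V 0 i"
  shows "\<exists>p. module.span (scl V) S \<inter> fil V p i = {0}"
  using \<open>finite S\<close> S
proof (induction S rule: finite_induct)
  note F = separated_filtered[OF V]
  interpret vector_space "scl V" by (rule filtered_space_vector_space[OF F])
  case empty
  then show ?case using fil_zero[OF F, of 0 i] by auto
next
  note F = separated_filtered[OF V]
  interpret vector_space "scl V" by (rule filtered_space_vector_space[OF F])
  case (insert a S)
  then obtain p where p: "span S \<inter> fil V p i = {0}" by auto
  show ?case
  proof (cases "\<exists>s\<in>span S. a + s \<in> fil V p i \<and> a + s \<noteq> 0")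
    case False
    have "x = 0" if x: "x \<in> span (insert a S)" "x \<in> fil V p i" for x
    proof -
      obtain c where c: "x - scl V c a \<in> span S" using x(1) by (auto simp: span_insert)
      show ?thesis
      proof (cases "c = 0")
        case True
        then show ?thesis using c x(2) p by auto
      next
        case c0: False
        define s where "s = scl V (inverse c) (x - scl V c a)"
        have s: "s \<in> span S" using c by (simp add: s_def span_scale)
        have xs: "scl V (inverse c) x = a + s"
          using c0 by (simp add: s_def scale_right_diff_distrib)
        then have "a + s \<in> fil V p i" using fil_scale[OF F x(2)] by metis
        then have "a + s = 0" using False s by auto
        then show ?thesis using xs c0 by simp
      qed
    qed
    then show ?thesis using fil_zero[OF F] span_zero by (intro exI[of _ p]) auto
  next
    case True
    then obtain s where s: "s \<in> span S" "a + s \<in> fil V p i" "a + s \<noteq> 0" by auto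
    from s(3) separatedD[OF V, of "a + s" i] obtain q where q: "a + s \<notin> fil V q i" by auto
    have "x = 0" if x: "x \<in> span (insert a S)" "x \<in> fil V (max p q) i" for x
    proof -
      have xp: "x \<in> fil V p i" and xq: "x \<in> fil V q i"
        using fil_mono[OF F _ x(2)] by auto
      obtain c where c: "x - scl V c a \<in> span S" using x(1) by (auto simp: span_insert)
      have "x - scl V c (a + s) = (x - scl V c a) - scl V c s"
        by (simp add: scale_right_distrib)
      then have "x - scl V c (a + s) \<in> span S" using c s(1) span_diff span_scale by metis
      moreover have "x - scl V c (a + s) \<in> fil V p i"
        by (intro fil_diff[OF F] xp fil_scale[OF F] s(2))
      ultimately have "x - scl V c (a + s) = 0" using p by blast
      then have x_eq: "x = scl V c (a + s)" by simp
      show ?thesis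
      proof (cases "c = 0")
        case False
        then have "scl V (inverse c) x = a + s" using x_eq by simp
        then have "a + s \<in> fil V q i" using fil_scale[OF F xq] by metis
        then show ?thesis using q by simp
      qed (use x_eq in simp)
    qed
    then show ?thesis using fil_zero[OF F] span_zero by (intro exI[of _ "max p q"]) auto
  qed
qed

text \<open>
  Vectors whose span meets a filtration step trivially can be put into a complement of this step, and
  the projection along the step fixes them.  By functoriality such projections separate the points
  of tensor products and symmetric powers.
\<close>

lemma projection_killing_fil:
  assumes V: "separated V" and "finite S" and S: "S \<subseteq> fil V 0 i"
  shows "\<exists>P p. Vector_Spaces.linear (scl V) (scl V) P \<and> (\<forall>x. P x \<in> fil V 0 i) \<and>
    (\<forall>x\<in>S. P x = x) \<and> (\<forall>x\<in>fil V p i. P x = 0)"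
proof -
  note F = separated_filtered[OF V]
  interpret vector_space "scl V" by (rule filtered_space_vector_space[OF F])
  interpret vp: vector_space_pair "scl V" "scl V" by unfold_locales
  obtain p where p: "span S \<inter> fil V p i = {0}"
    using finite_span_meets_fil_trivially[OF assms] by auto
  have sub: "subspace (fil V p i)" by (rule fil_subspace[OF F])
  obtain C where C: "C \<subseteq> fil V p i" "independent C" "fil V p i \<subseteq> span C"
    by (rule maximal_independent_subset[of "fil V p i"])
  have spanC: "span C = fil V p i"
    using C(1,3) span_minimal[OF C(1) sub] by auto
  define D where "D = extend_basis C"
  have D: "independent D" "span D = UNIV" "C \<subseteq> D"
    unfolding D_def
    by (rule independent_extend_basis[OF C(2)], rule span_extend_basis[OF C(2)],
        rule extend_basis_superset[OF C(2)])
  define R where "R = vp.construct D (\<lambda>b. if b \<in> C then 0 else b)"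
  have lin: "Vector_Spaces.linear (scl V) (scl V) R"
    unfolding R_def by (rule vp.linear_construct[OF D(1)])
  interpret R: Vector_Spaces.linear "scl V" "scl V" R by (rule lin)
  have Rb: "R b = (if b \<in> C then 0 else b)" if "b \<in> D" for b
    unfolding R_def by (rule vp.construct_basis[OF D(1) that])
  have R_fil: "R x = 0" if "x \<in> fil V p i" for x
    using that unfolding spanC[symmetric]
    by (induction rule: span_induct_alt) (use D(3) in \<open>auto simp: R.zero R.add R.scale Rb\<close>)
  have R_diff: "x - R x \<in> fil V p i" for x
  proof -
    have "x \<in> span D" using D(2) by simp
    then have "x - R x \<in> span C"
    proof (induction rule: span_induct_alt)
      case (step c x y)
      have "x - R x \<in> span C" using Rb[OF step(1)] by (auto intro: span_base span_zero)
      then have "scl V c (x - R x) + (y - R y) \<in> span C"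
        using step by (intro span_add span_scale)
      then show ?case by (simp add: R.add R.scale scale_right_diff_distrib algebra_simps)
    qed (simp add: span_zero R.zero)
    then show ?thesis by (simp add: spanC)
  qed
  have inj: "inj_on R (span S)"
  proof (rule inj_onI)
    fix x y assume xy: "x \<in> span S" "y \<in> span S" "R x = R y"
    then have "x - y \<in> span S \<inter> fil V p i"
      using span_diff R_diff[of "x - y"] by (simp add: R.diff)
    then show "x = y" unfolding p by simp
  qed
  obtain g where g: "g ` UNIV \<subseteq> span S" "Vector_Spaces.linear (scl V) (scl V) g"
    "\<forall>v\<in>span S. g (R v) = v"
    using vp.linear_exists_left_inverse_on[OF lin subspace_span inj] by blast
  interpret g: Vector_Spaces.linear "scl V" "scl V" g by (rule g(2))
  have "span S \<subseteq> fil V 0 i"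
    by (rule span_minimal[OF S fil_subspace[OF F]])
  then have "g (R x) \<in> fil V 0 i" for x
    using g(1) by auto
  moreover have "Vector_Spaces.linear (scl V) (scl V) (\<lambda>x. g (R x))"
    using Vector_Spaces.linear_compose[OF lin g(2)] by (simp add: o_def)
  moreover have "g (R x) = x" if "x \<in> S" for x
    using g(3) span_base[OF that] by blast
  moreover have "g (R x) = 0" if "x \<in> fil V p i" for x
    by (simp add: R_fil[OF that] g.zero)
  ultimately show ?thesis by blast
qed

text \<open>
  Only finitely many degrees occur in \<open>S\<close>, so the deepest of the steps needed for them serves for all;
  in the remaining degrees the projection is zero.
\<close>

lemma graded_projection_killing_fil:
  assumes V: "separated V" and "finite S" and S: "\<And>i x. (i, x) \<in> S \<Longrightarrow> x \<in> fil V 0 i"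
  obtains P p where "\<And>i. Vector_Spaces.linear (scl V) (scl V) (P i)"
    and "\<And>i x. P i x \<in> fil V 0 i" and "\<And>i x. (i, x) \<in> S \<Longrightarrow> P i x = x"
    and "\<And>i x. x \<in> fil V p i \<Longrightarrow> P i x = 0"
proof -
  note F = separated_filtered[OF V]
  interpret vector_space "scl V" by (rule filtered_space_vector_space[OF F])
  define \<Phi> where "\<Phi> i P p \<longleftrightarrow> Vector_Spaces.linear (scl V) (scl V) P \<and> (\<forall>x. P x \<in> fil V 0 i) \<and>
      (\<forall>x\<in>snd ` {s \<in> S. fst s = i}. P x = x) \<and> (\<forall>x\<in>fil V p i. P x = 0)" for i P p
  have "\<exists>P p. \<Phi> i P p" for i
    unfolding \<Phi>_def using \<open>finite S\<close> S by (intro projection_killing_fil[OF V]) auto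
  then obtain P p where \<Phi>: "\<And>i. \<Phi> i (P i) (p i)" by metis
  have P: "Vector_Spaces.linear (scl V) (scl V) (P i)" "P i x \<in> fil V 0 i"
      "(i, x) \<in> S \<Longrightarrow> P i x = x" "x \<in> fil V (p i) i \<Longrightarrow> P i x = 0" for i x
    using \<Phi>[of i] unfolding \<Phi>_def by force+
  define P' where "P' = (\<lambda>i x. if i \<in> fst ` S then P i x else 0)"
  have zero: "Vector_Spaces.linear (scl V) (scl V) (\<lambda>x. 0)"
    by unfold_locales simp_all
  show ?thesis
  proof (rule that[of P' "Max (p ` fst ` S)"])
    show "Vector_Spaces.linear (scl V) (scl V) (P' i)" for i
      using P(1) zero by (cases "i \<in> fst ` S") (simp_all add: P'_def)
    show "P' i x \<in> fil V 0 i" for i x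
      using P(2) fil_zero[OF F] by (simp add: P'_def)
    show "P' i x = x" if "(i, x) \<in> S" for i x
      using P(3)[OF that] that by (force simp: P'_def)
    show "P' i x = 0" if "x \<in> fil V (Max (p ` fst ` S)) i" for i x
    proof (cases "i \<in> fst ` S")
      case True
      then have "p i \<le> Max (p ` fst ` S)" using \<open>finite S\<close> by (intro Max_ge) auto
      then have "x \<in> fil V (p i) i" using fil_mono[OF F _ that] by blast
      then show ?thesis using P(4) by (simp add: P'_def)
    qed (simp add: P'_def)
  qed
qed

text \<open>Elements of the quotients are their own representatives, because \<open>qproj\<close> is idempotent.\<close>

lemma tensor_lext_tens:
  assumes "filtered_space V" "filtered_space W" "t \<in> fil (tensor V W) k d"
  shows "lext fscale (\<lambda>(a, b). tens V W a b) t = t"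
proof -
  have "qproj (tensor_rel V W) t = t"
    using assms(3)
    by (induction rule: tensor_induct[OF assms(1,2), consumes 1, case_names tens zero scale add])
      (simp_all add: tens_def qproj(2) qproj_zero qproj_scale qproj_add)
  then show ?thesis
    using qproj_lext[of "tensor_rel V W" t] by (simp add: tens_def case_prod_unfold)
qed

lemma sym_lext_sym_word:
  assumes "filtered_space V" "t \<in> fil (sym V) k d"
  shows "lext fscale (sym_word V) t = t"
proof -
  have "qproj (sym_rel V) t = t"
    using assms(2)
    by (induction rule: sym_induct[OF assms(1), consumes 1, case_names word zero scale add])
      (simp_all add: sym_word_def qproj(2) qproj_zero qproj_scale qproj_add)
  then show ?thesis
    using qproj_lext[of "sym_rel V" t] by (simp add: sym_word_def[abs_def])
qed

lemma linear_simps: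
  assumes "Vector_Spaces.linear s t f"
  shows "f (x + y) = f x + f y" "f (s c x) = t c (f x)"
  using assms by (simp_all add: Vector_Spaces.linear_def module_hom_def module_hom_axioms_def)

text \<open>A vector space with the trivial filtration, as a target for maps that do not respect filtrations.\<close>

definition unfiltered :: "('k, 'v) fspace \<Rightarrow> ('k, 'v) fspace" where
  "unfiltered V = \<lparr>scl = scl V, fil = \<lambda>k i. UNIV\<rparr>"

lemma unfiltered: "scl (unfiltered V) = scl V" "x \<in> fil (unfiltered V) k i"
  by (simp_all add: unfiltered_def)

lemma filtered_space_unfiltered:
  assumes "filtered_space V" shows "filtered_space (unfiltered V)"
proof -
  interpret module "scl V" by (rule filtered_space_module[OF assms])
  show ?thesis using assms
    by (simp add: unfiltered_def filtered_space_def)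
qed

text \<open>
  An element \<open>t\<close> of all filtration steps is fixed by \<open>P \<otimes> R\<close>, where \<open>P\<close> and \<open>R\<close> are projections that fix
  the finitely many vectors occurring in \<open>t\<close>.  If these kill the steps \<open>p\<close> and \<open>r\<close>, then \<open>P \<otimes> R\<close> kills
  the step \<open>p + r\<close> of the tensor product, so \<open>t = 0\<close>.
\<close>

lemma separated_tensor:
  assumes sV: "separated V" and sW: "separated W"
  shows "separated (tensor V W)"
proof -
  note V = separated_filtered[OF sV] and W = separated_filtered[OF sW]
  note T = filtered_space_tensor[OF V W]
  have "t = 0" if t: "\<And>k. t \<in> fil (tensor V W) k d" for t d
  proof -
    let ?K = "Poly_Mapping.keys t"
    have K: "?K \<subseteq> tensor_gens V W"
      using tensor_supported[OF V W t[of 0]] by (simp add: supported_def)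
    obtain P p where P: "\<And>i. Vector_Spaces.linear (scl V) (scl V) (P i)" "\<And>i x. P i x \<in> fil V 0 i"
        "\<And>i x. (i, x) \<in> fst ` ?K \<Longrightarrow> P i x = x" "\<And>i x. x \<in> fil V p i \<Longrightarrow> P i x = 0"
      by (rule graded_projection_killing_fil[OF sV, of "fst ` ?K"])
        (use K in \<open>auto simp: tensor_gens_def\<close>)
    obtain R r where R: "\<And>i. Vector_Spaces.linear (scl W) (scl W) (R i)" "\<And>i x. R i x \<in> fil W 0 i"
        "\<And>i x. (i, x) \<in> snd ` ?K \<Longrightarrow> R i x = x" "\<And>i x. x \<in> fil W r i \<Longrightarrow> R i x = 0"
      by (rule graded_projection_killing_fil[OF sW, of "snd ` ?K"])
        (use K in \<open>auto simp: tensor_gens_def\<close>)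
    define g where "g = (\<lambda>((i, x), (j, y)). tens V W (i, P i x) (j, R j y))"
    note X = filtered_space_unfiltered[OF T]
    have g: "bilinear_map V W (unfiltered (tensor V W)) 0 g"
      by (rule bilinear_mapI)
        (simp_all add: g_def unfiltered linear_simps[OF P(1)] linear_simps[OF R(1)] P(2) R(2)
          tens_add_left[OF V W] tens_add_right[OF V W] tens_scale_left[OF V W] tens_scale_right[OF V W])
    have "lext fscale g t = lext fscale (\<lambda>(a, b). tens V W a b) t"
      by (rule lext_cong) (use P(3) R(3) in \<open>force simp: g_def image_iff Bex_def\<close>)
    then have "t = lext fscale g t" by (simp add: tensor_lext_tens[OF V W t[of 0]])
    also have "\<dots> = 0"
      using t[of "p + r"]
    proof (induction rule: tensor_induct[OF V W, consumes 1, case_names tens zero scale add])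
      case (tens i j x y p' q')
      have "p \<le> p' \<or> r \<le> q'" using tens(3) by linarith
      then have "P i x = 0 \<or> R j y = 0"
        using fil_mono[OF V, of p p' x i] fil_mono[OF W, of r q' y j] tens(1,2) P(4) R(4) by blast
      then show ?case
        using lext_tens[OF V W X g]
          tens_zero_left[OF V W R(2)] tens_zero_right[OF V W P(2)]
        by (auto simp: unfiltered g_def)
    qed (simp_all add: lext_zero lext_fscale[OF vector_space_fscale] lext_add[OF vector_space_fscale])
    finally show ?thesis .
  qed
  then show ?thesis by (rule separatedI[OF T])
qed

lemma sym_word_zero_letter:
  assumes V: "filtered_space V" and "is_word V u" "is_word V v"
  shows "sym_word V (u @ (i, 0) # v) = 0"
  using multilinear_mapD(2)[OF sym_word_multilinear[OF V] assms(2,3) fil_zero[OF V], where c = 0 and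
      i = i]
  by (simp add: scl_simps[OF V])

text \<open>
  As for tensor products, with one projection applied to all letters, separately on each symmetric
  power.
\<close>

lemma separated_sym:
  assumes sV: "separated V"
  shows "separated (sym V)"
proof -
  note V = separated_filtered[OF sV]
  note T = filtered_space_sym[OF V]
  have "t = 0" if t: "\<And>k. t \<in> fil (sym V) k d" for t d
  proof -
    let ?K = "Poly_Mapping.keys t"
    have K: "?K \<subseteq> {w. is_word V w}"
      using sym_supported[OF V t[of 0]] by (simp add: supported_def)
    obtain P p where P: "\<And>i. Vector_Spaces.linear (scl V) (scl V) (P i)" "\<And>i x. P i x \<in> fil V 0 i"
        "\<And>i x. (i, x) \<in> \<Union>(set ` ?K) \<Longrightarrow> P i x = x" "\<And>i x. x \<in> fil V p i \<Longrightarrow> P i x = 0"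
      by (rule graded_projection_killing_fil[OF sV, of "\<Union>(set ` ?K)"])
        (use K in \<open>auto simp: is_word_def\<close>)
    define h where "h = map (\<lambda>(i, x). (i, P i x))"
    have h_word: "is_word V (h w)" for w
      using P(2) by (auto simp: h_def is_word_def)
    have h_id: "h w = w" if "w \<in> ?K" for w
      unfolding h_def using that P(3) by (intro map_idI) auto
    \<comment> \<open>Long words need not contain a letter deep in the filtration, so the word length is fixed.\<close>
    define g where "g = (\<lambda>n w. if length w = n then sym_word V (h w) else 0)"
    note X = filtered_space_unfiltered[OF T]
    have g: "multilinear_map V (unfiltered (sym V)) 0 (g n)" for n
    proof (rule multilinear_mapI)
      note m = multilinear_mapD[OF sym_word_multilinear[OF V], simplified]
      have h_app: "h (u @ (i, x) # v) = h u @ (i, P i x) # h v" for u i x v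
        by (simp add: h_def)
      fix u v i x assume "is_word V u" "is_word V v"
      show "g n (u @ (i, x + y) # v) = g n (u @ (i, x) # v) + g n (u @ (i, y) # v)" for y
        unfolding g_def h_app linear_simps[OF P(1)] using m(1)[OF h_word h_word P(2) P(2)] by simp
      show "g n (u @ (i, scl V c x) # v) = scl (unfiltered (sym V)) c (g n (u @ (i, x) # v))" for c
        unfolding g_def h_app linear_simps[OF P(1)] unfiltered
        using m(2)[OF h_word h_word P(2)] by simp
      have h_app2: "h (u @ (i, x) # (j, y) # v) = h u @ (i, P i x) # (j, P j y) # h v" for i x j y
        by (simp add: h_def)
      show "g n (u @ (i, x) # (j, y) # v) =
          scl (unfiltered (sym V)) (ksign (i * j)) (g n (u @ (j, y) # (i, x) # v))" for j y
        unfolding g_def h_app2 unfiltered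
        using m(3)[OF h_word[of u] h_word[of v] P(2)[of i x] P(2)[of j y]] by simp
    qed (simp add: unfiltered)
    have "lext fscale (g n) t = 0" for n
      using t[of "Suc (n * p)"]
    proof (induction rule: sym_induct[OF V, consumes 1, case_names word zero scale add])
      case (word w ps)
      have "g n w = 0"
      proof (cases "length w = n")
        case True
        have "\<exists>q\<in>set ps. p \<le> q"
        proof (rule ccontr)
          assume "\<not> (\<exists>q\<in>set ps. p \<le> q)"
          then have "sum_list ps \<le> sum_list (map (\<lambda>_. p) ps)"
            using sum_list_mono[of ps "\<lambda>q. q" "\<lambda>_. p"] by force
          then show False
            using word(2) True list_all2_lengthD[OF word(1)] by (simp add: sum_list_triv)
        qed
        then obtain m where m: "m < length ps" "p \<le> ps ! m" by (auto simp: in_set_conv_nth)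
        have "m < length w" using m(1) list_all2_lengthD[OF word(1)] by simp
        obtain i x where wm: "w ! m = (i, x)" by (cases "w ! m")
        have "x \<in> fil V (ps ! m) i"
          using list_all2_nthD[OF word(1) \<open>m < length w\<close>] wm by simp
        then have 0: "P i x = 0" using P(4) fil_mono[OF V m(2)] by blast
        have "h w = h (take m w @ (i, x) # drop (Suc m) w)"
          using id_take_nth_drop[OF \<open>m < length w\<close>] wm by (intro arg_cong[of _ _ h]) simp
        also have "\<dots> = h (take m w) @ (i, 0) # h (drop (Suc m) w)"
          by (simp add: h_def 0)
        finally have "h w = h (take m w) @ (i, 0) # h (drop (Suc m) w)" .
        then show ?thesis by (simp add: g_def sym_word_zero_letter[OF V h_word h_word])
      qed (simp add: g_def)
      then show ?case using lext_sym_word[OF V X g] by (simp add: unfiltered)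
    qed (simp_all add: lext_zero lext_fscale[OF vector_space_fscale] lext_add[OF vector_space_fscale])
    moreover have "lext fscale (sym_word V) t = (\<Sum>n\<in>length ` ?K. lext fscale (g n) t)"
    proof -
      have "lext fscale (sym_word V) t =
          (\<Sum>w\<in>?K. \<Sum>n\<in>length ` ?K. fscale (Poly_Mapping.lookup t w) (g n w))"
        unfolding lext_def
      proof (rule sum.cong)
        fix w assume w: "w \<in> ?K"
        have "(\<Sum>n\<in>length ` ?K. fscale (Poly_Mapping.lookup t w) (g n w)) =
            fscale (Poly_Mapping.lookup t w) (g (length w) w)"
          by (rule sum.remove[THEN trans, of _ "length w"])
            (use w in \<open>auto simp: g_def intro!: sum.neutral\<close>)
        then show "fscale (Poly_Mapping.lookup t w) (sym_word V w) =
            (\<Sum>n\<in>length ` ?K. fscale (Poly_Mapping.lookup t w) (g n w))"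
          by (simp add: g_def h_id[OF w])
      qed simp
      then show ?thesis
        by (simp add: lext_def) (rule sum.swap)
    qed
    ultimately show ?thesis by (simp add: sym_lext_sym_word[OF V t[of 0]])
  qed
  then show ?thesis by (rule separatedI[OF T])
qed


section \<open>Signs and composites of tensor maps\<close>

lemma ksign_0 [simp]: "ksign 0 = 1"
  by (simp add: ksign_def)

lemma ksign_add: "ksign (m + n) = (ksign m * ksign n :: 'k::field)"
  by (simp add: ksign_def)

text \<open>
  The sign arises from interchanging \<open>g'\<close> with \<open>f\<close>.
\<close>

lemma tensor_map_comp:
  assumes V0: "filtered_space V0" and W0: "filtered_space W0" and V1: "filtered_space V1"
    and W1: "filtered_space W1" and V2: "filtered_space V2" and W2: "filtered_space W2"
    and f: "filtered_map V0 V1 d f" and g: "filtered_map W0 W1 e g"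
    and f': "filtered_map V1 V2 d' f'" and g': "filtered_map W1 W2 e' g'"
    and t: "t \<in> fil (tensor V0 W0) k j"
  shows "tensor_map V2 W2 d' f' e' g' (tensor_map V1 W1 d f e g t) =
    fscale (ksign (e' * d)) (tensor_map V2 W2 (d + d') (\<lambda>x. f' (f x)) (e + e') (\<lambda>x. g' (g x)) t)"
proof -
  note T2 = filtered_space_tensor[OF V2 W2]
  note tm = tensor_map_filtered[OF V0 W0 V1 W1 f g] tensor_map_filtered[OF V1 W1 V2 W2 f' g']
    tensor_map_filtered[OF V0 W0 V2 W2 fm_comp[OF f f' V0] fm_comp[OF g g' W0]]
  have c: "filtered_map (tensor V0 W0) (tensor V2 W2) (d + e + (d' + e'))
      (\<lambda>t. tensor_map V2 W2 d' f' e' g' (tensor_map V1 W1 d f e g t))"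
    by (rule fm_comp[OF tm(1,2) filtered_space_tensor[OF V0 W0]])
  have c': "filtered_map (tensor V0 W0) (tensor V2 W2) (d + e + (d' + e'))
      (\<lambda>t. fscale (ksign (e' * d))
        (tensor_map V2 W2 (d + d') (\<lambda>x. f' (f x)) (e + e') (\<lambda>x. g' (g x)) t))"
    using fm_smult[OF tm(3) T2, of "ksign (e' * d)"] by (simp add: ac_simps)
  show ?thesis
  proof (rule tensor_ext[OF V0 W0 T2 c c' _ t])
    fix i j x y assume "x \<in> fil V0 0 i" "y \<in> fil W0 0 j"
    then have xy: "tens V1 W1 (i + d, f x) (j + e, g y) \<in> fil (tensor V1 W1) 0 (i + d + (j + e))"
      using tens_in[OF V1 W1 fm_in[OF f] fm_in[OF g]] by (metis add_0)
    show "tensor_map V2 W2 d' f' e' g' (tensor_map V1 W1 d f e g (tens V0 W0 (i, x) (j, y))) =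
        fscale (ksign (e' * d)) (tensor_map V2 W2 (d + d') (\<lambda>x. f' (f x)) (e + e') (\<lambda>x. g' (g x))
          (tens V0 W0 (i, x) (j, y)))"
      unfolding tensor_map_tens[OF V0 W0 V1 W1 f g] fm_scale[OF tm(2) xy, simplified]
        tensor_map_tens[OF V1 W1 V2 W2 f' g']
        tensor_map_tens[OF V0 W0 V2 W2 fm_comp[OF f f' V0] fm_comp[OF g g' W0]]
      by (simp add: ksign_add distrib_left distrib_right ac_simps)
  qed
qed

definition raises ::
    "('k::field, 'v::ab_group_add) fspace \<Rightarrow> ('k, 'w::ab_group_add) fspace \<Rightarrow> nat \<Rightarrow> int \<Rightarrow> ('v \<Rightarrow> 'w) \<Rightarrow>
      bool" where
  "raises V W p d f \<longleftrightarrow> (\<forall>k i. \<forall>x\<in>fil V k i. f x \<in> fil W (k + p) (i + d))"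

lemma raisesI: "(\<And>k i x. x \<in> fil V k i \<Longrightarrow> f x \<in> fil W (k + p) (i + d)) \<Longrightarrow> raises V W p d f"
  by (auto simp: raises_def)

lemma raisesD: "raises V W p d f \<Longrightarrow> x \<in> fil V k i \<Longrightarrow> f x \<in> fil W (k + p) (i + d)"
  by (auto simp: raises_def)

lemma filtered_map_raises: "filtered_map V W d f \<Longrightarrow> raises V W 0 d f"
  unfolding raises_def by (auto dest: fm_in)

lemma tensor_map_raises:
  assumes V0: "filtered_space V0" and W0: "filtered_space W0" and V: "filtered_space V"
    and W: "filtered_space W" and f: "filtered_map V0 V d f" and g: "filtered_map W0 W e g"
    and fp: "raises V0 V p d f" and gq: "raises W0 W q e g"
  shows "raises (tensor V0 W0) (tensor V W) (p + q) (d + e) (tensor_map V W d f e g)"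
proof (rule raisesI)
  note T = filtered_space_tensor[OF V W]
  note tm = tensor_map_filtered[OF V0 W0 V W f g]
  fix k l t assume "t \<in> fil (tensor V0 W0) k l"
  then show "tensor_map V W d f e g t \<in> fil (tensor V W) (k + (p + q)) (l + (d + e))"
  proof (induction rule: tensor_induct[OF V0 W0, consumes 1, case_names tens zero scale add])
    case (tens i j x y p' q')
    have "fscale (ksign (e * i)) (tens V W (i + d, f x) (j + e, g y))
        \<in> fil (tensor V W) ((p' + p) + (q' + q)) ((i + d) + (j + e))"
      using fil_scale[OF T] tens_in[OF V W raisesD[OF fp tens(1)] raisesD[OF gq tens(2)]] by simp
    also have "(p' + p) + (q' + q) = k + (p + q)" using tens(3) by simp
    also have "(i + d) + (j + e) = l + (d + e)" using tens(4) by simp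
    finally show ?case by (simp add: tensor_map_tens[OF V0 W0 V W f g])
  next
    case (scale c t)
    then show ?case
      using fm_scale[OF tm fil_0[OF filtered_space_tensor[OF V0 W0] scale(1)], of c]
        fil_scale[OF T, of _ _ _ c] by simp
  next
    case (add s t)
    then show ?case
      using fm_add[OF tm fil_0[OF filtered_space_tensor[OF V0 W0] add(1)]
          fil_0[OF filtered_space_tensor[OF V0 W0] add(2)]] fil_add[OF T]
      by simp
  qed (simp add: fm_zero[OF tm filtered_space_tensor[OF V0 W0] T] fil_zero[OF T])
qed

section \<open>Multiplication by letters\<close>

definition lmul :: "('k::field, 'v::ab_group_add) fspace \<Rightarrow> int \<times> 'v \<Rightarrow>
    ((int \<times> 'v) list \<Rightarrow>\<^sub>0 'k) \<Rightarrow> ((int \<times> 'v) list \<Rightarrow>\<^sub>0 'k)" where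
  "lmul V a = lext fscale (\<lambda>w. sym_word V (a # w))"

text \<open>
  Multiplication from the right is kept apart from multiplication from the left, since the two commute
  without signs.
\<close>

definition rmul :: "('k::field, 'v::ab_group_add) fspace \<Rightarrow> int \<times> 'v \<Rightarrow>
    ((int \<times> 'v) list \<Rightarrow>\<^sub>0 'k) \<Rightarrow> ((int \<times> 'v) list \<Rightarrow>\<^sub>0 'k)" where
  "rmul V a = lext fscale (\<lambda>w. sym_word V (w @ [a]))"

abbreviation sym_one :: "('k::field, 'v::ab_group_add) fspace \<Rightarrow> ((int \<times> 'v) list \<Rightarrow>\<^sub>0 'k)" where
  "sym_one V \<equiv> sym_word V []"

context
  fixes V :: "('k::field, 'v::ab_group_add) fspace"
  assumes V: "filtered_space V"
begin

lemmas fs_sym = filtered_space_sym[OF V]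

lemmas sym_word_rules = multilinear_mapD[OF sym_word_multilinear[OF V], simplified]

lemma sym_one_in: "sym_one V \<in> fil (sym V) 0 0"
  using sym_word_in_0[OF V, of "[]"] by simp

lemma lmul_multilinear:
  assumes x: "x \<in> fil V 0 i"
  shows "multilinear_map V (sym V) i (\<lambda>w. sym_word V ((i, x) # w))"
proof (rule multilinear_mapI)
  fix u v j y assume uv: "is_word V u" "is_word V v" "y \<in> fil V 0 j"
  note m = sym_word_rules(1,2,3)[of "(i, x) # u" v, simplified, OF _ uv(2) uv(3)]
  show "sym_word V ((i, x) # u @ (j, y + z) # v) =
      sym_word V ((i, x) # u @ (j, y) # v) + sym_word V ((i, x) # u @ (j, z) # v)"
    if "z \<in> fil V 0 j" for z
    using m(1)[OF _ that] x uv by simp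
  show "sym_word V ((i, x) # u @ (j, scl V c y) # v) =
      scl (sym V) c (sym_word V ((i, x) # u @ (j, y) # v))" for c
    using m(2) x uv by simp
  show "sym_word V ((i, x) # u @ (j, y) # (l, z) # v) =
      scl (sym V) (ksign (j * l)) (sym_word V ((i, x) # u @ (l, z) # (j, y) # v))"
    if "z \<in> fil V 0 l" for l z
    using m(3)[OF _ that] x uv by simp
next
  fix w ps assume "letters_in V w ps"
  then have "letters_in V ((i, x) # w) (0 # ps)" using x by simp
  from sym_word_in[OF V this] show "sym_word V ((i, x) # w) \<in> fil (sym V) (sum_list ps) (wdeg w + i)"
    by (simp add: add.commute)
qed

lemma rmul_multilinear:
  assumes x: "x \<in> fil V 0 i"
  shows "multilinear_map V (sym V) i (\<lambda>w. sym_word V (w @ [(i, x)]))"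
proof (rule multilinear_mapI)
  fix u v j y assume uv: "is_word V u" "is_word V v" "y \<in> fil V 0 j"
  note m = sym_word_rules(1,2,3)[of u "v @ [(i, x)]", simplified, OF uv(1) _ uv(3)]
  show "sym_word V ((u @ (j, y + z) # v) @ [(i, x)]) =
      sym_word V ((u @ (j, y) # v) @ [(i, x)]) + sym_word V ((u @ (j, z) # v) @ [(i, x)])"
    if "z \<in> fil V 0 j" for z
    using m(1)[OF _ that] x uv by simp
  show "sym_word V ((u @ (j, scl V c y) # v) @ [(i, x)]) =
      scl (sym V) c (sym_word V ((u @ (j, y) # v) @ [(i, x)]))" for c
    using m(2) x uv by simp
  show "sym_word V ((u @ (j, y) # (l, z) # v) @ [(i, x)]) =
      scl (sym V) (ksign (j * l)) (sym_word V ((u @ (l, z) # (j, y) # v) @ [(i, x)]))"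
    if "z \<in> fil V 0 l" for l z
    using m(3)[OF _ that] x uv by simp
next
  fix w ps assume "letters_in V w ps"
  then have "letters_in V (w @ [(i, x)]) (ps @ [0])" using x by (auto intro: list_all2_appendI)
  from sym_word_in[OF V this] show "sym_word V (w @ [(i, x)]) \<in> fil (sym V) (sum_list ps) (wdeg w + i)"
    by simp
qed

lemma lmul_word: "x \<in> fil V 0 i \<Longrightarrow> lmul V (i, x) (sym_word V w) = sym_word V ((i, x) # w)"
  unfolding lmul_def using lext_sym_word[OF V fs_sym lmul_multilinear] by simp

lemma rmul_word: "x \<in> fil V 0 i \<Longrightarrow> rmul V (i, x) (sym_word V w) = sym_word V (w @ [(i, x)])"
  unfolding rmul_def using lext_sym_word[OF V fs_sym rmul_multilinear] by simp

lemma lmul_fm: "x \<in> fil V 0 i \<Longrightarrow> filtered_map (sym V) (sym V) i (lmul V (i, x))"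
  unfolding lmul_def using lext_sym_filtered_map[OF V fs_sym lmul_multilinear] by simp

lemma rmul_fm: "x \<in> fil V 0 i \<Longrightarrow> filtered_map (sym V) (sym V) i (rmul V (i, x))"
  unfolding rmul_def using lext_sym_filtered_map[OF V fs_sym rmul_multilinear] by simp

lemma word_map_raises:
  assumes f: "filtered_map (sym V) (sym V) i f"
    and w: "\<And>w ps. letters_in V w ps \<Longrightarrow> f (sym_word V w) \<in> fil (sym V) (sum_list ps + p) (wdeg w + i)"
  shows "raises (sym V) (sym V) p i f"
proof (rule raisesI)
  fix k d t assume "t \<in> fil (sym V) k d"
  then show "f t \<in> fil (sym V) (k + p) (d + i)"
  proof (induction rule: sym_induct[OF V, consumes 1, case_names word zero scale add])
    case (word u ps)
    then show ?case using w by auto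
  next
    case (scale c t)
    then show ?case
      using fm_scale[OF f fil_0[OF fs_sym scale(1)], of c] fil_scale[OF fs_sym, of _ _ _ c] by simp
  next
    case (add s t)
    then show ?case
      using fm_add[OF f fil_0[OF fs_sym add(1)] fil_0[OF fs_sym add(2)]] fil_add[OF fs_sym] by simp
  qed (simp add: fm_zero[OF f fs_sym fs_sym] fil_zero[OF fs_sym])
qed

lemma lmul_raises:
  assumes x: "x \<in> fil V p i"
  shows "raises (sym V) (sym V) p i (lmul V (i, x))"
proof (rule word_map_raises[OF lmul_fm[OF fil_0[OF V x]]])
  fix w ps assume "letters_in V w ps"
  then have "letters_in V ((i, x) # w) (p # ps)" using x by simp
  from sym_word_in[OF V this]
  show "lmul V (i, x) (sym_word V w) \<in> fil (sym V) (sum_list ps + p) (wdeg w + i)"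
    by (simp add: add.commute lmul_word[OF fil_0[OF V x]])
qed

lemma rmul_raises:
  assumes x: "x \<in> fil V p i"
  shows "raises (sym V) (sym V) p i (rmul V (i, x))"
proof (rule word_map_raises[OF rmul_fm[OF fil_0[OF V x]]])
  fix w ps assume "letters_in V w ps"
  then have "letters_in V (w @ [(i, x)]) (ps @ [p])" using x by (auto intro: list_all2_appendI)
  from sym_word_in[OF V this]
  show "rmul V (i, x) (sym_word V w) \<in> fil (sym V) (sum_list ps + p) (wdeg w + i)"
    by (simp add: add.commute rmul_word[OF fil_0[OF V x]])
qed

lemma lmul_add:
  assumes x: "x \<in> fil V 0 i" and y: "y \<in> fil V 0 i" and t: "t \<in> fil (sym V) k d"
  shows "lmul V (i, x + y) t = lmul V (i, x) t + lmul V (i, y) t"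
  by (rule sym_word_ext[OF V fs_sym lmul_fm fm_plus[OF lmul_fm lmul_fm fs_sym] _ t])
    (use x y sym_word_rules(1)[of "[]"] in \<open>auto simp: lmul_word fil_add[OF V]\<close>)

lemma lmul_scale:
  assumes x: "x \<in> fil V 0 i" and t: "t \<in> fil (sym V) k d"
  shows "lmul V (i, scl V c x) t = fscale c (lmul V (i, x) t)"
  by (rule sym_word_ext[OF V fs_sym lmul_fm fm_smult[OF lmul_fm fs_sym, simplified] _ t])
    (use x sym_word_rules(2)[of "[]"] in \<open>auto simp: lmul_word fil_scale[OF V]\<close>)

lemma rmul_add:
  assumes x: "x \<in> fil V 0 i" and y: "y \<in> fil V 0 i" and t: "t \<in> fil (sym V) k d"
  shows "rmul V (i, x + y) t = rmul V (i, x) t + rmul V (i, y) t"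
  by (rule sym_word_ext[OF V fs_sym rmul_fm fm_plus[OF rmul_fm rmul_fm fs_sym] _ t])
    (use x y sym_word_rules(1)[of _ "[]"] in \<open>auto simp: rmul_word fil_add[OF V]\<close>)

lemma rmul_scale:
  assumes x: "x \<in> fil V 0 i" and t: "t \<in> fil (sym V) k d"
  shows "rmul V (i, scl V c x) t = fscale c (rmul V (i, x) t)"
  by (rule sym_word_ext[OF V fs_sym rmul_fm fm_smult[OF rmul_fm fs_sym, simplified] _ t])
    (use x sym_word_rules(2)[of _ "[]"] in \<open>auto simp: rmul_word fil_scale[OF V]\<close>)

lemma rmul_zero: "t \<in> fil (sym V) k d \<Longrightarrow> rmul V (i, 0) t = 0"
  using rmul_scale[OF fil_zero[OF V], of t k d i 0] by (simp add: scl_simps[OF V])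

lemma lmul_lmul:
  assumes x: "x \<in> fil V 0 i" and y: "y \<in> fil V 0 j" and t: "t \<in> fil (sym V) k d"
  shows "lmul V (i, x) (lmul V (j, y) t) = fscale (ksign (i * j)) (lmul V (j, y) (lmul V (i, x) t))"
proof (rule sym_word_ext[OF V fs_sym fm_comp[OF lmul_fm[OF y] lmul_fm[OF x] fs_sym] _ _ t])
  show "filtered_map (sym V) (sym V) (j + i)
      (\<lambda>t. fscale (ksign (i * j)) (lmul V (j, y) (lmul V (i, x) t)))"
    using fm_smult[OF fm_comp[OF lmul_fm[OF x] lmul_fm[OF y] fs_sym] fs_sym] by (simp add: add.commute)
  fix w assume "is_word V w"
  then show "lmul V (i, x) (lmul V (j, y) (sym_word V w)) =
      fscale (ksign (i * j)) (lmul V (j, y) (lmul V (i, x) (sym_word V w)))"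
    using sym_word_rules(3)[of "[]" w x i y j] x y by (simp add: lmul_word)
qed

lemma rmul_lmul:
  assumes x: "x \<in> fil V 0 i" and y: "y \<in> fil V 0 j" and t: "t \<in> fil (sym V) k d"
  shows "rmul V (j, y) (lmul V (i, x) t) = lmul V (i, x) (rmul V (j, y) t)"
proof (rule sym_word_ext[OF V fs_sym fm_comp[OF lmul_fm[OF x] rmul_fm[OF y] fs_sym] _ _ t])
  show "filtered_map (sym V) (sym V) (i + j) (\<lambda>t. lmul V (i, x) (rmul V (j, y) t))"
    using fm_comp[OF rmul_fm[OF y] lmul_fm[OF x] fs_sym] by (simp add: add.commute)
qed (use x y in \<open>simp add: lmul_word rmul_word\<close>)

lemma sym_word_move_letter:
  assumes "is_word V u" "is_word V w" "x \<in> fil V 0 i"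
  shows "sym_word V (u @ w @ [(i, x)]) = fscale (ksign (i * wdeg w)) (sym_word V (u @ (i, x) # w))"
  using assms(1,2)
proof (induction w arbitrary: u)
  case (Cons a w)
  obtain j y where a: "a = (j, y)" by (cases a)
  have "sym_word V (u @ (a # w) @ [(i, x)]) =
      fscale (ksign (i * wdeg w)) (sym_word V (u @ (j, y) # (i, x) # w))"
    using Cons.IH[of "u @ [a]"] Cons.prems a by simp
  also have "\<dots> = fscale (ksign (i * wdeg w)) (fscale (ksign (j * i))
      (sym_word V (u @ (i, x) # (j, y) # w)))"
    using sym_word_rules(3)[of u w y j x i] Cons.prems a assms(3) by simp
  finally show ?case by (simp add: a ksign_add distrib_left ac_simps)
qed simp

text \<open>
  Carrying a letter from the right end of a word to the left end moves it past all of the word.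
\<close>

lemma rmul_eq_lmul:
  assumes x: "x \<in> fil V 0 i" and t: "t \<in> fil (sym V) k d"
  shows "rmul V (i, x) t = fscale (ksign (i * d)) (lmul V (i, x) t)"
  using fil_0[OF fs_sym t]
proof (induction rule: sym_induct[OF V, consumes 1, case_names word zero scale add])
  case (word w ps)
  then show ?case
    using sym_word_move_letter[of "[]" w x i] letters_in_is_word[OF V word(1)] x
    by (simp add: rmul_word lmul_word)
next
  case zero
  show ?case by (simp add: fm_zero[OF rmul_fm[OF x] fs_sym fs_sym]
      fm_zero[OF lmul_fm[OF x] fs_sym fs_sym])
next
  case (scale c t)
  then show ?case
    by (simp add: fm_scale[OF rmul_fm[OF x], simplified] fm_scale[OF lmul_fm[OF x], simplified]
        mult.commute)
next
  case (add s t)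
  then show ?case
    by (simp add: fm_add[OF rmul_fm[OF x]] fm_add[OF lmul_fm[OF x]] free.scale_right_distrib)
qed

text \<open>The symmetric algebra is generated by the unit under multiplication by letters.\<close>

lemma sym_ext:
  assumes X: "filtered_space X"
    and f: "filtered_map (sym V) X d f" and g: "filtered_map (sym V) X d g"
    and one: "f (sym_one V) = g (sym_one V)"
    and step: "\<And>i x j t. x \<in> fil V 0 i \<Longrightarrow> t \<in> fil (sym V) 0 j \<Longrightarrow> f t = g t \<Longrightarrow>
      f (lmul V (i, x) t) = g (lmul V (i, x) t)"
    and t: "t \<in> fil (sym V) k j"
  shows "f t = g t"
proof (rule sym_word_ext[OF V X f g _ t])
  fix w assume "is_word V w"
  then show "f (sym_word V w) = g (sym_word V w)"
  proof (induction w)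
    case (Cons a w)
    obtain i x where "a = (i, x)" by (cases a)
    then show ?case
      using Cons step[of x i "sym_word V w" "wdeg w"] sym_word_in_0[OF V, of w]
      by (simp add: lmul_word)
  qed (rule one)
qed

text \<open>
  The operators \<open>T\<close> reduce the relations of the symmetric algebra to the first letters of a word, where
  they hold because the operators are linear in the letter and commute in the graded sense.
\<close>

lemma multilinear_map_rec:
  assumes X: "filtered_space X" and nil: "g [] \<in> fil X 0 0"
    and Cons: "\<And>i x w. x \<in> fil V 0 i \<Longrightarrow> is_word V w \<Longrightarrow> g ((i, x) # w) = T (i, x) (g w)"
    and T: "\<And>i x. x \<in> fil V 0 i \<Longrightarrow> filtered_map X X i (T (i, x))"
    and raises: "\<And>p i x. x \<in> fil V p i \<Longrightarrow> raises X X p i (T (i, x))"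
    and add: "\<And>i x y d t. x \<in> fil V 0 i \<Longrightarrow> y \<in> fil V 0 i \<Longrightarrow> t \<in> fil X 0 d \<Longrightarrow>
      T (i, x + y) t = T (i, x) t + T (i, y) t"
    and scale: "\<And>i x c d t. x \<in> fil V 0 i \<Longrightarrow> t \<in> fil X 0 d \<Longrightarrow>
      T (i, scl V c x) t = scl X c (T (i, x) t)"
    and comm: "\<And>i x j y d t. x \<in> fil V 0 i \<Longrightarrow> y \<in> fil V 0 j \<Longrightarrow> t \<in> fil X 0 d \<Longrightarrow>
      T (i, x) (T (j, y) t) = scl X (ksign (i * j)) (T (j, y) (T (i, x) t))"
  shows "multilinear_map V X 0 g"
proof -
  have g_in: "g w \<in> fil X (sum_list ps) (wdeg w)" if "letters_in V w ps" for w ps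
    using that
  proof (induction rule: list_all2_induct)
    case (Cons a w p ps)
    obtain i x where a: "a = (i, x)" by (cases a)
    then have x: "x \<in> fil V p i" using Cons by simp
    have "T (i, x) (g w) \<in> fil X (sum_list ps + p) (wdeg w + i)"
      by (rule raisesD[OF raises[OF x] Cons.IH])
    then show ?case
      by (simp add: a assms(3)[OF fil_0[OF V x] letters_in_is_word[OF V Cons.hyps(2)]] add.commute)
  qed (simp add: nil)
  have g_in0: "g w \<in> fil X 0 (wdeg w)" if "is_word V w" for w
    using g_in[OF is_word_letters_in[OF V that]] by (simp add: sum_list_replicate)
  show ?thesis
  proof (rule multilinear_mapI)
    fix u v i x y
    assume u: "is_word V u" and v: "is_word V v" and xy: "x \<in> fil V 0 i" "y \<in> fil V 0 i"
    from u show "g (u @ (i, x + y) # v) = g (u @ (i, x) # v) + g (u @ (i, y) # v)"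
    proof (induction u)
      case (Cons a u)
      obtain l z where a: "a = (l, z)" by (cases a)
      then show ?case
        using Cons v xy g_in0[of "u @ (i, x) # v"] g_in0[of "u @ (i, y) # v"]
        by (simp add: assms(3) fil_add[OF V] fm_add[OF T])
    qed (use v xy in \<open>simp add: Cons fil_add[OF V] add[OF _ _ g_in0]\<close>)
  next
    fix u v i c x assume u: "is_word V u" and v: "is_word V v" and x: "x \<in> fil V 0 i"
    from u show "g (u @ (i, scl V c x) # v) = scl X c (g (u @ (i, x) # v))"
    proof (induction u)
      case (Cons a u)
      obtain l z where a: "a = (l, z)" by (cases a)
      then show ?case
        using Cons v x g_in0[of "u @ (i, x) # v"]
        by (simp add: assms(3) fil_scale[OF V] fm_scale[OF T])
    qed (use v x in \<open>simp add: Cons fil_scale[OF V] scale[OF _ g_in0]\<close>)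
  next
    fix u v i j x y
    assume u: "is_word V u" and v: "is_word V v" and xy: "x \<in> fil V 0 i" "y \<in> fil V 0 j"
    from u show "g (u @ (i, x) # (j, y) # v) = scl X (ksign (i * j)) (g (u @ (j, y) # (i, x) # v))"
    proof (induction u)
      case Nil
      show ?case using v xy comm[OF xy g_in0[OF v]] by (simp add: Cons)
    next
      case (Cons a u)
      obtain l z where a: "a = (l, z)" by (cases a)
      have "g (a # u @ (i, x) # (j, y) # v) = T (l, z)
          (scl X (ksign (i * j)) (g (u @ (j, y) # (i, x) # v)))"
        using Cons v xy a by (simp add: assms(3))
      also have "\<dots> = scl X (ksign (i * j)) (g (a # u @ (j, y) # (i, x) # v))"
        using Cons.prems v xy a g_in0[of "u @ (j, y) # (i, x) # v"]
        by (simp add: assms(3) fm_scale[OF T])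
      finally show ?case by simp
    qed
  qed (use g_in in simp)
qed

end


section \<open>The coproduct\<close>

abbreviation sym_sq ::
    "('k::field, 'v::ab_group_add) fspace \<Rightarrow> ('k, (int \<times> ('k, 'v) symc) \<times> (int \<times> ('k, 'v) symc) \<Rightarrow>\<^sub>0
      'k) fspace" where
  "sym_sq V \<equiv> tensor (sym V) (sym V)"

abbreviation tens_sq :: "('k::field, 'v::ab_group_add) fspace \<Rightarrow> _" where
  "tens_sq V \<equiv> tens (sym V) (sym V)"

abbreviation tensor_map_sq :: "('k::field, 'v::ab_group_add) fspace \<Rightarrow> _" where
  "tensor_map_sq V \<equiv> tensor_map (sym V) (sym V)"

text \<open>
  The operator by which a primitive element \<open>a\<close> acts on the tensor square of the symmetric algebra:
  multiplication by \<open>a \<otimes> 1 + 1 \<otimes> a\<close>.  The recursion for the coproduct says that multiplying by a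
  letter corresponds to this operator.
\<close>

definition coprod_letter :: "('k::field, 'v::ab_group_add) fspace \<Rightarrow> int \<times> 'v \<Rightarrow> _ \<Rightarrow> _" where
  "coprod_letter V a t =
     tensor_map_sq V (fst a) (lmul V a) 0 (\<lambda>x. x) t +
     tensor_map_sq V 0 (\<lambda>x. x) (fst a) (lmul V a) t"

definition coprod_word :: "('k::field, 'v::ab_group_add) fspace \<Rightarrow> (int \<times> 'v) list \<Rightarrow> _" where
  "coprod_word V w = (\<Sum>(n, u, v)\<leftarrow>unshuffles w.
     fscale (ksign n) (tens_sq V (wdeg u, sym_word V u) (wdeg v, sym_word V v)))"

lemma coprod_altdef: "coprod V = lext fscale (coprod_word V)"
  by (simp add: coprod_def coprod_word_def[abs_def])

lemma unshuffles_words: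
  "(n, u, v) \<in> set (unshuffles w) \<Longrightarrow> is_word V w \<Longrightarrow> is_word V u \<and> is_word V v \<and> wdeg u + wdeg v = wdeg w"
  by (induction w arbitrary: n u v) auto

lemma fm_sum_list:
  assumes f: "filtered_map V W d f" and V: "filtered_space V" and W: "filtered_space W"
    and "\<And>a. a \<in> set xs \<Longrightarrow> h a \<in> fil V 0 i"
  shows "f (\<Sum>a\<leftarrow>xs. h a) = (\<Sum>a\<leftarrow>xs. f (h a)) \<and> (\<Sum>a\<leftarrow>xs. h a) \<in> fil V 0 i"
  using assms(4)
proof (induction xs)
  case (Cons a xs)
  then have "h a \<in> fil V 0 i" and "(\<Sum>a\<leftarrow>xs. f (h a)) = f (\<Sum>a\<leftarrow>xs. h a)"
    and "(\<Sum>a\<leftarrow>xs. h a) \<in> fil V 0 i" by auto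
  then show ?case by (simp add: fm_add[OF f] fil_add[OF V])
qed (simp add: fm_zero[OF f V W] fil_zero[OF V])

lemma tens_in_0:
  assumes "filtered_space V" "filtered_space W" "x \<in> fil V 0 i" "y \<in> fil W 0 j"
  shows "tens V W (i, x) (j, y) \<in> fil (tensor V W) 0 (i + j)"
  using tens_in[OF assms] by simp

context
  fixes V :: "('k::field, 'v::ab_group_add) fspace"
  assumes V: "filtered_space V"
begin

lemmas fs_sym_sq = filtered_space_tensor[OF fs_sym[OF V] fs_sym[OF V]]

lemma left_letter_fm: "x \<in> fil V 0 i \<Longrightarrow> filtered_map (sym_sq V) (sym_sq V) i
    (tensor_map_sq V i (lmul V (i, x)) 0 (\<lambda>x. x))"
  using tensor_map_filtered[OF fs_sym[OF V] fs_sym[OF V] fs_sym[OF V] fs_sym[OF V] lmul_fm[OF V]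
      fm_id(2)] by simp

lemma right_letter_fm: "x \<in> fil V 0 i \<Longrightarrow> filtered_map (sym_sq V) (sym_sq V) i
    (tensor_map_sq V 0 (\<lambda>x. x) i (lmul V (i, x)))"
  using tensor_map_filtered[OF fs_sym[OF V] fs_sym[OF V] fs_sym[OF V] fs_sym[OF V] fm_id(2)
      lmul_fm[OF V]] by simp

lemma left_letter_tens: "x \<in> fil V 0 i \<Longrightarrow>
    tensor_map_sq V i (lmul V (i, x)) 0 (\<lambda>x. x) (tens_sq V (a, s) (b, t)) =
    tens_sq V (a + i, lmul V (i, x) s) (b, t)"
  using tensor_map_tens[OF fs_sym[OF V] fs_sym[OF V] fs_sym[OF V] fs_sym[OF V] lmul_fm[OF V]
      fm_id(2)] by simp

lemma right_letter_tens: "x \<in> fil V 0 i \<Longrightarrow>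
    tensor_map_sq V 0 (\<lambda>x. x) i (lmul V (i, x)) (tens_sq V (a, s) (b, t)) =
    fscale (ksign (i * a)) (tens_sq V (a, s) (b + i, lmul V (i, x) t))"
  using tensor_map_tens[OF fs_sym[OF V] fs_sym[OF V] fs_sym[OF V] fs_sym[OF V] fm_id(2)
      lmul_fm[OF V]] by simp

lemma coprod_letter_fm: "x \<in> fil V 0 i \<Longrightarrow>
    filtered_map (sym_sq V) (sym_sq V) i (coprod_letter V (i, x))"
  unfolding coprod_letter_def[abs_def]
  using fm_plus[OF left_letter_fm right_letter_fm fs_sym_sq] by simp

lemma coprod_letter_tens: "x \<in> fil V 0 i \<Longrightarrow>
    coprod_letter V (i, x) (tens_sq V (a, s) (b, t)) =
    tens_sq V (a + i, lmul V (i, x) s) (b, t) +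
    fscale (ksign (i * a)) (tens_sq V (a, s) (b + i, lmul V (i, x) t))"
  by (simp add: coprod_letter_def left_letter_tens right_letter_tens)

lemma coprod_letter_raises:
  assumes x: "x \<in> fil V p i"
  shows "raises (sym_sq V) (sym_sq V) p i (coprod_letter V (i, x))"
proof -
  note x0 = fil_0[OF V x]
  have l: "raises (sym_sq V) (sym_sq V) p i
      (tensor_map_sq V i (lmul V (i, x)) 0 (\<lambda>x. x))"
    using tensor_map_raises[OF fs_sym[OF V] fs_sym[OF V] fs_sym[OF V] fs_sym[OF V] lmul_fm[OF V x0]
        fm_id(2)
        lmul_raises[OF V x] filtered_map_raises[OF fm_id(2)]] by simp
  have r: "raises (sym_sq V) (sym_sq V) p i
      (tensor_map_sq V 0 (\<lambda>x. x) i (lmul V (i, x)))"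
    using tensor_map_raises[OF fs_sym[OF V] fs_sym[OF V] fs_sym[OF V] fs_sym[OF V] fm_id(2)
        lmul_fm[OF V x0]
        filtered_map_raises[OF fm_id(2)] lmul_raises[OF V x]] by simp
  show ?thesis
    by (rule raisesI) (auto simp: coprod_letter_def intro!: fil_add[OF fs_sym_sq] raisesD[OF l]
        raisesD[OF r])
qed

lemma coprod_letter_rules:
  assumes x: "x \<in> fil V 0 i" and t: "t \<in> fil (sym_sq V) k d"
  shows coprod_letter_add: "y \<in> fil V 0 i \<Longrightarrow>
      coprod_letter V (i, x + y) t = coprod_letter V (i, x) t + coprod_letter V (i, y) t"
    and coprod_letter_scale: "coprod_letter V (i, scl V c x) t = fscale c (coprod_letter V (i, x) t)"
    and coprod_letter_comm: "y \<in> fil V 0 j \<Longrightarrow> coprod_letter V (i, x) (coprod_letter V (j, y) t) =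
      fscale (ksign (i * j)) (coprod_letter V (j, y) (coprod_letter V (i, x) t))"
proof -
  note CV = fs_sym[OF V]
  note in' = fm_in[OF lmul_fm[OF V]]
  show "coprod_letter V (i, x + y) t = coprod_letter V (i, x) t + coprod_letter V (i, y) t"
    if y: "y \<in> fil V 0 i"
    by (rule tensor_ext[OF CV CV fs_sym_sq coprod_letter_fm
        fm_plus[OF coprod_letter_fm coprod_letter_fm fs_sym_sq] _ t])
      (use x y in \<open>auto simp: coprod_letter_tens fil_add[OF V] lmul_add[OF V]
        tens_add_left[OF CV CV in' in'] tens_add_right[OF CV CV _ in' in'] free.scale_right_distrib\<close>)
  show "coprod_letter V (i, scl V c x) t = fscale c (coprod_letter V (i, x) t)"
    by (rule tensor_ext[OF CV CV fs_sym_sq coprod_letter_fm fm_smult[OF coprod_letter_fm fs_sym_sq,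
        simplified] _ t])
      (use x in \<open>auto simp: coprod_letter_tens fil_scale[OF V] lmul_scale[OF V]
        tens_scale_left[OF CV CV in', simplified] tens_scale_right[OF CV CV _ in', simplified]
        free.scale_right_distrib mult.commute\<close>)
  assume y: "y \<in> fil V 0 j"
  note fx = coprod_letter_fm[OF x] and fy = coprod_letter_fm[OF y]
  show "coprod_letter V (i, x) (coprod_letter V (j, y) t) =
      fscale (ksign (i * j)) (coprod_letter V (j, y) (coprod_letter V (i, x) t))"
  proof (rule tensor_ext[OF CV CV fs_sym_sq fm_comp[OF fy fx fs_sym_sq] _ _ t])
    show "filtered_map (sym_sq V) (sym_sq V) (j + i)
        (\<lambda>t. fscale (ksign (i * j)) (coprod_letter V (j, y) (coprod_letter V (i, x) t)))"
      using fm_smult[OF fm_comp[OF fx fy fs_sym_sq] fs_sym_sq] by (simp add: add.commute)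
    fix a b s u assume s: "s \<in> fil (sym V) 0 a" and u: "u \<in> fil (sym V) 0 b"
    note sc = tens_scale_left[OF CV CV in'[OF y in'[OF x s]] u, simplified]
      tens_scale_right[OF CV CV s in'[OF y in'[OF x u]], simplified]
    have st: "tens_sq V (a + i, lmul V (i, x) s) (b, u)
        \<in> fil (sym_sq V) 0 (a + i + b)"
      "tens_sq V (a, s) (b + i, lmul V (i, x) u) \<in> fil (sym_sq V) 0 (a + i + b)"
      using tens_in_0[OF CV CV in'[OF x s] u] tens_in_0[OF CV CV s in'[OF x u]]
      by (simp_all add: ac_simps)
    have su: "tens_sq V (a + j, lmul V (j, y) s) (b, u)
        \<in> fil (sym_sq V) 0 (a + j + b)"
      "tens_sq V (a, s) (b + j, lmul V (j, y) u) \<in> fil (sym_sq V) 0 (a + j + b)"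
      using tens_in_0[OF CV CV in'[OF y s] u] tens_in_0[OF CV CV s in'[OF y u]]
      by (simp_all add: ac_simps)
    let ?t = "tens_sq V" and ?x = "lmul V (i, x)" and ?y = "lmul V (j, y)"
    have "coprod_letter V (i, x) (coprod_letter V (j, y) (?t (a, s) (b, u))) =
        ?t (a + j + i, ?x (?y s)) (b, u) +
        fscale (ksign (i * (a + j))) (?t (a + j, ?y s) (b + i, ?x u)) +
        fscale (ksign (j * a)) (?t (a + i, ?x s) (b + j, ?y u) +
          fscale (ksign (i * a)) (?t (a, s) (b + j + i, ?x (?y u))))"
      unfolding coprod_letter_tens[OF y] fm_add[OF fx su(1) fil_scale[OF fs_sym_sq su(2), simplified]]
        fm_scale[OF fx su(2), simplified] coprod_letter_tens[OF x] ..
    moreover have "coprod_letter V (j, y) (coprod_letter V (i, x) (?t (a, s) (b, u))) =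
        ?t (a + i + j, ?y (?x s)) (b, u) +
        fscale (ksign (j * (a + i))) (?t (a + i, ?x s) (b + j, ?y u)) +
        fscale (ksign (i * a)) (?t (a + j, ?y s) (b + i, ?x u) +
          fscale (ksign (j * a)) (?t (a, s) (b + i + j, ?y (?x u))))"
      unfolding coprod_letter_tens[OF x] fm_add[OF fy st(1) fil_scale[OF fs_sym_sq st(2), simplified]]
        fm_scale[OF fy st(2), simplified] coprod_letter_tens[OF y] ..
    ultimately show "coprod_letter V (i, x) (coprod_letter V (j, y) (?t (a, s) (b, u))) =
        fscale (ksign (i * j)) (coprod_letter V (j, y) (coprod_letter V (i, x) (?t (a, s) (b, u))))"
      unfolding add.assoc add.commute[of j i] lmul_lmul[OF V x y s] lmul_lmul[OF V x y u]
        sc[unfolded add.assoc]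
      by (cases "even i"; cases "even j"; cases "even a")
        (simp_all add: ksign_def free.scale_right_distrib)
  qed
qed

lemma unshuffle_term_in:
  assumes "is_word V w" "(n, u, v) \<in> set (unshuffles w)"
  shows "tens_sq V (wdeg u, sym_word V u) (wdeg v, sym_word V v)
    \<in> fil (sym_sq V) 0 (wdeg w)"
  using tens_in_0[OF fs_sym[OF V] fs_sym[OF V] sym_word_in_0[OF V] sym_word_in_0[OF V]]
    unshuffles_words[OF assms(2,1)] by metis

lemma coprod_word_Cons:
  assumes x: "x \<in> fil V 0 i" and w: "is_word V w"
  shows "coprod_word V ((i, x) # w) = coprod_letter V (i, x) (coprod_word V w)"
proof -
  let ?t = "\<lambda>u v. tens_sq V (wdeg u, sym_word V u) (wdeg v, sym_word V v)"
  have "coprod_letter V (i, x) (coprod_word V w) =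
      (\<Sum>z\<leftarrow>unshuffles w. coprod_letter V (i, x) (case z of (n, u, v) \<Rightarrow> fscale (ksign n) (?t u v)))"
    unfolding coprod_word_def
    by (rule conjunct1, rule fm_sum_list[OF coprod_letter_fm[OF x] fs_sym_sq fs_sym_sq, where i =
        "wdeg w"])
      (use unshuffle_term_in[OF w] fil_scale[OF fs_sym_sq] in auto)
  also have "\<dots> = (\<Sum>(n, u, v)\<leftarrow>unshuffles w. fscale (ksign n) (?t ((i, x) # u) v) +
      fscale (ksign (n + i * wdeg u)) (?t u ((i, x) # v)))"
  proof (rule arg_cong[of _ _ sum_list], rule map_cong[OF refl], clarify)
    fix n u v assume *: "(n, u, v) \<in> set (unshuffles w)"
    show "coprod_letter V (i, x) (fscale (ksign n) (?t u v)) = fscale (ksign n) (?t ((i, x) # u) v) +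
      fscale (ksign (n + i * wdeg u)) (?t u ((i, x) # v))"
      using fm_scale[OF coprod_letter_fm[OF x] unshuffle_term_in[OF w *], of "ksign n"]
      by (simp add: coprod_letter_tens[OF x] lmul_word[OF V x] free.scale_right_distrib ksign_add
          add.commute)
  qed
  also have "\<dots> = coprod_word V ((i, x) # w)"
    by (simp add: coprod_word_def sum_list_addf case_prod_unfold o_def)
  finally show ?thesis ..
qed

lemma coprod_multilinear: "multilinear_map V (sym_sq V) 0 (coprod_word V)"
proof (rule multilinear_map_rec[OF V fs_sym_sq, where T = "coprod_letter V"])
  show "coprod_word V [] \<in> fil (sym_sq V) 0 0"
    using tens_in_0[OF fs_sym[OF V] fs_sym[OF V] sym_one_in[OF V] sym_one_in[OF V]]
    by (simp add: coprod_word_def)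
qed (auto simp: coprod_word_Cons coprod_letter_fm coprod_letter_raises
    intro: coprod_letter_add coprod_letter_scale coprod_letter_comm)

lemma coprod_fm: "filtered_map (sym V) (sym_sq V) 0 (coprod V)"
  unfolding coprod_altdef using lext_sym_filtered_map[OF V fs_sym_sq coprod_multilinear] by simp

lemma coprod_one: "coprod V (sym_one V) = tens_sq V (0, sym_one V) (0, sym_one V)"
  unfolding coprod_altdef using lext_sym_word[OF V fs_sym_sq coprod_multilinear, of "[]"]
  by (simp add: coprod_word_def)

lemma coprod_lmul:
  assumes x: "x \<in> fil V 0 i" and t: "t \<in> fil (sym V) k d"
  shows "coprod V (lmul V (i, x) t) = coprod_letter V (i, x) (coprod V t)"
proof (rule sym_word_ext[OF V fs_sym_sq fm_comp[OF lmul_fm[OF V x] coprod_fm fs_sym[OF V]] _ _ t])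
  show "filtered_map (sym V) (sym_sq V) (i + 0) (\<lambda>x'. coprod_letter V (i, x) (coprod V x'))"
    using fm_comp[OF coprod_fm coprod_letter_fm[OF x] fs_sym[OF V]] by simp
  fix w assume "is_word V w"
  then show "coprod V (lmul V (i, x) (sym_word V w)) = coprod_letter V (i, x) (coprod V (sym_word V w))"
    unfolding lmul_word[OF V x] unfolding coprod_altdef
    using lext_sym_word[OF V fs_sym_sq coprod_multilinear] by (simp add: coprod_word_Cons[OF x])
qed

end

section \<open>The counit\<close>

text \<open>
  The ground field sits in degree and filtration index \<open>0\<close>.  As a filtered map to it, the counit vanishes
  on all other degrees and on the first filtration step.
\<close>

definition ground_field :: "('k::field, 'k) fspace" where
  "ground_field = \<lparr>scl = (*), fil = \<lambda>k i. if k = 0 \<and> i = 0 then UNIV else {0}\<rparr>"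

lemma ground_field_simps [simp]: "scl ground_field = (*)"
  "fil ground_field k i = (if k = 0 \<and> i = 0 then UNIV else {0})"
  by (simp_all add: ground_field_def)

lemma filtered_space_ground_field: "filtered_space (ground_field :: ('k::field, 'k) fspace)"
proof -
  interpret vector_space "(*) :: 'k \<Rightarrow> 'k \<Rightarrow> 'k" by unfold_locales (simp_all add: algebra_simps)
  show ?thesis
    by (auto simp: filtered_space_def vector_space_axioms)
qed

context
  fixes V :: "('k::field, 'v::ab_group_add) fspace"
  assumes V: "filtered_space V"
begin

lemma counit_multilinear: "multilinear_map V ground_field 0 (\<lambda>w. if w = [] then 1 else 0)"
  by (rule multilinear_mapI) (auto split: if_splits)

lemma counit_fm: "filtered_map (sym V) ground_field 0 counit"
  unfolding counit_def
  using lext_sym_filtered_map[OF V filtered_space_ground_field counit_multilinear] by simp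

lemma counit_word: "counit (sym_word V w) = (if w = [] then 1 else 0)"
  unfolding counit_def
  using lext_sym_word[OF V filtered_space_ground_field counit_multilinear] by simp

lemma counit_one: "counit (sym_one V) = 1"
  by (simp add: counit_word)

lemma counit_lmul:
  assumes x: "x \<in> fil V 0 i" and t: "t \<in> fil (sym V) k d"
  shows "counit (lmul V (i, x) t) = 0"
  by (rule sym_word_ext[OF V filtered_space_ground_field
      fm_comp[OF lmul_fm[OF V x] counit_fm fs_sym[OF V]]
        fm_zero_map[OF filtered_space_ground_field] _ t])
    (simp add: lmul_word[OF V x] counit_word)

lemma counit_degree: "s \<in> fil (sym V) k i \<Longrightarrow> k \<noteq> 0 \<or> i \<noteq> 0 \<Longrightarrow> counit s = 0"
  using fm_in[OF counit_fm, of s k i] by auto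

end

text \<open>The map \<open>\<epsilon> \<otimes> id\<close>, on the tensor product of the symmetric algebra with any space.\<close>

definition counit_left :: "('k::field, 'm::ab_group_add) fspace \<Rightarrow> _ \<Rightarrow> 'm" where
  "counit_left M = lext (scl M) (\<lambda>((j, s), (l, n)). scl M (counit s) n)"

context
  fixes V :: "('k::field, 'v::ab_group_add) fspace" and M :: "('k, 'm::ab_group_add) fspace"
  assumes V: "filtered_space V" and M: "filtered_space M"
begin

lemma counit_left_bilinear: "bilinear_map (sym V) M M 0 (\<lambda>((j, s), (l, n)). scl M (counit s) n)"
proof (rule bilinear_mapI)
  fix i j p q s m assume s: "s \<in> fil (sym V) p i" and m: "m \<in> fil M q j"
  show "(\<lambda>((j, s), (l, n)). scl M (counit s) n) ((i, s), (j, m)) \<in> fil M (p + q) (i + j + 0)"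
  proof (cases "p = 0 \<and> i = 0")
    case True
    then show ?thesis using fil_scale[OF M m] by simp
  next
    case False
    then show ?thesis using counit_degree[OF V s] by (simp add: scl_simps[OF M] fil_zero[OF M])
  qed
qed (simp_all add: fm_add[OF counit_fm[OF V]] fm_scale[OF counit_fm[OF V], simplified]
    scl_distribs[OF M] scl_simps[OF M] mult.commute)

lemma counit_left_fm: "filtered_map (tensor (sym V) M) M 0 (counit_left M)"
  unfolding counit_left_def
  by (rule lext_tensor_filtered_map[OF fs_sym[OF V] M M counit_left_bilinear])

lemma counit_left_tens: "counit_left M (tens (sym V) M (i, s) (j, m)) = scl M (counit s) m"
  unfolding counit_left_def
  by (simp add: lext_tens[OF fs_sym[OF V] M M counit_left_bilinear])

lemma counit_left_letter:
  assumes x: "x \<in> fil V 0 i" and t: "t \<in> fil (tensor (sym V) M) k d"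
  shows "counit_left M (tensor_map (sym V) M i (lmul V (i, x)) 0 (\<lambda>x. x) t) = 0"
proof -
  note tm = tensor_map_filtered[OF fs_sym[OF V] M fs_sym[OF V] M lmul_fm[OF V x] fm_id(2)]
  show ?thesis
    by (rule tensor_ext[OF fs_sym[OF V] M M fm_comp[OF tm counit_left_fm
        filtered_space_tensor[OF fs_sym[OF V] M]]
          fm_zero_map[OF M] _ t])
      (simp add: tensor_map_tens[OF fs_sym[OF V] M fs_sym[OF V] M lmul_fm[OF V x] fm_id(2)]
        counit_left_tens
        counit_lmul[OF V x] scl_simps[OF M])
qed

end

text \<open>The map \<open>id \<otimes> \<epsilon>\<close> on the tensor square of the symmetric algebra.\<close>

definition counit_right :: "('k::field, 'v::ab_group_add) fspace \<Rightarrow> _ \<Rightarrow> _" where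
  "counit_right V = lext fscale (\<lambda>((i, s :: (int \<times> 'v) list \<Rightarrow>\<^sub>0 'k), (j, t)). fscale (counit t) s)"

context
  fixes V :: "('k::field, 'v::ab_group_add) fspace"
  assumes V: "filtered_space V"
begin

lemma counit_right_bilinear:
  "bilinear_map (sym V) (sym V) (sym V) 0
     (\<lambda>((i, s :: (int \<times> 'v) list \<Rightarrow>\<^sub>0 'k), (j, t)). fscale (counit t) s)"
proof (rule bilinear_mapI)
  fix i j p q s t assume s: "s \<in> fil (sym V) p i" and t: "t \<in> fil (sym V) q j"
  show "(\<lambda>((i, s :: (int \<times> 'v) list \<Rightarrow>\<^sub>0 'k), (j, t)). fscale (counit t) s) ((i, s), (j, t))
      \<in> fil (sym V) (p + q) (i + j + 0)"
  proof (cases "q = 0 \<and> j = 0")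
    case True
    then show ?thesis using fil_scale[OF fs_sym[OF V] s] by simp
  next
    case False
    then show ?thesis using counit_degree[OF V t] by (simp add: fil_zero[OF fs_sym[OF V]])
  qed
qed (simp_all add: fm_add[OF counit_fm[OF V]] fm_scale[OF counit_fm[OF V], simplified]
    free.scale_right_distrib free.scale_left_distrib mult.commute)

lemma counit_right_fm: "filtered_map (sym_sq V) (sym V) 0 (counit_right V)"
  unfolding counit_right_def
  using lext_tensor_filtered_map[OF fs_sym[OF V] fs_sym[OF V] fs_sym[OF V] counit_right_bilinear] by
      simp

lemma counit_right_tens: "counit_right V (tens_sq V (i, s) (j, t)) = fscale (counit t) s"
  unfolding counit_right_def
  using lext_tens[OF fs_sym[OF V] fs_sym[OF V] fs_sym[OF V] counit_right_bilinear] by simp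

lemma counit_right_coprod:
  assumes "t \<in> fil (sym V) k d"
  shows "counit_right V (coprod V t) = t"
proof (rule sym_ext[OF V fs_sym[OF V] _ fm_id(2) _ _ assms])
  show "filtered_map (sym V) (sym V) 0 (\<lambda>t. counit_right V (coprod V t))"
    using fm_comp[OF coprod_fm[OF V] counit_right_fm fs_sym[OF V]] by simp
  show "counit_right V (coprod V (sym_one V)) = sym_one V"
    by (simp add: coprod_one[OF V] counit_right_tens counit_one[OF V])
  fix i x j t
  assume x: "x \<in> fil V 0 i" and t: "t \<in> fil (sym V) 0 j" and IH: "counit_right V (coprod V t) = t"
  have "counit_right V (coprod_letter V (i, x) s) = lmul V (i, x) (counit_right V s)"
    if s: "s \<in> fil (sym_sq V) 0 j" for s
  proof (rule tensor_ext[OF fs_sym[OF V] fs_sym[OF V] fs_sym[OF V]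
        fm_comp[OF coprod_letter_fm[OF V x] counit_right_fm fs_sym_sq[OF V]] _ _ s])
    show "filtered_map (sym_sq V) (sym V) (i + 0) (\<lambda>s. lmul V (i, x) (counit_right V s))"
      using fm_comp[OF counit_right_fm lmul_fm[OF V x] fs_sym_sq[OF V]] by simp
    fix a b u v assume u: "u \<in> fil (sym V) 0 a" and v: "v \<in> fil (sym V) 0 b"
    have 1: "tens_sq V (a + i, lmul V (i, x) u) (b, v) \<in> fil (sym_sq V) 0 (a + i + b)"
      "tens_sq V (a, u) (b + i, lmul V (i, x) v) \<in> fil (sym_sq V) 0 (a + i + b)"
      using tens_in_0[OF fs_sym[OF V] fs_sym[OF V] fm_in[OF lmul_fm[OF V x] u] v]
        tens_in_0[OF fs_sym[OF V] fs_sym[OF V] u fm_in[OF lmul_fm[OF V x] v]] by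
          (simp_all add: ac_simps)
    show "counit_right V (coprod_letter V (i, x) (tens_sq V (a, u) (b, v))) =
        lmul V (i, x) (counit_right V (tens_sq V (a, u) (b, v)))"
      unfolding coprod_letter_tens[OF V x]
        fm_add[OF counit_right_fm 1(1) fil_scale[OF fs_sym_sq[OF V] 1(2), simplified]]
        fm_scale[OF counit_right_fm 1(2), simplified] counit_right_tens counit_lmul[OF V x v]
        fm_scale[OF lmul_fm[OF V x] u, simplified] by simp
  qed
  from this[OF fm_in[OF coprod_fm[OF V] t, simplified]] IH
  show "counit_right V (coprod V (lmul V (i, x) t)) = lmul V (i, x) t"
    by (simp add: coprod_lmul[OF V x t])
qed

end


section \<open>Coderivations are determined by their corestrictions\<close>

definition insert_right ::
    "('k::field, 'v::ab_group_add) fspace \<Rightarrow> (((int \<times> 'v) list \<Rightarrow>\<^sub>0 'k) \<Rightarrow> 'v) \<Rightarrow> int \<Rightarrow> _ \<Rightarrow> _" where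
  "insert_right V q d =
     lext fscale (\<lambda>((i, s), (j, t)). fscale (ksign (d * i)) (rmul V (j + d, q t) s))"

text \<open>
  The only candidate for a coderivation of degree \<open>d\<close> whose projection to letters is \<open>q\<close>, namely
  \<open>x \<mapsto> \<Sum> x' \<or> q(x'')\<close> with Koszul signs.
\<close>

definition coder ::
    "('k::field, 'v::ab_group_add) fspace \<Rightarrow> (((int \<times> 'v) list \<Rightarrow>\<^sub>0 'k) \<Rightarrow> 'v) \<Rightarrow> int \<Rightarrow> _ \<Rightarrow> _" where
  "coder V q d X = insert_right V q d (coprod V X)"

text \<open>
  The word length enters because \<open>x \<mapsto> \<Sum> x' \<or> pr(x'')\<close>, with \<open>pr\<close> the projection to letters, multiplies
  a word by its length (\<open>coder_proj1\<close>).
\<close>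

definition number_op :: "('k::field, 'v::ab_group_add) fspace \<Rightarrow> _ \<Rightarrow> _" where
  "number_op V = lext fscale (\<lambda>w. fscale (of_nat (length w)) (sym_word V w))"

lemma ksign_square: "ksign m * ksign m = (1 :: 'k::field)"
  by (simp add: ksign_def)

context
  fixes V :: "('k::field, 'v::ab_group_add) fspace"
  assumes V: "filtered_space V"
begin

lemma proj1_multilinear: "multilinear_map V V 0 (\<lambda>w. case w of [(i, x)] \<Rightarrow> x | _ \<Rightarrow> 0)"
proof (rule multilinear_mapI)
  fix w ps assume "letters_in V w ps"
  then show "(case w of [(i, x)] \<Rightarrow> x | _ \<Rightarrow> 0) \<in> fil V (sum_list ps) (wdeg w + 0)"
    by (cases w; cases ps) (auto simp: fil_zero[OF V] split: list.splits)
qed (auto simp: append_eq_Cons_conv Cons_eq_append_conv scl_simps[OF V] split: list.splits)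

lemma proj1_fm: "filtered_map (sym V) V 0 (sym_proj1 V)"
  unfolding sym_proj1_def by (rule lext_sym_filtered_map[OF V V proj1_multilinear])

lemma proj1_word: "sym_proj1 V (sym_word V w) = (case w of [(i, x)] \<Rightarrow> x | _ \<Rightarrow> 0)"
  unfolding sym_proj1_def by (rule lext_sym_word[OF V V proj1_multilinear])

lemma proj1_lmul:
  assumes x: "x \<in> fil V 0 i" and t: "t \<in> fil (sym V) k d"
  shows "sym_proj1 V (lmul V (i, x) t) = scl V (counit t) x"
  using fil_0[OF fs_sym[OF V] t]
proof (induction rule: sym_induct[OF V, consumes 1, case_names word zero scale add])
  case (word w ps)
  then show ?case
    by (simp add: lmul_word[OF V x] proj1_word counit_word[OF V] scl_simps[OF V] split: list.splits)
next
  case zero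
  show ?case
    by (simp add: fm_zero[OF lmul_fm[OF V x] fs_sym[OF V] fs_sym[OF V]]
        fm_zero[OF proj1_fm fs_sym[OF V] V]
        fm_zero[OF counit_fm[OF V] fs_sym[OF V] filtered_space_ground_field] scl_simps[OF V])
next
  case (scale c t)
  then show ?case
    by (simp add: fm_scale[OF lmul_fm[OF V x], simplified] fm_scale[OF counit_fm[OF V], simplified]
        fm_scale[OF proj1_fm fm_in[OF lmul_fm[OF V x]], simplified] scl_simps[OF V])
next
  case (add s t)
  then show ?case
    by (simp add: fm_add[OF lmul_fm[OF V x]] fm_add[OF counit_fm[OF V]] scl_distribs[OF V]
        fm_add[OF proj1_fm fm_in[OF lmul_fm[OF V x]] fm_in[OF lmul_fm[OF V x]]])
qed

lemma insert_right_bilinear: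
  assumes q: "filtered_map (sym V) V d q"
  shows "bilinear_map (sym V) (sym V) (sym V) d
    (\<lambda>((i, s), (j, t)). fscale (ksign (d * i)) (rmul V (j + d, q t) s))"
proof (rule bilinear_mapI)
  fix i j p r s t assume s: "s \<in> fil (sym V) p i" and t: "t \<in> fil (sym V) r j"
  have "fscale (ksign (d * i)) (rmul V (j + d, q t) s) \<in> fil (sym V) (p + r) (i + (j + d))"
    using fil_scale[OF fs_sym[OF V] raisesD[OF rmul_raises[OF V fm_in[OF q t]] s]] by simp
  then show "(\<lambda>((i, s), (j, t)). fscale (ksign (d * i)) (rmul V (j + d, q t) s)) ((i, s), (j, t))
      \<in> fil (sym V) (p + r) (i + j + d)"
    by (simp add: ac_simps)
qed (simp_all add: fm_add[OF rmul_fm[OF V fm_in[OF q]]]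
  fm_scale[OF rmul_fm[OF V fm_in[OF q]], simplified]
    fm_add[OF q] fm_scale[OF q, simplified] rmul_add[OF V fm_in[OF q] fm_in[OF q]]
    rmul_scale[OF V fm_in[OF q]] free.scale_right_distrib mult.commute)

lemma insert_right_fm:
  "filtered_map (sym V) V d q \<Longrightarrow> filtered_map (sym_sq V) (sym V) d (insert_right V q d)"
  unfolding insert_right_def
  using lext_tensor_filtered_map[OF fs_sym[OF V] fs_sym[OF V] fs_sym[OF V] insert_right_bilinear] by
      simp

lemma insert_right_tens:
  "filtered_map (sym V) V d q \<Longrightarrow> insert_right V q d (tens_sq V (i, s) (j, t)) =
     fscale (ksign (d * i)) (rmul V (j + d, q t) s)"
  unfolding insert_right_def
  using lext_tens[OF fs_sym[OF V] fs_sym[OF V] fs_sym[OF V] insert_right_bilinear] by simp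

lemma coder_fm:
  assumes q: "filtered_map (sym V) V d q"
  shows "filtered_map (sym V) (sym V) d (coder V q d)"
  unfolding coder_def[abs_def] using fm_comp[OF coprod_fm[OF V] insert_right_fm[OF q] fs_sym[OF V]]
      by simp

lemma coder_one: "filtered_map (sym V) V d q \<Longrightarrow> coder V q d (sym_one V) = sym_word V
    [(d, q (sym_one V))]"
  using rmul_word[OF V, of "q (sym_one V)" d "[]"] fm_in[of "sym V" V d q "sym_one V" 0 0]
  by (simp add: coder_def coprod_one[OF V] insert_right_tens sym_one_in[OF V])

lemma insert_right_left_letter:
  assumes q: "filtered_map (sym V) V d q" and x: "x \<in> fil V 0 i"
    and t: "t \<in> fil (sym_sq V) k l"
  shows "insert_right V q d (tensor_map_sq V i (lmul V (i, x)) 0 (\<lambda>x. x) t) =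
    fscale (ksign (d * i)) (lmul V (i, x) (insert_right V q d t))"
proof (rule tensor_ext[OF fs_sym[OF V] fs_sym[OF V] fs_sym[OF V]
      fm_comp[OF left_letter_fm[OF V x] insert_right_fm[OF q] fs_sym_sq[OF V]] _ _ t])
  show "filtered_map (sym_sq V) (sym V) (i + d)
      (\<lambda>t. fscale (ksign (d * i)) (lmul V (i, x) (insert_right V q d t)))"
    using fm_smult[OF fm_comp[OF insert_right_fm[OF q] lmul_fm[OF V x] fs_sym_sq[OF V]] fs_sym[OF V]]
    by (simp add: add.commute)
  fix a b s u assume s: "s \<in> fil (sym V) 0 a" and u: "u \<in> fil (sym V) 0 b"
  show "insert_right V q d (tensor_map_sq V i (lmul V (i, x)) 0 (\<lambda>x. x)
        (tens_sq V (a, s) (b, u))) =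
      fscale (ksign (d * i)) (lmul V (i, x) (insert_right V q d (tens_sq V (a, s) (b, u))))"
    unfolding left_letter_tens[OF V x] insert_right_tens[OF q]
      fm_scale[OF lmul_fm[OF V x] fm_in[OF rmul_fm[OF V fm_in[OF q u]] s], simplified]
      rmul_lmul[OF V x fm_in[OF q u] s]
    by (simp add: distrib_left ksign_add mult.commute)
qed

text \<open>
  A letter in the right factor is absorbed into \<open>q\<close>, and a letter in the left factor moves out.  Together
  they give a recursion for \<open>coder\<close> over the letters of a word, in which \<open>q\<close> varies.
\<close>

lemma insert_right_right_letter:
  assumes q: "filtered_map (sym V) V d q" and x: "x \<in> fil V 0 i"
    and t: "t \<in> fil (sym_sq V) k l"
  shows "insert_right V q d (tensor_map_sq V 0 (\<lambda>x. x) i (lmul V (i, x)) t) =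
    insert_right V (\<lambda>t. q (lmul V (i, x) t)) (i + d) t"
proof (rule tensor_ext[OF fs_sym[OF V] fs_sym[OF V] fs_sym[OF V]
      fm_comp[OF right_letter_fm[OF V x] insert_right_fm[OF q] fs_sym_sq[OF V]] _ _ t])
  note ql = fm_comp[OF lmul_fm[OF V x] q fs_sym[OF V]]
  show "filtered_map (sym_sq V) (sym V) (i + d)
      (insert_right V (\<lambda>t. q (lmul V (i, x) t)) (i + d))"
    by (rule insert_right_fm[OF ql])
  fix a b s u assume s: "s \<in> fil (sym V) 0 a" and u: "u \<in> fil (sym V) 0 b"
  show "insert_right V q d (tensor_map_sq V 0 (\<lambda>x. x) i (lmul V (i, x))
        (tens_sq V (a, s) (b, u))) =
      insert_right V (\<lambda>t. q (lmul V (i, x) t)) (i + d) (tens_sq V (a, s) (b, u))"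
    unfolding right_letter_tens[OF V x] insert_right_tens[OF ql]
      fm_scale[OF insert_right_fm[OF q] tens_in_0[OF fs_sym[OF V] fs_sym[OF V] s
        fm_in[OF lmul_fm[OF V x] u]], simplified]
      insert_right_tens[OF q]
    by (simp add: distrib_right ksign_add add.assoc)
qed

lemma coder_lmul:
  assumes q: "filtered_map (sym V) V d q" and x: "x \<in> fil V 0 i" and X: "X \<in> fil (sym V) k l"
  shows "coder V q d (lmul V (i, x) X) = fscale (ksign (d * i)) (lmul V (i, x) (coder V q d X)) +
    coder V (\<lambda>t. q (lmul V (i, x) t)) (i + d) X"
proof -
  note c = fm_in[OF coprod_fm[OF V] fil_0[OF fs_sym[OF V] X]]
  show ?thesis
    unfolding coder_def coprod_lmul[OF V x X] coprod_letter_def fst_conv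
      fm_add[OF insert_right_fm[OF q] fm_in[OF left_letter_fm[OF V x] c]
        fm_in[OF right_letter_fm[OF V x] c]]
      insert_right_left_letter[OF q x c] insert_right_right_letter[OF q x c] ..
qed

lemma insert_right_counit:
  assumes x: "x \<in> fil V 0 i" and t: "t \<in> fil (sym_sq V) k l"
  shows "insert_right V (\<lambda>t. scl V (counit t) x) i t = lmul V (i, x) (counit_right V t)"
proof -
  have e: "filtered_map (sym V) V i (\<lambda>t. scl V (counit t) x)"
  proof (rule filtered_mapI)
    fix k l t assume t: "t \<in> fil (sym V) k l"
    show "scl V (counit t) x \<in> fil V k (l + i)"
    proof (cases "k = 0 \<and> l = 0")
      case True
      then show ?thesis using fil_scale[OF V x] by simp
    next
      case False
      then show ?thesis using counit_degree[OF V t] by (simp add: scl_simps[OF V] fil_zero[OF V])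
    qed
  qed (simp_all add: fm_add[OF counit_fm[OF V]] fm_scale[OF counit_fm[OF V], simplified]
      scl_simps[OF V] scl_distribs[OF V])
  show ?thesis
  proof (rule tensor_ext[OF fs_sym[OF V] fs_sym[OF V] fs_sym[OF V] insert_right_fm[OF e] _ _ t])
    show "filtered_map (sym_sq V) (sym V) i (\<lambda>t. lmul V (i, x) (counit_right V t))"
      using fm_comp[OF counit_right_fm[OF V] lmul_fm[OF V x] fs_sym_sq[OF V]] by simp
    fix a b s u assume s: "s \<in> fil (sym V) 0 a" and u: "u \<in> fil (sym V) 0 b"
    show "insert_right V (\<lambda>t. scl V (counit t) x) i (tens_sq V (a, s) (b, u)) =
      lmul V (i, x) (counit_right V (tens_sq V (a, s) (b, u)))"
    proof (cases "b = 0")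
      case True
      then show ?thesis
        unfolding insert_right_tens[OF e] counit_right_tens[OF V]
            fm_scale[OF lmul_fm[OF V x] s, simplified]
        by (simp add: rmul_scale[OF V x s] rmul_eq_lmul[OF V x s] mult.assoc ksign_square
            mult.left_commute[of "ksign (i * a)"])
    next
      case False
      then have "counit u = 0" using counit_degree[OF V u] by simp
      then show ?thesis
        unfolding insert_right_tens[OF e] counit_right_tens[OF V]
        by (simp add: scl_simps[OF V] rmul_zero[OF V s] fm_zero[OF lmul_fm[OF V x] fs_sym[OF V]
            fs_sym[OF V]])
    qed
  qed
qed

lemma number_op_multilinear:
  "multilinear_map V (sym V) 0 (\<lambda>w. fscale (of_nat (length w)) (sym_word V w))"
proof (rule multilinear_mapI)
  note m = multilinear_mapD[OF sym_word_multilinear[OF V], simplified]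
  fix u v i x y assume *: "is_word V u" "is_word V v" "x \<in> fil V 0 i"
  show "fscale (of_nat (length (u @ (i, x + y) # v))) (sym_word V (u @ (i, x + y) # v)) =
      fscale (of_nat (length (u @ (i, x) # v))) (sym_word V (u @ (i, x) # v)) +
      fscale (of_nat (length (u @ (i, y) # v))) (sym_word V (u @ (i, y) # v))"
    if "y \<in> fil V 0 i"
    by (simp only: m(1)[OF * that] length_append length_Cons free.scale_right_distrib)
  show "fscale (of_nat (length (u @ (i, scl V c x) # v))) (sym_word V (u @ (i, scl V c x) # v)) =
      scl (sym V) c (fscale (of_nat (length (u @ (i, x) # v))) (sym_word V (u @ (i, x) # v)))" for c
    by (simp only: m(2)[OF *] length_append length_Cons scl_sym free.scale_scale mult.commute)
  show "fscale (of_nat (length (u @ (i, x) # (j, y) # v))) (sym_word V (u @ (i, x) # (j, y) # v)) =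
      scl (sym V) (ksign (i * j))
        (fscale (of_nat (length (u @ (j, y) # (i, x) # v))) (sym_word V (u @ (j, y) # (i, x) # v)))"
    if "y \<in> fil V 0 j" for j
    unfolding m(3)[OF * that] by (simp add: mult.commute)
qed (use fil_scale[OF fs_sym[OF V]] sym_word_in[OF V] in simp)

lemma number_op_fm: "filtered_map (sym V) (sym V) 0 (number_op V)"
  unfolding number_op_def using lext_sym_filtered_map[OF V fs_sym[OF V] number_op_multilinear] by simp

lemma number_op_word: "number_op V (sym_word V w) = fscale (of_nat (length w)) (sym_word V w)"
  unfolding number_op_def using lext_sym_word[OF V fs_sym[OF V] number_op_multilinear] by simp

lemma number_op_lmul:
  assumes x: "x \<in> fil V 0 i" and t: "t \<in> fil (sym V) k d"
  shows "number_op V (lmul V (i, x) t) = lmul V (i, x) (number_op V t) + lmul V (i, x) t"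
proof (rule sym_word_ext[OF V fs_sym[OF V] fm_comp[OF lmul_fm[OF V x] number_op_fm fs_sym[OF V]] _ _ t])
  show "filtered_map (sym V) (sym V) (i + 0) (\<lambda>t. lmul V (i, x) (number_op V t) + lmul V (i, x) t)"
    using fm_plus[OF fm_comp[OF number_op_fm lmul_fm[OF V x] fs_sym[OF V]], of "lmul V (i, x)"]
      lmul_fm[OF V x] fs_sym[OF V] by simp
  fix w assume "is_word V w"
  from sym_word_in_0[OF V this]
  show "number_op V (lmul V (i, x) (sym_word V w)) =
      lmul V (i, x) (number_op V (sym_word V w)) + lmul V (i, x) (sym_word V w)"
    by (simp add: lmul_word[OF V x] number_op_word fm_scale[OF lmul_fm[OF V x], simplified]
        free.scale_left_distrib add.commute)
qed

lemma coder_proj1: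
  assumes "X \<in> fil (sym V) k d"
  shows "coder V (sym_proj1 V) 0 X = number_op V X"
proof (rule sym_ext[OF V fs_sym[OF V] coder_fm[OF proj1_fm] number_op_fm _ _ assms])
  show "coder V (sym_proj1 V) 0 (sym_one V) = number_op V (sym_one V)"
    using sym_word_zero_letter[OF V, of "[]" "[]" 0]
    by (simp add: coder_one[OF proj1_fm] proj1_word number_op_word)
  fix i x j t
  assume x: "x \<in> fil V 0 i" and t: "t \<in> fil (sym V) 0 j"
    and IH: "coder V (sym_proj1 V) 0 t = number_op V t"
  have "coder V (\<lambda>t. sym_proj1 V (lmul V (i, x) t)) i t =
      insert_right V (\<lambda>t. scl V (counit t) x) i (coprod V t)"
    unfolding coder_def insert_right_def
  proof (rule lext_eq_on_supported)
    show "coprod V t \<in> supported (tensor_gens (sym V) (sym V))"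
      by (rule tensor_supported[OF fs_sym[OF V] fs_sym[OF V] fm_in[OF coprod_fm[OF V] t]])
  qed (auto simp: tensor_gens_def proj1_lmul[OF x])
  also have "\<dots> = lmul V (i, x) t"
    by (simp add: insert_right_counit[OF x fm_in[OF coprod_fm[OF V] t]] counit_right_coprod[OF V t])
  finally show "coder V (sym_proj1 V) 0 (lmul V (i, x) t) = number_op V (lmul V (i, x) t)"
    by (simp add: coder_lmul[OF proj1_fm x t] IH number_op_lmul[OF x t])
qed

abbreviation (input) "letters \<equiv> insert_right V (sym_proj1 V) 0"

lemma letters_fm: "filtered_map (sym_sq V) (sym V) 0 letters"
  by (rule insert_right_fm[OF proj1_fm])

text \<open>
  Splitting off one letter after \<open>coder V q d\<close>: the letter comes either from \<open>q\<close>, or from the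
  argument.  This part of the coderivation property is what the proof of uniqueness needs; the
  induction over words has to allow all \<open>q\<close>, because moving a letter into \<open>q\<close> changes it.
\<close>

lemma number_op_coder:
  assumes "filtered_map (sym V) V d q" "is_word V w"
  shows "number_op V (coder V q d (sym_word V w)) = coder V q d (sym_word V w) +
    letters (tensor_map_sq V d (coder V q d) 0 (\<lambda>x. x) (coprod V (sym_word V w)))"
  using assms
proof (induction w arbitrary: q d)
  case Nil
  note q = Nil(1)
  note tm = tensor_map_tens[OF fs_sym[OF V] fs_sym[OF V] fs_sym[OF V] fs_sym[OF V] coder_fm[OF q]
      fm_id(2)]
  have "letters (tensor_map_sq V d (coder V q d) 0 (\<lambda>x. x) (coprod V (sym_one V))) = 0"
    using rmul_zero[OF V fm_in[OF coder_fm[OF q] sym_one_in[OF V]]]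
    by (simp add: coprod_one[OF V] tm insert_right_tens[OF proj1_fm] proj1_word)
  then show ?case
    by (simp add: coder_one[OF q] number_op_word)
next
  case (Cons a w)
  obtain i x where a: "a = (i, x)" by (cases a)
  with Cons.prems have x: "x \<in> fil V 0 i" and w: "is_word V w" by simp_all
  note q = Cons.prems(1)
  note ql = fm_comp[OF lmul_fm[OF V x] q fs_sym[OF V]]
  note CV = fs_sym[OF V]
  let ?W = "sym_word V w" and ?q = "\<lambda>t. q (lmul V (i, x) t)" and ?l = "lmul V (i, x)"
  let ?c = "coprod V ?W" and ?f = "coder V q d" and ?g = "coder V (\<lambda>t. q (lmul V (i, x) t)) (i + d)"
  let ?T = "tensor_map_sq V"
  have W: "?W \<in> fil (sym V) 0 (wdeg w)" by (rule sym_word_in_0[OF V w])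
  have c: "?c \<in> fil (sym_sq V) 0 (wdeg w)"
    using fm_in[OF coprod_fm[OF V] W] by simp
  note f = coder_fm[OF q] and g = coder_fm[OF ql] and l = lmul_fm[OF V x] and id = fm_id(2)
  note tm = tensor_map_filtered[OF CV CV CV CV]
  note tt = tensor_map_tens[OF CV CV CV CV]
  have fW: "?f ?W \<in> fil (sym V) 0 (wdeg w + d)" and gW: "?g ?W \<in> fil (sym V) 0 (wdeg w + (i + d))"
    by (rule fm_in[OF f W], rule fm_in[OF g W])
  have tf: "filtered_map (sym_sq V) (sym_sq V) d (?T d ?f 0 (\<lambda>x. x))"
    and tg: "filtered_map (sym_sq V) (sym_sq V) (i + d) (?T (i + d) ?g 0 (\<lambda>x. x))"
    using tm[OF f id] tm[OF g id] by simp_all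
  \<comment> \<open>When the letter \<open>x\<close> goes to the left factor, \<open>coder\<close> moves it out or absorbs it into \<open>q\<close>.\<close>
  have left: "letters (?T d ?f 0 (\<lambda>x. x) (?T i ?l 0 (\<lambda>x. x) t)) =
      fscale (ksign (d * i)) (?l (letters (?T d ?f 0 (\<lambda>x. x) t))) + letters (?T (i + d) ?g 0 (\<lambda>x. x) t)"
    if t: "t \<in> fil (sym_sq V) 0 j" for t j
  proof (rule tensor_ext[OF CV CV CV _ _ _ t])
    show "filtered_map (sym_sq V) (sym V) (i + d)
        (\<lambda>t. letters (?T d ?f 0 (\<lambda>x. x) (?T i ?l 0 (\<lambda>x. x) t)))"
      using fm_comp[OF fm_comp[OF left_letter_fm[OF V x] tf fs_sym_sq[OF V]] letters_fm
          fs_sym_sq[OF V]] by simp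
    show "filtered_map (sym_sq V) (sym V) (i + d)
        (\<lambda>t. fscale (ksign (d * i)) (?l (letters (?T d ?f 0 (\<lambda>x. x) t))) + letters
          (?T (i + d) ?g 0 (\<lambda>x. x) t))"
      using fm_plus[OF fm_smult[OF fm_comp[OF fm_comp[OF tf letters_fm fs_sym_sq[OF V]] l
          fs_sym_sq[OF V]] CV,
            of "ksign (d * i)"] _ CV, of "\<lambda>t. letters (?T (i + d) ?g 0 (\<lambda>x. x) t)"]
        fm_comp[OF tg letters_fm fs_sym_sq[OF V]]
      by (simp add: add.commute)
    fix a b s u assume s: "s \<in> fil (sym V) 0 a" and u: "u \<in> fil (sym V) 0 b"
    note pu = fm_in[OF proj1_fm u]
    note r = rmul_fm[OF V pu]
    show "letters (?T d ?f 0 (\<lambda>x. x) (?T i ?l 0 (\<lambda>x. x) (tens_sq V (a, s) (b, u)))) =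
      fscale (ksign (d * i)) (?l (letters (?T d ?f 0 (\<lambda>x. x) (tens_sq V (a, s) (b, u))))) +
      letters (?T (i + d) ?g 0 (\<lambda>x. x) (tens_sq V (a, s) (b, u)))"
    proof -
      have 1: "fscale (ksign (d * i)) (?l (?f s)) \<in> fil (sym V) 0 (a + (i + d))"
        using fil_scale[OF CV fm_in[OF l fm_in[OF f s]]] by (simp add: ac_simps)
      show ?thesis
        unfolding left_letter_tens[OF V x] tt[OF f id] tt[OF g id]
        by (simp add: insert_right_tens[OF proj1_fm] coder_lmul[OF q x s]
            fm_add[OF r[simplified] 1 fm_in[OF g s]]
            fm_scale[OF r[simplified] fm_in[OF l fm_in[OF f s]], simplified]
            rmul_lmul[OF V x pu[simplified] fm_in[OF f s]])
    qed
  qed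
  \<comment> \<open>When it goes to the right factor, it is the letter that is split off: the rest must be empty.\<close>
  have right: "letters (?T d ?f 0 (\<lambda>x. x) (?T 0 (\<lambda>x. x) i ?l t)) =
      fscale (ksign (d * i)) (?l (?f (counit_right V t)))"
    if t: "t \<in> fil (sym_sq V) 0 j" for t j
  proof (rule tensor_ext[OF CV CV CV _ _ _ t])
    show "filtered_map (sym_sq V) (sym V) (i + d)
        (\<lambda>t. letters (?T d ?f 0 (\<lambda>x. x) (?T 0 (\<lambda>x. x) i ?l t)))"
      using fm_comp[OF fm_comp[OF right_letter_fm[OF V x] tf fs_sym_sq[OF V]] letters_fm
          fs_sym_sq[OF V]] by simp
    show "filtered_map (sym_sq V) (sym V) (i + d)
        (\<lambda>t. fscale (ksign (d * i)) (?l (?f (counit_right V t))))"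
      using fm_smult[OF fm_comp[OF fm_comp[OF counit_right_fm[OF V] f fs_sym_sq[OF V]] l
          fs_sym_sq[OF V]] CV,
            of "ksign (d * i)"]
      by (simp add: add.commute)
    fix a b s u assume s: "s \<in> fil (sym V) 0 a" and u: "u \<in> fil (sym V) 0 b"
    note lu = tens_in_0[OF CV CV s fm_in[OF l u]]
    have "letters (?T d ?f 0 (\<lambda>x. x) (?T 0 (\<lambda>x. x) i ?l (tens_sq V (a, s) (b, u)))) =
        fscale (ksign (i * a)) (rmul V (b + i, scl V (counit u) x) (?f s))"
      using fm_scale[OF letters_fm tens_in_0[OF CV CV fm_in[OF f s] fm_in[OF l u]], of "ksign (i * a)"]
      by (simp add: right_letter_tens[OF V x] fm_scale[OF tf lu, simplified] tt[OF f id]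
          insert_right_tens[OF proj1_fm] proj1_lmul[OF x u])
    also have "\<dots> = fscale (ksign (d * i)) (?l (?f (fscale (counit u) s)))"
    proof (cases "b = 0")
      case True
      have "ksign (i * a) * ksign (i * (a + d)) = (ksign (d * i) :: 'k)"
        by (simp add: ksign_def)
      then show ?thesis
        using True fm_in[OF f s]
        by (simp add: fm_scale[OF f s, simplified] fm_scale[OF l fm_in[OF f s], simplified]
            rmul_scale[OF V x fm_in[OF f s]] rmul_eq_lmul[OF V x fm_in[OF f s]]
            mult.left_commute[of _ "counit u"] mult.commute[of _ "counit u"])
    next
      case False
      then have "counit u = 0" using counit_degree[OF V u] by simp
      then show ?thesis
        using fm_zero[OF f CV CV] fm_zero[OF l CV CV] rmul_zero[OF V fm_in[OF f s]]
        by (simp add: scl_simps[OF V])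
    qed
    finally show "letters (?T d ?f 0 (\<lambda>x. x) (?T 0 (\<lambda>x. x) i ?l (tens_sq V (a, s) (b, u)))) =
        fscale (ksign (d * i)) (?l (?f (counit_right V (tens_sq V (a, s) (b, u)))))"
      by (simp add: counit_right_tens[OF V])
  qed
  let ?L = "letters (?T d ?f 0 (\<lambda>x. x) ?c)" and ?L' = "letters (?T (i + d) ?g 0 (\<lambda>x. x) ?c)"
  note lc = fm_in[OF left_letter_fm[OF V x] c] and rc = fm_in[OF right_letter_fm[OF V x] c]
  have L: "?L \<in> fil (sym V) 0 (wdeg w + d)"
    using fm_in[OF letters_fm fm_in[OF tf c]] by simp
  have "letters (?T d ?f 0 (\<lambda>x. x) (coprod V (?l ?W))) =
      fscale (ksign (d * i)) (?l ?L) + ?L' + fscale (ksign (d * i)) (?l (?f ?W))"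
    unfolding coprod_lmul[OF V x W] coprod_letter_def fst_conv fm_add[OF tf lc rc]
      fm_add[OF letters_fm fm_in[OF tf lc] fm_in[OF tf rc]] left[OF c] right[OF c]
      counit_right_coprod[OF V W] ..
  moreover have "number_op V (?f (?l ?W)) =
      fscale (ksign (d * i)) (?l (?f ?W + ?L) + ?l (?f ?W)) + (?g ?W + ?L')"
  proof -
    have 1: "fscale (ksign (d * i)) (?l (?f ?W)) \<in> fil (sym V) 0 (wdeg w + (i + d))"
      using fil_scale[OF CV fm_in[OF l fW]] by (simp add: ac_simps)
    show ?thesis
      unfolding coder_lmul[OF q x W] fm_add[OF number_op_fm 1 gW]
        fm_scale[OF number_op_fm fm_in[OF l fW], simplified] number_op_lmul[OF x fW]
        Cons.IH[OF q w] Cons.IH[OF ql w] ..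
  qed
  ultimately show ?case
    unfolding a lmul_word[OF V x, symmetric] coder_lmul[OF q x W] fm_add[OF l fW L]
    by (simp add: free.scale_right_distrib)
qed

lemma counit_left_coprod:
  assumes "t \<in> fil (sym V) k d"
  shows "counit_left (sym V) (coprod V t) = t"
proof (rule sym_ext[OF V fs_sym[OF V] _ fm_id(2) _ _ assms])
  show "filtered_map (sym V) (sym V) 0 (\<lambda>t. counit_left (sym V) (coprod V t))"
    using fm_comp[OF coprod_fm[OF V] counit_left_fm[OF V fs_sym[OF V]] fs_sym[OF V]] by simp
  show "counit_left (sym V) (coprod V (sym_one V)) = sym_one V"
    by (simp add: coprod_one[OF V] counit_left_tens[OF V fs_sym[OF V]] counit_one[OF V])
  fix i x j t
  assume x: "x \<in> fil V 0 i" and t: "t \<in> fil (sym V) 0 j"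
    and IH: "counit_left (sym V) (coprod V t) = t"
  note e = counit_left_fm[OF V fs_sym[OF V]] and l = lmul_fm[OF V x]
  have "counit_left (sym V) (tensor_map_sq V 0 (\<lambda>x. x) i (lmul V (i, x)) s) =
      lmul V (i, x) (counit_left (sym V) s)"
    if s: "s \<in> fil (sym_sq V) 0 j" for s
  proof (rule tensor_ext[OF fs_sym[OF V] fs_sym[OF V] fs_sym[OF V]
    fm_comp[OF right_letter_fm[OF V x] e fs_sym_sq[OF V]] _ _ s])
    show "filtered_map (sym_sq V) (sym V) (i + 0) (\<lambda>s. lmul V (i, x) (counit_left (sym V) s))"
      using fm_comp[OF e l fs_sym_sq[OF V]] by simp
    fix a b u v assume u: "u \<in> fil (sym V) 0 a" and v: "v \<in> fil (sym V) 0 b"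
    have "fscale (ksign (i * a)) (fscale (counit u) (lmul V (i, x) v)) = fscale (counit u)
        (lmul V (i, x) v)"
      using counit_degree[OF V u] by (cases "a = 0") simp_all
    then show "counit_left (sym V) (tensor_map_sq V 0 (\<lambda>x. x) i (lmul V (i, x))
          (tens_sq V (a, u) (b, v))) =
        lmul V (i, x) (counit_left (sym V) (tens_sq V (a, u) (b, v)))"
      using fm_scale[OF e tens_in_0[OF fs_sym[OF V] fs_sym[OF V] u fm_in[OF l v]], of "ksign (i * a)"]
      by (simp add: right_letter_tens[OF V x] counit_left_tens[OF V fs_sym[OF V]]
          fm_scale[OF l v, simplified])
  qed
  note right = this[OF fm_in[OF coprod_fm[OF V] t, simplified]]
  note c = fm_in[OF coprod_fm[OF V] t]
  show "counit_left (sym V) (coprod V (lmul V (i, x) t)) = lmul V (i, x) t"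
    unfolding coprod_lmul[OF V x t] coprod_letter_def fst_conv
      fm_add[OF e fm_in[OF left_letter_fm[OF V x] c] fm_in[OF right_letter_fm[OF V x] c]]
      counit_left_letter[OF V fs_sym[OF V] x c] right IH by simp
qed

lemma counit_insert_right:
  assumes q: "filtered_map (sym V) V d q" and t: "t \<in> fil (sym_sq V) k l"
  shows "counit (insert_right V q d t) = 0"
proof -
  have r: "counit (rmul V (i, x) s) = 0" if "x \<in> fil V 0 i" "s \<in> fil (sym V) 0 j" for i x s j
    unfolding rmul_eq_lmul[OF V that]
    using fm_scale[OF counit_fm[OF V] fm_in[OF lmul_fm[OF V that(1)] that(2)]]
    by (simp add: counit_lmul[OF V that])
  show ?thesis
    by (rule tensor_ext[OF fs_sym[OF V] fs_sym[OF V] filtered_space_ground_field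
          fm_comp[OF insert_right_fm[OF q] counit_fm[OF V] fs_sym_sq[OF V]]
          fm_zero_map[OF filtered_space_ground_field] _ t])
      (simp add: insert_right_tens[OF q] fm_scale[OF counit_fm[OF V]
        fm_in[OF rmul_fm[OF V fm_in[OF q]]], simplified]
        r[OF fm_in[OF q]])
qed

lemma counit_coder: "filtered_map (sym V) V d q \<Longrightarrow> X \<in> fil (sym V) k l \<Longrightarrow> counit (coder V q d X) = 0"
  unfolding coder_def by (rule counit_insert_right[OF _ fm_in[OF coprod_fm[OF V]]])

lemma unshuffles_length: "(n, u, v) \<in> set (unshuffles w) \<Longrightarrow> length u + length v = length w"
  by (induction w arbitrary: n u v) fastforce+

end

context
  fixes V :: "('k::field_char_0, 'v::ab_group_add) fspace"
  assumes V: "filtered_space V"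
begin

text \<open>Dividing by the word length inverts the number operator away from the constants.\<close>

lemma number_op_inject:
  assumes X: "X \<in> fil (sym V) k d" and Y: "Y \<in> fil (sym V) k d"
    and eq: "number_op V X = number_op V Y" and counit: "counit X = counit Y"
  shows "X = Y"
proof -
  define h where "h = (\<lambda>w. fscale (1 / of_nat (length w)) (sym_word V w))"
  note m = multilinear_mapD[OF sym_word_multilinear[OF V], simplified]
  have h: "multilinear_map V (sym V) 0 h"
  proof (rule multilinear_mapI)
    fix u v i x y assume *: "is_word V u" "is_word V v" "x \<in> fil V 0 i"
    show "h (u @ (i, x + y) # v) = h (u @ (i, x) # v) + h (u @ (i, y) # v)" if "y \<in> fil V 0 i"
      unfolding h_def
      by (simp only: m(1)[OF * that] length_append length_Cons free.scale_right_distrib)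
    show "h (u @ (i, scl V c x) # v) = scl (sym V) c (h (u @ (i, x) # v))" for c
      unfolding h_def
      by (simp only: m(2)[OF *] length_append length_Cons scl_sym free.scale_scale mult.commute)
    show "h (u @ (i, x) # (j, y) # v) = scl (sym V) (ksign (i * j)) (h (u @ (j, y) # (i, x) # v))"
      if "y \<in> fil V 0 j" for j
      unfolding h_def m(3)[OF * that] by (simp add: mult.commute)
  qed (use fil_scale[OF fs_sym[OF V]] sym_word_in[OF V] in \<open>simp add: h_def\<close>)
  define H where "H = lext fscale h"
  have H: "filtered_map (sym V) (sym V) 0 H" and Hw: "H (sym_word V w) = h w" for w
    unfolding H_def
    using lext_sym_filtered_map[OF V fs_sym[OF V] h] lext_sym_word[OF V fs_sym[OF V] h] by simp_all
  have inv: "H (number_op V Z) = Z - fscale (counit Z) (sym_one V)" if "Z \<in> fil (sym V) k d" for Z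
    using fil_0[OF fs_sym[OF V] that]
  proof (induction rule: sym_induct[OF V, consumes 1, case_names word zero scale add])
    case (word w ps)
    note w = sym_word_in_0[OF V letters_in_is_word[OF V word(1)]]
    show ?case
      by (simp add: number_op_word[OF V] fm_scale[OF H w, simplified] Hw h_def counit_word[OF V])
  next
    case zero
    show ?case
      by (simp add: fm_zero[OF number_op_fm[OF V] fs_sym[OF V] fs_sym[OF V]]
          fm_zero[OF H fs_sym[OF V] fs_sym[OF V]]
          fm_zero[OF counit_fm[OF V] fs_sym[OF V] filtered_space_ground_field])
  next
    case (scale c t)
    then show ?case
      using fm_in[OF number_op_fm[OF V] scale(1)]
      by (simp add: fm_scale[OF number_op_fm[OF V], simplified] fm_scale[OF H, simplified]
          fm_scale[OF counit_fm[OF V], simplified] free.scale_right_diff_distrib)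
  next
    case (add s t)
    then show ?case
      using fm_in[OF number_op_fm[OF V] add(1)] fm_in[OF number_op_fm[OF V] add(2)]
      by (simp add: fm_add[OF number_op_fm[OF V]] fm_add[OF H] fm_add[OF counit_fm[OF V]]
          free.scale_left_distrib)
  qed
  have "X - fscale (counit X) (sym_one V) = Y - fscale (counit Y) (sym_one V)"
    unfolding inv[OF X, symmetric] inv[OF Y, symmetric] eq ..
  then show ?thesis unfolding counit by simp
qed

text \<open>
  With \<open>pr\<close> the projection to letters, the two sides have the same image under the number operator:
  applying \<open>id\<close> on the left factor and \<open>pr\<close> on the right factor to the coderivation equation expresses
  this image through the values on shorter words and through \<open>pr \<circ> Q\<close>.  And neither side has a constant
  part.
\<close>

theorem coderivation_eq_coder:
  assumes Q: "filtered_map (sym V) (sym V) 1 Q"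
    and coder: "\<And>i X. X \<in> fil (sym V) 0 i \<Longrightarrow> coprod V (Q X) =
      tensor_map_sq V 1 Q 0 id (coprod V X) + tensor_map_sq V 0 id 1 Q (coprod V X)"
    and X: "X \<in> fil (sym V) k i"
  shows "Q X = coder V (\<lambda>t. sym_proj1 V (Q t)) 1 X"
proof -
  note CV = fs_sym[OF V] and id = fm_id(1)
  have q: "filtered_map (sym V) V 1 (\<lambda>t. sym_proj1 V (Q t))"
    using fm_comp[OF Q proj1_fm[OF V] CV] by simp
  let ?q = "\<lambda>t. sym_proj1 V (Q t)"
  let ?T = "tensor_map_sq V" and ?f = "coder V ?q 1" and ?L = "insert_right V (sym_proj1 V) 0"
  note f = coder_fm[OF V q] and L = letters_fm[OF V]
  note tt = tensor_map_tens[OF CV CV CV CV]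
  have Ql: "filtered_map (sym_sq V) (sym_sq V) 1 (?T 1 Q 0 id)"
    and Qr: "filtered_map (sym_sq V) (sym_sq V) 1 (?T 0 id 1 Q)"
    and fl: "filtered_map (sym_sq V) (sym_sq V) 1 (?T 1 ?f 0 id)"
    using tensor_map_filtered[OF CV CV CV CV Q id] tensor_map_filtered[OF CV CV CV CV id Q]
      tensor_map_filtered[OF CV CV CV CV f id] by simp_all
  \<comment> \<open>Applying \<open>\<epsilon> \<otimes> \<epsilon>\<close> to the coderivation equation gives \<open>\<epsilon>(Q Y) = \<epsilon>(Q Y) + \<epsilon>(Q Y)\<close>.\<close>
  have counit_Q: "counit (Q Y) = 0" if Y: "Y \<in> fil (sym V) 0 j" for Y j
  proof -
    note c = fm_in[OF coprod_fm[OF V] Y]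
    note el = counit_left_fm[OF V CV] and er = counit_right_fm[OF V] and e = counit_fm[OF V]
    have 1: "counit_right V (?T 1 Q 0 id t) = Q (counit_right V t)"
      if t: "t \<in> fil (sym_sq V) 0 l" for t l
    proof (rule tensor_ext[OF CV CV CV fm_comp[OF Ql er fs_sym_sq[OF V]] _ _ t])
      show "filtered_map (sym_sq V) (sym V) (1 + 0) (\<lambda>t. Q (counit_right V t))"
        using fm_comp[OF er Q fs_sym_sq[OF V]] by simp
    qed (simp add: tt[OF Q id] counit_right_tens[OF V] fm_scale[OF Q, simplified])
    have 2: "counit (counit_right V (?T 0 id 1 Q t)) = counit (Q (counit_left (sym V) t))"
      if t: "t \<in> fil (sym_sq V) 0 l" for t l
    proof (rule tensor_ext[OF CV CV filtered_space_ground_field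
          fm_comp[OF fm_comp[OF Qr er fs_sym_sq[OF V]] e fs_sym_sq[OF V]] _ _ t])
      show "filtered_map (sym_sq V) ground_field (1 + 0 + 0)
          (\<lambda>t. counit (Q (counit_left (sym V) t)))"
        using fm_comp[OF fm_comp[OF el Q fs_sym_sq[OF V]] e fs_sym_sq[OF V]] by simp
      fix a b s u assume s: "s \<in> fil (sym V) 0 a" and u: "u \<in> fil (sym V) 0 b"
      have "ksign a * (counit (Q u) * counit s) = counit s * counit (Q u)"
        using counit_degree[OF V s] by (cases "a = 0") simp_all
      then show "counit (counit_right V (?T 0 id 1 Q (tens_sq V (a, s) (b, u)))) =
          counit (Q (counit_left (sym V) (tens_sq V (a, s) (b, u))))"
        using fm_scale[OF er tens_in_0[OF CV CV s fm_in[OF Q u]], of "ksign a"]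
        by (simp add: tt[OF id Q] counit_right_tens[OF V] counit_left_tens[OF V CV]
            fm_scale[OF e fil_scale[OF CV s], simplified] fm_scale[OF e s, simplified]
            fm_scale[OF Q u, simplified] fm_scale[OF e fm_in[OF Q u], simplified])
    qed
    note QY = fm_in[OF Q Y]
    have "counit (Q Y) = counit (counit_right V (coprod V (Q Y)))"
      by (simp add: counit_right_coprod[OF V QY])
    also have "\<dots> = counit (Q Y) + counit (Q Y)"
      unfolding coder[OF Y] fm_add[OF er fm_in[OF Ql c] fm_in[OF Qr c]]
        fm_add[OF e fm_in[OF er fm_in[OF Ql c]] fm_in[OF er fm_in[OF Qr c]]]
      by (simp add: 1[OF c[simplified]] 2[OF c[simplified]] counit_right_coprod[OF V Y]
          counit_left_coprod[OF V Y])
    finally show ?thesis by simp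
  qed
  have word: "Q (sym_word V w) = ?f (sym_word V w)" if "is_word V w" for w
    using that
  proof (induction w rule: length_induct)
    case (1 w)
    let ?W = "sym_word V w"
    have W: "?W \<in> fil (sym V) 0 (wdeg w)" by (rule sym_word_in_0[OF V 1(2)])
    have c: "coprod V ?W \<in> fil (sym_sq V) 0 (wdeg w)"
      using fm_in[OF coprod_fm[OF V] W] by simp
    have right: "?L (?T 0 id 1 Q t) = insert_right V ?q 1 t"
      if t: "t \<in> fil (sym_sq V) 0 l" for t l
    proof (rule tensor_ext[OF CV CV CV _ insert_right_fm[OF V q] _ t])
      show "filtered_map (sym_sq V) (sym V) 1 (\<lambda>t. ?L (?T 0 id 1 Q t))"
        using fm_comp[OF Qr L fs_sym_sq[OF V]] by simp
      fix a b s u assume s: "s \<in> fil (sym V) 0 a" and u: "u \<in> fil (sym V) 0 b"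
      show "?L (?T 0 id 1 Q (tens_sq V (a, s) (b, u))) =
          insert_right V ?q 1 (tens_sq V (a, s) (b, u))"
        using fm_scale[OF L tens_in_0[OF CV CV s fm_in[OF Q u]], of "ksign a"]
        by (simp add: tt[OF id Q] insert_right_tens[OF V q] insert_right_tens[OF V proj1_fm[OF V]])
    qed
    \<comment> \<open>Only the summands with one letter on the right survive, where the word on the left is shorter.\<close>
    have left: "?L (?T 1 Q 0 id (coprod V ?W)) = ?L (?T 1 ?f 0 id (coprod V ?W))"
    proof -
      have cw: "coprod V ?W = (\<Sum>z\<leftarrow>unshuffles w. (case z of (n, u, v) \<Rightarrow>
          fscale (ksign n) (tens_sq V (wdeg u, sym_word V u) (wdeg v, sym_word V v))))"
        using lext_sym_word[OF V fs_sym_sq[OF V] coprod_multilinear[OF V]]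
        by (simp add: coprod_altdef coprod_word_def)
      have in_c: "(case z of (n, u, v) \<Rightarrow> fscale (ksign n)
            (tens_sq V (wdeg u, sym_word V u) (wdeg v, sym_word V v)))
          \<in> fil (sym_sq V) 0 (wdeg w)" if "z \<in> set (unshuffles w)" for z
        using unshuffle_term_in[OF V 1(2)] that fil_scale[OF fs_sym_sq[OF V]] by
            (auto split: prod.splits)
      have LQ: "filtered_map (sym_sq V) (sym V) 1 (\<lambda>t. ?L (?T 1 Q 0 id t))"
        and Lf: "filtered_map (sym_sq V) (sym V) 1 (\<lambda>t. ?L (?T 1 ?f 0 id t))"
        using fm_comp[OF Ql L fs_sym_sq[OF V]] fm_comp[OF fl L fs_sym_sq[OF V]] by simp_all
      have "?L (?T 1 Q 0 id (tens_sq V (wdeg u, sym_word V u) (wdeg v, sym_word V v))) =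
          ?L (?T 1 ?f 0 id (tens_sq V (wdeg u, sym_word V u) (wdeg v, sym_word V v)))"
        if "(n, u, v) \<in> set (unshuffles w)" for n u v
      proof -
        have uv: "is_word V u" "is_word V v" using unshuffles_words[OF that 1(2)] by auto
        note u = sym_word_in_0[OF V uv(1)]
        have "rmul V (wdeg v, sym_proj1 V (sym_word V v)) (Q (sym_word V u)) =
            rmul V (wdeg v, sym_proj1 V (sym_word V v)) (?f (sym_word V u))"
        proof (cases "length v = 1")
          case True
          then have "Q (sym_word V u) = ?f (sym_word V u)"
            using 1(1) uv(1) unshuffles_length[OF V that] by auto
          then show ?thesis by simp
        next
          case False
          then have "sym_proj1 V (sym_word V v) = 0"
            by (cases v) (auto simp: proj1_word[OF V] split: list.splits)
          then show ?thesis by (simp add: rmul_zero[OF V fm_in[OF Q u]] rmul_zero[OF V fm_in[OF f u]])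
        qed
        then show ?thesis
          by (simp add: tt[OF Q id] tt[OF f id] insert_right_tens[OF V proj1_fm[OF V]])
      qed
      note summand = this
      let ?h = "\<lambda>z. case z of (n, u, v) \<Rightarrow>
          fscale (ksign n) (tens_sq V (wdeg u, sym_word V u) (wdeg v, sym_word V v))"
      have "?L (?T 1 Q 0 id (coprod V ?W)) = (\<Sum>z\<leftarrow>unshuffles w. ?L (?T 1 Q 0 id (?h z)))"
        unfolding cw by (rule fm_sum_list[OF LQ fs_sym_sq[OF V] CV in_c, THEN conjunct1])
      also have "\<dots> = (\<Sum>z\<leftarrow>unshuffles w. ?L (?T 1 ?f 0 id (?h z)))"
      proof (rule arg_cong[of _ _ sum_list], rule map_cong[OF refl], clarify)
        fix n u v assume z: "(n, u, v) \<in> set (unshuffles w)"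
        show "?L (?T 1 Q 0 id (fscale (ksign n)
              (tens_sq V (wdeg u, sym_word V u) (wdeg v, sym_word V v)))) =
            ?L (?T 1 ?f 0 id (fscale (ksign n)
              (tens_sq V (wdeg u, sym_word V u) (wdeg v, sym_word V v))))"
          using fm_scale[OF LQ unshuffle_term_in[OF V 1(2) z], of "ksign n"]
            fm_scale[OF Lf unshuffle_term_in[OF V 1(2) z], of "ksign n"] summand[OF z]
          by simp
      qed
      also have "\<dots> = ?L (?T 1 ?f 0 id (coprod V ?W))"
        unfolding cw by (rule fm_sum_list[OF Lf fs_sym_sq[OF V] CV in_c, THEN conjunct1, symmetric])
      finally show ?thesis .
    qed
    have "number_op V (Q ?W) = ?L (coprod V (Q ?W))"
      using coder_proj1[OF V fm_in[OF Q W]] by (simp add: coder_def)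
    also have "\<dots> = ?L (?T 1 Q 0 id (coprod V ?W)) + ?L (?T 0 id 1 Q (coprod V ?W))"
      unfolding coder[OF W] by (rule fm_add[OF L fm_in[OF Ql c] fm_in[OF Qr c]])
    also have "\<dots> = number_op V (?f ?W)"
      unfolding left right[OF c] number_op_coder[OF V q 1(2)] by (simp add: coder_def id_def)
    finally have N: "number_op V (Q ?W) = number_op V (?f ?W)" .
    show ?case
      by (rule number_op_inject[OF fm_in[OF Q W] fm_in[OF f W] N])
        (simp add: counit_Q[OF W] counit_coder[OF V q W])
  qed
  show ?thesis by (rule sym_word_ext[OF V CV Q f word X])
qed

end


section \<open>Cofree comodules\<close>

lemma tensor_map_left_tens:
  assumes "filtered_space V0" "filtered_space W" "filtered_space V" "filtered_map V0 V d f"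
  shows "tensor_map V W d f 0 (\<lambda>x. x) (tens V0 W (i, x) (j, y)) = tens V W (i + d, f x) (j, y)"
  using tensor_map_tens[OF assms(1,2,3,2,4) fm_id(2)] by simp

lemma tensor_map_right_tens:
  assumes "filtered_space V" "filtered_space W0" "filtered_space W" "filtered_map W0 W e g"
  shows "tensor_map V W 0 (\<lambda>x. x) e g (tens V W0 (i, x) (j, y)) =
    fscale (ksign (e * i)) (tens V W (i, x) (j + e, g y))"
  using tensor_map_tens[OF assms(1,2,1,3) fm_id(2) assms(4)] by simp

lemma tensor_map_left_fm:
  assumes "filtered_space V0" "filtered_space W" "filtered_space V" "filtered_map V0 V d f"
  shows "filtered_map (tensor V0 W) (tensor V W) d (tensor_map V W d f 0 (\<lambda>x. x))"
  using tensor_map_filtered[OF assms(1,2,3,2,4) fm_id(2)] by simp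

lemma tensor_map_right_fm:
  assumes "filtered_space V" "filtered_space W0" "filtered_space W" "filtered_map W0 W e g"
  shows "filtered_map (tensor V W0) (tensor V W) e (tensor_map V W 0 (\<lambda>x. x) e g)"
  using tensor_map_filtered[OF assms(1,2,1,3) fm_id(2) assms(4)] by simp

lemma tensor_map_right_zero:
  assumes V: "filtered_space V" and W0: "filtered_space W0" and W: "filtered_space W"
    and g: "filtered_map W0 W e g" and zero: "\<And>j y. y \<in> fil W0 0 j \<Longrightarrow> g y = 0"
    and t: "t \<in> fil (tensor V W0) k i"
  shows "tensor_map V W 0 (\<lambda>x. x) e g t = 0"
proof (rule tensor_ext[OF V W0 filtered_space_tensor[OF V W] tensor_map_right_fm[OF V W0 W g]
      fm_zero_map[OF filtered_space_tensor[OF V W]] _ t])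
  fix i j x y assume "x \<in> fil V 0 i" "y \<in> fil W0 0 j"
  then show "tensor_map V W 0 (\<lambda>x. x) e g (tens V W0 (i, x) (j, y)) = 0"
    by (simp add: tensor_map_right_tens[OF V W0 W g] zero tens_zero_right[OF V W])
qed

text \<open>The associator with the last tensor factor held fixed.\<close>

definition assoc_at ::
    "('k::field, 'u::ab_group_add) fspace \<Rightarrow> ('k, 'v::ab_group_add) fspace \<Rightarrow>
     ('k, 'w::ab_group_add) fspace \<Rightarrow> int \<times> 'w \<Rightarrow> _ \<Rightarrow> _" where
  "assoc_at U V W c = lext fscale (\<lambda>((i, x), (j, y)).
     tens U (tensor V W) (i, x) (j + fst c, tens V W (j, y) c))"

context
  fixes U :: "('k::field, 'u::ab_group_add) fspace" and V :: "('k, 'v::ab_group_add) fspace"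
    and W :: "('k, 'w::ab_group_add) fspace"
  assumes U: "filtered_space U" and V: "filtered_space V" and W: "filtered_space W"
begin

lemmas VW = filtered_space_tensor[OF V W]
lemmas UV = filtered_space_tensor[OF U V]
lemmas U_VW = filtered_space_tensor[OF U VW]

lemma assoc_at_bilinear:
  assumes z: "z \<in> fil W 0 l"
  shows "bilinear_map U V (tensor U (tensor V W)) l (\<lambda>((i, x), (j, y)).
     tens U (tensor V W) (i, x) (j + l, tens V W (j, y) (l, z)))"
proof (rule bilinear_mapI)
  fix i j p q x y assume x: "x \<in> fil U p i" and y: "y \<in> fil V q j"
  have "tens V W (j, y) (l, z) \<in> fil (tensor V W) q (j + l)"
    using tens_in[OF V W y z] by simp
  from tens_in[OF U VW x this]
  show "(\<lambda>((i, x), (j, y)). tens U (tensor V W) (i, x) (j + l, tens V W (j, y) (l, z))) ((i, x), (j, y))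
      \<in> fil (tensor U (tensor V W)) (p + q) (i + j + l)"
    by (simp add: ac_simps)
qed (simp_all add: tens_add_left[OF U VW _ _ tens_in_0[OF V W _ z]]
    tens_scale_left[OF U VW _ tens_in_0[OF V W _ z]]
    tens_add_left[OF V W _ _ z] tens_scale_left[OF V W _ z]
    tens_add_right[OF U VW _ tens_in_0[OF V W _ z] tens_in_0[OF V W _ z]]
    tens_scale_right[OF U VW _ tens_in_0[OF V W _ z], simplified])

lemma assoc_at_tens: "z \<in> fil W 0 l \<Longrightarrow> assoc_at U V W (l, z) (tens U V (i, x) (j, y)) =
    tens U (tensor V W) (i, x) (j + l, tens V W (j, y) (l, z))"
  unfolding assoc_at_def using lext_tens[OF U V U_VW assoc_at_bilinear] by simp

lemma assoc_at_fm: "z \<in> fil W 0 l \<Longrightarrow> filtered_map (tensor U V) (tensor U (tensor V W)) l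
    (assoc_at U V W (l, z))"
  unfolding assoc_at_def using lext_tensor_filtered_map[OF U V U_VW assoc_at_bilinear] by simp

lemma tensor_assoc_altdef: "tensor_assoc U V W = lext fscale (\<lambda>((d, t), c). assoc_at U V W c t)"
  by (simp add: tensor_assoc_def assoc_at_def case_prod_unfold)

lemma tensor_assoc_bilinear:
  "bilinear_map (tensor U V) W (tensor U (tensor V W)) 0 (\<lambda>((d, t), c). assoc_at U V W c t)"
proof (rule bilinear_mapI)
  fix i j t z z' assume t: "t \<in> fil (tensor U V) 0 i" and z: "z \<in> fil W 0 j"
  note s = tensor_supported[OF U V t]
  show "(\<lambda>((d, t), c). assoc_at U V W c t) ((i, t), (j, z + z')) =
      (\<lambda>((d, t), c). assoc_at U V W c t) ((i, t), (j, z)) +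
      (\<lambda>((d, t), c). assoc_at U V W c t) ((i, t), (j, z'))" if z': "z' \<in> fil W 0 j"
    unfolding assoc_at_def prod.case lext_fun_add[OF vector_space_fscale, symmetric]
    by (rule lext_eq_on_supported[OF s])
      (auto simp: tensor_gens_def tens_add_right[OF V W _ z z']
        tens_add_right[OF U VW _ tens_in_0[OF V W _ z] tens_in_0[OF V W _ z']])
  show "(\<lambda>((d, t), c). assoc_at U V W c t) ((i, t), (j, scl W c z)) =
      scl (tensor U (tensor V W)) c ((\<lambda>((d, t), c). assoc_at U V W c t) ((i, t), (j, z)))" for c
    unfolding assoc_at_def prod.case scl_tensor lext_fun_scale[OF vector_space_fscale, symmetric]
    by (rule lext_eq_on_supported[OF s])
      (auto simp: tensor_gens_def tens_scale_right[OF V W _ z]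
        tens_scale_right[OF U VW _ tens_in_0[OF V W _ z], simplified])
next
  fix i j p q t z assume t: "t \<in> fil (tensor U V) p i" and z: "z \<in> fil W q j"
  note z0 = fil_0[OF W z]
  note a = assoc_at_fm[OF z0]
  from t have "assoc_at U V W (j, z) t \<in> fil (tensor U (tensor V W)) (p + q) (i + j)"
  proof (induction rule: tensor_induct[OF U V, consumes 1, case_names tens zero scale add])
    case (tens i' j' x y p' q')
    have "tens U (tensor V W) (i', x) (j' + j, tens V W (j', y) (j, z))
        \<in> fil (tensor U (tensor V W)) (p' + (q' + q)) (i' + (j' + j))"
      by (intro tens_in[OF U VW] tens_in[OF V W] tens z)
    then show ?case
      using tens(3,4) by (simp add: assoc_at_tens[OF z0] add.assoc[symmetric])
  next
    case zero
    show ?case by (simp add: fm_zero[OF a UV U_VW] fil_zero[OF U_VW])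
  next
    case (scale c t)
    then show ?case
      using fm_scale[OF a fil_0[OF UV scale(1)], of c] fil_scale[OF U_VW, of _ _ _ c] by simp
  next
    case (add s t)
    then show ?case
      using fm_add[OF a fil_0[OF UV add(1)] fil_0[OF UV add(2)]] fil_add[OF U_VW] by simp
  qed
  then show "(\<lambda>((d, t), c). assoc_at U V W c t) ((i, t), (j, z))
      \<in> fil (tensor U (tensor V W)) (p + q) (i + j + 0)" by simp
qed (simp_all add: fm_add[OF assoc_at_fm] fm_scale[OF assoc_at_fm, simplified])

lemma tensor_assoc_tens:
  "tensor_assoc U V W (tens (tensor U V) W (d, t) c) = assoc_at U V W c t"
  unfolding tensor_assoc_altdef
  using lext_tens[OF UV W U_VW tensor_assoc_bilinear] by simp

lemma tensor_assoc_fm: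
  "filtered_map (tensor (tensor U V) W) (tensor U (tensor V W)) 0 (tensor_assoc U V W)"
  unfolding tensor_assoc_altdef
  using lext_tensor_filtered_map[OF UV W U_VW tensor_assoc_bilinear] by simp

end

definition letter_act ::
    "('k::field, 'l::ab_group_add) fspace \<Rightarrow> ('k, 'm::ab_group_add) fspace \<Rightarrow> int \<times> 'l \<Rightarrow> _ \<Rightarrow> _" where
  "letter_act L M a = tensor_map (Sc L) M (fst a) (lmul (shift 1 L) a) 0 (\<lambda>x. x)"

abbreviation cm_one ::
    "('k::field, 'l::ab_group_add) fspace \<Rightarrow> ('k, 'm::ab_group_add) fspace \<Rightarrow> int \<Rightarrow> 'm \<Rightarrow> ('k, 'l, 'm)
      comod" where
  "cm_one L M j m \<equiv> tens (Sc L) M (0, sym_one (shift 1 L)) (j, m)"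

context
  fixes L :: "('k::field, 'l::ab_group_add) fspace"
  assumes L: "filtered_space L"
begin

lemmas filtered_shift = filtered_space_shift[OF L, of 1]

lemma filtered_space_Sc: "filtered_space (Sc L)"
  unfolding Sc_def by (rule fs_sym[OF filtered_shift])

lemmas lmul_Sc = lmul_fm[OF filtered_shift, folded Sc_def]
lemmas one_Sc = sym_one_in[OF filtered_shift, folded Sc_def]

context
  fixes M :: "('k, 'm::ab_group_add) fspace"
  assumes M: "filtered_space M"
begin

lemma filtered_space_Cm: "filtered_space (Cm L M)"
  unfolding Cm_def by (rule filtered_space_tensor[OF filtered_space_Sc M])

lemmas filtered_space_ScCm = filtered_space_tensor[OF filtered_space_Sc filtered_space_Cm]

lemma scl_Cm [simp]: "scl (Cm L M) = fscale"
  by (simp add: Cm_def)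

lemma cm_one_in: "m \<in> fil M k j \<Longrightarrow> cm_one L M j m \<in> fil (Cm L M) k j"
  using tens_in[OF filtered_space_Sc M one_Sc] unfolding Cm_def by fastforce

lemma letter_act_fm: "x \<in> fil (shift 1 L) 0 i \<Longrightarrow> filtered_map (Cm L M) (Cm L M) i
    (letter_act L M (i, x))"
  unfolding letter_act_def Cm_def
  using tensor_map_left_fm[OF filtered_space_Sc M filtered_space_Sc lmul_Sc] by simp

lemma letter_act_tens: "x \<in> fil (shift 1 L) 0 i \<Longrightarrow>
    letter_act L M (i, x) (tens (Sc L) M (d, s) (j, m)) = tens (Sc L) M
        (d + i, lmul (shift 1 L) (i, x) s) (j, m)"
  unfolding letter_act_def
  using tensor_map_left_tens[OF filtered_space_Sc M filtered_space_Sc lmul_Sc] by simp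

lemma letter_act_raises:
  assumes x: "x \<in> fil (shift 1 L) p i"
  shows "raises (Cm L M) (Cm L M) p i (letter_act L M (i, x))"
  unfolding letter_act_def Cm_def
  using tensor_map_raises[OF filtered_space_Sc M filtered_space_Sc M
      lmul_Sc[OF fil_0[OF filtered_shift x]] fm_id(2)
      lmul_raises[OF filtered_shift x, folded Sc_def] filtered_map_raises[OF fm_id(2)]] by simp

text \<open>The comodule is generated by \<open>1 \<otimes> M\<close> under multiplication by letters.\<close>

lemma Cm_ext:
  assumes X: "filtered_space X"
    and f: "filtered_map (Cm L M) X d f" and g: "filtered_map (Cm L M) X d g"
    and one: "\<And>j m. m \<in> fil M 0 j \<Longrightarrow> f (cm_one L M j m) = g (cm_one L M j m)"
    and step: "\<And>i x j t. x \<in> fil (shift 1 L) 0 i \<Longrightarrow> t \<in> fil (Cm L M) 0 j \<Longrightarrow> f t = g t \<Longrightarrow>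
      f (letter_act L M (i, x) t) = g (letter_act L M (i, x) t)"
    and t: "t \<in> fil (Cm L M) k j"
  shows "f t = g t"
proof (rule tensor_ext[OF filtered_space_Sc M X f[unfolded Cm_def[of L M]]
  g[unfolded Cm_def[of L M]] _ t[unfolded Cm_def[of L M]]])
  note S = filtered_space_Sc
  fix i j s m assume s: "s \<in> fil (Sc L) 0 i" and m: "m \<in> fil M 0 j"
  have words: "f (tens (Sc L) M (wdeg w, sym_word (shift 1 L) w) (j, m)) =
      g (tens (Sc L) M (wdeg w, sym_word (shift 1 L) w) (j, m))" if "is_word (shift 1 L) w" for w
    using that
  proof (induction w)
    case Nil
    show ?case using one[OF m] by simp
  next
    case (Cons a w)
    obtain l x where a: "a = (l, x)" by (cases a)
    with Cons.prems have x: "x \<in> fil (shift 1 L) 0 l" and w: "is_word (shift 1 L) w" by simp_all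
    note t = tens_in_0[OF S M sym_word_in_0[OF filtered_shift w, folded Sc_def] m, folded
        Cm_def[of L M]]
    show ?case
      using step[OF x t Cons.IH[OF w]]
      by (simp add: letter_act_tens[OF x] a lmul_word[OF filtered_shift x] add.commute)
  qed
  show "f (tens (Sc L) M (i, s) (j, m)) = g (tens (Sc L) M (i, s) (j, m))"
    using s[unfolded Sc_def]
  proof (induction rule: sym_induct[OF filtered_shift, consumes 1, case_names word zero scale add])
    case (word w ps)
    then show ?case using words[OF letters_in_is_word[OF filtered_shift]] by auto
  next
    case zero
    show ?case
      by (simp add: tens_zero_left[OF S M m] fm_zero[OF f filtered_space_Cm X]
          fm_zero[OF g filtered_space_Cm X])
  next
    case (scale c t)
    note t = scale(1)[folded Sc_def]
    show ?case
      using tens_scale_left[OF S M t m, of c] scale(2)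
        fm_scale[OF f tens_in_0[OF S M t m, folded Cm_def[of L M]], of c]
        fm_scale[OF g tens_in_0[OF S M t m, folded Cm_def[of L M]], of c]
      by (simp add: Sc_def)
  next
    case (add s t)
    note s = add(1)[folded Sc_def] and t = add(2)[folded Sc_def]
    show ?case
      using tens_add_left[OF S M s t m] add(3,4)
        fm_add[OF f tens_in_0[OF S M s m, folded Cm_def[of L M]]
          tens_in_0[OF S M t m, folded Cm_def[of L M]]]
        fm_add[OF g tens_in_0[OF S M s m, folded Cm_def[of L M]]
          tens_in_0[OF S M t m, folded Cm_def[of L M]]]
      by simp
  qed
qed

lemma coact_fm: "filtered_map (Cm L M) (tensor (Sc L) (Cm L M)) 0 (coact L M)"
proof -
  note S = filtered_space_Sc
  have "filtered_map (tensor (Sc L) M) (tensor (tensor (Sc L) (Sc L)) M) 0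
      (tensor_map (tensor (Sc L) (Sc L)) M 0 (coprod (shift 1 L)) 0 (\<lambda>x. x))"
    using tensor_map_left_fm[OF S M filtered_space_tensor[OF S S]]
        coprod_fm[OF filtered_shift, folded Sc_def] by blast
  from fm_comp[OF this tensor_assoc_fm[OF S S M] filtered_space_tensor[OF S M]]
  show ?thesis
    by (simp add: coact_def[abs_def] Cm_def id_def)
qed

lemma coact_tens: "coact L M (tens (Sc L) M (d, s) (j, m)) =
    assoc_at (Sc L) (Sc L) M (j, m) (coprod (shift 1 L) s)"
  unfolding coact_def id_def
    tensor_map_left_tens[OF filtered_space_Sc M filtered_space_tensor[OF filtered_space_Sc
      filtered_space_Sc]
      coprod_fm[OF filtered_shift, folded Sc_def]]
    tensor_assoc_tens[OF filtered_space_Sc filtered_space_Sc M] ..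

lemma coact_one: "m \<in> fil M 0 j \<Longrightarrow>
    coact L M (cm_one L M j m) = tens (Sc L) (Cm L M) (0, sym_one (shift 1 L)) (j, cm_one L M j m)"
  unfolding coact_tens coprod_one[OF filtered_shift] Sc_def[symmetric]
  using assoc_at_tens[OF filtered_space_Sc filtered_space_Sc M, of m j 0 _ 0] by (simp add: Cm_def)

lemma coact_letter:
  assumes x: "x \<in> fil (shift 1 L) 0 i" and X: "X \<in> fil (Cm L M) k d"
  shows "coact L M (letter_act L M (i, x) X) =
    tensor_map (Sc L) (Cm L M) i (lmul (shift 1 L) (i, x)) 0 (\<lambda>x. x) (coact L M X) +
    tensor_map (Sc L) (Cm L M) 0 (\<lambda>x. x) i (letter_act L M (i, x)) (coact L M X)"
proof -
  note S = filtered_space_Sc and CM = filtered_space_Cm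
  note SCM = filtered_space_tensor[OF S CM]
  note l = tensor_map_left_fm[OF S CM S lmul_Sc[OF x]] and r =
      tensor_map_right_fm[OF S CM CM letter_act_fm[OF x]]
  let ?l = "tensor_map (Sc L) (Cm L M) i (lmul (shift 1 L) (i, x)) 0 (\<lambda>x. x)"
    and ?r = "tensor_map (Sc L) (Cm L M) 0 (\<lambda>x. x) i (letter_act L M (i, x))"
  note cl = coprod_letter_fm[OF filtered_shift x, folded Sc_def]
  show ?thesis
  proof (rule tensor_ext[OF S M SCM _ _ _ X[unfolded Cm_def[of L M]]])
    show "filtered_map (tensor (Sc L) M) (tensor (Sc L) (Cm L M)) (i + 0)
        (\<lambda>X. coact L M (letter_act L M (i, x) X))"
      using fm_comp[OF letter_act_fm[OF x] coact_fm CM] by (simp add: Cm_def)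
    show "filtered_map (tensor (Sc L) M) (tensor (Sc L) (Cm L M)) (i + 0)
        (\<lambda>X. ?l (coact L M X) + ?r (coact L M X))"
      using fm_plus[OF fm_comp[OF coact_fm l CM] fm_comp[OF coact_fm r CM] SCM] by (simp add: Cm_def)
    fix d j s m assume s: "s \<in> fil (Sc L) 0 d" and m: "m \<in> fil M 0 j"
    note a = assoc_at_fm[OF S S M m]
    have "assoc_at (Sc L) (Sc L) M (j, m) (coprod_letter (shift 1 L) (i, x) t) =
        ?l (assoc_at (Sc L) (Sc L) M (j, m) t) + ?r (assoc_at (Sc L) (Sc L) M (j, m) t)"
      if t: "t \<in> fil (tensor (Sc L) (Sc L)) 0 d" for t
    proof (rule tensor_ext[OF S S SCM _ _ _ t])
      show "filtered_map (tensor (Sc L) (Sc L)) (tensor (Sc L) (Cm L M)) (i + j)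
          (\<lambda>t. assoc_at (Sc L) (Sc L) M (j, m) (coprod_letter (shift 1 L) (i, x) t))"
        using fm_comp[OF cl a filtered_space_tensor[OF S S]] by (simp add: Cm_def)
      show "filtered_map (tensor (Sc L) (Sc L)) (tensor (Sc L) (Cm L M)) (i + j)
          (\<lambda>t. ?l (assoc_at (Sc L) (Sc L) M (j, m) t) + ?r (assoc_at (Sc L) (Sc L) M (j, m) t))"
        using fm_plus[OF fm_comp[OF a[folded Cm_def[of L M]] l filtered_space_tensor[OF S S]]
            fm_comp[OF a[folded Cm_def[of L M]] r filtered_space_tensor[OF S S]] SCM]
        by (simp add: add.commute)
      fix a' b u v assume u: "u \<in> fil (Sc L) 0 a'" and v: "v \<in> fil (Sc L) 0 b"
      have 1: "tens (Sc L) (Sc L) (a' + i, lmul (shift 1 L) (i, x) u) (b, v) \<in> fil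
          (tensor (Sc L) (Sc L)) 0 (a' + i + b)"
        "tens (Sc L) (Sc L) (a', u) (b + i, lmul (shift 1 L) (i, x) v) \<in> fil (tensor (Sc L) (Sc L))
          0 (a' + i + b)"
        using tens_in_0[OF S S fm_in[OF lmul_Sc[OF x] u] v]
            tens_in_0[OF S S u fm_in[OF lmul_Sc[OF x] v]]
        by (simp_all add: ac_simps)
      show "assoc_at (Sc L) (Sc L) M (j, m) (coprod_letter (shift 1 L) (i, x)
          (tens (Sc L) (Sc L) (a', u) (b, v))) =
          ?l (assoc_at (Sc L) (Sc L) M (j, m) (tens (Sc L) (Sc L) (a', u) (b, v))) +
          ?r (assoc_at (Sc L) (Sc L) M (j, m) (tens (Sc L) (Sc L) (a', u) (b, v)))"
        unfolding coprod_letter_tens[OF filtered_shift x, folded Sc_def]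
          fm_add[OF a 1(1) fil_scale[OF filtered_space_tensor[OF S S] 1(2), simplified]]
          fm_scale[OF a 1(2), simplified] assoc_at_tens[OF S S M m]
        unfolding Cm_def[symmetric] tensor_map_left_tens[OF S CM S lmul_Sc[OF x]]
          tensor_map_right_tens[OF S CM CM letter_act_fm[OF x]] letter_act_tens[OF x]
        by (simp add: ac_simps)
    qed
    from this[OF fm_in[OF coprod_fm[OF filtered_shift, folded Sc_def] s, simplified]]
    show "coact L M (letter_act L M (i, x) (tens (Sc L) M (d, s) (j, m))) =
        ?l (coact L M (tens (Sc L) M (d, s) (j, m))) + ?r (coact L M (tens (Sc L) M (d, s) (j, m)))"
      unfolding letter_act_tens[OF x] coact_tens coprod_lmul[OF filtered_shift x s[unfolded Sc_def]] .
  qed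
qed

lemmas counit_left_Cm = counit_left_fm[OF filtered_shift M, folded Sc_def, folded Cm_def[of L M]]

lemma counit_left_one: "m \<in> fil M k j \<Longrightarrow> counit_left M (cm_one L M j m) = m"
  by (simp add: Sc_def counit_left_tens[OF filtered_shift M] counit_one[OF filtered_shift]
      scl_simps[OF M])

lemma coact_counit:
  assumes "X \<in> fil (Cm L M) k d"
  shows "tensor_map (Sc L) M 0 (\<lambda>x. x) 0 (counit_left M) (coact L M X) = X"
proof (rule Cm_ext[OF filtered_space_Cm _ fm_id(2) _ _ assms])
  note S = filtered_space_Sc and CM = filtered_space_Cm and e = counit_left_Cm
  let ?k = "tensor_map (Sc L) M 0 (\<lambda>x. x) 0 (counit_left M)"
  note k = tensor_map_right_fm[OF S CM M e, folded Cm_def[of L M]]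
  show "filtered_map (Cm L M) (Cm L M) 0 (\<lambda>X. ?k (coact L M X))"
    using fm_comp[OF coact_fm k CM] by simp
  show "?k (coact L M (cm_one L M j m)) = cm_one L M j m" if "m \<in> fil M 0 j" for j m
    by (simp add: coact_one[OF that] tensor_map_right_tens[OF S CM M e] counit_left_one[OF that])
  fix i x j t assume x: "x \<in> fil (shift 1 L) 0 i" and t: "t \<in> fil (Cm L M) 0 j" and IH:
      "?k (coact L M t) = t"
  note l = lmul_Sc[OF x] and la = letter_act_fm[OF x]
  note c = fm_in[OF coact_fm t]
  note lc = fm_in[OF tensor_map_left_fm[OF S CM S l] c] and rc =
      fm_in[OF tensor_map_right_fm[OF S CM CM la] c]
  have "?k (tensor_map (Sc L) (Cm L M) i (lmul (shift 1 L) (i, x)) 0 (\<lambda>x. x) (coact L M t)) =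
      letter_act L M (i, x) (?k (coact L M t))"
    using tensor_map_comp[OF S CM S CM S M l fm_id(2) fm_id(2) e c]
      tensor_map_comp[OF S CM S M S M fm_id(2) e l fm_id(2) c] by (simp add: letter_act_def)
  moreover have "?k (tensor_map (Sc L) (Cm L M) 0 (\<lambda>x. x) i (letter_act L M (i, x)) (coact L M t)) = 0"
  proof -
    have "counit_left M (letter_act L M (i, x) y) = 0" if "y \<in> fil (Cm L M) 0 j" for y j
      using counit_left_letter[OF filtered_shift M x that[unfolded Cm_def Sc_def]] by
          (simp add: letter_act_def Sc_def)
    from tensor_map_right_zero[OF S CM M fm_comp[OF la e CM] this c]
    show ?thesis
      using tensor_map_comp[OF S CM S CM S M fm_id(2) la fm_id(2) e c] by simp
  qed
  ultimately show "?k (coact L M (letter_act L M (i, x) t)) = letter_act L M (i, x) t"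
    unfolding coact_letter[OF x t] fm_add[OF k lc rc] by (simp add: IH)
qed

end

text \<open>
  Since \<open>id \<otimes> \<epsilon> \<otimes> id\<close> is a left inverse of the coaction, applying it to the defining equations of
  morphisms and coderivations recovers these maps from their compositions with \<open>\<epsilon> \<otimes> id\<close>.
\<close>

lemma comodule_morphism_formula:
  assumes M: "filtered_space M" and N: "filtered_space N"
    and F: "filtered_map (Cm L M) (Cm L N) 0 F"
    and co: "\<And>i X. X \<in> fil (Cm L M) 0 i \<Longrightarrow>
      coact L N (F X) = tensor_map (Sc L) (Cm L N) 0 id 0 F (coact L M X)"
    and X: "X \<in> fil (Cm L M) k d"
  shows "F X = tensor_map (Sc L) N 0 (\<lambda>x. x) 0 (\<lambda>X. counit_left N (F X)) (coact L M X)"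
proof -
  note S = filtered_space_Sc and CM = filtered_space_Cm[OF M] and CN = filtered_space_Cm[OF N]
  have "F X = tensor_map (Sc L) N 0 (\<lambda>x. x) 0 (counit_left N) (coact L N (F X))"
    by (rule coact_counit[OF N fm_in[OF F X], symmetric])
  then show ?thesis
    using tensor_map_comp[OF S CM S CN S N fm_id(2) F fm_id(2) counit_left_Cm[OF N]
        fm_in[OF coact_fm[OF M] X]]
    by (simp add: co[OF fil_0[OF CM X]] id_def)
qed

lemma comodule_coderivation_formula:
  assumes M: "filtered_space M" and Q: "filtered_map (Sc L) (Sc L) 1 Q"
    and \<phi>: "filtered_map (Cm L M) (Cm L M) 1 \<phi>"
    and co: "\<And>i X. X \<in> fil (Cm L M) 0 i \<Longrightarrow> coact L M (\<phi> X) =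
      tensor_map (Sc L) (Cm L M) 1 Q 0 id (coact L M X) + tensor_map (Sc L) (Cm L M) 0 id 1 \<phi>
        (coact L M X)"
    and X: "X \<in> fil (Cm L M) k d"
  shows "\<phi> X = tensor_map (Sc L) M 1 Q 0 (\<lambda>x. x) X +
    tensor_map (Sc L) M 0 (\<lambda>x. x) 1 (\<lambda>X. counit_left M (\<phi> X)) (coact L M X)"
proof -
  note S = filtered_space_Sc and CM = filtered_space_Cm[OF M] and e = counit_left_Cm[OF M]
  let ?k = "tensor_map (Sc L) M 0 (\<lambda>x. x) 0 (counit_left M)"
  note k = tensor_map_right_fm[OF S CM M e, folded Cm_def[of L M]]
  note c = fm_in[OF coact_fm[OF M] fil_0[OF CM X]]
  have Qe: "?k (tensor_map (Sc L) (Cm L M) 1 Q 0 (\<lambda>x. x) (coact L M X)) =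
      tensor_map (Sc L) M 1 Q 0 (\<lambda>x. x) (?k (coact L M X))"
    using tensor_map_comp[OF S CM S CM S M Q fm_id(2) fm_id(2) e c]
      tensor_map_comp[OF S CM S M S M fm_id(2) e Q fm_id(2) c] by simp
  have "\<phi> X = ?k (coact L M (\<phi> X))"
    by (rule coact_counit[OF M fm_in[OF \<phi> X], symmetric])
  also have "\<dots> = ?k (tensor_map (Sc L) (Cm L M) 1 Q 0 (\<lambda>x. x) (coact L M X)) +
      ?k (tensor_map (Sc L) (Cm L M) 0 (\<lambda>x. x) 1 \<phi> (coact L M X))"
    unfolding co[OF fil_0[OF CM X]] id_def
    by (rule fm_add[OF k fm_in[OF tensor_map_left_fm[OF S CM S Q] c]
          fm_in[OF tensor_map_right_fm[OF S CM CM \<phi>] c]])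
  finally show ?thesis
    using tensor_map_comp[OF S CM S CM S M fm_id(2) \<phi> fm_id(2) e c]
    by (simp add: Qe coact_counit[OF M X])
qed

end


section \<open>Truncated exponentials and twisting\<close>

definition expN :: "('k::field_char_0, 'v::ab_group_add) fspace \<Rightarrow> ('v \<Rightarrow> 'v) \<Rightarrow> nat \<Rightarrow> 'v \<Rightarrow> 'v" where
  "expN X l N x = (\<Sum>n\<le>N. scl X (1 / fact n) ((l ^^ n) x))"

text \<open>
  Operators that raise the filtration are topologically nilpotent; their exponential series is a
  Cauchy sequence at every vector.
\<close>

definition nilop :: "('k::field, 'v::ab_group_add) fspace \<Rightarrow> ('v \<Rightarrow> 'v) \<Rightarrow> bool" where
  "nilop X l \<longleftrightarrow> filtered_map X X 0 l \<and> raises X X 1 0 l"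

definition vanishes :: "('k, 'v::ab_group_add) fspace \<Rightarrow> int \<Rightarrow> (nat \<Rightarrow> 'v) \<Rightarrow> bool" where
  "vanishes X i x \<longleftrightarrow> (\<forall>k. \<exists>N. \<forall>n\<ge>N. x n \<in> fil X k i)"

text \<open>
  \<open>y\<close> is the value at \<open>x\<close> of \<open>e\<^sup>-\<^sup>l\<^sup>' F e\<^sup>l\<close>.  Saying this without the inverse exponential makes
  compositions of twists immediate.
\<close>

definition twisted_value ::
    "('k::field_char_0, 'v::ab_group_add) fspace \<Rightarrow> ('v \<Rightarrow> 'v) \<Rightarrow>
     ('k, 'w::ab_group_add) fspace \<Rightarrow> ('w \<Rightarrow> 'w) \<Rightarrow> int \<Rightarrow> ('v \<Rightarrow> 'w) \<Rightarrow> int \<Rightarrow> 'v \<Rightarrow> 'w \<Rightarrow> bool" where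
  "twisted_value X l Y l' d F i x y \<longleftrightarrow>
     y \<in> fil Y 0 (i + d) \<and> vanishes Y (i + d) (\<lambda>N. F (expN X l N x) - expN Y l' N y)"

lemma nilop_fm: "nilop X l \<Longrightarrow> filtered_map X X 0 l"
  by (simp add: nilop_def)

lemma nilop_in: "nilop X l \<Longrightarrow> x \<in> fil X k i \<Longrightarrow> l x \<in> fil X (Suc k) i"
  unfolding nilop_def using raisesD[of X X 1 0 l x k i] by simp

context
  fixes X :: "('k::field, 'v::ab_group_add) fspace"
  assumes X: "filtered_space X"
begin

lemma vanishes_add: "vanishes X i x \<Longrightarrow> vanishes X i y \<Longrightarrow> vanishes X i (\<lambda>n. x n + y n)"
  unfolding vanishes_def by (metis (no_types, lifting) fil_add[OF X] le_trans nle_le)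

lemma vanishes_scale: "vanishes X i x \<Longrightarrow> vanishes X i (\<lambda>n. scl X c (x n))"
  unfolding vanishes_def by (meson fil_scale[OF X])

lemma vanishes_neg: "vanishes X i x \<Longrightarrow> vanishes X i (\<lambda>n. - x n)"
  unfolding vanishes_def by (meson fil_neg[OF X])

lemma vanishes_diff: "vanishes X i x \<Longrightarrow> vanishes X i y \<Longrightarrow> vanishes X i (\<lambda>n. x n - y n)"
  using vanishes_add[of i x "\<lambda>n. - y n"] vanishes_neg by simp

lemma vanishesI_Suc:
  assumes "\<And>n. x n \<in> fil X (Suc n) i"
  shows "vanishes X i x"
  unfolding vanishes_def
proof
  fix k
  have "x n \<in> fil X k i" if "n \<ge> k" for n
    using fil_mono[OF X _ assms[of n], of k] that by simp
  then show "\<exists>N. \<forall>n\<ge>N. x n \<in> fil X k i" by blast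
qed

lemma vanishes_zero: "vanishes X i (\<lambda>n. 0)"
  by (simp add: vanishes_def fil_zero[OF X])

lemma pow_fm: "nilop X l \<Longrightarrow> filtered_map X X 0 (l ^^ n)"
proof (induction n)
  case (Suc n)
  then show ?case
    using fm_comp[OF Suc.IH nilop_fm X] by (simp add: o_def)
qed (simp add: fm_id)

lemma pow_in: "nilop X l \<Longrightarrow> x \<in> fil X k i \<Longrightarrow> (l ^^ n) x \<in> fil X (k + n) i"
  by (induction n) (auto dest: nilop_in)

lemma nilop_plus:
  assumes a: "nilop X a" and b: "nilop X b"
  shows "nilop X (\<lambda>x. a x + b x)"
  using fm_plus[OF nilop_fm[OF a] nilop_fm[OF b] X] nilop_in[OF a] nilop_in[OF b]
  by (auto simp: nilop_def intro!: raisesI fil_add[OF X])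

lemma nilop_neg:
  assumes a: "nilop X a"
  shows "nilop X (\<lambda>x. - a x)"
  using fm_smult[OF nilop_fm[OF a] X, of "-1"] nilop_in[OF a]
  by (auto simp: nilop_def scl_minus1[OF X] intro!: raisesI fil_neg[OF X])

lemma nilop_zero: "nilop X (\<lambda>x. 0)"
  by (auto simp: nilop_def fm_zero_map[OF X] fil_zero[OF X] intro!: raisesI)

end

lemma vanishes_image:
  fixes X :: "('k::field, 'v::ab_group_add) fspace" and Y :: "('k, 'w::ab_group_add) fspace"
  assumes "filtered_map X Y d f" "vanishes X i x"
  shows "vanishes Y (i + d) (\<lambda>n. f (x n))"
  using assms(2) fm_in[OF assms(1)] unfolding vanishes_def by metis

context
  fixes X :: "('k::field_char_0, 'v::ab_group_add) fspace"
  assumes X: "filtered_space X"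
begin

lemma expN_fm:
  assumes l: "nilop X l"
  shows "filtered_map X X 0 (expN X l N)"
proof (rule filtered_mapI)
  fix i x y assume "x \<in> fil X 0 i" "y \<in> fil X 0 i"
  then show "expN X l N (x + y) = expN X l N x + expN X l N y"
    by (simp add: expN_def fm_add[OF pow_fm[OF X l]] scl_distribs[OF X] sum.distrib)
next
  fix i c x assume "x \<in> fil X 0 i"
  then show "expN X l N (scl X c x) = scl X c (expN X l N x)"
    by (simp add: expN_def fm_scale[OF pow_fm[OF X l]] scl_simps[OF X] scl_sum_right[OF X] mult.commute)
next
  fix k i x assume "x \<in> fil X k i"
  then show "expN X l N x \<in> fil X k (i + 0)"
    unfolding expN_def using fm_in[OF pow_fm[OF X l]] by (auto intro!: fil_sum[OF X] fil_scale[OF X])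
qed

lemma expN_in: "nilop X l \<Longrightarrow> x \<in> fil X k i \<Longrightarrow> expN X l N x \<in> fil X k i"
  using fm_in[OF expN_fm] by fastforce

lemma expN_cong:
  assumes l: "nilop X l" and eq: "\<And>x. x \<in> fil X 0 i \<Longrightarrow> l x = l' x" and x: "x \<in> fil X 0 i"
  shows "expN X l N x = expN X l' N x"
proof -
  have "(l ^^ n) x = (l' ^^ n) x" for n
  proof (induction n)
    case (Suc n)
    have "(l ^^ n) x \<in> fil X 0 i" using fm_in[OF pow_fm[OF X l] x] by simp
    from eq[OF this] Suc show ?case by simp
  qed simp
  then show ?thesis by (simp add: expN_def)
qed

lemma expN_zero_op: "expN X (\<lambda>x. 0) N x = x"
proof -
  have pow0: "((\<lambda>x. 0) ^^ n) x = (if n = 0 then x else 0)" for n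
    by (cases n) simp_all
  have "expN X (\<lambda>x. 0) N x = (\<Sum>n\<le>N. if n = 0 then x else 0)"
    unfolding expN_def by (rule sum.cong) (auto simp: scl_simps[OF X] pow0)
  then show ?thesis by simp
qed

lemma expN_tail:
  assumes l: "nilop X l" and x: "x \<in> fil X 0 i" and "n \<le> m"
  shows "expN X l m x - expN X l n x \<in> fil X (Suc n) i"
proof -
  have "{..m} = {..n} \<union> {Suc n..m}" using \<open>n \<le> m\<close> by auto
  then have "expN X l m x = expN X l n x + (\<Sum>k=Suc n..m. scl X (1 / fact k) ((l ^^ k) x))"
    unfolding expN_def by (simp add: sum.union_disjoint ivl_disj_int)
  moreover have "(\<Sum>k=Suc n..m. scl X (1 / fact k) ((l ^^ k) x)) \<in> fil X (Suc n) i"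
  proof (intro fil_sum[OF X] fil_scale[OF X])
    fix k assume k: "k \<in> {Suc n..m}"
    have "(l ^^ k) x \<in> fil X k i" using pow_in[OF X l x, of k] by simp
    then show "(l ^^ k) x \<in> fil X (Suc n) i" using fil_mono[OF X, of "Suc n" k] k by simp
  qed
  ultimately show ?thesis by simp
qed

text \<open>The binomial formula for divided powers of commuting operators.\<close>

lemma divided_power_plus:
  assumes a: "nilop X a" and b: "nilop X b"
    and comm: "\<And>x. x \<in> fil X 0 i \<Longrightarrow> a (b x) = b (a x)" and x: "x \<in> fil X 0 i"
  shows "scl X (1 / fact n) (((\<lambda>x. a x + b x) ^^ n) x) =
    (\<Sum>j\<le>n. scl X (1 / fact j) ((a ^^ j) (scl X (1 / fact (n - j)) ((b ^^ (n - j)) x))))"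
proof (induction n)
  case 0
  show ?case by (simp add: scl_simps[OF X])
next
  case (Suc n)
  let ?A = "\<lambda>j y. scl X (1 / fact j) ((a ^^ j) y)" and ?B = "\<lambda>j. scl X (1 / fact j) ((b ^^ j) x)"
  let ?c = "\<lambda>x. a x + b x"
  have fa: "filtered_map X X 0 a" and fb: "filtered_map X X 0 b" by
      (rule nilop_fm[OF a], rule nilop_fm[OF b])
  note c = nilop_plus[OF X a b]
  note fc = nilop_fm[OF c]
  have B_in: "?B j \<in> fil X 0 i" for j
    using fil_scale[OF X fm_in[OF pow_fm[OF X b] x]] by simp
  have apow: "(a ^^ j) y \<in> fil X 0 i" if "y \<in> fil X 0 i" for j y
    using fm_in[OF pow_fm[OF X a] that] by simp
  have bpow: "(b ^^ j) x \<in> fil X 0 i" for j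
    using fm_in[OF pow_fm[OF X b] x] by simp
  have comm_pow: "b ((a ^^ j) y) = (a ^^ j) (b y)" if "y \<in> fil X 0 i" for j y
  proof (induction j)
    case (Suc j)
    have "b (a ((a ^^ j) y)) = a (b ((a ^^ j) y))" by (rule comm[OF apow[OF that], symmetric])
    then show ?case by (simp add: Suc)
  qed simp
  have ?case if cpow: "scl X (1 / fact (Suc n)) ((?c ^^ Suc n) x) =
      scl X (1 / of_nat (Suc n)) (?c (scl X (1 / fact n) ((?c ^^ n) x)))"
  proof -
    have AB_in: "?A j (?B l) \<in> fil X 0 i" for j l
      by (intro fil_scale[OF X] apow B_in)
    have nz: "1 + of_nat j \<noteq> (0 :: 'k)" for j
      using of_nat_neq_0[of j, where ?'a = 'k] by simp
    have aA: "a (?A j y) = scl X (of_nat (Suc j)) (?A (Suc j) y)" if "y \<in> fil X 0 i" for j y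
      using fm_scale[OF fa apow[OF that]] nz[of j] by (simp add: scl_simps[OF X] divide_simps)
    have bB: "b (?A j (?B l)) = scl X (of_nat (Suc l)) (?A j (?B (Suc l)))" for j l
    proof -
      have 1: "b (?B l) = scl X (of_nat (Suc l)) (?B (Suc l))"
        using fm_scale[OF fb bpow] nz[of l] by (simp add: scl_simps[OF X] divide_simps)
      show ?thesis
        unfolding fm_scale[OF fb apow[OF B_in]] comm_pow[OF B_in] 1 fm_scale[OF pow_fm[OF X a] B_in]
        by (simp only: scl_simps[OF X] mult.commute)
    qed
    have s1: "(\<Sum>j\<le>n. a (?A j (?B (n - j)))) = (\<Sum>j\<le>Suc n. scl X (of_nat j) (?A j (?B (Suc n - j))))"
      by (subst sum.atMost_Suc_shift) (simp only: aA[OF B_in] diff_Suc_Suc of_nat_0 mult_zero_left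
          scl_simps[OF X] add_0_left)
    have s2: "(\<Sum>j\<le>n. b (?A j (?B (n - j)))) =
        (\<Sum>j\<le>Suc n. scl X (of_nat (Suc n - j)) (?A j (?B (Suc n - j))))"
    proof -
      have "(\<Sum>j\<le>n. b (?A j (?B (n - j)))) =
          (\<Sum>j\<le>n. scl X (of_nat (Suc n - j)) (?A j (?B (Suc n - j))))"
        by (rule sum.cong[OF refl], unfold bB) (simp only: atMost_iff Suc_diff_le)
      then show ?thesis by (simp add: scl_simps[OF X])
    qed
    have "?c (scl X (1 / fact n) ((?c ^^ n) x)) = ?c (\<Sum>j\<le>n. ?A j (?B (n - j)))"
      by (simp add: Suc.IH)
    also have "\<dots> = (\<Sum>j\<le>n. a (?A j (?B (n - j)))) + (\<Sum>j\<le>n. b (?A j (?B (n - j))))"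
      using AB_in
      by (intro arg_cong2[of _ _ _ _ "(+)"] fm_sum[OF fa X X, of _ _ i] fm_sum[OF fb X X, of _ _ i])
          simp_all
    also have "\<dots> = (\<Sum>j\<le>Suc n. scl X (of_nat (Suc n)) (?A j (?B (Suc n - j))))"
      unfolding s1 s2 sum.distrib[symmetric]
      by (rule sum.cong[OF refl])
        (simp only: scl_distribs(3)[OF X, symmetric] of_nat_add[symmetric] atMost_iff
          le_add_diff_inverse)
    also have "\<dots> = scl X (of_nat (Suc n)) (\<Sum>j\<le>Suc n. ?A j (?B (Suc n - j)))"
      by (rule scl_sum_right[OF X, symmetric])
    finally have *: "?c (scl X (1 / fact n) ((?c ^^ n) x)) =
        scl X (of_nat (Suc n)) (\<Sum>j\<le>Suc n. ?A j (?B (Suc n - j)))" .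
    have "1 / of_nat (Suc n) * of_nat (Suc n) = (1 :: 'k)"
      by (simp del: of_nat_Suc)
    then show ?thesis
      unfolding cpow * scl_simps(4)[OF X] by (simp only: scl_simps(3)[OF X])
  qed
  moreover have "scl X (1 / fact (Suc n)) ((?c ^^ Suc n) x) =
      scl X (1 / of_nat (Suc n)) (?c (scl X (1 / fact n) ((?c ^^ n) x)))"
    using fm_scale[OF fc fm_in[OF pow_fm[OF X c] x], of "1 / fact n" n]
    by (simp add: scl_simps[OF X])
  ultimately show ?case by blast
qed

text \<open>
  The two sides differ by the products of \<open>a\<^sup>j / j!\<close> and \<open>b\<^sup>m / m!\<close> with \<open>j \<le> N\<close>, \<open>m \<le> N\<close> and \<open>j + m > N\<close>.
\<close>

lemma expN_plus:
  assumes a: "nilop X a" and b: "nilop X b"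
    and comm: "\<And>x. x \<in> fil X 0 i \<Longrightarrow> a (b x) = b (a x)" and x: "x \<in> fil X 0 i"
  shows "expN X a N (expN X b N x) - expN X (\<lambda>x. a x + b x) N x \<in> fil X (Suc N) i"
proof -
  let ?f = "\<lambda>j m. scl X (1 / fact j) ((a ^^ j) (scl X (1 / fact m) ((b ^^ m) x)))"
  have in': "scl X (1 / fact m) ((b ^^ m) x) \<in> fil X m i" for m
    using fil_scale[OF X pow_in[OF X b x]] by simp
  have f_in: "?f j m \<in> fil X (j + m) i" for j m
    using fil_scale[OF X pow_in[OF X a in']] by (simp add: add.commute)
  have "expN X a N (expN X b N x) = (\<Sum>j\<le>N. \<Sum>m\<le>N. ?f j m)"
  proof -
    have "(a ^^ j) (expN X b N x) = (\<Sum>m\<le>N. (a ^^ j) (scl X (1 / fact m) ((b ^^ m) x)))" for j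
      unfolding expN_def by (rule fm_sum[OF pow_fm[OF X a] X X]) (use fil_0[OF X in'] in auto)
    then show ?thesis by (simp add: expN_def[of X a] scl_sum_right[OF X])
  qed
  also have "\<dots> = (\<Sum>(j, m)\<in>{..N} \<times> {..N}. ?f j m)"
    by (rule sum.cartesian_product)
  also have "{..N} \<times> {..N} = {(j, m). j + m \<le> N} \<union> {(j, m). j \<le> N \<and> m \<le> N \<and> N < j + m}"
    by auto
  also have "(\<Sum>(j, m)\<in>\<dots>. ?f j m) = (\<Sum>(j, m)\<in>{(j, m). j + m \<le> N}. ?f j m) +
      (\<Sum>(j, m)\<in>{(j, m). j \<le> N \<and> m \<le> N \<and> N < j + m}. ?f j m)"
  proof (rule sum.union_disjoint)
    show "finite {(j, m). j + m \<le> N}" "finite {(j, m). j \<le> N \<and> m \<le> N \<and> N < j + m}"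
      by (rule finite_subset[of _ "{..N} \<times> {..N}"]; auto)+
  qed auto
  also have "(\<Sum>(j, m)\<in>{(j, m). j + m \<le> N}. ?f j m) = (\<Sum>n\<le>N. \<Sum>j\<le>n. ?f j (n - j))"
    by (rule sum.triangle_reindex_eq)
  also have "\<dots> = expN X (\<lambda>x. a x + b x) N x"
    by (simp only: expN_def divided_power_plus[OF a b comm x])
  finally have "expN X a N (expN X b N x) - expN X (\<lambda>x. a x + b x) N x =
      (\<Sum>(j, m)\<in>{(j, m). j \<le> N \<and> m \<le> N \<and> N < j + m}. ?f j m)" by simp
  also have "\<dots> \<in> fil X (Suc N) i"
    by (rule fil_sum[OF X]) (auto intro!: fil_mono[OF X _ f_in])
  finally show ?thesis .
qed

lemma expN_neg:
  assumes l: "nilop X l" and x: "x \<in> fil X 0 i"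
  shows "expN X (\<lambda>x. - l x) N (expN X l N x) - x \<in> fil X (Suc N) i"
proof -
  have "(- l (l x)) = l (- l x)" if "x \<in> fil X 0 i" for x
    using fm_neg[OF nilop_fm[OF l] X X fm_in[OF nilop_fm[OF l] that]] by simp
  from expN_plus[OF nilop_neg[OF X l] l _ x, of N] this
  show ?thesis by (simp add: expN_zero_op)
qed

text \<open>
  Up to a term of arbitrarily deep filtration, the exponential is inverted by that of the negative.
\<close>

lemma vanishes_expN_imp_fil:
  assumes l: "nilop X l" and x: "x \<in> fil X 0 i" and v: "vanishes X i (\<lambda>N. expN X l N x)"
  shows "x \<in> fil X k i"
proof -
  obtain N where N: "\<And>n. n \<ge> N \<Longrightarrow> expN X l n x \<in> fil X k i"
    using v unfolding vanishes_def by blast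
  let ?n = "max N k"
  have "expN X (\<lambda>x. - l x) ?n (expN X l ?n x) \<in> fil X k i"
    by (rule expN_in[OF nilop_neg[OF X l] N]) simp
  moreover have "expN X (\<lambda>x. - l x) ?n (expN X l ?n x) - x \<in> fil X k i"
    by (rule fil_mono[OF X _ expN_neg[OF l x]]) simp
  ultimately have "expN X (\<lambda>x. - l x) ?n (expN X l ?n x) -
      (expN X (\<lambda>x. - l x) ?n (expN X l ?n x) - x) \<in> fil X k i"
    by (rule fil_diff[OF X])
  then show ?thesis by simp
qed

end

lemma vanishes_expN:
  fixes X :: "('k::field_char_0, 'v::ab_group_add) fspace"
  assumes X: "filtered_space X" and l: "nilop X l" and v: "vanishes X i x"
  shows "vanishes X i (\<lambda>N. expN X l N (x N))"
  using v expN_in[OF X l] unfolding vanishes_def by metis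

lemma linear_on_sum:
  assumes X: "filtered_space X" and Y: "filtered_space Y" and f:
      "linear_on (scl X) (scl Y) (fil X 0 i) f"
    and "finite A" "\<And>a. a \<in> A \<Longrightarrow> g a \<in> fil X 0 i"
  shows "f (\<Sum>a\<in>A. g a) = (\<Sum>a\<in>A. f (g a))"
  using assms(4,5)
proof (induction A rule: finite_induct)
  case empty
  show ?case
    using linear_on_scale[OF f fil_zero[OF X], of 0] by (simp add: scl_simps[OF X] scl_simps[OF Y])
next
  case (insert a A)
  then have "f (g a + sum g A) = f (g a) + f (sum g A)"
    by (intro linear_on_add[OF f]) (auto intro: fil_sum[OF X])
  then show ?case using insert by simp
qed

lemma expN_intertwine:
  fixes X :: "('k::field_char_0, 'v::ab_group_add) fspace" and Y :: "('k, 'w::ab_group_add) fspace"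
  assumes X: "filtered_space X" and Y: "filtered_space Y" and l: "nilop X l"
    and f: "linear_on (scl X) (scl Y) (fil X 0 i) f"
    and eq: "\<And>x. x \<in> fil X 0 i \<Longrightarrow> f (l x) = l' (f x)" and x: "x \<in> fil X 0 i"
  shows "f (expN X l N x) = expN Y l' N (f x)"
proof -
  have p: "(l ^^ n) x \<in> fil X 0 i" for n
    using fm_in[OF pow_fm[OF X l] x] by simp
  have "f ((l ^^ n) x) = (l' ^^ n) (f x)" for n
    by (induction n) (simp_all add: eq[OF p])
  then show ?thesis
    unfolding expN_def
    by (subst linear_on_sum[OF X Y f]) (auto simp: linear_on_scale[OF f p] intro!: fil_scale[OF X] p)
qed

lemma fm_linear_on: "filtered_map X Y d f \<Longrightarrow> linear_on (scl X) (scl Y) (fil X 0 i) f"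
  by (simp add: filtered_map_def)

context
  fixes X :: "('k::field_char_0, 'v::ab_group_add) fspace" and Y :: "('k, 'w::ab_group_add) fspace"
    and l l'
  assumes X: "filtered_space X" and Y: "filtered_space Y" and l: "nilop X l" and l': "nilop Y l'"
begin

lemma twisted_value_in0: "twisted_value X l Y l' d F i x y \<Longrightarrow> y \<in> fil Y 0 (i + d)"
  by (simp add: twisted_value_def)

lemma twisted_value_add:
  assumes F: "filtered_map X Y d F" and x: "x \<in> fil X 0 i" "x' \<in> fil X 0 i"
    and t: "twisted_value X l Y l' d F i x y" and t': "twisted_value X l Y l' d F i x' y'"
  shows "twisted_value X l Y l' d F i (x + x') (y + y')"
proof -
  note e = expN_fm[OF X l] and e' = expN_fm[OF Y l']
  have "F (expN X l N (x + x')) - expN Y l' N (y + y') =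
      (F (expN X l N x) - expN Y l' N y) + (F (expN X l N x') - expN Y l' N y')" for N
    using fm_add[OF F fm_in[OF e x(1)] fm_in[OF e x(2)]]
    by (simp add: fm_add[OF e x] fm_add[OF e' twisted_value_in0[OF t] twisted_value_in0[OF t']])
  then show ?thesis
    using t t' vanishes_add[OF Y] fil_add[OF Y] by (simp add: twisted_value_def)
qed

lemma twisted_value_scale:
  assumes F: "filtered_map X Y d F" and x: "x \<in> fil X 0 i"
    and t: "twisted_value X l Y l' d F i x y"
  shows "twisted_value X l Y l' d F i (scl X c x) (scl Y c y)"
proof -
  note e = expN_fm[OF X l] and e' = expN_fm[OF Y l']
  have "F (expN X l N (scl X c x)) - expN Y l' N (scl Y c y) =
      scl Y c (F (expN X l N x) - expN Y l' N y)" for N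
    using fm_scale[OF F fm_in[OF e x]]
    by (simp add: fm_scale[OF e x] fm_scale[OF e' twisted_value_in0[OF t]] scl_distribs[OF Y])
  then show ?thesis
    using t vanishes_scale[OF Y] fil_scale[OF Y] by (simp add: twisted_value_def)
qed

lemma twisted_value_zero:
  assumes F: "filtered_map X Y d F"
  shows "twisted_value X l Y l' d F i 0 0"
  using fm_zero[OF expN_fm[OF X l] X X] fm_zero[OF expN_fm[OF Y l'] Y Y] fm_zero[OF F X Y]
  by (simp add: twisted_value_def vanishes_zero[OF Y] fil_zero[OF Y])

lemma twisted_value_plus:
  assumes t: "twisted_value X l Y l' d F i x y" and t': "twisted_value X l Y l' d G i x z"
  shows "twisted_value X l Y l' d (\<lambda>x. F x + G x) i x (y + z)"
proof -
  note e' = expN_fm[OF Y l']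
  have eq: "F (expN X l N x) + G (expN X l N x) - expN Y l' N (y + z) =
      (F (expN X l N x) - expN Y l' N y) + (G (expN X l N x) - expN Y l' N z)" for N
    by (simp add: fm_add[OF e' twisted_value_in0[OF t] twisted_value_in0[OF t']])
  show ?thesis
    using t t' unfolding twisted_value_def eq by (auto intro!: vanishes_add[OF Y] fil_add[OF Y])
qed

lemma twisted_value_cong:
  assumes "\<And>x. x \<in> fil X 0 i \<Longrightarrow> F x = G x" "x \<in> fil X 0 i"
  shows "twisted_value X l Y l' d F i x y \<longleftrightarrow> twisted_value X l Y l' d G i x y"
  using assms expN_in[OF X l] by (simp add: twisted_value_def)

lemma twisted_value_equivariant:
  assumes F: "filtered_map X Y d F" and eq: "\<And>x. x \<in> fil X 0 i \<Longrightarrow> F (l x) = l' (F x)"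
    and x: "x \<in> fil X 0 i"
  shows "twisted_value X l Y l' d F i x (F x)"
  using fm_in[OF F x] expN_intertwine[OF X Y l fm_linear_on[OF F] eq x]
  by (simp add: twisted_value_def vanishes_zero[OF Y])

lemma twisted_value_fil:
  assumes F: "filtered_map X Y d F" and x: "x \<in> fil X k i" and t: "twisted_value X l Y l' d F i x y"
  shows "y \<in> fil Y k (i + d)"
proof -
  obtain N where N: "\<And>n. n \<ge> N \<Longrightarrow> F (expN X l n x) - expN Y l' n y \<in> fil Y k (i + d)"
    using t unfolding twisted_value_def vanishes_def by blast
  let ?n = "max N k"
  have "F (expN X l ?n x) - (F (expN X l ?n x) - expN Y l' ?n y) \<in> fil Y k (i + d)"
    by (intro fil_diff[OF Y] N fm_in[OF F] expN_in[OF X l x]) simp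
  then have "expN Y (\<lambda>y. - l' y) ?n (expN Y l' ?n y) \<in> fil Y k (i + d)"
    by (intro expN_in[OF Y nilop_neg[OF Y l']]) simp
  moreover have "expN Y (\<lambda>y. - l' y) ?n (expN Y l' ?n y) - y \<in> fil Y k (i + d)"
    by (rule fil_mono[OF Y _ expN_neg[OF Y l' twisted_value_in0[OF t]]]) simp
  ultimately have "expN Y (\<lambda>y. - l' y) ?n (expN Y l' ?n y) -
      (expN Y (\<lambda>y. - l' y) ?n (expN Y l' ?n y) - y) \<in> fil Y k (i + d)"
    by (rule fil_diff[OF Y])
  then show ?thesis by simp
qed

lemma twisted_value_unique:
  assumes sep: "separated Y"
    and t: "twisted_value X l Y l' d F i x y" and t': "twisted_value X l Y l' d F i x z"
  shows "y = z"
proof -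
  note e' = expN_fm[OF Y l']
  note y = twisted_value_in0[OF t] and z = twisted_value_in0[OF t']
  have eq: "expN Y l' N (y - z) = (F (expN X l N x) - expN Y l' N z) -
      (F (expN X l N x) - expN Y l' N y)" for N
    by (simp add: fm_diff[OF e' Y Y y z])
  have "vanishes Y (i + d) (\<lambda>N. expN Y l' N (y - z))"
    using t t' unfolding twisted_value_def eq
    by (elim conjE) (rule vanishes_diff[OF Y])
  then have "y - z = 0"
    using separatedD[OF sep vanishes_expN_imp_fil[OF Y l' fil_diff[OF Y y z]]] by blast
  then show ?thesis by simp
qed

lemma twisted_value_limit:
  assumes F: "filtered_map X Y d F" and x: "x \<in> fil X 0 i" and t: "twisted_value X l Y l' d F i x y"
  shows "flimit Y (i + d) (\<lambda>N. expN Y (\<lambda>y. - l' y) N (F (expN X l N x))) y"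
proof -
  note n = expN_fm[OF Y nilop_neg[OF Y l']]
  note y = twisted_value_in0[OF t]
  have "vanishes Y (i + d) (\<lambda>N. expN Y (\<lambda>y. - l' y) N (F (expN X l N x) - expN Y l' N y))"
    using t vanishes_expN[OF Y nilop_neg[OF Y l']] by (simp add: twisted_value_def)
  moreover have "vanishes Y (i + d) (\<lambda>N. expN Y (\<lambda>y. - l' y) N (expN Y l' N y) - y)"
    by (rule vanishesI_Suc[OF Y expN_neg[OF Y l' y]])
  ultimately have "vanishes Y (i + d) (\<lambda>N. expN Y (\<lambda>y. - l' y) N (F (expN X l N x) - expN Y l' N y) +
      (expN Y (\<lambda>y. - l' y) N (expN Y l' N y) - y))"
    by (rule vanishes_add[OF Y])
  then show ?thesis
    using fm_diff[OF n Y Y fm_in[OF F expN_in[OF X l x]] expN_in[OF Y l' y]] y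
    by (simp add: flimit_def vanishes_def)
qed

end

lemma twisted_value_comp:
  fixes X :: "('k::field_char_0, 'v::ab_group_add) fspace" and Y :: "('k, 'w::ab_group_add) fspace"
    and Z :: "('k, 'z::ab_group_add) fspace"
  assumes X: "filtered_space X" and Y: "filtered_space Y" and Z: "filtered_space Z"
    and l: "nilop X l" and l': "nilop Y l'"
    and F: "filtered_map X Y d F" and G: "filtered_map Y Z e G" and x: "x \<in> fil X 0 i"
    and t: "twisted_value X l Y l' d F i x y" and t': "twisted_value Y l' Z l'' e G (i + d) y z"
  shows "twisted_value X l Z l'' (d + e) (\<lambda>x. G (F x)) i x z"
proof -
  have y: "y \<in> fil Y 0 (i + d)" using t by (simp add: twisted_value_def)
  have "vanishes Z (i + d + e) (\<lambda>N. G (F (expN X l N x) - expN Y l' N y) +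
      (G (expN Y l' N y) - expN Z l'' N z))"
    using t t' unfolding twisted_value_def
    by (intro vanishes_add[OF Z] vanishes_image[OF G]) auto
  then show ?thesis
    using fm_diff[OF G Y Z fm_in[OF F expN_in[OF X l x]] expN_in[OF Y l' y]] t'
    by (simp add: twisted_value_def add.assoc)
qed

text \<open>
  Since \<open>e\<^sup>a\<^sup>+\<^sup>b = e\<^sup>a e\<^sup>b\<close>, a map that intertwines \<open>a\<close> with \<open>a'\<close> needs to be twisted only by the
  other summands.
\<close>

lemma twisted_value_split:
  fixes X :: "('k::field_char_0, 'v::ab_group_add) fspace" and Y :: "('k, 'w::ab_group_add) fspace"
  assumes X: "filtered_space X" and Y: "filtered_space Y"
    and a: "nilop X a" and b: "nilop X b" and a': "nilop Y a'" and b': "nilop Y b'"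
    and comm: "\<And>x. x \<in> fil X 0 i \<Longrightarrow> a (b x) = b (a x)"
    and comm': "\<And>y. y \<in> fil Y 0 (i + d) \<Longrightarrow> a' (b' y) = b' (a' y)"
    and F: "filtered_map X Y d F" and eq: "\<And>x. x \<in> fil X 0 i \<Longrightarrow> F (a x) = a' (F x)"
    and x: "x \<in> fil X 0 i" and t: "twisted_value X b Y b' d F i x y"
  shows "twisted_value X (\<lambda>x. a x + b x) Y (\<lambda>y. a' y + b' y) d F i x y"
proof -
  have y: "y \<in> fil Y 0 (i + d)" using t by (simp add: twisted_value_def)
  let ?c = "\<lambda>x. a x + b x" and ?c' = "\<lambda>y. a' y + b' y"
  note c = nilop_plus[OF X a b]
  note bx = expN_in[OF X b x] and by' = expN_in[OF Y b' y]
  have "vanishes Y (i + d) (\<lambda>N. expN Y a' N (F (expN X b N x) - expN Y b' N y))"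
    using t vanishes_expN[OF Y a'] by (simp add: twisted_value_def)
  moreover have "vanishes Y (i + d) (\<lambda>N. expN Y a' N (expN Y b' N y) - expN Y ?c' N y)"
    using expN_plus[OF Y a' b' comm' y] by (intro vanishesI_Suc[OF Y])
  moreover have "vanishes Y (i + d) (\<lambda>N. F (expN X a N (expN X b N x) - expN X ?c N x))"
    using fm_in[OF F expN_plus[OF X a b comm x]] by (intro vanishesI_Suc[OF Y])
  ultimately have "vanishes Y (i + d) (\<lambda>N.
      (expN Y a' N (F (expN X b N x) - expN Y b' N y) +
       (expN Y a' N (expN Y b' N y) - expN Y ?c' N y)) -
      F (expN X a N (expN X b N x) - expN X ?c N x))"
    by (rule vanishes_diff[OF Y vanishes_add[OF Y]])
  moreover have "(expN Y a' N (F (expN X b N x) - expN Y b' N y) +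
       (expN Y a' N (expN Y b' N y) - expN Y ?c' N y)) -
      F (expN X a N (expN X b N x) - expN X ?c N x) =
      F (expN X ?c N x) - expN Y ?c' N y" for N
    using fm_diff[OF expN_fm[OF Y a'] Y Y fm_in[OF F bx] by', of N]
      fm_diff[OF F X Y expN_in[OF X a bx] expN_in[OF X c x], of N N N]
      expN_intertwine[OF X Y a fm_linear_on[OF F] eq bx, of N N]
    by simp
  ultimately show ?thesis using y by (simp add: twisted_value_def)
qed


section \<open>Exponentials acting on tensor products and comodules\<close>

lemma tensor_map_cong:
  assumes X: "filtered_space X" and Y: "filtered_space Y"
    and f: "\<And>i x. x \<in> fil X 0 i \<Longrightarrow> f x = f' x" and g: "\<And>i y. y \<in> fil Y 0 i \<Longrightarrow> g y = g' y"
    and t: "t \<in> fil (tensor X Y) k i"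
  shows "tensor_map V W d f e g t = tensor_map V W d f' e g' t"
  unfolding tensor_map_def
  by (rule lext_eq_on_supported[OF tensor_supported[OF X Y t]]) (auto simp: tensor_gens_def f g)

context
  fixes X :: "('k::field_char_0, 'v::ab_group_add) fspace" and Y :: "('k, 'w::ab_group_add) fspace"
  assumes X: "filtered_space X" and Y: "filtered_space Y"
begin

lemma nilop_left:
  assumes l: "nilop X l"
  shows "nilop (tensor X Y) (tensor_map X Y 0 l 0 (\<lambda>x. x))"
  using tensor_map_left_fm[OF X Y X nilop_fm[OF l]] l
    tensor_map_raises[OF X Y X Y nilop_fm[OF l] fm_id(2) _ filtered_map_raises[OF fm_id(2)], of 1]
  by (simp add: nilop_def)

lemma nilop_right:
  assumes l: "nilop Y l"
  shows "nilop (tensor X Y) (tensor_map X Y 0 (\<lambda>x. x) 0 l)"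
  using tensor_map_right_fm[OF X Y Y nilop_fm[OF l]] l
    tensor_map_raises[OF X Y X Y fm_id(2) nilop_fm[OF l] filtered_map_raises[OF fm_id(2)], of 1]
  by (simp add: nilop_def)

lemma left_right_commute:
  assumes l: "nilop X l" and l': "nilop Y l'" and t: "t \<in> fil (tensor X Y) 0 i"
  shows "tensor_map X Y 0 l 0 (\<lambda>x. x) (tensor_map X Y 0 (\<lambda>x. x) 0 l' t) =
    tensor_map X Y 0 (\<lambda>x. x) 0 l' (tensor_map X Y 0 l 0 (\<lambda>x. x) t)"
  using tensor_map_comp[OF X Y X Y X Y fm_id(2) nilop_fm[OF l'] nilop_fm[OF l] fm_id(2) t]
    tensor_map_comp[OF X Y X Y X Y nilop_fm[OF l] fm_id(2) fm_id(2) nilop_fm[OF l'] t] by simp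

lemma expN_left_tens:
  assumes l: "nilop X l" and x: "x \<in> fil X 0 i" and y: "y \<in> fil Y 0 j"
  shows "expN (tensor X Y) (tensor_map X Y 0 l 0 (\<lambda>x. x)) N (tens X Y (i, x) (j, y)) =
    tens X Y (i, expN X l N x) (j, y)"
proof (rule expN_intertwine[OF X filtered_space_tensor[OF X Y] l _ _ x,
      where f = "\<lambda>x. tens X Y (i, x) (j, y)", symmetric])
  show "linear_on (scl X) (scl (tensor X Y)) (fil X 0 i) (\<lambda>x. tens X Y (i, x) (j, y))"
    by (simp add: linear_on_def tens_add_left[OF X Y _ _ y] tens_scale_left[OF X Y _ y])
qed (simp add: tensor_map_left_tens[OF X Y X nilop_fm[OF l]])

lemma expN_right_tens:
  assumes l: "nilop Y l" and x: "x \<in> fil X 0 i" and y: "y \<in> fil Y 0 j"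
  shows "expN (tensor X Y) (tensor_map X Y 0 (\<lambda>x. x) 0 l) N (tens X Y (i, x) (j, y)) =
    tens X Y (i, x) (j, expN Y l N y)"
proof (rule expN_intertwine[OF Y filtered_space_tensor[OF X Y] l _ _ y,
      where f = "\<lambda>y. tens X Y (i, x) (j, y)", symmetric])
  show "linear_on (scl Y) (scl (tensor X Y)) (fil Y 0 j) (\<lambda>y. tens X Y (i, x) (j, y))"
    by (simp add: linear_on_def tens_add_right[OF X Y x] tens_scale_right[OF X Y x])
qed (simp add: tensor_map_right_tens[OF X Y Y nilop_fm[OF l]])

end

abbreviation pi_mul :: "('k::field_char_0, 'l::ab_group_add) fspace \<Rightarrow> 'l \<Rightarrow> ('k, 'l) symc \<Rightarrow> ('k, 'l)
  symc" where
  "pi_mul L \<pi> \<equiv> lmul (shift 1 L) (0, \<pi>)"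

abbreviation pi_act ::
    "('k::field_char_0, 'l::ab_group_add) fspace \<Rightarrow> 'l \<Rightarrow> ('k, 'm::ab_group_add) fspace \<Rightarrow>
     ('k, 'l, 'm) comod \<Rightarrow> ('k, 'l, 'm) comod" where
  "pi_act L \<pi> M \<equiv> letter_act L M (0, \<pi>)"

abbreviation sc_twisted ::
    "('k::field_char_0, 'l::ab_group_add) fspace \<Rightarrow> 'l \<Rightarrow> int \<Rightarrow> (('k, 'l) symc \<Rightarrow> ('k, 'l) symc) \<Rightarrow>
     int \<Rightarrow> ('k, 'l) symc \<Rightarrow> ('k, 'l) symc \<Rightarrow> bool" where
  "sc_twisted L \<pi> \<equiv> twisted_value (Sc L) (pi_mul L \<pi>) (Sc L) (pi_mul L \<pi>)"

abbreviation cm_twisted ::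
    "('k::field_char_0, 'l::ab_group_add) fspace \<Rightarrow> 'l \<Rightarrow> ('k, 'm::ab_group_add) fspace \<Rightarrow>
     ('k, 'n::ab_group_add) fspace \<Rightarrow> int \<Rightarrow> (('k, 'l, 'm) comod \<Rightarrow> ('k, 'l, 'n) comod) \<Rightarrow>
     int \<Rightarrow> ('k, 'l, 'm) comod \<Rightarrow> ('k, 'l, 'n) comod \<Rightarrow> bool" where
  "cm_twisted L \<pi> M N \<equiv> twisted_value (Cm L M) (pi_act L \<pi> M) (Cm L N) (pi_act L \<pi> N)"

lemma lmul_lext: "lmul V a (lext fscale g Y) = lext fscale (\<lambda>w. lmul V a (g w)) Y"
  unfolding lmul_def
  by (simp add: lext_def[of fscale g] lext_sum[OF vector_space_fscale]
      lext_fscale[OF vector_space_fscale])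
    (simp add: lext_def)

lemma sym_mult_power:
  assumes V: "filtered_space V" and p: "p \<in> fil V 0 i" and Y: "Y \<in> fil (sym V) k d"
  shows "sym_mult V (sym_word V (replicate n (i, p))) Y = (lmul V (i, p) ^^ n) Y"
proof -
  note X = filtered_space_unfiltered[OF fs_sym[OF V]]
  note s = sym_supported[OF V Y]
  note m = multilinear_mapD[OF sym_word_multilinear[OF V], simplified]
  let ?h = "\<lambda>u. lext fscale (\<lambda>v. sym_word V (u @ v)) Y"
  have h: "multilinear_map V (unfiltered (sym V)) 0 ?h"
  proof (rule multilinear_mapI)
    fix u v i x y assume *: "is_word V u" "is_word V v" "x \<in> fil V 0 i"
    show "?h (u @ (i, x + y) # v) = ?h (u @ (i, x) # v) + ?h (u @ (i, y) # v)" if y: "y \<in> fil V 0 i"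
      unfolding lext_fun_add[OF vector_space_fscale, symmetric]
      by (rule lext_eq_on_supported[OF s]) (use * y in \<open>simp add: m(1)\<close>)
    show "?h (u @ (i, scl V c x) # v) = scl (unfiltered (sym V)) c (?h (u @ (i, x) # v))" for c
      unfolding unfiltered scl_sym lext_fun_scale[OF vector_space_fscale, symmetric]
      by (rule lext_eq_on_supported[OF s]) (use * in \<open>simp add: m(2)\<close>)
    show "?h (u @ (i, x) # (j, y) # v) =
        scl (unfiltered (sym V)) (ksign (i * j)) (?h (u @ (j, y) # (i, x) # v))"
      if y: "y \<in> fil V 0 j" for j
      unfolding unfiltered scl_sym lext_fun_scale[OF vector_space_fscale, symmetric]
      by (rule lext_eq_on_supported[OF s]) (use * y m(3)[OF *(1) _ *(3) y] in simp)
  qed (simp add: unfiltered)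
  have "?h (replicate n (i, p)) = (lmul V (i, p) ^^ n) Y"
  proof (induction n)
    case 0
    show ?case by (simp add: sym_lext_sym_word[OF V Y])
  next
    case (Suc n)
    show ?case by (simp add: Suc.IH[symmetric] lmul_lext lmul_word[OF V p])
  qed
  then show ?thesis
    using lext_sym_word[OF V X h] by (simp add: sym_mult_def unfiltered)
qed

context
  fixes L :: "('k::field_char_0, 'l::ab_group_add) fspace" and \<pi> :: 'l
  assumes L: "filtered_space L" and pi: "\<pi> \<in> fil (shift 1 L) 1 0"
begin

lemmas pi0 = fil_0[OF filtered_shift[OF L] pi]

lemma nilop_pi_mul: "nilop (Sc L) (pi_mul L \<pi>)"
  using lmul_Sc[OF L pi0] lmul_raises[OF filtered_shift[OF L] pi] by (simp add: nilop_def Sc_def)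

lemma nilop_letter_act:
  assumes M: "filtered_space M"
  shows "nilop (Cm L M) (pi_act L \<pi> M)"
  using letter_act_fm[OF L M pi0] letter_act_raises[OF L M pi] by (simp add: nilop_def)

text \<open>
  Multiplication by a power of \<open>\<pi>\<close> iterates the multiplication by the letter \<open>\<pi>\<close>.  So twisting is the
  conjugation by exponentials of an operator.
\<close>

lemma act_exp_sum:
  assumes M: "filtered_space M" and X: "X \<in> fil (Cm L M) 0 i"
  shows "act L M (exp_sum L \<pi> N) X = expN (Cm L M) (pi_act L \<pi> M) N X"
proof -
  note S = filtered_space_Sc[OF L]
  have mult: "sym_mult (shift 1 L) (exp_sum L \<pi> N) Y = expN (Sc L) (pi_mul L \<pi>) N Y"
    if "Y \<in> fil (Sc L) 0 j" for Y j
    unfolding expN_def sym_mult_power[OF filtered_shift[OF L] pi0 that[unfolded Sc_def], symmetric]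
    unfolding exp_sum_def sym_mult_def
    by (simp add: lext_sum[OF vector_space_fscale] lext_fscale[OF vector_space_fscale] Sc_def)
  note e = expN_fm[OF S nilop_pi_mul]
  have "act L M (exp_sum L \<pi> N) X = tensor_map (Sc L) M 0 (expN (Sc L) (pi_mul L \<pi>) N) 0 (\<lambda>x. x) X"
    unfolding act_def by (rule tensor_map_cong[OF S M mult _ X[unfolded Cm_def]]) auto
  also have "\<dots> = expN (Cm L M) (pi_act L \<pi> M) N X"
    unfolding letter_act_def fst_conv Cm_def
  proof (rule tensor_ext[OF S M filtered_space_tensor[OF S M] tensor_map_left_fm[OF S M S e] _ _
    X[unfolded Cm_def]])
    show "filtered_map (tensor (Sc L) M) (tensor (Sc L) M) 0
        (expN (tensor (Sc L) M) (tensor_map (Sc L) M 0 (pi_mul L \<pi>) 0 (\<lambda>x. x)) N)"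
      by (rule expN_fm[OF filtered_space_tensor[OF S M] nilop_left[OF S M nilop_pi_mul]])
  qed (simp add: tensor_map_left_tens[OF S M S e] expN_left_tens[OF S M nilop_pi_mul])
  finally show ?thesis .
qed

end

lemma letter_act_uminus:
  assumes L: "filtered_space L" and M: "filtered_space M" and x: "x \<in> fil (shift 1 L) 0 i"
    and X: "X \<in> fil (Cm L M) 0 j"
  shows "letter_act L M (i, - x) X = - letter_act L M (i, x) X"
proof -
  note S = filtered_space_Sc[OF L] and V = filtered_shift[OF L]
  note mx = fil_neg[OF V x]
  have "lmul (shift 1 L) (i, - x) s = - lmul (shift 1 L) (i, x) s" if "s \<in> fil (Sc L) 0 d" for s d
    using lmul_scale[OF V x that[unfolded Sc_def], of "-1"]
    by (simp add: scl_minus1[OF V, simplified] scl_minus1[OF fs_sym[OF V], simplified])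
  note neg = this
  have "letter_act L M (i, - x) X = fscale (-1) (letter_act L M (i, x) X)"
  proof (rule tensor_ext[OF S M filtered_space_tensor[OF S M] _ _ _ X[unfolded Cm_def]])
    show "filtered_map (tensor (Sc L) M) (tensor (Sc L) M) i (letter_act L M (i, - x))"
      using letter_act_fm[OF L M mx] by (simp add: Cm_def)
    show "filtered_map (tensor (Sc L) M) (tensor (Sc L) M) i
        (\<lambda>X. fscale (-1) (letter_act L M (i, x) X))"
      using fm_smult[OF letter_act_fm[OF L M x] filtered_space_Cm[OF L M], of "-1"] by
          (simp add: Cm_def)
    fix d j s m assume s: "s \<in> fil (Sc L) 0 d" and m: "m \<in> fil M 0 j"
    have "lmul (shift 1 L) (i, - x) s = scl (Sc L) (-1) (lmul (shift 1 L) (i, x) s)"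
      using neg[OF s] by (simp add: scl_minus1[OF S])
    then show "letter_act L M (i, - x) (tens (Sc L) M (d, s) (j, m)) =
        fscale (-1) (letter_act L M (i, x) (tens (Sc L) M (d, s) (j, m)))"
      using tens_scale_left[OF S M fm_in[OF lmul_Sc[OF L x] s] m, of "-1"]
      by (simp add: letter_act_tens[OF L M mx] letter_act_tens[OF L M x])
  qed
  then show ?thesis by (simp add: free.scale_minus_left)
qed

section \<open>Existence of twists\<close>

lemma complete_fspace_flimit:
  assumes N: "complete_fspace N" and x: "\<And>n. x n \<in> fil N 0 i"
    and cauchy: "\<And>n m. n \<le> m \<Longrightarrow> x m - x n \<in> fil N (Suc n) i"
  shows "\<exists>y. flimit N i x y"
proof -
  note F = separated_filtered[OF complete_fspace_separated[OF N]]
  have "x m - x n \<in> fil N k i" if "k \<le> m" "k \<le> n" for k m n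
  proof (cases "n \<le> m")
    case True
    then show ?thesis using fil_mono[OF F _ cauchy, of k n m] that by simp
  next
    case False
    then have "x n - x m \<in> fil N k i" using fil_mono[OF F _ cauchy, of k m n] that by simp
    from fil_neg[OF F this] show ?thesis by simp
  qed
  then have "\<forall>k. \<exists>N0. \<forall>m\<ge>N0. \<forall>n\<ge>N0. x m - x n \<in> fil N k i" by blast
  then show ?thesis using N x unfolding complete_fspace_def by blast
qed

lemma complete_fspace_shift: "complete_fspace L \<Longrightarrow> complete_fspace (shift n L)"
  by (simp add: complete_fspace_def flimit_def shift_def)

lemma expN_flimit_exists:
  fixes X :: "('k::field_char_0, 'v::ab_group_add) fspace"
  assumes X: "filtered_space X" and l: "nilop X l" and N: "complete_fspace N"
    and f: "filtered_map X N d f" and x: "x \<in> fil X 0 i"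
  shows "\<exists>y. flimit N (i + d) (\<lambda>n. f (expN X l n x)) y"
proof (rule complete_fspace_flimit[OF N])
  note F = separated_filtered[OF complete_fspace_separated[OF N]]
  note e = expN_in[OF X l x]
  show "f (expN X l n x) \<in> fil N 0 (i + d)" for n
    by (rule fm_in[OF f e])
  show "f (expN X l m x) - f (expN X l n x) \<in> fil N (Suc n) (i + d)" if "n \<le> m" for n m
    using fm_in[OF f expN_tail[OF X l x that]] by (simp add: fm_diff[OF f X F e e])
qed

lemma tens_vanishes:
  assumes X: "filtered_space X" and Y: "filtered_space Y" and x: "x \<in> fil X 0 i" and y: "vanishes Y j y"
  shows "vanishes (tensor X Y) (i + j) (\<lambda>n. tens X Y (i, x) (j, y n))"
  unfolding vanishes_def
proof
  fix k
  obtain N where "\<And>n. n \<ge> N \<Longrightarrow> y n \<in> fil Y k j" using y unfolding vanishes_def by blast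
  then show "\<exists>N. \<forall>n\<ge>N. tens X Y (i, x) (j, y n) \<in> fil (tensor X Y) k (i + j)"
    using tens_in[OF X Y x, of _ k j] by (intro exI[of _ N]) simp
qed

lemma tens_vanishes_left:
  assumes X: "filtered_space X" and Y: "filtered_space Y" and y: "y \<in> fil Y 0 j" and x: "vanishes X i x"
  shows "vanishes (tensor X Y) (i + j) (\<lambda>n. tens X Y (i, x n) (j, y))"
  unfolding vanishes_def
proof
  fix k
  obtain N where "\<And>n. n \<ge> N \<Longrightarrow> x n \<in> fil X k i" using x unfolding vanishes_def by blast
  then show "\<exists>N. \<forall>n\<ge>N. tens X Y (i, x n) (j, y) \<in> fil (tensor X Y) k (i + j)"
    using tens_in[OF X Y _ y, of _ k i] by (intro exI[of _ N]) simp
qed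

lemma flimit_vanishes: "flimit X i x y \<longleftrightarrow> y \<in> fil X 0 i \<and> vanishes X i (\<lambda>n. x n - y)"
  by (simp add: flimit_def vanishes_def)

context
  fixes L :: "('k::field_char_0, 'l::ab_group_add) fspace" and \<pi> :: 'l
  assumes L: "filtered_space L" and pi: "\<pi> \<in> fil (shift 1 L) 1 0"
begin

text \<open>
  As \<open>\<pi>\<close> is primitive, the coaction intertwines the action of \<open>\<pi>\<close> with the sum of its actions on the two
  tensor factors.
\<close>

lemma coact_twisted:
  assumes M: "filtered_space M" and X: "X \<in> fil (Cm L M) 0 i"
  shows "twisted_value (Cm L M) (pi_act L \<pi> M) (tensor (Sc L) (Cm L M))
    (\<lambda>t. tensor_map (Sc L) (Cm L M) 0 (pi_mul L \<pi>) 0 (\<lambda>x. x) t +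
         tensor_map (Sc L) (Cm L M) 0 (\<lambda>x. x) 0 (pi_act L \<pi> M) t) 0 (coact L M) i X (coact L M X)"
proof (rule twisted_value_equivariant[OF filtered_space_Cm[OF L M] filtered_space_ScCm[OF L M]
      nilop_letter_act[OF L pi M] _ coact_fm[OF L M] coact_letter[OF L M pi0[OF L pi]] X])
  show "nilop (tensor (Sc L) (Cm L M)) (\<lambda>t. tensor_map (Sc L) (Cm L M) 0 (pi_mul L \<pi>) 0 (\<lambda>x. x) t +
         tensor_map (Sc L) (Cm L M) 0 (\<lambda>x. x) 0 (pi_act L \<pi> M) t)"
    by (intro nilop_plus filtered_space_ScCm[OF L M] nilop_left nilop_right filtered_space_Sc[OF L]
        filtered_space_Cm[OF L M] nilop_pi_mul[OF L pi] nilop_letter_act[OF L pi M])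
qed

text \<open>
  Maps of the form \<open>(id \<otimes> f) \<circ> coact\<close> can be twisted: as \<open>\<pi>\<close> is primitive, its exponential is
  grouplike, hence the exponential in the left factor can be pulled out, and the one in the right
  factor is absorbed into \<open>f\<close>, whose target is complete.
\<close>

lemma corestriction_twisted:
  assumes M: "filtered_space M" and N: "filtered_space N" and f: "filtered_map (Cm L M) N d f"
    and X: "X \<in> fil (Cm L M) 0 i"
    and t: "twisted_value (tensor (Sc L) (Cm L M)) (tensor_map (Sc L) (Cm L M) 0 (\<lambda>x. x) 0
        (pi_act L \<pi> M))
      (Cm L N) (\<lambda>x. 0) d (tensor_map (Sc L) N 0 (\<lambda>x. x) d f) i (coact L M X) Y"
  shows "cm_twisted L \<pi> M N d
    (\<lambda>X. tensor_map (Sc L) N 0 (\<lambda>x. x) d f (coact L M X)) i X Y"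
proof -
  note S = filtered_space_Sc[OF L] and CM = filtered_space_Cm[OF L M] and CN = filtered_space_Cm[OF L N]
  note T = filtered_space_ScCm[OF L M]
  let ?a = "tensor_map (Sc L) (Cm L M) 0 (pi_mul L \<pi>) 0 (\<lambda>x. x)"
    and ?b = "tensor_map (Sc L) (Cm L M) 0 (\<lambda>x. x) 0 (pi_act L \<pi> M)"
    and ?H = "tensor_map (Sc L) N 0 (\<lambda>x. x) d f"
  note pm = nilop_pi_mul[OF L pi] and pa = nilop_letter_act[OF L pi]
  have a: "nilop (tensor (Sc L) (Cm L M)) ?a" and b: "nilop (tensor (Sc L) (Cm L M)) ?b"
    by (rule nilop_left[OF S CM pm], rule nilop_right[OF S CM pa[OF M]])
  have H: "filtered_map (tensor (Sc L) (Cm L M)) (Cm L N) d ?H"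
    using tensor_map_right_fm[OF S CM N f] by (simp add: Cm_def[of L N])
  note c = fm_in[OF coact_fm[OF L M] X]
  have "twisted_value (tensor (Sc L) (Cm L M)) (\<lambda>t. ?a t + ?b t) (Cm L N) (\<lambda>x. pi_act L \<pi> N x + 0) d
      ?H i (coact L M X) Y"
  proof (rule twisted_value_split[OF T CN a b pa[OF N] nilop_zero[OF CN] _ _ H _ _ t])
    show "?a (?b t) = ?b (?a t)" if "t \<in> fil (tensor (Sc L) (Cm L M)) 0 i" for t
      by (rule left_right_commute[OF S CM pm pa[OF M] that])
    show "?H (?a t) = pi_act L \<pi> N (?H t)" if t: "t \<in> fil (tensor (Sc L) (Cm L M)) 0 i" for t
      using tensor_map_comp[OF S CM S CM S N nilop_fm[OF pm] fm_id(2) fm_id(2) f t]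
        tensor_map_comp[OF S CM S N S N fm_id(2) f nilop_fm[OF pm] fm_id(2) t]
      by (simp add: letter_act_def)
    show "coact L M X \<in> fil (tensor (Sc L) (Cm L M)) 0 i" using c by simp
  qed (simp add: fm_zero[OF nilop_fm[OF pa[OF N]] CN CN])
  then have H': "twisted_value (tensor (Sc L) (Cm L M)) (\<lambda>t. ?a t + ?b t) (Cm L N) (pi_act L \<pi> N) d
      ?H i (coact L M X) Y"
    by simp
  show ?thesis
    using twisted_value_comp[OF CM T CN pa[OF M] nilop_plus[OF T a b] coact_fm[OF L M] H X
        coact_twisted[OF M X]]
      H' by simp
qed

text \<open>
  In the right factor the exponential acts on the argument of \<open>f\<close>, and the limit \<open>y\<close> is taken in \<open>N\<close>.  The
  target carries the zero operator: its own exponential belongs to the left factor.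
\<close>

lemma right_factor_twisted:
  assumes M: "filtered_space M" and N: "filtered_space N" and f: "filtered_map (Cm L M) N d f"
    and s: "s \<in> fil (Sc L) 0 i" and Z: "Z \<in> fil (Cm L M) 0 j"
    and y: "flimit N (j + d) (\<lambda>n. f (expN (Cm L M) (pi_act L \<pi> M) n Z)) y"
  shows "twisted_value (tensor (Sc L) (Cm L M)) (tensor_map (Sc L) (Cm L M) 0 (\<lambda>x. x) 0 (pi_act L \<pi> M))
      (Cm L N) (\<lambda>x. 0) d (tensor_map (Sc L) N 0 (\<lambda>x. x) d f) (i + j)
      (tens (Sc L) (Cm L M) (i, s) (j, Z)) (fscale (ksign (d * i)) (tens (Sc L) N (i, s) (j + d, y)))"
proof -
  note S = filtered_space_Sc[OF L] and CM = filtered_space_Cm[OF L M] and CN = filtered_space_Cm[OF L N]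
  note pa = nilop_letter_act[OF L pi M]
  have y0: "y \<in> fil N 0 (j + d)" using y by (simp add: flimit_def)
  note fe = fm_in[OF f expN_in[OF CM pa Z]]
  have "vanishes (Cm L N) (i + (j + d)) (\<lambda>n. tens (Sc L) N (i, s)
      (j + d, f (expN (Cm L M) (pi_act L \<pi> M) n Z) - y))"
    unfolding Cm_def[of L N] using y by (intro tens_vanishes[OF S N s]) (simp add: flimit_vanishes)
  then have "vanishes (Cm L N) (i + (j + d)) (\<lambda>n. fscale (ksign (d * i))
      (tens (Sc L) N (i, s) (j + d, f (expN (Cm L M) (pi_act L \<pi> M) n Z) - y)))"
    using vanishes_scale[OF CN] by (simp add: Cm_def[of L N])
  moreover have "fscale (ksign (d * i)) (tens (Sc L) N (i, s) (j + d, y)) \<in> fil (Cm L N) 0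
      (i + (j + d))"
    using fil_scale[OF CN tens_in_0[OF S N s y0, folded Cm_def]] by (simp add: Cm_def[of L N])
  ultimately show ?thesis
    by (simp add: twisted_value_def expN_zero_op[OF CN] expN_right_tens[OF S CM pa s Z]
        tensor_map_right_tens[OF S CM N f] tens_diff_right[OF S N s fe y0]
        free.scale_right_diff_distrib add.assoc)
qed

lemma corestriction_twisted_exists:
  assumes M: "filtered_space M" and cN: "complete_fspace N" and f: "filtered_map (Cm L M) N d f"
    and X: "X \<in> fil (Cm L M) 0 i"
  shows "\<exists>Y. cm_twisted L \<pi> M N d
    (\<lambda>X. tensor_map (Sc L) N 0 (\<lambda>x. x) d f (coact L M X)) i X Y"
proof -
  note N = separated_filtered[OF complete_fspace_separated[OF cN]]
  note S = filtered_space_Sc[OF L] and CM = filtered_space_Cm[OF L M] and CN = filtered_space_Cm[OF L N]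
  note T = filtered_space_ScCm[OF L M]
  note pa = nilop_letter_act[OF L pi M]
  note b = nilop_right[OF S CM pa]
  have H: "filtered_map (tensor (Sc L) (Cm L M)) (Cm L N) d (tensor_map (Sc L) N 0 (\<lambda>x. x) d f)"
    using tensor_map_right_fm[OF S CM N f] by (simp add: Cm_def[of L N])
  note tw = T CN b nilop_zero[OF CN]
  have "\<exists>Y. twisted_value (tensor (Sc L) (Cm L M)) (tensor_map (Sc L) (Cm L M) 0 (\<lambda>x. x) 0
      (pi_act L \<pi> M))
      (Cm L N) (\<lambda>x. 0) d (tensor_map (Sc L) N 0 (\<lambda>x. x) d f) i t Y"
    if t: "t \<in> fil (tensor (Sc L) (Cm L M)) 0 i" for t
    using t
  proof (induction rule: tensor_induct[OF S CM, consumes 1, case_names tens zero scale add])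
    case (tens i' j s Z p q)
    then have s: "s \<in> fil (Sc L) 0 i'" and Z: "Z \<in> fil (Cm L M) 0 j" by simp_all
    from expN_flimit_exists[OF CM pa cN f Z] obtain y where
      "flimit N (j + d) (\<lambda>n. f (expN (Cm L M) (pi_act L \<pi> M) n Z)) y" ..
    from right_factor_twisted[OF M N f s Z this] show ?case using tens(4) by auto
  next
    case zero
    show ?case using twisted_value_zero[OF tw H] by blast
  next
    case (scale c t)
    then show ?case using twisted_value_scale[OF tw H, of t i _ c] by auto
  next
    case (add s t)
    then show ?case using twisted_value_add[OF tw H] by blast
  qed
  from this[OF fm_in[OF coact_fm[OF L M] X, simplified]]
  show ?thesis using corestriction_twisted[OF M N f X] by blast
qed

lemma corestriction_twisted_one:
  assumes M: "filtered_space M" and N: "filtered_space N" and f: "filtered_map (Cm L M) N d f"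
    and m: "m \<in> fil M 0 j" and y: "flimit N (j + d)
        (\<lambda>n. f (expN (Cm L M) (pi_act L \<pi> M) n (cm_one L M j m))) y"
  shows "cm_twisted L \<pi> M N d
    (\<lambda>X. tensor_map (Sc L) N 0 (\<lambda>x. x) d f (coact L M X)) j (cm_one L M j m) (cm_one L N (j + d) y)"
  using corestriction_twisted[OF M N f cm_one_in[OF L M m], of "cm_one L N (j + d) y"]
    right_factor_twisted[OF M N f one_Sc[OF L] cm_one_in[OF L M m] y]
  by (simp add: coact_one[OF L M m])

end


section \<open>Twisting algebras, modules and morphisms\<close>

text \<open>
  The last condition, that the twist maps \<open>1 \<otimes> M\<close> to \<open>1 \<otimes> N\<close>, makes linear parts compose.  For module
  structures it comes from the flatness of the twisted algebra.
\<close>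

definition twistable ::
    "('k::field_char_0, 'l::ab_group_add) fspace \<Rightarrow> 'l \<Rightarrow> ('k, 'm::ab_group_add) fspace \<Rightarrow>
      ('k, 'n::ab_group_add) fspace \<Rightarrow> int \<Rightarrow>
     (('k, 'l, 'm) comod \<Rightarrow> ('k, 'l, 'n) comod) \<Rightarrow> bool" where
  "twistable L \<pi> M N d F \<longleftrightarrow> filtered_map (Cm L M) (Cm L N) d F \<and>
     (\<forall>i X. X \<in> fil (Cm L M) 0 i \<longrightarrow>
       (\<exists>Y. cm_twisted L \<pi> M N d F i X Y)) \<and>
     (\<forall>j m. m \<in> fil M 0 j \<longrightarrow> (\<exists>n. n \<in> fil N 0 (j + d) \<and>
       cm_twisted L \<pi> M N d F j
         (cm_one L M j m) (cm_one L N (j + d) n)))"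

context
  fixes L :: "('k::field_char_0, 'l::ab_group_add) fspace" and \<pi> :: 'l
  assumes L: "filtered_space L" and pi: "\<pi> \<in> fil (shift 1 L) 1 0"
begin

text \<open>
  The analogue of \<open>right_factor_twisted\<close> for the symmetric coalgebra as a comodule over itself, with the
  projection to letters in the role of \<open>f\<close>.
\<close>

lemma insert_right_twisted:
  assumes q: "filtered_map (Sc L) (shift 1 L) d q"
    and s: "s \<in> fil (Sc L) 0 i" and u: "u \<in> fil (Sc L) 0 j"
    and y: "flimit (shift 1 L) (j + d) (\<lambda>n. q (expN (Sc L) (pi_mul L \<pi>) n u)) y"
  shows "twisted_value (tensor (Sc L) (Sc L)) (tensor_map (Sc L) (Sc L) 0 (\<lambda>x. x) 0 (pi_mul L \<pi>))
      (Sc L) (\<lambda>x. 0) d (insert_right (shift 1 L) q d) (i + j)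
      (tens (Sc L) (Sc L) (i, s) (j, u)) (fscale (ksign (d * i)) (rmul (shift 1 L) (j + d, y) s))"
proof -
  note S = filtered_space_Sc[OF L] and V = filtered_shift[OF L]
  note pm = nilop_pi_mul[OF L pi]
  let ?e = "\<lambda>n. expN (Sc L) (pi_mul L \<pi>) n u"
  have y0: "y \<in> fil (shift 1 L) 0 (j + d)" using y by (simp add: flimit_def)
  note qe = fm_in[OF q expN_in[OF S pm u]]
  have v: "vanishes (Sc L) (i + (j + d)) (\<lambda>n. rmul (shift 1 L) (j + d, q (?e n) - y) s)"
    unfolding vanishes_def
  proof
    fix k
    obtain N where N: "\<And>n. n \<ge> N \<Longrightarrow> q (?e n) - y \<in> fil (shift 1 L) k (j + d)"
      using y unfolding flimit_def by blast
    show "\<exists>N. \<forall>n\<ge>N. rmul (shift 1 L) (j + d, q (?e n) - y) s \<in> fil (Sc L) k (i + (j + d))"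
      using raisesD[OF rmul_raises[OF V N] s[unfolded Sc_def]] by (intro exI[of _ N]) (simp add: Sc_def)
  qed
  have diff: "rmul (shift 1 L) (j + d, q (?e n) - y) s =
      rmul (shift 1 L) (j + d, q (?e n)) s - rmul (shift 1 L) (j + d, y) s" for n
    using rmul_add[OF V fil_diff[OF V qe[of n] y0] y0 s[unfolded Sc_def]] by simp
  have "vanishes (Sc L) (i + (j + d)) (\<lambda>n. fscale (ksign (d * i))
      (rmul (shift 1 L) (j + d, q (?e n) - y) s))"
    using vanishes_scale[OF S v] by (simp add: Sc_def)
  moreover have "fscale (ksign (d * i)) (rmul (shift 1 L) (j + d, y) s) \<in> fil (Sc L) 0 (i + (j + d))"
    using fil_scale[OF S fm_in[OF rmul_fm[OF V y0, folded Sc_def] s]] by (simp add: Sc_def)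
  ultimately show ?thesis
    by (simp add: twisted_value_def expN_zero_op[OF S] expN_right_tens[OF S S pm s u]
        insert_right_tens[OF V q[unfolded Sc_def], folded Sc_def] diff
        free.scale_right_diff_distrib add.assoc)
qed

lemma coder_twisted:
  assumes q: "filtered_map (Sc L) (shift 1 L) d q" and X: "X \<in> fil (Sc L) 0 i"
    and t: "twisted_value (tensor (Sc L) (Sc L)) (tensor_map (Sc L) (Sc L) 0 (\<lambda>x. x) 0 (pi_mul L \<pi>))
      (Sc L) (\<lambda>x. 0) d (insert_right (shift 1 L) q d) i (coprod (shift 1 L) X) Y"
  shows "sc_twisted L \<pi> d
    (coder (shift 1 L) q d) i X Y"
proof -
  note S = filtered_space_Sc[OF L] and V = filtered_shift[OF L]
  note T = filtered_space_tensor[OF S S] and pm = nilop_pi_mul[OF L pi]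
  let ?a = "tensor_map (Sc L) (Sc L) 0 (pi_mul L \<pi>) 0 (\<lambda>x. x)"
    and ?b = "tensor_map (Sc L) (Sc L) 0 (\<lambda>x. x) 0 (pi_mul L \<pi>)"
    and ?H = "insert_right (shift 1 L) q d"
  have a: "nilop (tensor (Sc L) (Sc L)) ?a" and b: "nilop (tensor (Sc L) (Sc L)) ?b"
    by (rule nilop_left[OF S S pm], rule nilop_right[OF S S pm])
  note H = insert_right_fm[OF V q[unfolded Sc_def], folded Sc_def]
  note co = coprod_fm[OF V, folded Sc_def]
  have "twisted_value (tensor (Sc L) (Sc L)) (\<lambda>t. ?a t + ?b t) (Sc L)
      (\<lambda>x. pi_mul L \<pi> x + 0) d ?H i (coprod (shift 1 L) X) Y"
  proof (rule twisted_value_split[OF T S a b pm nilop_zero[OF S] _ _ H _ _ t])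
    show "?a (?b t) = ?b (?a t)" if "t \<in> fil (tensor (Sc L) (Sc L)) 0 i" for t
      by (rule left_right_commute[OF S S pm pm that])
    show "?H (?a t) = pi_mul L \<pi> (?H t)" if t: "t \<in> fil (tensor (Sc L) (Sc L)) 0 i" for t
      using insert_right_left_letter[OF V q[unfolded Sc_def] pi0[OF L pi] t[unfolded Sc_def], folded
          Sc_def] by simp
    show "coprod (shift 1 L) X \<in> fil (tensor (Sc L) (Sc L)) 0 i" using fm_in[OF co X] by simp
  qed (simp add: fm_zero[OF nilop_fm[OF pm] S S])
  then have H': "twisted_value (tensor (Sc L) (Sc L)) (\<lambda>t. ?a t + ?b t) (Sc L)
      (pi_mul L \<pi>) d ?H i (coprod (shift 1 L) X) Y" by simp
  have c: "twisted_value (Sc L) (pi_mul L \<pi>) (tensor (Sc L) (Sc L)) (\<lambda>t. ?a t + ?b t) 0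
      (coprod (shift 1 L)) i X (coprod (shift 1 L) X)"
  proof (rule twisted_value_equivariant[OF S T pm nilop_plus[OF T a b] co _ X])
    show "coprod (shift 1 L) (pi_mul L \<pi> x) = ?a (coprod (shift 1 L) x) + ?b (coprod (shift 1 L) x)"
      if "x \<in> fil (Sc L) 0 i" for x
      using coprod_lmul[OF V pi0[OF L pi] that[unfolded Sc_def]] by (simp add: coprod_letter_def Sc_def)
  qed
  show ?thesis
    using twisted_value_comp[OF S T S pm nilop_plus[OF T a b] co H X c] H'
    by (simp add: coder_def[abs_def])
qed

lemma coder_twisted_exists:
  assumes q: "filtered_map (Sc L) (shift 1 L) d q" and compl: "complete_fspace (shift 1 L)"
    and X: "X \<in> fil (Sc L) 0 i"
  shows "\<exists>Y. sc_twisted L \<pi> d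
    (coder (shift 1 L) q d) i X Y"
proof -
  note S = filtered_space_Sc[OF L] and V = filtered_shift[OF L]
  note T = filtered_space_tensor[OF S S] and pm = nilop_pi_mul[OF L pi]
  note tw = T S nilop_right[OF S S pm] nilop_zero[OF S]
  note H = insert_right_fm[OF V q[unfolded Sc_def], folded Sc_def]
  have "\<exists>Y. twisted_value (tensor (Sc L) (Sc L)) (tensor_map (Sc L) (Sc L) 0 (\<lambda>x. x) 0 (pi_mul L \<pi>))
      (Sc L) (\<lambda>x. 0) d (insert_right (shift 1 L) q d) i t Y" if "t \<in> fil (tensor (Sc L) (Sc L)) 0
        i" for t
    using that
  proof (induction rule: tensor_induct[OF S S, consumes 1, case_names tens zero scale add])
    case (tens i' j s u p r)
    then have s: "s \<in> fil (Sc L) 0 i'" and u: "u \<in> fil (Sc L) 0 j" by simp_all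
    from expN_flimit_exists[OF S pm compl q u] obtain y where
      "flimit (shift 1 L) (j + d) (\<lambda>n. q (expN (Sc L) (pi_mul L \<pi>) n u)) y" ..
    from insert_right_twisted[OF q s u this] show ?case using tens(4) by auto
  next
    case zero
    show ?case using twisted_value_zero[OF tw H] by blast
  next
    case (scale c t)
    then show ?case using twisted_value_scale[OF tw H, of t i _ c] by auto
  next
    case (add s t)
    then show ?case using twisted_value_add[OF tw H] by blast
  qed
  from this[OF fm_in[OF coprod_fm[OF V, folded Sc_def] X, simplified]]
  show ?thesis using coder_twisted[OF q X] by blast
qed

lemma tensor_left_twisted:
  assumes M: "filtered_space M" and Q: "filtered_map (Sc L) (Sc L) d Q"
    and s: "s \<in> fil (Sc L) 0 i" and m: "m \<in> fil M 0 j"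
    and t: "sc_twisted L \<pi> d Q i s y"
  shows "cm_twisted L \<pi> M M d
    (tensor_map (Sc L) M d Q 0 (\<lambda>x. x)) (i + j) (tens (Sc L) M (i, s) (j, m))
      (tens (Sc L) M (i + d, y) (j, m))"
proof -
  note S = filtered_space_Sc[OF L] and pm = nilop_pi_mul[OF L pi]
  have y: "y \<in> fil (Sc L) 0 (i + d)" using t by (simp add: twisted_value_def)
  have "vanishes (tensor (Sc L) M) (i + d + j) (\<lambda>n. tens (Sc L) M (i + d,
      Q (expN (Sc L) (pi_mul L \<pi>) n s) - expN (Sc L) (pi_mul L \<pi>) n y) (j, m))"
    using t by (intro tens_vanishes_left[OF S M m]) (simp add: twisted_value_def)
  moreover have "i + j + d = i + d + j" by simp
  ultimately show ?thesis
    using tens_in_0[OF S M y m]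
    by (simp only: twisted_value_def letter_act_def Cm_def expN_left_tens[OF S M pm s m] fst_conv
        expN_left_tens[OF S M pm y m] tensor_map_left_tens[OF S M S Q]
        tens_diff_left[OF S M fm_in[OF Q expN_in[OF S pm s]] expN_in[OF S pm y] m])
qed

lemma separated_Cm:
  assumes "separated L" "separated M"
  shows "separated (Cm L M)"
  unfolding Cm_def Sc_def by (intro separated_tensor separated_sym separated_shift assms)

context
  fixes M :: "('k, 'm::ab_group_add) fspace" and N :: "('k, 'n::ab_group_add) fspace" and d F
  assumes sL: "separated L" and sM: "separated M" and sN: "separated N"
    and F: "twistable L \<pi> M N d F"
begin

private lemma M: "filtered_space M" and N: "filtered_space N"
  using sM sN by (simp_all add: separated_filtered)

private lemmas CM = filtered_space_Cm[OF L M] and CN = filtered_space_Cm[OF L N]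
private lemmas pM = nilop_letter_act[OF L pi M] and pN = nilop_letter_act[OF L pi N]

lemma twistable_fm: "filtered_map (Cm L M) (Cm L N) d F"
  using F by (simp add: twistable_def)

text \<open>
  The operator \<open>flim\<close> looks for a limit in any degree.  No second value can occur, because components
  of different degrees are independent.
\<close>

lemma twist_eqI:
  assumes X: "X \<in> fil (Cm L M) 0 i"
    and t: "cm_twisted L \<pi> M N d F i X Y"
  shows "twist L \<pi> M N F X = Y"
proof -
  define z where "z = (\<lambda>k. act L N (exp_sum L (- \<pi>) k) (F (act L M (exp_sum L \<pi> k) X)))"
  note Fe = fm_in[OF twistable_fm expN_in[OF CM pM X]]
  have pi': "- \<pi> \<in> fil (shift 1 L) 1 0" by (rule fil_neg[OF filtered_shift[OF L] pi])
  have z: "z = (\<lambda>k. expN (Cm L N) (\<lambda>y. - pi_act L \<pi> N y) k (F (expN (Cm L M) (pi_act L \<pi> M) k X)))"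
    unfolding z_def act_exp_sum[OF L pi M X] act_exp_sum[OF L pi' N Fe]
    by (rule ext, rule expN_cong[OF CN nilop_letter_act[OF L pi' N] _ Fe])
      (rule letter_act_uminus[OF L N pi0[OF L pi]])
  have lim: "flimit (Cm L N) (i + d) z Y"
    unfolding z by (rule twisted_value_limit[OF CM CN pM pN twistable_fm X t])
  have z_in: "z k \<in> fil (Cm L N) 0 (i + d)" for k
    unfolding z by (rule expN_in[OF CN nilop_neg[OF CN pN] Fe])
  note sep = separated_Cm[OF sL sN]
  have "Y' = Y" if lim': "flimit (Cm L N) j z Y'" for Y' j
  proof (cases "j = i + d")
    case True
    have "Y' - Y \<in> fil (Cm L N) k (i + d)" for k
    proof -
      obtain n1 where "\<forall>n\<ge>n1. z n - Y \<in> fil (Cm L N) k (i + d)" using lim unfolding flimit_def by blast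
      moreover obtain n2 where "\<forall>n\<ge>n2. z n - Y' \<in> fil (Cm L N) k (i + d)"
        using lim' True unfolding flimit_def by blast
      ultimately have "z (max n1 n2) - Y \<in> fil (Cm L N) k (i + d)"
          "z (max n1 n2) - Y' \<in> fil (Cm L N) k (i + d)"
        by auto
      from fil_diff[OF CN this] show ?thesis by simp
    qed
    from separatedD[OF sep this] show ?thesis by simp
  next
    case False
    obtain n0 where n0: "\<And>n. n \<ge> n0 \<Longrightarrow> z n - Y' \<in> fil (Cm L N) 0 j"
      using lim' unfolding flimit_def by blast
    have z0: "z n = 0" if "n \<ge> n0" for n
    proof -
      have "z n \<in> fil (Cm L N) 0 j"
        using fil_add[OF CN n0[OF that], of Y'] lim' by (simp add: flimit_def)
      then show ?thesis
        using tensor_degrees_disjoint[OF filtered_space_Sc[OF L] N, of "z n" "i + d" j] z_in False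
        by (simp add: Cm_def)
    qed
    have "W = 0" if W: "flimit (Cm L N) l z W" for W l
    proof (rule separatedD[OF sep])
      fix k
      obtain n1 where "\<forall>n\<ge>n1. z n - W \<in> fil (Cm L N) k l" using W unfolding flimit_def by blast
      then have "0 - W \<in> fil (Cm L N) k l" using z0[of "max n0 n1"] by
          (metis max.cobounded1 max.cobounded2)
      from fil_neg[OF CN this] show "W \<in> fil (Cm L N) k l" by simp
    qed
    from this[OF lim] this[OF lim'] show ?thesis by simp
  qed
  then show ?thesis
    unfolding twist_def z_def[symmetric] flim_def using lim by (intro the_equality) blast+
qed

lemma twist_twisted_value:
  assumes X: "X \<in> fil (Cm L M) 0 i"
  shows "cm_twisted L \<pi> M N d F i X (twist L \<pi> M N F X)"
proof -
  obtain Y where Y: "cm_twisted L \<pi> M N d F i X Y"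
    using F X unfolding twistable_def by blast
  then show ?thesis using twist_eqI[OF X Y] by simp
qed

lemma twist_fm: "filtered_map (Cm L M) (Cm L N) d (twist L \<pi> M N F)"
proof (rule filtered_mapI)
  note tw = CM CN pM pN
  fix i X X' assume X: "X \<in> fil (Cm L M) 0 i" and X': "X' \<in> fil (Cm L M) 0 i"
  show "twist L \<pi> M N F (X + X') = twist L \<pi> M N F X + twist L \<pi> M N F X'"
    by (rule twist_eqI[OF fil_add[OF CM X X'] twisted_value_add[OF tw twistable_fm X X'
          twist_twisted_value[OF X] twist_twisted_value[OF X']]])
next
  note tw = CM CN pM pN
  fix i c X assume X: "X \<in> fil (Cm L M) 0 i"
  show "twist L \<pi> M N F (scl (Cm L M) c X) = scl (Cm L N) c (twist L \<pi> M N F X)"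
    by (rule twist_eqI[OF fil_scale[OF CM X] twisted_value_scale[OF tw twistable_fm X
          twist_twisted_value[OF X]]])
next
  fix k i X assume X: "X \<in> fil (Cm L M) k i"
  show "twist L \<pi> M N F X \<in> fil (Cm L N) k (i + d)"
    by (rule twisted_value_fil[OF CM CN pM pN twistable_fm X twist_twisted_value[OF fil_0[OF CM X]]])
qed

lemma comp0_counit_left: "comp0 L M N H j m = counit_left N (H (cm_one L M j m))"
  by (simp add: comp0_def counit_left_def)

lemma twist_one:
  assumes m: "m \<in> fil M 0 j"
  shows "twist L \<pi> M N F (cm_one L M j m) = cm_one L N (j + d) (comp0 L M N (twist L \<pi> M N F) j m)"
proof -
  obtain n where n: "n \<in> fil N 0 (j + d)"
    and t: "cm_twisted L \<pi> M N d F j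
         (cm_one L M j m) (cm_one L N (j + d) n)"
    using F m unfolding twistable_def by blast
  have "twist L \<pi> M N F (cm_one L M j m) = cm_one L N (j + d) n"
    by (rule twist_eqI[OF cm_one_in[OF L M m] t])
  then show ?thesis by (simp add: comp0_counit_left counit_left_one[OF L N n])
qed

lemma comp0_twist_linear:
  "linear_on (scl M) (scl N) (fil M 0 j) (comp0 L M N (twist L \<pi> M N F) j)"
proof -
  note S = filtered_space_Sc[OF L]
  note e = fm_comp[OF twist_fm counit_left_Cm[OF L N] CM]
  show ?thesis
    unfolding linear_on_def comp0_counit_left
    by (simp add: tens_add_right[OF S M one_Sc[OF L]] tens_scale_right[OF S M one_Sc[OF L]]
        fm_add[OF e cm_one_in[OF L M] cm_one_in[OF L M]] fm_scale[OF e cm_one_in[OF L M], simplified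
          scl_Cm[OF L M]])
qed

lemma comp0_twist_in:
  assumes "m \<in> fil M k j"
  shows "comp0 L M N (twist L \<pi> M N F) j m \<in> fil N k (j + d)"
  unfolding comp0_counit_left
  using fm_in[OF counit_left_Cm[OF L N] fm_in[OF twist_fm cm_one_in[OF L M assms]]] by simp

end

text \<open>
  Both sides are twisted values of the same map at the same point.
\<close>

lemma twist_comp_eq:
  assumes sL: "separated L" and sM: "separated M" and sN: "separated N" and sN': "separated N'" and
      sP: "separated P"
    and F: "twistable L \<pi> M N d F" and G: "twistable L \<pi> N P e G"
    and F': "twistable L \<pi> M N' d' F'" and G': "twistable L \<pi> N' P e' G'" and deg: "d + e = d' + e'"
    and eq: "\<And>X. X \<in> fil (Cm L M) 0 i \<Longrightarrow> G (F X) = G' (F' X)" and X: "X \<in> fil (Cm L M) 0 i"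
  shows "twist L \<pi> N P G (twist L \<pi> M N F X) = twist L \<pi> N' P G' (twist L \<pi> M N' F' X)"
proof -
  note M = separated_filtered[OF sM] and N = separated_filtered[OF sN]
    and N' = separated_filtered[OF sN'] and P = separated_filtered[OF sP]
  note CM = filtered_space_Cm[OF L M] and CN = filtered_space_Cm[OF L N]
    and CN' = filtered_space_Cm[OF L N'] and CP = filtered_space_Cm[OF L P]
  note pM = nilop_letter_act[OF L pi M] and pN = nilop_letter_act[OF L pi N]
    and pN' = nilop_letter_act[OF L pi N'] and pP = nilop_letter_act[OF L pi P]
  note fF = twistable_fm[OF sL sM sN F] and fG = twistable_fm[OF sL sN sP G]
    and fF' = twistable_fm[OF sL sM sN' F'] and fG' = twistable_fm[OF sL sN' sP G']
  have 1: "cm_twisted L \<pi> M P (d + e)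
      (\<lambda>X. G (F X)) i X (twist L \<pi> N P G (twist L \<pi> M N F X))"
    by (rule twisted_value_comp[OF CM CN CP pM pN fF fG X twist_twisted_value[OF sL sM sN F X]
          twist_twisted_value[OF sL sN sP G fm_in[OF twist_fm[OF sL sM sN F] X]]])
  have 2: "cm_twisted L \<pi> M P (d + e)
      (\<lambda>X. G' (F' X)) i X (twist L \<pi> N' P G' (twist L \<pi> M N' F' X))"
    unfolding deg
    by (rule twisted_value_comp[OF CM CN' CP pM pN' fF' fG' X twist_twisted_value[OF sL sM sN' F' X]
          twist_twisted_value[OF sL sN' sP G' fm_in[OF twist_fm[OF sL sM sN' F'] X]]])
  have "cm_twisted L \<pi> M P (d + e)
      (\<lambda>X. G (F X)) i X (twist L \<pi> N' P G' (twist L \<pi> M N' F' X))"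
    using 2 twisted_value_cong[OF CM CP pM pP eq X] by simp
  then show ?thesis
    by (rule twisted_value_unique[OF CM CP pM pP separated_Cm[OF sL sP] 1])
qed

lemma twist_square_zero:
  assumes sL: "separated L" and sM: "separated M" and F: "twistable L \<pi> M M d F"
    and eq: "\<And>X. X \<in> fil (Cm L M) 0 i \<Longrightarrow> F (F X) = 0" and X: "X \<in> fil (Cm L M) 0 i"
  shows "twist L \<pi> M M F (twist L \<pi> M M F X) = 0"
proof -
  note M = separated_filtered[OF sM]
  note CM = filtered_space_Cm[OF L M]
  note pM = nilop_letter_act[OF L pi M]
  note fF = twistable_fm[OF sL sM sM F]
  have 1: "cm_twisted L \<pi> M M (d + d)
      (\<lambda>X. F (F X)) i X (twist L \<pi> M M F (twist L \<pi> M M F X))"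
    by (rule twisted_value_comp[OF CM CM CM pM pM fF fF X twist_twisted_value[OF sL sM sM F X]
          twist_twisted_value[OF sL sM sM F fm_in[OF twist_fm[OF sL sM sM F] X]]])
  have "cm_twisted L \<pi> M M (d + d)
      (\<lambda>X. F (F X)) i X 0"
    using expN_in[OF CM pM X] fm_zero[OF expN_fm[OF CM pM] CM CM]
    by (simp add: twisted_value_def eq vanishes_zero[OF CM] fil_zero[OF CM])
  then show ?thesis
    by (rule twisted_value_unique[OF CM CM pM pM separated_Cm[OF sL sM] 1])
qed

text \<open>
  The coactions are equivariant for the exponentials, so that both sides are values at \<open>X\<close> of the twist
  of \<open>coact \<circ> F = (id \<otimes> F) \<circ> coact\<close>.
\<close>

lemma twist_comodule_morphism:
  assumes sL: "separated L" and sM: "separated M" and sN: "separated N"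
    and F: "twistable L \<pi> M N 0 F"
    and co: "\<And>i X. X \<in> fil (Cm L M) 0 i \<Longrightarrow>
      coact L N (F X) = tensor_map (Sc L) (Cm L N) 0 (\<lambda>x. x) 0 F (coact L M X)"
    and X: "X \<in> fil (Cm L M) 0 i"
  shows "coact L N (twist L \<pi> M N F X) =
    tensor_map (Sc L) (Cm L N) 0 (\<lambda>x. x) 0 (twist L \<pi> M N F) (coact L M X)"
proof -
  note M = separated_filtered[OF sM] and N = separated_filtered[OF sN]
  note S = filtered_space_Sc[OF L]
  note CM = filtered_space_Cm[OF L M] and CN = filtered_space_Cm[OF L N]
  note TM = filtered_space_ScCm[OF L M] and TN = filtered_space_ScCm[OF L N]
  note pM = nilop_letter_act[OF L pi M] and pN = nilop_letter_act[OF L pi N]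
  note pm = nilop_pi_mul[OF L pi]
  note fF = twistable_fm[OF sL sM sN F] and tF = twist_fm[OF sL sM sN F]
  let ?a = "tensor_map (Sc L) (Cm L M) 0 (pi_mul L \<pi>) 0 (\<lambda>x. x)"
    and ?b = "tensor_map (Sc L) (Cm L M) 0 (\<lambda>x. x) 0 (pi_act L \<pi> M)"
    and ?a' = "tensor_map (Sc L) (Cm L N) 0 (pi_mul L \<pi>) 0 (\<lambda>x. x)"
    and ?b' = "tensor_map (Sc L) (Cm L N) 0 (\<lambda>x. x) 0 (pi_act L \<pi> N)"
    and ?H = "tensor_map (Sc L) (Cm L N) 0 (\<lambda>x. x) 0 F"
    and ?h = "tensor_map (Sc L) (Cm L N) 0 (\<lambda>x. x) 0 (twist L \<pi> M N F)"
  have a: "nilop (tensor (Sc L) (Cm L M)) ?a" and b: "nilop (tensor (Sc L) (Cm L M)) ?b"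
    and a': "nilop (tensor (Sc L) (Cm L N)) ?a'" and b': "nilop (tensor (Sc L) (Cm L N)) ?b'"
    by (rule nilop_left[OF S CM pm], rule nilop_right[OF S CM pM], rule nilop_left[OF S CN pm],
        rule nilop_right[OF S CN pN])
  note H = tensor_map_right_fm[OF S CM CN fF] and h = tensor_map_right_fm[OF S CM CN tF]
  have Hb: "twisted_value (tensor (Sc L) (Cm L M)) ?b (tensor (Sc L) (Cm L N)) ?b' 0 ?H j t (?h t)"
    if "t \<in> fil (tensor (Sc L) (Cm L M)) 0 j" for t j
    using that
  proof (induction rule: tensor_induct[OF S CM, consumes 1, case_names tens zero scale add])
    case (tens i' j' s Z p q)
    then have s: "s \<in> fil (Sc L) 0 i'" and Z: "Z \<in> fil (Cm L M) 0 j'" by simp_all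
    note tZ = fm_in[OF tF Z] and Fe = fm_in[OF fF expN_in[OF CM pM Z]]
    have "vanishes (tensor (Sc L) (Cm L N)) (i' + (j' + 0)) (\<lambda>n. tens (Sc L) (Cm L N) (i', s)
        (j' + 0, F (expN (Cm L M) (pi_act L \<pi> M) n Z) -
          expN (Cm L N) (pi_act L \<pi> N) n (twist L \<pi> M N F Z)))"
      using twist_twisted_value[OF sL sM sN F Z] by (intro tens_vanishes[OF S CN s])
          (simp add: twisted_value_def)
    then show ?case
      using tens_in_0[OF S CN s tZ] tens(4)
      by (simp add: twisted_value_def expN_right_tens[OF S CM pM s Z]
          tensor_map_right_tens[OF S CM CN fF]
          tensor_map_right_tens[OF S CM CN tF] expN_right_tens[OF S CN pN s tZ[simplified]]
          tens_diff_right[OF S CN s Fe[simplified] expN_in[OF CN pN tZ[simplified]]])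
  next
    case zero
    show ?case using twisted_value_zero[OF TM TN b b' H] by (simp add: fm_zero[OF h TM TN])
  next
    case (scale c t)
    then show ?case using twisted_value_scale[OF TM TN b b' H, of t j "?h t" c] by
        (simp add: fm_scale[OF h, simplified])
  next
    case (add s t)
    then show ?case using twisted_value_add[OF TM TN b b' H add(1,2)] by (simp add: fm_add[OF h])
  qed
  have c: "coact L M X \<in> fil (tensor (Sc L) (Cm L M)) 0 i"
    using fm_in[OF coact_fm[OF L M] X] by simp
  have "twisted_value (tensor (Sc L) (Cm L M)) (\<lambda>t. ?a t + ?b t) (tensor (Sc L) (Cm L N))
      (\<lambda>t. ?a' t + ?b' t) 0
      ?H i (coact L M X) (?h (coact L M X))"
  proof (rule twisted_value_split[OF TM TN a b a' b' _ _ H _ c Hb[OF c]])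
    show "?a (?b t) = ?b (?a t)" if "t \<in> fil (tensor (Sc L) (Cm L M)) 0 i" for t
      by (rule left_right_commute[OF S CM pm pM that])
    show "?a' (?b' t) = ?b' (?a' t)" if "t \<in> fil (tensor (Sc L) (Cm L N)) 0 (i + 0)" for t
      by (rule left_right_commute[OF S CN pm pN that])
    show "?H (?a t) = ?a' (?H t)" if t: "t \<in> fil (tensor (Sc L) (Cm L M)) 0 i" for t
      using tensor_map_comp[OF S CM S CM S CN nilop_fm[OF pm] fm_id(2) fm_id(2) fF t]
        tensor_map_comp[OF S CM S CN S CN fm_id(2) fF nilop_fm[OF pm] fm_id(2) t] by simp
  qed
  then have "twisted_value (Cm L M) (pi_act L \<pi> M) (tensor (Sc L) (Cm L N)) (\<lambda>t. ?a' t + ?b' t) (0 + 0)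
      (\<lambda>X. ?H (coact L M X)) i X (?h (coact L M X))"
    by (intro twisted_value_comp[OF CM TM TN pM nilop_plus[OF TM a b] coact_fm[OF L M] H X
          coact_twisted[OF L pi M X]]) simp
  then have 1: "twisted_value (Cm L M) (pi_act L \<pi> M) (tensor (Sc L) (Cm L N)) (\<lambda>t. ?a' t + ?b' t)
      (0 + 0)
      (\<lambda>X. coact L N (F X)) i X (?h (coact L M X))"
    using twisted_value_cong[OF CM TN pM nilop_plus[OF TN a' b'] co X] by simp
  have "twist L \<pi> M N F X \<in> fil (Cm L N) 0 (i + 0)" by (rule fm_in[OF tF X])
  from twisted_value_comp[OF CM CN TN pM pN fF coact_fm[OF L N] X twist_twisted_value[OF sL sM sN F X]
      coact_twisted[OF L pi N this]]
  have 2: "twisted_value (Cm L M) (pi_act L \<pi> M) (tensor (Sc L) (Cm L N)) (\<lambda>t. ?a' t + ?b' t) (0 + 0)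
      (\<lambda>X. coact L N (F X)) i X (coact L N (twist L \<pi> M N F X))" .
  have "separated (tensor (Sc L) (Cm L N))"
    by (intro separated_tensor separated_Cm[OF sL sN])
      (simp add: Sc_def separated_sym separated_shift sL)
  from twisted_value_unique[OF CM TN pM nilop_plus[OF TN a' b'] this 2 1] show ?thesis .
qed

end


context
  fixes L :: "('k::field_char_0, 'l::ab_group_add) fspace" and Q :: "('k, 'l) symc \<Rightarrow> ('k, 'l) symc"
      and \<pi> :: 'l
  assumes alg: "linf_algebra L Q" and mc: "maurer_cartan L Q \<pi>"
begin

private lemma compl: "complete_fspace L"
  using alg by (simp add: linf_algebra_def)

private lemmas sepL = complete_fspace_separated[OF compl]
private lemmas L = separated_filtered[OF sepL]

private lemma pi: "\<pi> \<in> fil (shift 1 L) 1 0"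
  using mc by (simp add: maurer_cartan_def)

private lemmas S = filtered_space_Sc[OF L] and V = filtered_shift[OF L] and pm = nilop_pi_mul[OF L pi]

private lemma Q_fm: "filtered_map (Sc L) (Sc L) 1 Q"
  using alg by (simp add: linf_algebra_def)

private lemma q_fm: "filtered_map (Sc L) (shift 1 L) 1 (\<lambda>t. sym_proj1 (shift 1 L) (Q t))"
  using fm_comp[OF Q_fm proj1_fm[OF V, folded Sc_def] S] by simp

private lemma Q_eq_coder:
  assumes "X \<in> fil (Sc L) 0 i"
  shows "Q X = coder (shift 1 L) (\<lambda>t. sym_proj1 (shift 1 L) (Q t)) 1 X"
  using alg assms
  by (intro coderivation_eq_coder[OF V, folded Sc_def] Q_fm) (auto simp: linf_algebra_def Sc_def)

lemma algebra_twisted_exists: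
  assumes X: "X \<in> fil (Sc L) 0 i"
  shows "\<exists>Y. sc_twisted L \<pi> 1 Q i X Y"
  using coder_twisted_exists[OF L pi q_fm complete_fspace_shift[OF compl] X]
    twisted_value_cong[OF S S pm pm Q_eq_coder X] by simp

text \<open>
  By the formula for coderivations, the twisted value at \<open>1\<close> is the limit of the letters \<open>pr(Q(e\<^sup>\<pi>))\<close>, which
  is the left-hand side of the Maurer--Cartan equation.
\<close>

lemma algebra_twisted_one:
  "sc_twisted L \<pi> 1 Q 0 (sym_one (shift 1 L)) 0"
proof -
  note one = one_Sc[OF L]
  have power: "(pi_mul L \<pi> ^^ n) (sym_one (shift 1 L)) = sym_word (shift 1 L) (replicate n (0, \<pi>))"
      for n
    by (induction n) (simp_all add: lmul_word[OF V pi0[OF L pi]])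
  have pow_in: "sym_word (shift 1 L) (replicate n (0, \<pi>)) \<in> fil (Sc L) 0 0" for n
    using fm_in[OF pow_fm[OF S pm] one, of n] by (simp add: power)
  have "sym_proj1 (shift 1 L) (Q (expN (Sc L) (pi_mul L \<pi>) N (sym_one (shift 1 L)))) =
      (\<Sum>n\<le>N. scl L (1 / fact n) (sym_proj1 (shift 1 L)
        (Q (sym_word (shift 1 L) (replicate n (0, \<pi>))))))" for N
    unfolding expN_def power
    by (subst fm_sum[OF q_fm S V, where i = 0])
      (simp_all add: fil_scale[OF S pow_in] fm_scale[OF q_fm pow_in])
  then have "flimit (shift 1 L) (0 + 1) (\<lambda>N. sym_proj1 (shift 1 L)
      (Q (expN (Sc L) (pi_mul L \<pi>) N (sym_one (shift 1 L))))) 0"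
    using mc by (simp add: maurer_cartan_def)
  from insert_right_twisted[OF L pi q_fm one one this]
  have "sc_twisted L \<pi> 1
      (coder (shift 1 L) (\<lambda>t. sym_proj1 (shift 1 L) (Q t)) 1) 0 (sym_one (shift 1 L)) 0"
    using rmul_zero[OF V one[unfolded Sc_def]]
    by (intro coder_twisted[OF L pi q_fm one]) (simp add: coprod_one[OF V] Sc_def[symmetric])
  then show ?thesis
    using twisted_value_cong[OF S S pm pm Q_eq_coder one] by simp
qed

context
  fixes M :: "('k, 'm::ab_group_add) fspace" and \<phi>
  assumes mod: "linf_module L Q M \<phi>"
begin

lemma module_complete: "complete_fspace M"
  using mod by (simp add: linf_module_def)

lemmas module_separated = complete_fspace_separated[OF module_complete]
lemmas module_filtered = separated_filtered[OF module_separated]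

lemma module_fm: "filtered_map (Cm L M) (Cm L M) 1 \<phi>"
  using mod by (simp add: linf_module_def)

text \<open>
  The summand \<open>Q \<otimes> id\<close> of \<open>\<phi>\<close> is twisted through \<open>Q\<close>, and it contributes nothing on \<open>1 \<otimes> M\<close> because the
  twisted coderivation kills the unit.
\<close>

lemma module_structure_twistable: "twistable L \<pi> M M 1 \<phi>"
proof -
  note M = module_filtered
  note CM = filtered_space_Cm[OF L M] and pM = nilop_letter_act[OF L pi M]
  let ?p = "\<lambda>X. counit_left M (\<phi> X)"
  let ?Q = "tensor_map (Sc L) M 1 Q 0 (\<lambda>x. x)" and ?P =
      "\<lambda>X. tensor_map (Sc L) M 0 (\<lambda>x. x) 1 ?p (coact L M X)"
  let ?tw = "cm_twisted L \<pi> M M 1"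
  have p: "filtered_map (Cm L M) M 1 ?p"
    using fm_comp[OF module_fm counit_left_Cm[OF L M] CM] by simp
  have QM: "filtered_map (Cm L M) (Cm L M) 1 ?Q"
    using tensor_map_left_fm[OF S M S Q_fm] by (simp add: Cm_def)
  have formula: "\<phi> X = ?Q X + ?P X" if "X \<in> fil (Cm L M) 0 i" for X i
    using mod that by (intro comodule_coderivation_formula[OF L M Q_fm module_fm])
        (auto simp: linf_module_def)
  have cong: "?tw \<phi> i X Y \<longleftrightarrow> ?tw (\<lambda>X. ?Q X + ?P X) i X Y" if "X \<in> fil (Cm L M) 0 i" for X Y i
    by (rule twisted_value_cong[OF CM CM pM pM _ that]) (rule formula)
  have Q_tw: "\<exists>Y. ?tw ?Q i X Y" if "X \<in> fil (Cm L M) 0 i" for X i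
    using that[unfolded Cm_def]
  proof (induction rule: tensor_induct[OF S M, consumes 1, case_names tens zero scale add])
    case (tens i' j s m p q)
    then have s: "s \<in> fil (Sc L) 0 i'" and m: "m \<in> fil M 0 j" by simp_all
    obtain Y where "sc_twisted L \<pi> 1 Q i' s Y"
      using algebra_twisted_exists[OF s] ..
    from tensor_left_twisted[OF L pi M Q_fm s m this] show ?case using tens(4) by auto
  next
    case zero
    show ?case using twisted_value_zero[OF CM CM pM pM QM] by blast
  next
    case (scale c t)
    then show ?case
      using twisted_value_scale[OF CM CM pM pM QM, of t i _ c] by (auto simp: Cm_def)
  next
    case (add s t)
    then show ?case using twisted_value_add[OF CM CM pM pM QM] unfolding Cm_def by blast
  qed
  have "\<exists>Y. ?tw \<phi> i X Y" if X: "X \<in> fil (Cm L M) 0 i" for X i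
  proof -
    obtain Y where Y: "?tw ?Q i X Y" using Q_tw[OF X] ..
    obtain Z where Z: "?tw ?P i X Z"
      using corestriction_twisted_exists[OF L pi M module_complete p X] ..
    have "?tw (\<lambda>X. ?Q X + ?P X) i X (Y + Z)"
      by (rule twisted_value_plus[OF CM CM pM pM Y Z])
    then have "?tw \<phi> i X (Y + Z)"
      using cong X by blast
    then show ?thesis ..
  qed
  moreover have "\<exists>n. n \<in> fil M 0 (j + 1) \<and> ?tw \<phi> j (cm_one L M j m) (cm_one L M (j + 1) n)"
    if m: "m \<in> fil M 0 j" for j m
  proof -
    note X = cm_one_in[OF L M m]
    obtain n where n: "flimit M (j + 1) (\<lambda>k. ?p (expN (Cm L M) (pi_act L \<pi> M) k (cm_one L M j m))) n"
      using expN_flimit_exists[OF CM pM module_complete p X] ..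
    have "?tw ?Q (0 + j) (cm_one L M j m) (tens (Sc L) M (0 + 1, 0) (j, m))"
      by (rule tensor_left_twisted[OF L pi M Q_fm one_Sc[OF L] m algebra_twisted_one])
    then have "?tw ?Q j (cm_one L M j m) 0"
      by (simp add: tens_zero_left[OF S M m])
    from twisted_value_plus[OF CM CM pM pM this corestriction_twisted_one[OF L pi M M p m n]]
    have "?tw (\<lambda>X. ?Q X + ?P X) j (cm_one L M j m) (0 + cm_one L M (j + 1) n)" .
    then have "?tw \<phi> j (cm_one L M j m) (cm_one L M (j + 1) n)"
      using cong X by simp
    then show ?thesis using n by (auto simp: flimit_def)
  qed
  ultimately show ?thesis
    unfolding twistable_def using module_fm by blast
qed

text \<open>
  The twisted structure has square zero, and on \<open>1 \<otimes> M\<close> it is given by its linear part.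
\<close>

lemma twisted_module_is_complex: "is_complex M (comp0 L M M (twist L \<pi> M M \<phi>))"
  unfolding is_complex_def
proof (intro allI conjI ballI)
  note M = module_filtered and sM = module_separated
  note T = module_structure_twistable
  fix i
  show "linear_on (scl M) (scl M) (fil M 0 i) (comp0 L M M (twist L \<pi> M M \<phi>) i)"
    by (rule comp0_twist_linear[OF L pi sepL sM sM T])
  show "comp0 L M M (twist L \<pi> M M \<phi>) i ` fil M 0 i \<subseteq> fil M 0 (i + 1)"
    using comp0_twist_in[OF L pi sepL sM sM T] by blast
  fix x assume x: "x \<in> fil M 0 i"
  have "twist L \<pi> M M \<phi> (twist L \<pi> M M \<phi> (cm_one L M i x)) = 0"
    using mod cm_one_in[OF L M x]
    by (intro twist_square_zero[OF L pi sepL sM T]) (auto simp: linf_module_def)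
  then show "comp0 L M M (twist L \<pi> M M \<phi>) (i + 1) (comp0 L M M (twist L \<pi> M M \<phi>) i x) = 0"
    unfolding twist_one[OF L pi sepL sM sM T x]
    by (subst comp0_counit_left[OF L pi sepL sM sM T])
      (simp add: fm_zero[OF counit_left_Cm[OF L M] filtered_space_Cm[OF L M] M])
qed

end

context
  fixes M :: "('k, 'm::ab_group_add) fspace" and \<phi> and N :: "('k, 'n::ab_group_add) fspace" and \<psi> and F
  assumes M: "linf_module L Q M \<phi>" and N: "linf_module L Q N \<psi>" and F: "linf_morphism L M \<phi> N \<psi> F"
begin

lemma morphism_twistable: "twistable L \<pi> M N 0 F"
proof -
  note fM = module_filtered[OF M] and fN = module_filtered[OF N]
  note CM = filtered_space_Cm[OF L fM] and CN = filtered_space_Cm[OF L fN]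
  note pM = nilop_letter_act[OF L pi fM] and pN = nilop_letter_act[OF L pi fN]
  have F_fm: "filtered_map (Cm L M) (Cm L N) 0 F" using F by (simp add: linf_morphism_def)
  let ?f = "\<lambda>X. counit_left N (F X)"
  let ?P = "\<lambda>X. tensor_map (Sc L) N 0 (\<lambda>x. x) 0 ?f (coact L M X)"
  have f: "filtered_map (Cm L M) N 0 ?f"
    using fm_comp[OF F_fm counit_left_Cm[OF L fN] CM] by simp
  have formula: "F X = ?P X" if "X \<in> fil (Cm L M) 0 i" for X i
    using F that by (intro comodule_morphism_formula[OF L fM fN F_fm]) (auto simp: linf_morphism_def)
  have cong: "cm_twisted L \<pi> M N 0 F i X Y \<longleftrightarrow>
      cm_twisted L \<pi> M N 0 ?P i X Y"
    if "X \<in> fil (Cm L M) 0 i" for X Y i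
    by (rule twisted_value_cong[OF CM CN pM pN _ that]) (rule formula)
  have "\<exists>n. n \<in> fil N 0 (j + 0) \<and> cm_twisted L \<pi> M N 0 F j
      (cm_one L M j m) (cm_one L N (j + 0) n)" if m: "m \<in> fil M 0 j" for j m
  proof -
    note X = cm_one_in[OF L fM m]
    obtain n where n: "flimit N (j + 0) (\<lambda>k. ?f (expN (Cm L M) (pi_act L \<pi> M) k (cm_one L M j m))) n"
      using expN_flimit_exists[OF CM pM module_complete[OF N] f X] ..
    from corestriction_twisted_one[OF L pi fM fN f m n] show ?thesis
      using cong[OF X] n unfolding flimit_def by blast
  qed
  then show ?thesis
    unfolding twistable_def using F_fm cong corestriction_twisted_exists[OF L pi fM
        module_complete[OF N] f]
    by blast
qed

lemma twisted_linf_morphism: "linf_morphism L M (twist L \<pi> M M \<phi>) N (twist L \<pi> N N \<psi>) (twist L \<pi> M N F)"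
  unfolding linf_morphism_def
proof (intro conjI allI ballI)
  note sM = module_separated[OF M] and sN = module_separated[OF N]
  note T = morphism_twistable
  show "filtered_map (Cm L M) (Cm L N) 0 (twist L \<pi> M N F)"
    by (rule twist_fm[OF L pi sepL sM sN T])
  fix i X assume X: "X \<in> fil (Cm L M) 0 i"
  show "coact L N (twist L \<pi> M N F X) = tensor_map (Sc L) (Cm L N) 0 id 0 (twist L \<pi> M N F)
      (coact L M X)"
    unfolding id_def using F X
    by (intro twist_comodule_morphism[OF L pi sepL sM sN T _ X]) (auto simp: linf_morphism_def id_def)
  show "twist L \<pi> M N F (twist L \<pi> M M \<phi> X) = twist L \<pi> N N \<psi> (twist L \<pi> M N F X)"
    using F X
    by (intro twist_comp_eq[OF L pi sepL sM sM sN sN module_structure_twistable[OF M] T T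
          module_structure_twistable[OF N]]) (auto simp: linf_morphism_def)
qed

lemma comp0_twist_morphism_in: "m \<in> fil M 0 j \<Longrightarrow> comp0 L M N (twist L \<pi> M N F) j m \<in> fil N 0 j"
  using comp0_twist_in[OF L pi sepL module_separated[OF M] module_separated[OF N]
      morphism_twistable] by fastforce

lemma twisted_chain_map:
  "chain_map M (comp0 L M M (twist L \<pi> M M \<phi>)) N (comp0 L N N (twist L \<pi> N N \<psi>))
    (comp0 L M N (twist L \<pi> M N F))"
  unfolding chain_map_def
proof (intro conjI allI ballI)
  note sM = module_separated[OF M] and sN = module_separated[OF N]
  note fM = module_filtered[OF M]
  note T = morphism_twistable and TM = module_structure_twistable[OF M] and TN =
      module_structure_twistable[OF N]
  fix i
  show "linear_on (scl M) (scl N) (fil M 0 i) (comp0 L M N (twist L \<pi> M N F) i)"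
    by (rule comp0_twist_linear[OF L pi sepL sM sN T])
  show "comp0 L M N (twist L \<pi> M N F) i ` fil M 0 i \<subseteq> fil N 0 i"
    using comp0_twist_morphism_in by blast
  fix x assume x: "x \<in> fil M 0 i"
  have "twist L \<pi> M N F (twist L \<pi> M M \<phi> (cm_one L M i x)) = twist L \<pi> N N \<psi>
      (twist L \<pi> M N F (cm_one L M i x))"
    using twisted_linf_morphism cm_one_in[OF L fM x] by (auto simp: linf_morphism_def)
  then show "comp0 L M N (twist L \<pi> M N F) (i + 1) (comp0 L M M (twist L \<pi> M M \<phi>) i x) =
      comp0 L N N (twist L \<pi> N N \<psi>) i (comp0 L M N (twist L \<pi> M N F) i x)"
    unfolding twist_one[OF L pi sepL sM sM TM x] twist_one[OF L pi sepL sM sN T x]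
      comp0_counit_left[OF L pi sepL sM sN T, of "twist L \<pi> M N F" "i + 1"]
      comp0_counit_left[OF L pi sepL sN sN TN, of "twist L \<pi> N N \<psi>" i]
    by simp
qed

end

lemma comp0_twist_square:
  assumes M: "linf_module L Q M \<phi>" and N: "linf_module L Q N \<psi>" and M': "linf_module L Q M' \<phi>'" and
      N': "linf_module L Q N' \<psi>'"
    and F: "linf_morphism L M \<phi> M' \<phi>' F" and G: "linf_morphism L N \<psi> N' \<psi>' G"
    and U: "linf_morphism L M \<phi> N \<psi> U" and U': "linf_morphism L M' \<phi>' N' \<psi>' U'"
    and eq: "\<And>X. X \<in> fil (Cm L M) 0 i \<Longrightarrow> G (U X) = U' (F X)" and x: "x \<in> fil M 0 i"
  shows "comp0 L N N' (twist L \<pi> N N' G) i (comp0 L M N (twist L \<pi> M N U) i x) =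
    comp0 L M' N' (twist L \<pi> M' N' U') i (comp0 L M M' (twist L \<pi> M M' F) i x)"
proof -
  note s = module_separated[OF M] module_separated[OF N] module_separated[OF M'] module_separated[OF N']
  note TF = morphism_twistable[OF M M' F] and TG = morphism_twistable[OF N N' G]
    and TU = morphism_twistable[OF M N U] and TU' = morphism_twistable[OF M' N' U']
  have "twist L \<pi> N N' G (twist L \<pi> M N U (cm_one L M i x)) =
      twist L \<pi> M' N' U' (twist L \<pi> M M' F (cm_one L M i x))"
    by (rule twist_comp_eq[OF L pi sepL s TU TG TF TU' _ eq
        cm_one_in[OF L module_filtered[OF M] x]]) simp_all
  then show ?thesis
    unfolding twist_one[OF L pi sepL s(1,2) TU x] twist_one[OF L pi sepL s(1,3) TF x]
      comp0_counit_left[OF L pi sepL s(2,4) TG, of "twist L \<pi> N N' G"]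
      comp0_counit_left[OF L pi sepL s(3,4) TU', of "twist L \<pi> M' N' U'"]
    by simp
qed

end

section \<open>Chasing cohomology classes\<close>

definition boundaries :: "('k, 'v::ab_group_add) fspace \<Rightarrow> (int \<Rightarrow> 'v \<Rightarrow> 'v) \<Rightarrow> int \<Rightarrow> 'v set" where
  "boundaries V d i = d (i - 1) ` fil V 0 (i - 1)"

context
  fixes V :: "('k::field, 'v::ab_group_add) fspace" and d
  assumes V: "filtered_space V" and d: "is_complex V d"
begin

lemma is_complex_fm: "linear_on (scl V) (scl V) (fil V 0 i) (d i)"
  using d by (simp add: is_complex_def)

lemma cocycle_diff:
  assumes x: "x \<in> cocycles V d i" and y: "y \<in> cocycles V d i"
  shows "x - y \<in> cocycles V d i"
proof -
  have xy: "x \<in> fil V 0 i" "y \<in> fil V 0 i" "d i x = 0" "d i y = 0" using x y by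
      (simp_all add: cocycles_def)
  have "d i ((x - y) + y) = d i (x - y) + d i y"
    by (rule linear_on_add[OF is_complex_fm fil_diff[OF V xy(1,2)] xy(2)])
  then show ?thesis using xy fil_diff[OF V xy(1,2)] by (simp add: cocycles_def)
qed

lemma boundaries_subset: "boundaries V d i \<subseteq> cocycles V d i"
proof
  fix x assume "x \<in> boundaries V d i"
  then obtain z where z: "z \<in> fil V 0 (i - 1)" "x = d (i - 1) z" by (auto simp: boundaries_def)
  have "d (i - 1) z \<in> fil V 0 (i - 1 + 1)" "d (i - 1 + 1) (d (i - 1) z) = 0"
    using d z(1) unfolding is_complex_def by blast+
  then show "x \<in> cocycles V d i" by (simp add: cocycles_def z)
qed

lemma boundaries_add: "x \<in> boundaries V d i \<Longrightarrow> y \<in> boundaries V d i \<Longrightarrow> x + y \<in> boundaries V d i"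
  unfolding boundaries_def
  by (auto simp: linear_on_add[OF is_complex_fm, symmetric] intro!: imageI fil_add[OF V])

lemma boundaries_neg: "x \<in> boundaries V d i \<Longrightarrow> - x \<in> boundaries V d i"
proof -
  assume "x \<in> boundaries V d i"
  then obtain z where z: "z \<in> fil V 0 (i - 1)" "x = d (i - 1) z" by (auto simp: boundaries_def)
  have "d (i - 1) (scl V (-1) z) = - x"
    using linear_on_scale[OF is_complex_fm z(1), of "-1"] z(2) by (simp add: scl_minus1[OF V])
  then show ?thesis unfolding boundaries_def using fil_scale[OF V z(1), of "-1"] by (metis imageI)
qed

lemma boundaries_zero: "0 \<in> boundaries V d i"
  using linear_on_scale[OF is_complex_fm fil_zero[OF V], of "i - 1" 0] fil_zero[OF V, of 0 "i - 1"]
  unfolding boundaries_def by (force simp: scl_simps[OF V])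

lemma equiv_cohomologous: "equiv (cocycles V d i) (cohomologous V d i)"
proof (rule equivI)
  note b = boundaries_def[of V d i, symmetric]
  show "cohomologous V d i \<subseteq> cocycles V d i \<times> cocycles V d i" by (auto simp: cohomologous_def)
  show "refl_on (cocycles V d i) (cohomologous V d i)"
    by (rule refl_onI) (auto simp: cohomologous_def b boundaries_zero)
  show "sym_on UNIV (cohomologous V d i)"
    by (rule sym_onI) (use boundaries_neg in \<open>fastforce simp: cohomologous_def b\<close>)
  show "trans (cohomologous V d i)"
    by (rule transI) (use boundaries_add in \<open>fastforce simp: cohomologous_def b\<close>)
qed

lemma class_eq_iff:
  "x \<in> cocycles V d i \<Longrightarrow> y \<in> cocycles V d i \<Longrightarrow>
    cohomologous V d i `` {x} = cohomologous V d i `` {y} \<longleftrightarrow> x - y \<in> boundaries V d i"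
  by (subst eq_equiv_class_iff[OF equiv_cohomologous]) (auto simp: cohomologous_def boundaries_def)

lemma zero_cocycle: "0 \<in> cocycles V d i"
  using boundaries_subset boundaries_zero by blast

lemma class_eq_zero_iff:
  "x \<in> cocycles V d i \<Longrightarrow> cohomologous V d i `` {x} = cohom_zero V d i \<longleftrightarrow> x \<in> boundaries V d i"
  using class_eq_iff[OF _ zero_cocycle] by (simp add: cohom_zero_def)

lemma cohom_eq: "cohom V d i = (\<lambda>x. cohomologous V d i `` {x}) ` cocycles V d i"
  by (auto simp: cohom_def quotient_def)

end

context
  fixes V :: "('k::field, 'v::ab_group_add) fspace" and W :: "('k, 'w::ab_group_add) fspace" and d e f
  assumes V: "filtered_space V" and W: "filtered_space W" and d: "is_complex V d" and e:
      "is_complex W e"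
    and f: "chain_map V d W e f"
begin

lemma chain_map_lin: "linear_on (scl V) (scl W) (fil V 0 i) (f i)"
  using f by (simp add: chain_map_def)

lemma chain_map_diff:
  assumes "x \<in> fil V 0 i" "y \<in> fil V 0 i"
  shows "f i (x - y) = f i x - f i y"
  using linear_on_add[OF chain_map_lin fil_diff[OF V assms] assms(2)] by simp

lemma chain_map_cocycle: "x \<in> cocycles V d i \<Longrightarrow> f i x \<in> cocycles W e i"
proof -
  assume x: "x \<in> cocycles V d i"
  then have "f (i + 1) (d i x) = e i (f i x)" "f i x \<in> fil W 0 i"
    using f unfolding chain_map_def cocycles_def by blast+
  moreover have "f (i + 1) 0 = 0"
    using chain_map_diff[OF fil_zero[OF V] fil_zero[OF V]] by simp
  ultimately show ?thesis using x by (simp add: cocycles_def)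
qed

lemma chain_map_boundary: "x \<in> boundaries V d i \<Longrightarrow> f i x \<in> boundaries W e i"
proof -
  assume "x \<in> boundaries V d i"
  then obtain z where z: "z \<in> fil V 0 (i - 1)" "x = d (i - 1) z" by (auto simp: boundaries_def)
  have "f (i - 1 + 1) (d (i - 1) z) = e (i - 1) (f (i - 1) z)" "f (i - 1) z \<in> fil W 0 (i - 1)"
    using f z(1) unfolding chain_map_def by blast+
  then show ?thesis by (simp add: boundaries_def z)
qed

lemma cohom_map_class:
  assumes x: "x \<in> cocycles V d i"
  shows "cohom_map W e f i (cohomologous V d i `` {x}) = cohomologous W e i `` {f i x}"
proof -
  have eq: "cohomologous W e i `` {f i y} = cohomologous W e i `` {f i x}"
    if "y \<in> cohomologous V d i `` {x}" for y
  proof -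
    from that have y: "y \<in> cocycles V d i" "x - y \<in> boundaries V d i"
      by (auto simp: cohomologous_def boundaries_def)
    have "f i x - f i y \<in> boundaries W e i"
      using chain_map_boundary[OF y(2)] x y(1) by (simp add: chain_map_diff cocycles_def)
    then show ?thesis
      using class_eq_iff[OF W e chain_map_cocycle[OF x] chain_map_cocycle[OF y(1)]] by simp
  qed
  have "x \<in> cohomologous V d i `` {x}"
    using equiv_class_self[OF equiv_cohomologous[OF V d] x] .
  then show ?thesis unfolding cohom_map_def using eq by blast
qed

text \<open>
  Injectivity and surjectivity in cohomology in terms of cocycles, for chasing elements.
\<close>

lemma cohom_map_kernel_iff:
  "{X \<in> cohom V d i. cohom_map W e f i X = cohom_zero W e i} = {cohom_zero V d i} \<longleftrightarrow>
    (\<forall>x \<in> cocycles V d i. f i x \<in> boundaries W e i \<longrightarrow> x \<in> boundaries V d i)" (is "?L \<longleftrightarrow> ?R")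
proof
  assume L: ?L
  show ?R
  proof (intro ballI impI)
    fix x assume x: "x \<in> cocycles V d i" "f i x \<in> boundaries W e i"
    have "cohomologous V d i `` {x} \<in> {X \<in> cohom V d i. cohom_map W e f i X = cohom_zero W e i}"
      using x class_eq_zero_iff[OF W e chain_map_cocycle[OF x(1)]]
      by (simp add: cohom_eq[OF V d] cohom_map_class)
    then show "x \<in> boundaries V d i" unfolding L using class_eq_zero_iff[OF V d x(1)] by simp
  qed
next
  assume R: ?R
  have "cohom_map W e f i (cohom_zero V d i) = cohom_zero W e i"
    using cohom_map_class[OF zero_cocycle[OF V d]] chain_map_diff[OF fil_zero[OF V] fil_zero[OF V],
        of i]
    by (simp add: cohom_zero_def)
  moreover have "cohom_zero V d i \<in> cohom V d i"
    using zero_cocycle[OF V d] by (auto simp: cohom_eq[OF V d] cohom_zero_def)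
  moreover have "X = cohom_zero V d i" if "X \<in> cohom V d i" "cohom_map W e f i X = cohom_zero W e i"
      for X
  proof -
    from that(1) obtain x where x: "x \<in> cocycles V d i" "X = cohomologous V d i `` {x}"
      by (auto simp: cohom_eq[OF V d])
    have "f i x \<in> boundaries W e i"
      using that(2) class_eq_zero_iff[OF W e chain_map_cocycle[OF x(1)]] by
          (simp add: x(2) cohom_map_class[OF x(1)])
    then have "x \<in> boundaries V d i" using R x(1) by blast
    then show ?thesis using class_eq_zero_iff[OF V d x(1)] x(2) by simp
  qed
  ultimately show ?L by blast
qed

lemma cohom_map_bij_iff:
  "bij_betw (cohom_map W e f i) (cohom V d i) (cohom W e i) \<longleftrightarrow>
    (\<forall>x \<in> cocycles V d i. f i x \<in> boundaries W e i \<longrightarrow> x \<in> boundaries V d i) \<and>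
    (\<forall>y \<in> cocycles W e i. \<exists>x \<in> cocycles V d i. f i x - y \<in> boundaries W e i)"
proof -
  have "inj_on (cohom_map W e f i) (cohom V d i) \<longleftrightarrow>
      (\<forall>x \<in> cocycles V d i. f i x \<in> boundaries W e i \<longrightarrow> x \<in> boundaries V d i)" (is "?L \<longleftrightarrow> ?R")
  proof
    assume L: ?L
    show ?R
    proof (intro ballI impI)
      fix x assume x: "x \<in> cocycles V d i" "f i x \<in> boundaries W e i"
      have "f i x - f i 0 \<in> boundaries W e i"
        using x(2) chain_map_diff[OF fil_zero[OF V] fil_zero[OF V], of i] by simp
      then have "cohom_map W e f i (cohomologous V d i `` {x}) = cohom_map W e f i
          (cohomologous V d i `` {0})"
        using class_eq_iff[OF W e chain_map_cocycle[OF x(1)] chain_map_cocycle[OF zero_cocycle[OF V d]]]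
        by (simp add: cohom_map_class x(1) zero_cocycle[OF V d])
      then have "cohomologous V d i `` {x} = cohomologous V d i `` {0}"
        using L x(1) zero_cocycle[OF V d] unfolding inj_on_def cohom_eq[OF V d] by blast
      then show "x \<in> boundaries V d i"
        using class_eq_iff[OF V d x(1) zero_cocycle[OF V d]] by simp
    qed
  next
    assume R: ?R
    show ?L
    proof (rule inj_onI)
      fix A B assume AB: "A \<in> cohom V d i" "B \<in> cohom V d i" "cohom_map W e f i A = cohom_map W e f i B"
      obtain x y where x: "x \<in> cocycles V d i" "A = cohomologous V d i `` {x}"
        and y: "y \<in> cocycles V d i" "B = cohomologous V d i `` {y}"
        using AB(1,2) unfolding cohom_eq[OF V d] by blast
      have "f i x - f i y \<in> boundaries W e i"
        using AB(3) class_eq_iff[OF W e chain_map_cocycle[OF x(1)] chain_map_cocycle[OF y(1)]]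
        by (simp add: x y cohom_map_class)
      then have "f i (x - y) \<in> boundaries W e i"
        using chain_map_diff[of x i y] x(1) y(1) by (simp add: cocycles_def)
      then have "x - y \<in> boundaries V d i"
        using R cocycle_diff[OF V d x(1) y(1)] by blast
      then show "A = B" using class_eq_iff[OF V d x(1) y(1)] x(2) y(2) by simp
    qed
  qed
  moreover have "cohom_map W e f i ` cohom V d i = cohom W e i \<longleftrightarrow>
      (\<forall>y \<in> cocycles W e i. \<exists>x \<in> cocycles V d i. f i x - y \<in> boundaries W e i)"
  proof -
    let ?I = "(\<lambda>x. cohomologous W e i `` {f i x}) ` cocycles V d i"
    have image: "cohom_map W e f i ` cohom V d i = ?I"
      unfolding cohom_eq[OF V d] image_image by (rule image_cong) (simp_all add: cohom_map_class)
    have mem: "cohomologous W e i `` {y} \<in> ?I \<longleftrightarrow> (\<exists>x \<in> cocycles V d i. f i x - y \<in> boundaries W e i)"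
      if "y \<in> cocycles W e i" for y
      using class_eq_iff[OF W e chain_map_cocycle that] by (auto simp: image_iff)
    have sub: "?I \<subseteq> cohom W e i"
      using chain_map_cocycle by (auto simp: cohom_eq[OF W e])
    have "?I = cohom W e i \<longleftrightarrow> cohom W e i \<subseteq> ?I"
      using sub by (auto simp only: subset_antisym order_refl)
    also have "\<dots> \<longleftrightarrow> (\<forall>y \<in> cocycles W e i. cohomologous W e i `` {y} \<in> ?I)"
      unfolding cohom_eq[OF W e] by (rule image_subset_iff)
    finally show ?thesis
      unfolding image using mem by simp
  qed
  ultimately show ?thesis unfolding bij_betw_def by simp
qed

end

lemma cohom_exact_at:
  assumes U: "filtered_space U" and V: "filtered_space V" and W: "filtered_space W"
    and c: "is_complex U c" and d: "is_complex V d" and e: "is_complex W e"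
    and f: "chain_map U c V d f" and g: "chain_map V d W e g"
    and exact: "cohom_map V d f i ` cohom U c i = {X \<in> cohom V d i. cohom_map W e g i X = cohom_zero
        W e i}"
  shows "x \<in> cocycles U c i \<Longrightarrow> g i (f i x) \<in> boundaries W e i"
    and "y \<in> cocycles V d i \<Longrightarrow> g i y \<in> boundaries W e i \<Longrightarrow>
      \<exists>x \<in> cocycles U c i. f i x - y \<in> boundaries V d i"
proof -
  note fc = chain_map_cocycle[OF U V c d f] and gc = chain_map_cocycle[OF V W d e g]
  note fm = cohom_map_class[OF U V c d f] and gm = cohom_map_class[OF V W d e g]
  show "g i (f i x) \<in> boundaries W e i" if x: "x \<in> cocycles U c i"
  proof -
    have "cohomologous V d i `` {f i x} \<in> cohom_map V d f i ` cohom U c i"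
      using fm[OF x] x by (auto simp: cohom_eq[OF U c] image_iff)
    then have "cohom_map W e g i (cohomologous V d i `` {f i x}) = cohom_zero W e i"
      unfolding exact by simp
    then show ?thesis
      using class_eq_zero_iff[OF W e gc[OF fc[OF x]]] by (simp add: gm[OF fc[OF x]])
  qed
  show "\<exists>x \<in> cocycles U c i. f i x - y \<in> boundaries V d i"
    if y: "y \<in> cocycles V d i" "g i y \<in> boundaries W e i"
  proof -
    have "cohomologous V d i `` {y} \<in> {X \<in> cohom V d i. cohom_map W e g i X = cohom_zero W e i}"
      using y class_eq_zero_iff[OF W e gc[OF y(1)]] by (simp add: gm[OF y(1)] cohom_eq[OF V d])
    then obtain x where x: "x \<in> cocycles U c i"
      "cohomologous V d i `` {y} = cohom_map V d f i (cohomologous U c i `` {x})"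
      unfolding exact[symmetric] by (auto simp: cohom_eq[OF U c])
    then have "f i x - y \<in> boundaries V d i"
      using class_eq_iff[OF V d fc[OF x(1)] y(1)] by (simp add: fm[OF x(1)])
    then show ?thesis using x(1) by blast
  qed
qed

text \<open>
  A map between left exact sequences.  On the left terms it is injective because it is so on the
  middle terms.  For surjectivity, a class of \<open>B\<close> has a preimage in the middle term \<open>H(A0)\<close>; injectivity
  on the right terms shows that the preimage goes to zero in \<open>H(A1)\<close>, so it comes from \<open>H(A)\<close>.
\<close>

lemma quasi_iso_of_kernels:
  assumes fs: "filtered_space A" "filtered_space A0" "filtered_space A1"
      "filtered_space B" "filtered_space B0" "filtered_space B1"
    and cx: "is_complex A dA" "is_complex B dB"
    and f: "chain_map A dA A0 d0 f" and g: "chain_map A0 d0 A1 d1 g"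
    and f': "chain_map B dB B0 e0 f'" and g': "chain_map B0 e0 B1 e1 g'"
    and u: "chain_map A dA B dB u" and u0: "quasi_iso A0 d0 B0 e0 u0" and u1: "quasi_iso A1 d1 B1 e1 u1"
    and sq0: "\<And>i x. x \<in> fil A 0 i \<Longrightarrow> f' i (u i x) = u0 i (f i x)"
    and sq1: "\<And>i x. x \<in> fil A0 0 i \<Longrightarrow> g' i (u0 i x) = u1 i (g i x)"
    and kerA: "\<And>i. {X \<in> cohom A dA i. cohom_map A0 d0 f i X = cohom_zero A0 d0 i} = {cohom_zero A dA i}"
    and exA: "\<And>i. cohom_map A0 d0 f i ` cohom A dA i =
      {X \<in> cohom A0 d0 i. cohom_map A1 d1 g i X = cohom_zero A1 d1 i}"
    and kerB: "\<And>i. {X \<in> cohom B dB i. cohom_map B0 e0 f' i X = cohom_zero B0 e0 i} =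
        {cohom_zero B dB i}"
    and exB: "\<And>i. cohom_map B0 e0 f' i ` cohom B dB i =
      {X \<in> cohom B0 e0 i. cohom_map B1 e1 g' i X = cohom_zero B1 e1 i}"
  shows "quasi_iso A dA B dB u"
proof -
  have cx0: "is_complex A0 d0" "is_complex B0 e0" "chain_map A0 d0 B0 e0 u0"
    and cx1: "is_complex A1 d1" "is_complex B1 e1" "chain_map A1 d1 B1 e1 u1"
    using u0 u1 by (simp_all add: quasi_iso_def)
  note bij0 = u0[unfolded quasi_iso_def, THEN conjunct2, THEN conjunct2, THEN conjunct2, rule_format,
      unfolded cohom_map_bij_iff[OF fs(2,5) cx0]]
  note bij1 = u1[unfolded quasi_iso_def, THEN conjunct2, THEN conjunct2, THEN conjunct2, rule_format,
      unfolded cohom_map_bij_iff[OF fs(3,6) cx1]]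
  note kA = kerA[unfolded cohom_map_kernel_iff[OF fs(1,2) cx(1) cx0(1) f], rule_format]
  note kB = kerB[unfolded cohom_map_kernel_iff[OF fs(4,5) cx(2) cx0(2) f'], rule_format]
  note eA = cohom_exact_at[OF fs(1,2,3) cx(1) cx0(1) cx1(1) f g exA]
  note eB = cohom_exact_at[OF fs(4,5,6) cx(2) cx0(2) cx1(2) f' g' exB]
  have inj: "x \<in> boundaries A dA i" if x: "x \<in> cocycles A dA i" "u i x \<in> boundaries B dB i" for x i
  proof -
    have "f' i (u i x) \<in> boundaries B0 e0 i"
      by (rule chain_map_boundary[OF fs(4,5) cx(2) cx0(2) f' x(2)])
    then have "u0 i (f i x) \<in> boundaries B0 e0 i"
      using sq0 x(1) by (simp add: cocycles_def)
    then have "f i x \<in> boundaries A0 d0 i"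
      using bij0 chain_map_cocycle[OF fs(1,2) cx(1) cx0(1) f x(1)] by blast
    then show ?thesis by (rule kA[OF x(1)])
  qed
  have surj: "\<exists>x \<in> cocycles A dA i. u i x - y \<in> boundaries B dB i" if y: "y \<in> cocycles B dB i" for y i
  proof -
    have f'y: "f' i y \<in> cocycles B0 e0 i" by (rule chain_map_cocycle[OF fs(4,5) cx(2) cx0(2) f' y])
    obtain z where z: "z \<in> cocycles A0 d0 i" "u0 i z - f' i y \<in> boundaries B0 e0 i"
      using bij0 f'y by blast
    have u0z: "u0 i z \<in> cocycles B0 e0 i" by (rule chain_map_cocycle[OF fs(2,5) cx0 z(1)])
    have "g' i (u0 i z) - g' i (f' i y) \<in> boundaries B1 e1 i"
      using chain_map_boundary[OF fs(5,6) cx0(2) cx1(2) g' z(2)]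
        chain_map_diff[OF fs(5,6) cx0(2) cx1(2) g' , of "u0 i z" i "f' i y"] u0z f'y
      by (simp add: cocycles_def)
    from boundaries_add[OF fs(6) cx1(2) this eB(1)[OF y]]
    have "u1 i (g i z) \<in> boundaries B1 e1 i"
      using sq1 z(1) by (simp add: cocycles_def)
    then have "g i z \<in> boundaries A1 d1 i"
      using bij1 chain_map_cocycle[OF fs(2,3) cx0(1) cx1(1) g z(1)] by blast
    from eA(2)[OF z(1) this] obtain x where
      x: "x \<in> cocycles A dA i" "f i x - z \<in> boundaries A0 d0 i" by blast
    have fx: "f i x \<in> cocycles A0 d0 i" by (rule chain_map_cocycle[OF fs(1,2) cx(1) cx0(1) f x(1)])
    have ux: "u i x \<in> cocycles B dB i" by (rule chain_map_cocycle[OF fs(1,4) cx u x(1)])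
    have "u0 i (f i x) - u0 i z \<in> boundaries B0 e0 i"
      using chain_map_boundary[OF fs(2,5) cx0 x(2)] chain_map_diff[OF fs(2,5) cx0, of "f i x" i z]
          fx z(1)
      by (simp add: cocycles_def)
    from boundaries_add[OF fs(5) cx0(2) this z(2)]
    have "f' i (u i x - y) \<in> boundaries B0 e0 i"
      using chain_map_diff[OF fs(4,5) cx(2) cx0(2) f', of "u i x" i y] ux y sq0 x(1)
      by (simp add: cocycles_def)
    from kB[OF cocycle_diff[OF fs(4) cx(2) ux y] this] show ?thesis using x(1) by blast
  qed
  show ?thesis
    unfolding quasi_iso_def using cx u cohom_map_bij_iff[OF fs(1,4) cx u] inj surj by blast
qed

theorem proposition3p3:
  fixes L :: "('k::field_char_0, 'l::ab_group_add) fspace"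
    and Q :: "('k, 'l) symc \<Rightarrow> ('k, 'l) symc"
    and M :: "('k, 'm::ab_group_add) fspace"
    and \<phi> :: "('k, 'l, 'm) comod \<Rightarrow> ('k, 'l, 'm) comod"
    and N :: "('k, 'n::ab_group_add) fspace"
    and \<psi> :: "('k, 'l, 'n) comod \<Rightarrow> ('k, 'l, 'n) comod"
    and Mr :: "nat \<Rightarrow> ('k, 'r::ab_group_add) fspace"
    and \<phi>r :: "nat \<Rightarrow> ('k, 'l, 'r) comod \<Rightarrow> ('k, 'l, 'r) comod"
    and Nr :: "nat \<Rightarrow> ('k, 's::ab_group_add) fspace"
    and \<psi>r :: "nat \<Rightarrow> ('k, 'l, 's) comod \<Rightarrow> ('k, 'l, 's) comod"
    and F :: "('k, 'l, 'm) comod \<Rightarrow> ('k, 'l, 'r) comod"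
    and dF :: "nat \<Rightarrow> ('k, 'l, 'r) comod \<Rightarrow> ('k, 'l, 'r) comod"
    and G :: "('k, 'l, 'n) comod \<Rightarrow> ('k, 'l, 's) comod"
    and dG :: "nat \<Rightarrow> ('k, 'l, 's) comod \<Rightarrow> ('k, 'l, 's) comod"
    and U :: "('k, 'l, 'm) comod \<Rightarrow> ('k, 'l, 'n) comod"
    and Ur :: "nat \<Rightarrow> ('k, 'l, 'r) comod \<Rightarrow> ('k, 'l, 's) comod"
    and \<pi> :: 'l
  assumes "linf_algebra L Q"
    and "linf_module L Q M \<phi>" and "linf_module L Q N \<psi>"
    and "resolution L Q M \<phi> Mr \<phi>r F dF"
    and "resolution L Q N \<psi> Nr \<psi>r G dG"
    and "resolution_morphism L M \<phi> Mr \<phi>r F dF N \<psi> Nr \<psi>r G dG U Ur"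
    and "\<pi> \<in> MC_res L Q M \<phi> Mr \<phi>r F dF \<inter> MC_res L Q N \<psi> Nr \<psi>r G dG"
    and "\<And>n. linf_quasi_iso L (twist_alg L \<pi> Q)
               (Mr n) (twist L \<pi> (Mr n) (Mr n) (\<phi>r n))
               (Nr n) (twist L \<pi> (Nr n) (Nr n) (\<psi>r n))
               (twist L \<pi> (Mr n) (Nr n) (Ur n))"
  shows "linf_quasi_iso L (twist_alg L \<pi> Q)
           M (twist L \<pi> M M \<phi>)
           N (twist L \<pi> N N \<psi>)
           (twist L \<pi> M N U)"
proof -
  note alg = assms(1) and M = assms(2) and N = assms(3)
  have Mr: "linf_module L Q (Mr n) (\<phi>r n)" and dF:
      "linf_morphism L (Mr n) (\<phi>r n) (Mr (Suc n)) (\<phi>r (Suc n)) (dF n)"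
    and F: "linf_morphism L M \<phi> (Mr 0) (\<phi>r 0) F" for n
    using assms(4) by (simp_all add: resolution_def)
  have Nr: "linf_module L Q (Nr n) (\<psi>r n)" and dG:
      "linf_morphism L (Nr n) (\<psi>r n) (Nr (Suc n)) (\<psi>r (Suc n)) (dG n)"
    and G: "linf_morphism L N \<psi> (Nr 0) (\<psi>r 0) G" for n
    using assms(5) by (simp_all add: resolution_def)
  have U: "linf_morphism L M \<phi> N \<psi> U" and Ur: "linf_morphism L (Mr n) (\<phi>r n) (Nr n) (\<psi>r n) (Ur n)"
    and GU: "X \<in> fil (Cm L M) 0 i \<Longrightarrow> G (U X) = Ur 0 (F X)"
    and dU: "Y \<in> fil (Cm L (Mr n)) 0 i \<Longrightarrow> dG n (Ur n Y) = Ur (Suc n) (dF n Y)" for n i X Y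
    using assms(6) by (simp_all add: resolution_morphism_def)
  have mc: "maurer_cartan L Q \<pi>"
    using assms(7) by (simp add: MC_res_def)
  note cm = twisted_chain_map[OF alg mc] and sq = comp0_twist_square[OF alg mc]
  note fs = module_filtered[OF alg mc]
  have qi: "quasi_iso (Mr n) (comp0 L (Mr n) (Mr n) (twist L \<pi> (Mr n) (Mr n) (\<phi>r n)))
      (Nr n) (comp0 L (Nr n) (Nr n) (twist L \<pi> (Nr n) (Nr n) (\<psi>r n)))
      (comp0 L (Mr n) (Nr n) (twist L \<pi> (Mr n) (Nr n) (Ur n)))" for n
    using assms(8)[of n] by (simp add: linf_quasi_iso_def)
  have "quasi_iso M (comp0 L M M (twist L \<pi> M M \<phi>)) N (comp0 L N N (twist L \<pi> N N \<psi>))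
      (comp0 L M N (twist L \<pi> M N U))"
  proof (rule quasi_iso_of_kernels[OF fs[OF M] fs[OF Mr] fs[OF Mr] fs[OF N] fs[OF Nr] fs[OF Nr]
        twisted_module_is_complex[OF alg mc M] twisted_module_is_complex[OF alg mc N]
        cm[OF M Mr F] cm[OF Mr Mr dF] cm[OF N Nr G] cm[OF Nr Nr dG] cm[OF M N U] qi qi])
    show "comp0 L N (Nr 0) (twist L \<pi> N (Nr 0) G) i (comp0 L M N (twist L \<pi> M N U) i x) =
        comp0 L (Mr 0) (Nr 0) (twist L \<pi> (Mr 0) (Nr 0) (Ur 0)) i
          (comp0 L M (Mr 0) (twist L \<pi> M (Mr 0) F) i x)"
      if "x \<in> fil M 0 i" for i x
      by (rule sq[OF M N Mr Nr F G U Ur GU that])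
    show "comp0 L (Nr 0) (Nr (Suc 0)) (twist L \<pi> (Nr 0) (Nr (Suc 0)) (dG 0)) i
          (comp0 L (Mr 0) (Nr 0) (twist L \<pi> (Mr 0) (Nr 0) (Ur 0)) i x) =
        comp0 L (Mr (Suc 0)) (Nr (Suc 0)) (twist L \<pi> (Mr (Suc 0)) (Nr (Suc 0)) (Ur (Suc 0))) i
          (comp0 L (Mr 0) (Mr (Suc 0)) (twist L \<pi> (Mr 0) (Mr (Suc 0)) (dF 0)) i x)"
      if "x \<in> fil (Mr 0) 0 i" for i x
      by (rule sq[OF Mr Nr Mr Nr dF dG Ur Ur dU that])
  qed (use assms(7) in \<open>simp_all add: MC_res_def Let_def\<close>)
  then show ?thesis
    using assms(8)[of 0] twisted_linf_morphism[OF alg mc M N U] by (simp add: linf_quasi_iso_def)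
qed


end
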